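(* Let $G$ be a finite group with $G=\widetilde{G}$ (i.e. there is no prime $p$ dividing $|G|$ for which a Sylow $p$-subgroup of $G$ is both cyclic and contained in the center of $G$), and let $1\le n\le 12$. Then $G$ has exactly $n$ subgroups if and only if $G$ is isomorphic to one of the groups in the $n$-th row below; the groups listed are pairwise non-isomorphic and each satisfies $G=\widetilde{G}$. $n=1$: the trivial group. $n=2,3,4$: none. $n=5$: $Z_2\times Z_2$. $n=6$: $Z_3\times Z_3$; $S_3$; $Q_8$. $n=7$: none. $n=8$: $Z_2\times Z_4$; $Z_5\times Z_5$; $D_{10}$; $Z_4\ltimes Z_3$. $n=9$: none. $n=10$: $Z_3\times Z_9$; $Z_7\times Z_7$; $D_{14}$; $A_4$; $Z_3\ltimes Z_7$; $Z_4\ltimes Z_5$; $Z_8\ltimes Z_3$; $D_8$; $E_{27}$. $n=11$: $Z_2\times Z_8$; $Q_{16}$; $Z_2\ltimes Z_8$. $n=12$: $Z_4\ltimes Z_7$; $Z_9\ltimes Z_7$; $Z_8\ltimes Z_5$; $Z_{16}\ltimes Z_3$. In particular, for $n=1,2,\ldots,12$ the number of isomorphism classes of finite groups with $G=\widetilde{G}$ and exactly $n$ subgroups is, respectively, $1,0,0,0,1,3,0,4,0,9,3,4$.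
   Context: The number of subgroups of a group $G$ counts all subgroups, including the trivial subgroup and $G$ itself. For a finite group $G$, let $\pi$ be the set of primes $p$ dividing $|G|$ such that a Sylow $p$-subgroup of $G$ is cyclic and contained in the center of $G$; then $\widetilde{G}=O_{\pi'}(G)$ is the largest normal subgroup of $G$ of order not divisible by any prime in $\pi$, and $G$ is the direct product of its Sylow $p$-subgroups for $p\in\pi$ and $\widetilde{G}$. Thus $G=\widetilde{G}$ exactly when $\pi=\emptyset$. Notation. $Z_m$ is the cyclic group of order $m$; $D_{2m}$ is the dihedral group of order $2m$ (so $D_8, D_{10}, D_{14}$ have orders $8,10,14$); $Q_8$ and $Q_{16}$ are the quaternion and generalized quaternion groups of orders $8$ and $16$; $S_3$, $A_4$ are symmetric and alternating groups; $E_{27}$ is the extraspecial group of order $27$ and exponent $9$. For a prime $\ell$ and a prime $s\neq \ell$, $Z_{\ell^k}\ltimes Z_s$ (that is, $Z_4\ltimes Z_3$, $Z_8\ltimes Z_3$, $Z_{16}\ltimes Z_3$, $Z_4\ltimes Z_5$, $Z_8\ltimes Z_5$, $Z_3\ltimes Z_7$, $Z_4\ltimes Z_7$, $Z_9\ltimes Z_7$) denotes the semidirect product with normal subgroup $Z_s$ in which a generator of $Z_{\ell^k}$ acts on $Z_s$ as an automorphism of order $\ell$. $Z_2\ltimes Z_8$ denotes the group of order $16$ with presentation $\langle a,b\mid a^2=1,\ b^8=1,\ a^{-1}ba=b^5\rangle$. *)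

theory Defs
  imports "HOL-Algebra.Algebra"
begin

definition subgroup_count :: "('a, 'b) monoid_scheme \<Rightarrow> nat" where
  "subgroup_count G = card {H. subgroup H G}"

definition center :: "('a, 'b) monoid_scheme \<Rightarrow> 'a set" where
  "center G = {z \<in> carrier G. \<forall>x \<in> carrier G. z \<otimes>\<^bsub>G\<^esub> x = x \<otimes>\<^bsub>G\<^esub> z}"

definition sylow_subgroup :: "nat \<Rightarrow> 'a set \<Rightarrow> ('a, 'b) monoid_scheme \<Rightarrow> bool" where
  "sylow_subgroup p P G \<longleftrightarrow> subgroup P G \<and> card P = p ^ multiplicity p (order G)"

definition central_cyclic_primes :: "('a, 'b) monoid_scheme \<Rightarrow> nat set" where
  "central_cyclic_primes G =
     {p. Factorial_Ring.prime p \<and> p dvd order G \<and>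
         (\<exists>P. sylow_subgroup p P G \<and> cyclic_group (G\<lparr>carrier := P\<rparr>) \<and> P \<subseteq> center G)}"

(* O_{pi'}(G); the order on sets is inclusion. *)
definition pi_prime_core :: "nat set \<Rightarrow> ('a, 'b) monoid_scheme \<Rightarrow> 'a set" where
  "pi_prime_core \<pi> G = (GREATEST N. N \<lhd> G \<and> (\<forall>p \<in> \<pi>. \<not> p dvd card N))"

definition tilde :: "('a, 'b) monoid_scheme \<Rightarrow> 'a set" where
  "tilde G = pi_prime_core (central_cyclic_primes G) G"

(* The pair (i, x) stands for a^i b^x, where a and b generate Z_m and Z_s and
   a^{-1} b a = b^r.  This is a group when r^m = 1 modulo s. *)
definition cyclic_semidirect :: "nat \<Rightarrow> nat \<Rightarrow> int \<Rightarrow> (int \<times> int) monoid" where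
  "cyclic_semidirect m s r =
     \<lparr>carrier = carrier (integer_mod_group m) \<times> carrier (integer_mod_group s),
      monoid.mult = (\<lambda>(i, x) (j, y). ((i + j) mod int m, (r ^ nat j * x + y) mod int s)),
      one = (0, 0)\<rparr>"

(* D_{2m} *)
definition dihedral_group :: "nat \<Rightarrow> (int \<times> int) monoid" where
  "dihedral_group m = cyclic_semidirect 2 m (-1)"

(* Order 4m; the generalized quaternion group Q_{4m} when m > 1 is a power of 2.
   The pair (i, a) stands for x^i y^a, where x^{2m} = 1, y^2 = x^m, y x y^{-1} = x^{-1}. *)
definition dicyclic_group :: "nat \<Rightarrow> (int \<times> int) monoid" where
  "dicyclic_group m =
     \<lparr>carrier = {0..<2 * int m} \<times> {0..<2},
      monoid.mult = (\<lambda>(i, a) (j, b).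
        ((i + (-1) ^ nat a * j + int m * a * b) mod (2 * int m), (a + b) mod 2)),
      one = (0, 0)\<rparr>"

(* Extraspecial of order 27 and exponent 9: see order_E27, exponent_E27, extraspecial_E27. *)
definition E27 :: "(int \<times> int) monoid" where
  "E27 = cyclic_semidirect 3 9 4"

lemma cyclic_semidirect_simps:
  assumes "m > 0" "s > 0"
  shows "carrier (cyclic_semidirect m s r) = {0..<int m} \<times> {0..<int s}"
    and "(i, x) \<otimes>\<^bsub>cyclic_semidirect m s r\<^esub> (j, y) =
           ((i + j) mod int m, (r ^ nat j * x + y) mod int s)"
    and "\<one>\<^bsub>cyclic_semidirect m s r\<^esub> = (0, 0)"
  using assms by (auto simp: cyclic_semidirect_def carrier_integer_mod_group)

lemma power_mod_exponent:
  fixes r :: int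
  assumes "m > 0" "r ^ m mod s = 1 mod s"
  shows "r ^ (n mod m) mod s = r ^ n mod s"
proof -
  have "r ^ n mod s = (r ^ m) ^ (n div m) * r ^ (n mod m) mod s"
    by (metis mult_div_mod_eq power_add power_mult)
  also have "\<dots> = ((r ^ m mod s) ^ (n div m)) * r ^ (n mod m) mod s"
    by (metis mod_mult_left_eq power_mod)
  also have "\<dots> = r ^ (n mod m) mod s"
    by (metis assms(2) mod_mult_left_eq mult_1 power_mod power_one)
  finally show ?thesis ..
qed

lemma group_cyclic_semidirect:
  assumes "m > 0" "s > 0" and r: "r ^ m mod int s = 1 mod int s"
  shows "group (cyclic_semidirect m s r)"
proof (rule groupI)
  note simps = cyclic_semidirect_simps[OF assms(1,2)]
  note pow = power_mod_exponent[OF assms(1) r]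
  fix u v w
  assume u: "u \<in> carrier (cyclic_semidirect m s r)"
    and v: "v \<in> carrier (cyclic_semidirect m s r)"
    and w: "w \<in> carrier (cyclic_semidirect m s r)"
  obtain i x j y k z where uvw: "u = (i, x)" "v = (j, y)" "w = (k, z)"
    by (metis surj_pair)
  have nn: "0 \<le> j" "0 \<le> k" using v w uvw by (auto simp: simps)
  have e: "nat ((j + k) mod int m) = (nat j + nat k) mod m"
    using nn by (metis add_nonneg_nonneg nat_add_distrib nat_int nat_mod_distrib of_nat_0_le_iff)
  have "(r ^ nat k * ((r ^ nat j * x + y) mod int s) + z) mod int s
        = (r ^ nat k * (r ^ nat j * x + y) + z) mod int s"
    by (metis mod_add_left_eq mod_mult_right_eq)
  also have "\<dots> = (r ^ (nat j + nat k) * x + (r ^ nat k * y + z)) mod int s"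
    by (simp add: algebra_simps power_add)
  also have "\<dots> = (r ^ ((nat j + nat k) mod m) * x + (r ^ nat k * y + z) mod int s) mod int s"
    by (intro mod_add_cong mod_mult_cong) (simp_all add: pow)
  finally have snd: "(r ^ nat k * ((r ^ nat j * x + y) mod int s) + z) mod int s = \<dots>" .
  have fst: "((i + j) mod int m + k) mod int m = (i + (j + k) mod int m) mod int m"
    by (simp add: mod_add_left_eq mod_add_right_eq add.assoc)
  show "u \<otimes>\<^bsub>cyclic_semidirect m s r\<^esub> v \<otimes>\<^bsub>cyclic_semidirect m s r\<^esub> w =
      u \<otimes>\<^bsub>cyclic_semidirect m s r\<^esub> (v \<otimes>\<^bsub>cyclic_semidirect m s r\<^esub> w)"
    unfolding uvw simps e fst snd ..
next
  note simps = cyclic_semidirect_simps[OF assms(1,2)]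
  note pow = power_mod_exponent[OF assms(1) r]
  fix u assume u: "u \<in> carrier (cyclic_semidirect m s r)"
  obtain i x where ix: "u = (i, x)" by (metis surj_pair)
  have "\<exists>y \<in> {0..<int s}. (r ^ nat i * y + x) mod int s = 0"
  proof -
    define q where "q = r ^ nat i"
    have "q ^ m = (r ^ m) ^ nat i"
      unfolding q_def by (simp add: power_mult[symmetric] mult.commute)
    then have "q ^ m mod int s = (r ^ m mod int s) ^ nat i mod int s"
      by (simp add: power_mod)
    then have "q ^ m mod int s = 1 mod int s"
      by (simp add: r power_mod)
    then have "int s dvd q ^ m - 1"
      by (simp add: mod_eq_dvd_iff)
    moreover have "q * (- (q ^ (m - 1) * x)) + x = - (x * (q ^ m - 1))"
      using assms(1) by (cases m) (simp_all add: algebra_simps)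
    ultimately have "(q * (- (q ^ (m - 1) * x)) + x) mod int s = 0"
      by simp
    then have "(q * ((- (q ^ (m - 1) * x)) mod int s) + x) mod int s = 0"
      by (metis mod_add_left_eq mod_mult_right_eq)
    moreover have "(- (q ^ (m - 1) * x)) mod int s \<in> {0..<int s}"
      using assms(2) by simp
    ultimately show ?thesis unfolding q_def[symmetric] by (rule bexI)
  qed
  then obtain y where y: "(r ^ nat i * y + x) mod int s = 0" "y \<in> {0..<int s}"
    by (rule bexE)
  show "\<exists>v \<in> carrier (cyclic_semidirect m s r). v \<otimes>\<^bsub>cyclic_semidirect m s r\<^esub> u =
       \<one>\<^bsub>cyclic_semidirect m s r\<^esub>"
  proof (rule bexI)
    show "((- i) mod int m, y) \<otimes>\<^bsub>cyclic_semidirect m s r\<^esub> u = \<one>\<^bsub>cyclic_semidirect m s r\<^esub>"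
      unfolding ix simps y(1) by (simp add: mod_add_left_eq)
    show "((- i) mod int m, y) \<in> carrier (cyclic_semidirect m s r)"
      unfolding simps using y(2) assms(1) by simp
  qed
next
  note simps = cyclic_semidirect_simps[OF assms(1,2)]
  fix u v assume "u \<in> carrier (cyclic_semidirect m s r)" "v \<in> carrier (cyclic_semidirect m s r)"
  then show "u \<otimes>\<^bsub>cyclic_semidirect m s r\<^esub> v \<in> carrier (cyclic_semidirect m s r)"
    using assms(1,2) by (cases u; cases v) (simp add: simps)
next
  show "\<one>\<^bsub>cyclic_semidirect m s r\<^esub> \<in> carrier (cyclic_semidirect m s r)"
    using assms(1,2) by (simp add: cyclic_semidirect_simps)
next
  note simps = cyclic_semidirect_simps[OF assms(1,2)]
  fix u assume "u \<in> carrier (cyclic_semidirect m s r)"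
  then show "\<one>\<^bsub>cyclic_semidirect m s r\<^esub> \<otimes>\<^bsub>cyclic_semidirect m s r\<^esub> u = u"
    using assms(1,2) by (cases u) (auto simp: simps)
qed

lemma dicyclic_assoc_aux:
  fixes i j k a b c :: int and m :: nat
  assumes "a \<in> {0, 1}" "b \<in> {0, 1}" "c \<in> {0, 1}" "m > 0"
  shows "((i + (-1) ^ nat a * j + int m * a * b) mod (2 * int m) + (-1) ^ nat ((a + b) mod 2) * k
          + int m * ((a + b) mod 2) * c) mod (2 * int m)
       = (i + (-1) ^ nat a * ((j + (-1) ^ nat b * k + int m * b * c) mod (2 * int m))
          + int m * a * ((b + c) mod 2)) mod (2 * int m)" (is "?l mod _ = ?r mod _")
proof -
  let ?N = "2 * int m"
  have 1: "?l mod ?N = (i + (-1) ^ nat a * j + int m * a * b + (-1) ^ nat ((a + b) mod 2) * k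
          + int m * ((a + b) mod 2) * c) mod ?N"
    by (intro mod_add_cong refl) simp
  have 2: "?r mod ?N = (i + (-1) ^ nat a * (j + (-1) ^ nat b * k + int m * b * c)
          + int m * a * ((b + c) mod 2)) mod ?N"
    by (intro mod_add_cong mod_mult_cong refl) simp
  show ?thesis unfolding 1 2 mod_eq_dvd_iff
    using assms(1-3) by (elim insertE emptyE) (simp_all add: algebra_simps)
qed

lemma group_dicyclic_group:
  assumes "m > 0"
  shows "group (dicyclic_group m)"
proof -
  have mult: "(i, a) \<otimes>\<^bsub>dicyclic_group m\<^esub> (j, b) =
      ((i + (-1) ^ nat a * j + int m * a * b) mod (2 * int m), (a + b) mod 2)" for i a j b
    by (simp add: dicyclic_group_def)
  have two: "{0..<2::int} = {0, 1}" by auto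
  show ?thesis
  proof (rule groupI)
    fix u assume u: "u \<in> carrier (dicyclic_group m)"
    obtain i a where ia: "u = (i, a)" by (metis surj_pair)
    have "a = 0 \<or> a = 1" using u ia by (auto simp: dicyclic_group_def)
    then show "\<exists>v \<in> carrier (dicyclic_group m). v \<otimes>\<^bsub>dicyclic_group m\<^esub> u = \<one>\<^bsub>dicyclic_group m\<^esub>"
    proof
      assume "a = 0"
      then show ?thesis using assms
        by (intro bexI[of _ "((- i) mod (2 * int m), 0)"])
           (auto simp: ia dicyclic_group_def mod_add_left_eq)
    next
      assume "a = 1"
      then show ?thesis using assms
        by (intro bexI[of _ "((i - int m) mod (2 * int m), 1)"])
           (use mod_add_left_eq[of "i - int m" "2 * int m" "int m - i"]
            in \<open>auto simp: ia dicyclic_group_def algebra_simps\<close>)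
    qed
  next
    fix u v w
    assume u: "u \<in> carrier (dicyclic_group m)" and v: "v \<in> carrier (dicyclic_group m)"
      and w: "w \<in> carrier (dicyclic_group m)"
    obtain i a j b k c where uvw: "u = (i, a)" "v = (j, b)" "w = (k, c)"
      by (metis surj_pair)
    have "a \<in> {0, 1}" "b \<in> {0, 1}" "c \<in> {0, 1}"
      using u v w uvw by (auto simp: dicyclic_group_def two)
    then show "u \<otimes>\<^bsub>dicyclic_group m\<^esub> v \<otimes>\<^bsub>dicyclic_group m\<^esub> w =
        u \<otimes>\<^bsub>dicyclic_group m\<^esub> (v \<otimes>\<^bsub>dicyclic_group m\<^esub> w)"
      unfolding uvw mult using dicyclic_assoc_aux[of a b c m i j k] assms
      by (intro arg_cong2[of _ _ _ _ Pair]) (blast, simp add: mod_add_left_eq mod_add_right_eq add.assoc)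
  qed (use assms in \<open>auto simp: dicyclic_group_def\<close>)
qed

(* Extraspecial p-groups: Z(G) = [G, G] has order p and G/Z(G) has exponent p. *)
definition extraspecial :: "nat \<Rightarrow> ('a, 'b) monoid_scheme \<Rightarrow> bool" where
  "extraspecial p G \<longleftrightarrow>
     group G \<and> Factorial_Ring.prime p \<and> (\<exists>k. order G = p ^ k) \<and> card (center G) = p \<and>
     derived G (carrier G) = center G \<and> (\<forall>x \<in> carrier G. x [^]\<^bsub>G\<^esub> p \<in> center G)"

lemma group_E27: "group E27"
  unfolding E27_def by (rule group_cyclic_semidirect) auto

lemma order_E27: "order E27 = 27"
  by (simp add: order_def E27_def cyclic_semidirect_simps)

lemma E27_carrier: "carrier E27 = {0, 1, 2} \<times> {0, 1, 2, 3, 4, 5, 6, 7, 8}"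
proof -
  have "{0..<3::int} = {0, 1, 2}" "{0..<9::int} = {0, 1, 2, 3, 4, 5, 6, 7, 8}" by auto
  then show ?thesis by (simp add: E27_def cyclic_semidirect_simps)
qed

lemma E27_mult: "(i, x) \<otimes>\<^bsub>E27\<^esub> (j, y) = ((i + j) mod 3, (4 ^ nat j * x + y) mod 9)"
  by (simp add: E27_def cyclic_semidirect_simps)

lemma E27_one: "\<one>\<^bsub>E27\<^esub> = (0, 0)"
  by (simp add: E27_def cyclic_semidirect_simps)

lemma E27_center: "center E27 = {(0, 0), (0, 3), (0, 6)}"
proof
  show "{(0, 0), (0, 3), (0, 6)} \<subseteq> center E27"
    by (auto simp: center_def E27_carrier E27_mult)
  show "center E27 \<subseteq> {(0, 0), (0, 3), (0, 6)}"
  proof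
    fix z assume z: "z \<in> center E27"
    have "(0, 1) \<in> carrier E27" "(1, 0) \<in> carrier E27" by (auto simp: E27_carrier)
    then have "z \<in> carrier E27" "z \<otimes>\<^bsub>E27\<^esub> (0, 1) = (0, 1) \<otimes>\<^bsub>E27\<^esub> z"
      "z \<otimes>\<^bsub>E27\<^esub> (1, 0) = (1, 0) \<otimes>\<^bsub>E27\<^esub> z"
      using z by (auto simp: center_def)
    then show "z \<in> {(0, 0), (0, 3), (0, 6)}"
      by (cases z) (auto simp: E27_carrier E27_mult)
  qed
qed

lemma group_pow_3_9:
  assumes "group G" "y \<in> carrier G"
  shows "y [^]\<^bsub>G\<^esub> (3::nat) = y \<otimes>\<^bsub>G\<^esub> y \<otimes>\<^bsub>G\<^esub> y" "y [^]\<^bsub>G\<^esub> (9::nat) = (y [^]\<^bsub>G\<^esub> (3::nat)) [^]\<^bsub>G\<^esub> (3::nat)"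
proof -
  interpret group G by fact
  show "y [^]\<^bsub>G\<^esub> (3::nat) = y \<otimes>\<^bsub>G\<^esub> y \<otimes>\<^bsub>G\<^esub> y"
    using assms(2) by (simp add: numeral_3_eq_3)
  show "y [^]\<^bsub>G\<^esub> (9::nat) = (y [^]\<^bsub>G\<^esub> (3::nat)) [^]\<^bsub>G\<^esub> (3::nat)"
    using assms(2) by (simp add: nat_pow_pow)
qed

lemma E27_pow_3:
  assumes "(i, x) \<in> carrier E27"
  shows "(i, x) [^]\<^bsub>E27\<^esub> (3::nat) = (0, 3 * x mod 9)"
  unfolding group_pow_3_9(1)[OF group_E27 assms]
  using assms by (auto simp: E27_carrier E27_mult)

lemma exponent_E27: "(LEAST e::nat. e > 0 \<and> (\<forall>x \<in> carrier E27. x [^]\<^bsub>E27\<^esub> e = \<one>\<^bsub>E27\<^esub>)) = 9"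
proof (rule Least_equality)
  have "u [^]\<^bsub>E27\<^esub> (9::nat) = \<one>\<^bsub>E27\<^esub>" if "u \<in> carrier E27" for u
  proof -
    obtain i x where u: "u = (i, x)" by (metis surj_pair)
    have "(0, 3 * x mod 9) \<in> carrier E27"
      using that u by (auto simp: E27_carrier)
    then have "(u [^]\<^bsub>E27\<^esub> (3::nat)) [^]\<^bsub>E27\<^esub> (3::nat) = \<one>\<^bsub>E27\<^esub>"
      using that by (simp add: u E27_pow_3 E27_one mod_mult_right_eq)
    then show ?thesis
      by (simp only: group_pow_3_9(2)[OF group_E27 that])
  qed
  then show "(9::nat) > 0 \<and> (\<forall>x \<in> carrier E27. x [^]\<^bsub>E27\<^esub> (9::nat) = \<one>\<^bsub>E27\<^esub>)"
    by simp
  fix e :: nat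
  assume e: "e > 0 \<and> (\<forall>x \<in> carrier E27. x [^]\<^bsub>E27\<^esub> e = \<one>\<^bsub>E27\<^esub>)"
  have pow: "(0, 1) [^]\<^bsub>E27\<^esub> k = (0, int k mod 9)" for k :: nat
  proof (induction k)
    case (Suc k)
    then show ?case
      using monoid.nat_pow_Suc[OF group.is_monoid[OF group_E27], of "(0, 1)" k]
      by (simp add: E27_mult mod_add_right_eq add.commute)
  qed (simp add: E27_one monoid.nat_pow_0[OF group.is_monoid[OF group_E27]])
  have "(0, 1) \<in> carrier E27" by (simp add: E27_carrier)
  with e have "(0, 1) [^]\<^bsub>E27\<^esub> e = \<one>\<^bsub>E27\<^esub>" by blast
  then have "int e mod 9 = 0"
    by (simp add: pow E27_one)
  then have "9 dvd e" by presburger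
  with e show "9 \<le> e" by (simp add: dvd_imp_le)
qed

lemma E27_commutator_aux:
  fixes i j x y :: int
  assumes "i \<in> {0, 1, 2}" "j \<in> {0, 1, 2}"
  shows "(4 ^ nat j * x + y) mod 9 =
    (4 ^ nat ((j + i) mod 3) * (3 * (x * j - y * i) mod 9) + (4 ^ nat i * y + x) mod 9) mod 9"
    (is "_ = ?r mod 9")
proof -
  have 1: "?r mod 9 = (4 ^ nat ((j + i) mod 3) * (3 * (x * j - y * i)) + (4 ^ nat i * y + x)) mod 9"
    by (intro mod_add_cong mod_mult_cong refl) simp_all
  show ?thesis
    unfolding 1 mod_eq_dvd_iff using assms
    by (elim insertE emptyE; hypsubst; simp; presburger?)
qed

lemma extraspecial_E27: "extraspecial 3 E27"
proof -
  interpret group E27 by (rule group_E27)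
  have sub: "subgroup (center E27) E27"
  proof (rule subgroupI)
    fix u assume u: "u \<in> center E27"
    then have "inv\<^bsub>E27\<^esub> u = u \<otimes>\<^bsub>E27\<^esub> u"
      by (intro inv_equality) (auto simp: E27_center E27_carrier E27_mult E27_one)
    then show "inv\<^bsub>E27\<^esub> u \<in> center E27"
      using u by (auto simp: E27_center E27_mult)
  qed (auto simp: E27_center E27_carrier E27_mult)
  have comm: "u \<otimes>\<^bsub>E27\<^esub> v \<otimes>\<^bsub>E27\<^esub> inv\<^bsub>E27\<^esub> u \<otimes>\<^bsub>E27\<^esub> inv\<^bsub>E27\<^esub> v = w"
    if "u \<in> carrier E27" "v \<in> carrier E27" "w \<in> carrier E27"
      "u \<otimes>\<^bsub>E27\<^esub> v = w \<otimes>\<^bsub>E27\<^esub> (v \<otimes>\<^bsub>E27\<^esub> u)" for u v w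
    using that by (simp add: m_assoc)
  have "u \<otimes>\<^bsub>E27\<^esub> v \<otimes>\<^bsub>E27\<^esub> inv\<^bsub>E27\<^esub> u \<otimes>\<^bsub>E27\<^esub> inv\<^bsub>E27\<^esub> v \<in> center E27"
    if uv: "u \<in> carrier E27" "v \<in> carrier E27" for u v
  proof -
    obtain i x j y where ix: "u = (i, x)" "v = (j, y)" by (metis surj_pair)
    have ij: "i \<in> {0, 1, 2}" "j \<in> {0, 1, 2}" using uv ix by (auto simp: E27_carrier)
    define w where "w = (0::int, 3 * (x * j - y * i) mod 9)"
    have "3 * (x * j - y * i) mod 9 = 3 * ((x * j - y * i) mod 3)" by presburger
    moreover have "(x * j - y * i) mod 3 \<in> {0, 1, 2}" by auto
    ultimately have w: "w \<in> center E27" unfolding w_def by (auto simp: E27_center)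
    have "u \<otimes>\<^bsub>E27\<^esub> v = w \<otimes>\<^bsub>E27\<^esub> (v \<otimes>\<^bsub>E27\<^esub> u)"
      unfolding ix w_def E27_mult E27_commutator_aux[OF ij, of x y, symmetric]
      by (simp add: add.commute)
    moreover have "w \<in> carrier E27" using w by (simp add: center_def)
    ultimately show ?thesis using comm[OF uv] w by metis
  qed
  then have "derived E27 (carrier E27) \<subseteq> center E27"
    unfolding derived_def by (intro generate_subgroup_incl sub) auto
  moreover have "center E27 \<subseteq> derived E27 (carrier E27)"
  proof -
    have mem: "w \<in> derived E27 (carrier E27)"
      if "u \<in> carrier E27" "v \<in> carrier E27" "w \<in> carrier E27"
        "u \<otimes>\<^bsub>E27\<^esub> v = w \<otimes>\<^bsub>E27\<^esub> (v \<otimes>\<^bsub>E27\<^esub> u)" for u v w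
      unfolding derived_def using that comm[OF that] by (intro generate.incl) force
    have "(0, 0) \<in> derived E27 (carrier E27)"
      by (rule mem[of "(0, 0)" "(0, 0)"]) (auto simp: E27_carrier E27_mult)
    moreover have "(0, 3) \<in> derived E27 (carrier E27)"
      by (rule mem[of "(0, 1)" "(1, 0)"]) (auto simp: E27_carrier E27_mult)
    moreover have "(0, 6) \<in> derived E27 (carrier E27)"
      by (rule mem[of "(1, 0)" "(0, 1)"]) (auto simp: E27_carrier E27_mult)
    ultimately show ?thesis by (simp add: E27_center)
  qed
  moreover have "u [^]\<^bsub>E27\<^esub> (3::nat) \<in> center E27" if "u \<in> carrier E27" for u
    using that E27_pow_3[of "fst u" "snd u"] by (auto simp: E27_carrier E27_center)
  moreover have "card (center E27) = 3" by (simp add: E27_center)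
  moreover have "order E27 = 3 ^ 3" by (simp add: order_E27)
  moreover have "Factorial_Ring.prime (3::nat)" by simp
  ultimately show ?thesis
    unfolding extraspecial_def using group_E27 by blast
qed

(* Isomorphic copies over a sum type, so that all listed groups have the same type. *)
abbreviation of_pairs :: "(int \<times> int) monoid \<Rightarrow> (int \<times> int + (nat \<Rightarrow> nat)) monoid" where
  "of_pairs \<equiv> image_group Inl"

abbreviation of_perms :: "(nat \<Rightarrow> nat) monoid \<Rightarrow> (int \<times> int + (nat \<Rightarrow> nat)) monoid" where
  "of_perms \<equiv> image_group Inr"

abbreviation Zmod :: "nat \<Rightarrow> int monoid" where
  "Zmod \<equiv> integer_mod_group"

(* In Z_{l^k} |x Z_s the generator acts by a multiplier of order l modulo s: -1 for l = 2,
   and 2 modulo 7 for l = 3.  The multiplier 5 modulo 8 comes from the presentation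
   a^2 = b^8 = 1, a^{-1} b a = b^5.  dicyclic_group 2 and 4 are Q_8 and Q_16. *)
definition listed_groups :: "nat \<Rightarrow> (int \<times> int + (nat \<Rightarrow> nat)) monoid list" where
  "listed_groups n =
    (if n = 1 then [of_pairs (singleton_group (0, 0))]
     else if n = 5 then [of_pairs (Zmod 2 \<times>\<times> Zmod 2)]
     else if n = 6 then
       [of_pairs (Zmod 3 \<times>\<times> Zmod 3),
        of_perms (sym_group 3),
        of_pairs (dicyclic_group 2)]
     else if n = 8 then
       [of_pairs (Zmod 2 \<times>\<times> Zmod 4),
        of_pairs (Zmod 5 \<times>\<times> Zmod 5),
        of_pairs (dihedral_group 5),
        of_pairs (cyclic_semidirect 4 3 (-1))]
     else if n = 10 then
       [of_pairs (Zmod 3 \<times>\<times> Zmod 9),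
        of_pairs (Zmod 7 \<times>\<times> Zmod 7),
        of_pairs (dihedral_group 7),
        of_perms (alt_group 4),
        of_pairs (cyclic_semidirect 3 7 2),
        of_pairs (cyclic_semidirect 4 5 (-1)),
        of_pairs (cyclic_semidirect 8 3 (-1)),
        of_pairs (dihedral_group 4),
        of_pairs E27]
     else if n = 11 then
       [of_pairs (Zmod 2 \<times>\<times> Zmod 8),
        of_pairs (dicyclic_group 4),
        of_pairs (cyclic_semidirect 2 8 5)]
     else if n = 12 then
       [of_pairs (cyclic_semidirect 4 7 (-1)),
        of_pairs (cyclic_semidirect 9 7 2),
        of_pairs (cyclic_semidirect 8 5 (-1)),
        of_pairs (cyclic_semidirect 16 3 (-1))]
     else [])"

(* Every finite group is isomorphic to one with carrier in nat. *)
definition tilde_groups :: "nat \<Rightarrow> nat monoid set" where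
  "tilde_groups n =
     {G. group G \<and> finite (carrier G) \<and> carrier G = tilde G \<and> subgroup_count G = n}"

definition tilde_classes :: "nat \<Rightarrow> nat monoid set set" where
  "tilde_classes n =
     tilde_groups n // {(G, H). G \<in> tilde_groups n \<and> H \<in> tilde_groups n \<and> G \<cong> H}"

end

(*
A group with a cyclic normal subgroup <b> and cyclic quotient generated by the image of a consists of
products a^i b^x, and its subgroups correspond to triples of natural numbers subject to divisibility
conditions. Hence its subgroups can be counted by evaluating an arithmetic expression. All groups of
the table except A_4 are of this kind.

Conversely, let G be a group without central cyclic Sylow subgroups that has at most 12 subgroups.
If some Sylow p-subgroup P is not normal, then the k conjugates of P, their normalizers and the
subgroups for a prime divisor of k give k <= 9, and k = 1 (mod p) leaves few cases. Either P is
self-normalizing with a normal complement of order 3, 5 or 7, so that G is metacyclic, or p = 3, k = 4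
and G is A_4. If all Sylow subgroups are normal, then none of them is cyclic and central, and two
noncyclic ones already give too many subgroups, so G is a noncyclic p-group. A noncyclic group of
order p^n with n >= 3 (n >= 4 if p = 2) has a noncyclic maximal subgroup, and passing to it loses at
least p + 1 subgroups, which bounds n.
*)

theory Submission
  imports Defs "HOL-Number_Theory.Cong" "HOL-Library.Code_Binary_Nat"
begin

section \<open>Subgroups of given order and conjugation\<close>

text \<open>Subgroups of different orders are different, so each exclusion consists in naming orders
  m whose families \<open>subs G m\<close> have guaranteed sizes adding up to at least 13. The
  parity and divisibility arguments around the counts serve to show that the named orders are
  distinct. When a Sylow p-subgroup with k conjugates is self-normalizing, |G| = p^a k; for prime k
  the complement is simply a Sylow k-subgroup. Counting alone does not always make P
  self-normalizing: S_3 x Z_5 has three Sylow 2-subgroups and exactly 12 subgroups. The hypothesis G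
  = tilde G, in the form that \<open>central_cyclic_primes G\<close> is empty, enters there and in
  the case where all Sylow subgroups are normal. The parameters (m, s, r, t) of a metacyclic group
  fix it up to isomorphism, and they can be normalised: replacing a by a b^y shifts t, and for t = 0
  replacing a by a^k turns r into r^k. The parameter t admits nonsplit groups such as Q_8 and
  Q_16.\<close>

abbreviation nprime :: "nat \<Rightarrow> bool" where "nprime p \<equiv> Factorial_Ring.prime p"

lemma prime_power_dvd_imp:
  fixes p :: nat assumes "nprime p" "d dvd p ^ n" shows "\<exists>i\<le>n. d = p ^ i"
  using assms by (simp add: divides_primepow_nat)

lemma card_le_mult_fibres:
  assumes "finite S" "finite T" "f ` S \<subseteq> T" "\<And>y. y \<in> T \<Longrightarrow> card {x \<in> S. f x = y} \<le> c"
  shows "card S \<le> c * card T"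
proof -
  have "card S = (\<Sum>y\<in>T. card {x \<in> S. f x = y})"
    using sum.group[OF assms(1-3), of "\<lambda>_. 1::nat"] by simp
  also have "\<dots> \<le> (\<Sum>y\<in>T. c)" by (rule sum_mono) (use assms in auto)
  finally show ?thesis by (simp add: mult.commute)
qed

lemma card_eq_mult_fibres:
  assumes "finite S" "\<And>y. y \<in> f ` S \<Longrightarrow> card {x \<in> S. f x = y} = c"
  shows "card S = card (f ` S) * c"
proof -
  have "card S = (\<Sum>y\<in>f ` S. card {x \<in> S. f x = y})"
    using sum.image_gen[OF assms(1), of "\<lambda>_. 1::nat" f] by simp
  also have "\<dots> = (\<Sum>y\<in>f ` S. c)" by (rule sum.cong) (use assms in auto)
  finally show ?thesis by simp
qed

definition subs :: "('a, 'b) monoid_scheme \<Rightarrow> nat \<Rightarrow> 'a set set" where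
  "subs G n = {H. subgroup H G \<and> card H = n}"

lemma subsI: "subgroup H G \<Longrightarrow> card H = n \<Longrightarrow> H \<in> subs G n"
  by (simp add: subs_def)

lemma subsD: "H \<in> subs G n \<Longrightarrow> subgroup H G" "H \<in> subs G n \<Longrightarrow> card H = n"
  by (simp_all add: subs_def)

lemma subs_disjoint: "m \<noteq> n \<Longrightarrow> subs G m \<inter> subs G n = {}"
  by (auto simp: subs_def)

locale fin_group = group G for G (structure) +
  assumes fin: "finite (carrier G)"

lemma (in group) subgroup_restrict_iff:
  assumes "subgroup K G"
  shows "subgroup H (G\<lparr>carrier := K\<rparr>) \<longleftrightarrow> subgroup H G \<and> H \<subseteq> K"
proof
  assume H: "subgroup H (G\<lparr>carrier := K\<rparr>)"
  show "subgroup H G \<and> H \<subseteq> K" using incl_subgroup[OF assms H] subgroup.subset[OF H] by simp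
next
  assume "subgroup H G \<and> H \<subseteq> K"
  then show "subgroup H (G\<lparr>carrier := K\<rparr>)" using subgroup_incl assms by blast
qed

lemma (in group) subs_restrict:
  assumes "subgroup K G" shows "subs (G\<lparr>carrier := K\<rparr>) n = {H \<in> subs G n. H \<subseteq> K}"
  using subgroup_restrict_iff[OF assms] by (auto simp: subs_def)

context fin_group
begin

lemma sub_carrier: "subgroup H G \<Longrightarrow> H \<subseteq> carrier G"
  by (rule subgroup.subset)

lemma sub_finite: "subgroup H G \<Longrightarrow> finite H"
  using fin finite_subset sub_carrier by blast

lemma sub_one: "subgroup H G \<Longrightarrow> \<one> \<in> H"
  by (rule subgroup.one_closed)

lemma sub_card_pos: "subgroup H G \<Longrightarrow> 0 < card H"
  using sub_finite sub_one card_gt_0_iff by blast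

lemma order_pos: "0 < order G"
  using fin order_gt_0_iff_finite by blast

lemma sub_fin_group: "subgroup H G \<Longrightarrow> fin_group (G\<lparr>carrier := H\<rparr>)"
  unfolding fin_group_def fin_group_axioms_def
  using subgroup_imp_group sub_finite by auto

lemma order_restrict [simp]: "order (G\<lparr>carrier := H\<rparr>) = card H"
  by (simp add: order_def)

lemma card_sub_dvd: "subgroup H G \<Longrightarrow> card H dvd order G"
  using lagrange dvd_triv_right by metis

lemma card_sub_dvd_sub:
  assumes "subgroup H G" "subgroup K G" "H \<subseteq> K" shows "card H dvd card K"
proof -
  interpret K: fin_group "G\<lparr>carrier := K\<rparr>" by (rule sub_fin_group) fact
  show ?thesis using K.card_sub_dvd[of H] subgroup_incl[OF assms] by simp
qed

lemma sub_eqI: "subgroup K G \<Longrightarrow> H \<subseteq> K \<Longrightarrow> card H = card K \<Longrightarrow> H = K"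
  using card_subset_eq sub_finite by blast

lemma sub_eq_carrierI: "subgroup H G \<Longrightarrow> card H = order G \<Longrightarrow> H = carrier G"
  by (rule sub_eqI) (auto simp: order_def subgroup_self dest: sub_carrier)

text \<open>In a finite group an inverse is a power, so a set closed under products already contains
  it.\<close>

lemma closed_imp_subgroup:
  assumes "H \<subseteq> carrier G" "\<one> \<in> H" "\<And>x y. x \<in> H \<Longrightarrow> y \<in> H \<Longrightarrow> x \<otimes> y \<in> H"
  shows "subgroup H G"
proof (rule subgroupI)
  fix x assume x: "x \<in> H"
  then have xc: "x \<in> carrier G" using assms by auto
  have pw: "x [^] (n::nat) \<in> H" for n by (induction n) (use assms x in auto)
  have "inv x = x [^] (ord x - 1)"
  proof (rule inv_equality)
    have "ord x \<ge> 1" using ord_ge_1[OF fin xc] by simp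
    then show "x [^] (ord x - 1) \<otimes> x = \<one>"
      using pow_ord_eq_1[OF xc] nat_pow_Suc[of x "ord x - 1"] by (simp del: nat_pow_Suc)
  qed (use xc in auto)
  then show "inv x \<in> H" using pw by simp
qed (use assms in auto)

lemma finite_subgroups: "finite {H. subgroup H G}"
  by (rule finite_subset[of _ "Pow (carrier G)"]) (use fin sub_carrier in auto)

lemma finite_subs [simp]: "finite (subs G n)"
  by (rule finite_subset[OF _ finite_subgroups]) (auto simp: subs_def)

lemma sum_subs_le:
  assumes "finite M" shows "(\<Sum>m\<in>M. card (subs G m)) \<le> subgroup_count G"
proof -
  have "(\<Sum>m\<in>M. card (subs G m)) = card (\<Union>m\<in>M. subs G m)"
    by (rule card_UN_disjoint[symmetric]) (use assms finite_subs subs_disjoint in auto)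
  also have "\<dots> \<le> subgroup_count G"
    unfolding subgroup_count_def by (rule card_mono[OF finite_subgroups]) (auto simp: subs_def)
  finally show ?thesis .
qed

lemma subgroup_count_eq_sum: "subgroup_count G = (\<Sum>d | d dvd order G. card (subs G d))"
proof -
  have "{H. subgroup H G} = (\<Union>d\<in>{d. d dvd order G}. subs G d)"
    using card_sub_dvd by (auto simp: subs_def)
  moreover have "card (\<Union>d\<in>{d. d dvd order G}. subs G d) = (\<Sum>d | d dvd order G. card (subs G d))"
    by (rule card_UN_disjoint) (use order_pos finite_subs subs_disjoint in auto)
  ultimately show ?thesis unfolding subgroup_count_def by simp
qed

lemma one_subgroup: "subgroup {\<one>} G" by (rule triv_subgroup)

lemma subs_1: "subs G 1 = {{\<one>}}"
proof -
  have "H \<in> {{\<one>}}" if "H \<in> subs G 1" for H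
  proof -
    from that have H: "subgroup H G" "card H = 1" by (simp_all add: subs_def)
    obtain x where x: "H = {x}" using H(2) by (rule card_1_singletonE)
    show ?thesis using sub_one[OF H(1)] unfolding x by simp
  qed
  moreover have "{\<one>} \<in> subs G 1" using one_subgroup by (simp add: subs_def)
  ultimately show ?thesis by blast
qed

lemma subs_order: "subs G (order G) = {carrier G}"
  using sub_eq_carrierI subgroup_self by (auto simp: subs_def order_def)

lemma card_subs_pos: "subgroup H G \<Longrightarrow> 1 \<le> card (subs G (card H))"
proof -
  assume "subgroup H G"
  then have "H \<in> subs G (card H)" by (simp add: subs_def)
  then have "card (subs G (card H)) > 0" using finite_subs card_gt_0_iff by blast
  then show ?thesis by simp
qed

lemma gen_subgroup: "x \<in> carrier G \<Longrightarrow> subgroup (generate G {x}) G"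
  by (rule generate_is_subgroup) auto

lemma card_gen: "x \<in> carrier G \<Longrightarrow> card (generate G {x}) = ord x"
  by (simp add: generate_pow_card)

lemma gen_sub: "subgroup H G \<Longrightarrow> x \<in> H \<Longrightarrow> generate G {x} \<subseteq> H"
  by (rule generate_subgroup_incl) auto

lemma gen_mem: "x \<in> generate G {x}" by (rule generate.incl) auto

lemma gen_eq: "x \<in> carrier G \<Longrightarrow> generate G {x} = {x [^] k | k. k \<in> (UNIV :: nat set)}"
  using generate_pow_nat[of x] ord_ge_1[OF fin, of x] by simp

lemma ord_pos: "x \<in> carrier G \<Longrightarrow> 0 < ord x"
  using ord_ge_1[OF fin, of x] by simp

lemma sub_pow: "subgroup H G \<Longrightarrow> x \<in> H \<Longrightarrow> x [^] (n::nat) \<in> H"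
  by (induction n) (simp_all add: subgroup.m_closed sub_one)

lemma ord_dvd_sub: "subgroup H G \<Longrightarrow> x \<in> H \<Longrightarrow> ord x dvd card H"
proof -
  assume H: "subgroup H G" "x \<in> H"
  then have x: "x \<in> carrier G" using sub_carrier by blast
  show ?thesis using card_sub_dvd_sub[OF gen_subgroup[OF x] H(1) gen_sub[OF H]] card_gen[OF x] by simp
qed

lemma exists_prime_power_subgroup:
  assumes "nprime p" "p ^ i dvd order G" shows "\<exists>H. H \<in> subs G (p ^ i)"
proof -
  obtain m where "order G = p ^ i * m" using assms by (auto simp: dvd_def)
  then show ?thesis using sylow_thm[OF assms(1) group_axioms _ fin] by (auto simp: subs_def)
qed

lemma exists_prime_power_subgroup_in:
  assumes "nprime p" "subgroup K G" "p ^ i dvd card K"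
  shows "\<exists>H. H \<in> subs G (p ^ i) \<and> H \<subseteq> K"
proof -
  interpret K: fin_group "G\<lparr>carrier := K\<rparr>" by (rule sub_fin_group) fact
  show ?thesis using K.exists_prime_power_subgroup[of p i] assms
    by (auto simp: subs_restrict)
qed

lemma card_subs_prime_power_pos:
  assumes "nprime p" "p ^ i dvd order G" shows "1 \<le> card (subs G (p ^ i))"
  using exists_prime_power_subgroup[OF assms] card_subs_pos subsD by metis

section \<open>Conjugation, normalizers and group actions\<close>

definition cj :: "'a \<Rightarrow> 'a set \<Rightarrow> 'a set" where "cj x H = (\<lambda>h. x \<otimes> h \<otimes> inv x) ` H"

text \<open>Normality of H is written \<open>Nm H = carrier G\<close> throughout;
  \<open>normal_iff_Nm\<close> links this to the library notion.\<close>

definition Nm :: "'a set \<Rightarrow> 'a set" where "Nm H = {x \<in> carrier G. cj x H = H}"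

lemma cj_one: "H \<subseteq> carrier G \<Longrightarrow> cj \<one> H = H"
  by (force simp: cj_def)

lemma cj_mult: "x \<in> carrier G \<Longrightarrow> y \<in> carrier G \<Longrightarrow> H \<subseteq> carrier G \<Longrightarrow> cj (x \<otimes> y) H = cj x (cj y H)"
  unfolding cj_def image_image by (rule image_cong) (auto simp: m_assoc inv_mult_group subset_iff)

lemma cj_carrier: "x \<in> carrier G \<Longrightarrow> H \<subseteq> carrier G \<Longrightarrow> cj x H \<subseteq> carrier G"
  by (auto simp: cj_def)

lemma cj_inv: "x \<in> carrier G \<Longrightarrow> H \<subseteq> carrier G \<Longrightarrow> cj (inv x) (cj x H) = H"
  using cj_mult[of "inv x" x H] by (simp add: cj_one)

lemma cj_inv': "x \<in> carrier G \<Longrightarrow> H \<subseteq> carrier G \<Longrightarrow> cj x (cj (inv x) H) = H"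
  using cj_mult[of x "inv x" H] by (simp add: cj_one)

lemma cj_mono: "H \<subseteq> K \<Longrightarrow> cj x H \<subseteq> cj x K"
  by (auto simp: cj_def)

lemma cj_card: "x \<in> carrier G \<Longrightarrow> H \<subseteq> carrier G \<Longrightarrow> card (cj x H) = card H"
  unfolding cj_def by (rule card_image) (auto simp: inj_on_def subset_iff)

lemma cj_subgroup:
  assumes "x \<in> carrier G" "subgroup H G" shows "subgroup (cj x H) G"
proof (rule closed_imp_subgroup)
  note H = subgroup.mem_carrier[OF assms(2)]
  show "cj x H \<subseteq> carrier G" using cj_carrier assms sub_carrier by blast
  have "x \<otimes> \<one> \<otimes> inv x = \<one>" using assms by simp
  then show "\<one> \<in> cj x H" using sub_one[OF assms(2)] unfolding cj_def by (metis image_eqI)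
  fix a b assume "a \<in> cj x H" "b \<in> cj x H"
  then obtain h k where hk: "h \<in> H" "k \<in> H" "a = x \<otimes> h \<otimes> inv x" "b = x \<otimes> k \<otimes> inv x"
    by (auto simp: cj_def)
  then have "a \<otimes> b = x \<otimes> (h \<otimes> k) \<otimes> inv x" using assms(1) H[OF hk(1)] H[OF hk(2)]
    by (simp add: m_assoc) (simp add: m_assoc[symmetric])
  then show "a \<otimes> b \<in> cj x H" using hk subgroup.m_closed[OF assms(2)] by (auto simp: cj_def)
qed

lemma cj_subs: "x \<in> carrier G \<Longrightarrow> H \<in> subs G n \<Longrightarrow> cj x H \<in> subs G n"
  using cj_subgroup cj_card sub_carrier by (auto simp: subs_def)

lemma cj_self: "subgroup H G \<Longrightarrow> x \<in> H \<Longrightarrow> cj x H = H"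
proof (rule sub_eqI)
  assume H: "subgroup H G" "x \<in> H"
  show "cj x H \<subseteq> H" using H subgroup.m_closed[OF H(1)] subgroup.m_inv_closed[OF H(1)] by (auto simp: cj_def)
  show "card (cj x H) = card H" using H sub_carrier by (auto intro: cj_card)
qed

lemma Nm_subgroup: "H \<subseteq> carrier G \<Longrightarrow> subgroup (Nm H) G"
  by (rule closed_imp_subgroup) (auto simp: Nm_def cj_one cj_mult)

lemma Nm_self: "subgroup H G \<Longrightarrow> H \<subseteq> Nm H"
  using cj_self sub_carrier unfolding Nm_def by blast

lemma Nm_conj: "x \<in> Nm H \<Longrightarrow> h \<in> H \<Longrightarrow> x \<otimes> h \<otimes> inv x \<in> H"
  by (auto simp: Nm_def cj_def)

lemma NmI: "x \<in> carrier G \<Longrightarrow> subgroup H G \<Longrightarrow> (\<And>h. h \<in> H \<Longrightarrow> x \<otimes> h \<otimes> inv x \<in> H) \<Longrightarrow> x \<in> Nm H"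
  using sub_eqI[of H "cj x H"] cj_card[of x H] sub_carrier by (auto simp: Nm_def cj_def)

lemma Nm_carrier: "H \<subseteq> carrier G \<Longrightarrow> Nm H \<subseteq> carrier G"
  by (auto simp: Nm_def)

text \<open>The elements of P that carry x to g x form the coset of the stabilizer through g, so all
  fibres of the orbit map have the same size. The action is a bare function whose laws are assumed
  at the point x; \<open>inj\<close> stands for acting by inverses.\<close>

lemma orbit_stabilizer_card:
  assumes P: "subgroup P G"
    and one: "act \<one> x = x"
    and mult: "\<And>g h. g \<in> P \<Longrightarrow> h \<in> P \<Longrightarrow> act (g \<otimes> h) x = act g (act h x)"
    and inj: "\<And>g h y. g \<in> P \<Longrightarrow> h \<in> P \<Longrightarrow> act g (act h x) = act g x \<Longrightarrow> act h x = x"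
  shows "card P = card ((\<lambda>g. act g x) ` P) * card {g \<in> P. act g x = x}"
proof (rule card_eq_mult_fibres)
  show "finite P" using P sub_finite by blast
  note Pc = subgroup.mem_carrier[OF P]
  fix y assume "y \<in> (\<lambda>g. act g x) ` P"
  then obtain g where g: "g \<in> P" "y = act g x" by auto
  have "bij_betw (\<lambda>h. g \<otimes> h) {h \<in> P. act h x = x} {h \<in> P. act h x = y}"
  proof (rule bij_betwI')
    fix h k assume "h \<in> {h \<in> P. act h x = x}" "k \<in> {h \<in> P. act h x = x}"
    then show "(g \<otimes> h = g \<otimes> k) = (h = k)" using g Pc by auto
  next
    fix h assume "h \<in> {h \<in> P. act h x = x}"
    then show "g \<otimes> h \<in> {h \<in> P. act h x = y}" using g mult subgroup.m_closed[OF P] by auto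
  next
    fix k assume k: "k \<in> {h \<in> P. act h x = y}"
    let ?h = "inv g \<otimes> k"
    have h: "?h \<in> P" using k g subgroup.m_closed[OF P] subgroup.m_inv_closed[OF P] by auto
    have e: "g \<otimes> ?h = k" using k g Pc by (simp add: m_assoc[symmetric])
    then have "act g (act ?h x) = act g x" using mult[OF g(1) h] k g(2) by simp
    then have "act ?h x = x" using inj g h by blast
    then show "\<exists>h\<in>{h \<in> P. act h x = x}. k = g \<otimes> h" using h e by force
  qed
  then show "card {h \<in> P. act h x = y} = card {g \<in> P. act g x = x}"
    by (simp add: bij_betw_same_card)
qed

text \<open>By orbit-stabilizer every orbit has p-power length, and off the fixed points this length
  is not 1; hence p divides the number of points that are not fixed.\<close>

lemma p_group_fixed_points:
  assumes p: "nprime p" and P: "subgroup P G" "card P = p ^ n" and E: "finite E"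
    and closed: "\<And>g x. g \<in> P \<Longrightarrow> x \<in> E \<Longrightarrow> act g x \<in> E"
    and one: "\<And>x. x \<in> E \<Longrightarrow> act \<one> x = x"
    and mult: "\<And>g h x. g \<in> P \<Longrightarrow> h \<in> P \<Longrightarrow> x \<in> E \<Longrightarrow> act (g \<otimes> h) x = act g (act h x)"
  shows "[card E = card {x \<in> E. \<forall>g\<in>P. act g x = x}] (mod p)"
proof -
  let ?F = "{x \<in> E. \<forall>g\<in>P. act g x = x}"
  let ?R = "{(x, y). x \<in> E - ?F \<and> y \<in> E - ?F \<and> (\<exists>g\<in>P. y = act g x)}"
  note Pc = subgroup.mem_carrier[OF P(1)] and Pi = subgroup.m_inv_closed[OF P(1)]
    and Pm = subgroup.m_closed[OF P(1)]
  have cancel: "act (inv g) (act g x) = x" if "g \<in> P" "x \<in> E" for g x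
    using mult[of "inv g" g x] that Pi Pc one by simp
  have nF: "act g x \<in> E - ?F" if g: "g \<in> P" and x: "x \<in> E - ?F" for g x
  proof -
    have "act g x \<notin> ?F"
    proof
      assume "act g x \<in> ?F"
      then have "act (inv g) (act g x) = act g x" using Pi g by blast
      then have "act g x = x" using cancel g x by auto
      with \<open>act g x \<in> ?F\<close> x show False by auto
    qed
    then show ?thesis using closed g x by blast
  qed
  have eq: "equiv (E - ?F) ?R"
  proof (rule equivI)
    show "?R \<subseteq> (E - ?F) \<times> (E - ?F)" by blast
    show "refl_on (E - ?F) ?R" using one sub_one[OF P(1)] by (auto simp: refl_on_def) metis
    show "sym ?R" using cancel Pi by (auto simp: sym_def) (metis)+
    show "trans ?R" using mult Pm unfolding trans_def by simp (metis)
  qed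
  have "p dvd card (E - ?F)"
  proof (rule equiv_imp_dvd_card[OF _ eq])
    show "finite (E - ?F)" using E by simp
    fix C assume "C \<in> (E - ?F) // ?R"
    then obtain x where x: "x \<in> E - ?F" "C = ?R `` {x}" by (auto simp: quotient_def)
    then have C: "C = (\<lambda>g. act g x) ` P" using nF by blast
    have "card P = card C * card {g \<in> P. act g x = x}"
      unfolding C
    proof (rule orbit_stabilizer_card[OF P(1)])
      show "act \<one> x = x" "\<And>g h. g \<in> P \<Longrightarrow> h \<in> P \<Longrightarrow> act (g \<otimes> h) x = act g (act h x)"
        using x one mult by auto
      fix g h assume "g \<in> P" "h \<in> P" "act g (act h x) = act g x"
      moreover have "x \<in> E" using x by simp
      ultimately show "act h x = x" using cancel[of g "act h x"] cancel[of g x] closed[of h x] by simp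
    qed
    then obtain i where i: "card C = p ^ i" using prime_power_dvd_imp[OF p] P(2) by (metis dvd_triv_left)
    have "i \<noteq> 0"
    proof
      assume "i = 0"
      then obtain y where "C = {y}" using i card_1_singletonE by (metis power_0)
      moreover have "x \<in> C" using C one x sub_one[OF P(1)] by force
      ultimately show False using C x by blast
    qed
    then show "p dvd card C" using i by simp
  qed
  moreover have "card E = card (E - ?F) + card ?F"
  proof -
    have "card ((E - ?F) \<union> ?F) = card (E - ?F) + card ?F" by (rule card_Un_disjoint) (use E in auto)
    moreover have "(E - ?F) \<union> ?F = E" by blast
    ultimately show ?thesis by simp
  qed
  ultimately show ?thesis by (auto simp: cong_def mod_add_eq[symmetric] elim!: dvdE)
qed

definition cls :: "'a set \<Rightarrow> 'a set set" where "cls H = (\<lambda>x. cj x H) ` carrier G"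

lemma card_cls: "subgroup H G \<Longrightarrow> card (cls H) * card (Nm H) = order G"
proof -
  assume H: "subgroup H G"
  note Hc = sub_carrier[OF H]
  have "card (carrier G) = card ((\<lambda>g. cj g H) ` carrier G) * card {g \<in> carrier G. cj g H = H}"
  proof (rule orbit_stabilizer_card[OF subgroup_self])
    fix g h assume "g \<in> carrier G" "h \<in> carrier G" "cj g (cj h H) = cj g H"
    then show "cj h H = H" using cj_inv[of g "cj h H"] cj_inv[of g H] Hc cj_carrier by metis
  qed (use Hc cj_one cj_mult in auto)
  then show ?thesis by (simp add: cls_def Nm_def order_def)
qed

lemma cls_subs: "H \<in> subs G n \<Longrightarrow> cls H \<subseteq> subs G n"
  using cj_subs by (auto simp: cls_def)

lemma cls_self: "subgroup H G \<Longrightarrow> H \<in> cls H"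
  unfolding cls_def using cj_one[OF sub_carrier] one_closed by (metis image_eqI)

lemma finite_cls: "finite (cls H)" using fin by (simp add: cls_def)

text \<open>A member of \<open>cls H\<close> is fixed under conjugation by P precisely when P
  normalizes it.\<close>

lemma cls_fixed_points:
  assumes "nprime p" "subgroup P G" "card P = p ^ n" "subgroup H G"
  shows "[card (cls H) = card {K \<in> cls H. P \<subseteq> Nm K}] (mod p)"
proof -
  note Hc = sub_carrier[OF assms(4)] and Pc = sub_carrier[OF assms(2)]
  have "[card (cls H) = card {K \<in> cls H. \<forall>g\<in>P. cj g K = K}] (mod p)"
  proof (rule p_group_fixed_points[OF assms(1-3) finite_cls])
    fix g K assume g: "g \<in> P" and "K \<in> cls H"
    then obtain x where x: "x \<in> carrier G" "K = cj x H" by (auto simp: cls_def)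
    have "g \<in> carrier G" using g Pc by blast
    then have "cj g K = cj (g \<otimes> x) H" "g \<otimes> x \<in> carrier G" using cj_mult[of g x H] x Hc by auto
    then show "cj g K \<in> cls H" unfolding cls_def by blast
  next
    fix K assume "K \<in> cls H" then show "cj \<one> K = K" using cj_one cj_carrier Hc by (auto simp: cls_def)
  next
    fix g h K assume gh: "g \<in> P" "h \<in> P" and "K \<in> cls H"
    then obtain x where x: "x \<in> carrier G" "K = cj x H" by (auto simp: cls_def)
    show "cj (g \<otimes> h) K = cj g (cj h K)" using cj_mult[of g h K] cj_carrier[OF x(1) Hc] gh Pc x by blast
  qed
  moreover have "{K \<in> cls H. \<forall>g\<in>P. cj g K = K} = {K \<in> cls H. P \<subseteq> Nm K}"
    using Pc by (auto simp: Nm_def)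
  ultimately show ?thesis by simp
qed

lemma card_set_mult:
  assumes "subgroup H G" "subgroup K G"
  shows "card (H <#> K) * card (H \<inter> K) = card H * card K"
proof -
  note Hc = subgroup.mem_carrier[OF assms(1)] and Kc = subgroup.mem_carrier[OF assms(2)]
  let ?f = "\<lambda>(h, k). h \<otimes> k"
  have "card (H \<times> K) = card (?f ` (H \<times> K)) * card (H \<inter> K)"
  proof (rule card_eq_mult_fibres)
    show "finite (H \<times> K)" using assms sub_finite by blast
    fix y assume "y \<in> ?f ` (H \<times> K)"
    then obtain h k where hk: "h \<in> H" "k \<in> K" "y = h \<otimes> k" by auto
    \<comment> \<open>The factorisations of h k are the pairs (h d, d^-1 k) with d in the
      intersection; d is recovered from a pair (h', k') as h^-1 h'.\<close>
    have "bij_betw (\<lambda>d. (h \<otimes> d, inv d \<otimes> k)) (H \<inter> K) {x \<in> H \<times> K. ?f x = y}"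
    proof (rule bij_betwI')
      fix d e assume "d \<in> H \<inter> K" "e \<in> H \<inter> K"
      then show "((h \<otimes> d, inv d \<otimes> k) = (h \<otimes> e, inv e \<otimes> k)) = (d = e)" using hk Hc by auto
    next
      fix d assume d: "d \<in> H \<inter> K"
      then have "h \<otimes> d \<otimes> (inv d \<otimes> k) = h \<otimes> k" using hk Hc Kc
        by (simp add: m_assoc) (simp add: m_assoc[symmetric])
      then show "(h \<otimes> d, inv d \<otimes> k) \<in> {x \<in> H \<times> K. ?f x = y}"
        using d hk subgroup.m_closed[OF assms(1)] subgroup.m_closed[OF assms(2)] subgroup.m_inv_closed[OF assms(2)] by auto
    next
      fix x assume "x \<in> {x \<in> H \<times> K. ?f x = y}"
      then obtain h' k' where x: "x = (h', k')" "h' \<in> H" "k' \<in> K" "h' \<otimes> k' = h \<otimes> k" using hk by auto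
      let ?d = "inv h \<otimes> h'"
      have "?d = k \<otimes> inv k'"
      proof -
        have "h' = h \<otimes> k \<otimes> inv k'" using x hk Hc Kc by (metis inv_solve_right m_closed)
        then show ?thesis using hk x Hc Kc by (simp add: m_assoc) (simp add: m_assoc[symmetric])
      qed
      then have dK: "?d \<in> K" using x hk subgroup.m_closed[OF assms(2)] subgroup.m_inv_closed[OF assms(2)] by auto
      have dH: "?d \<in> H" using x hk subgroup.m_closed[OF assms(1)] subgroup.m_inv_closed[OF assms(1)] by auto
      have "h \<otimes> ?d = h'" using hk x Hc by (simp add: m_assoc[symmetric])
      moreover have "inv ?d \<otimes> k = k'" using \<open>?d = k \<otimes> inv k'\<close> hk x Kc by (simp add: inv_mult_group m_assoc)
      ultimately show "\<exists>d\<in>H \<inter> K. x = (h \<otimes> d, inv d \<otimes> k)" using dK dH x by force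
    qed
    then show "card {x \<in> H \<times> K. ?f x = y} = card (H \<inter> K)" by (simp add: bij_betw_same_card)
  qed
  moreover have "?f ` (H \<times> K) = H <#> K" by (auto simp: set_mult_def)
  ultimately show ?thesis by (simp add: card_cartesian_product)
qed

lemma set_mult_subgroup:
  assumes "subgroup H G" "subgroup K G" "K \<subseteq> Nm H"
  shows "subgroup (H <#> K) G" "H \<subseteq> H <#> K" "K \<subseteq> H <#> K"
proof -
  note Hc = subgroup.mem_carrier[OF assms(1)] and Kc = subgroup.mem_carrier[OF assms(2)]
  show 1: "H \<subseteq> H <#> K"
  proof
    fix h assume "h \<in> H"
    then have "h = h \<otimes> \<one>" "h \<in> H" using Hc by auto
    then show "h \<in> H <#> K" using sub_one[OF assms(2)] unfolding set_mult_def by blast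
  qed
  show 2: "K \<subseteq> H <#> K"
  proof
    fix h assume "h \<in> K"
    then have "h = \<one> \<otimes> h" "h \<in> K" using Kc by auto
    then show "h \<in> H <#> K" using sub_one[OF assms(1)] unfolding set_mult_def by blast
  qed
  show "subgroup (H <#> K) G"
  proof (rule closed_imp_subgroup)
    show "H <#> K \<subseteq> carrier G" using Hc Kc by (auto simp: set_mult_def)
    show "\<one> \<in> H <#> K" using 1 sub_one[OF assms(1)] by auto
    fix x y assume "x \<in> H <#> K" "y \<in> H <#> K"
    then obtain h k h' k' where e: "h \<in> H" "k \<in> K" "h' \<in> H" "k' \<in> K" "x = h \<otimes> k" "y = h' \<otimes> k'"
      by (auto simp: set_mult_def)
    have "k \<otimes> h' \<otimes> inv k \<in> H" using Nm_conj e assms(3) by blast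
    then have "h \<otimes> (k \<otimes> h' \<otimes> inv k) \<in> H" using e subgroup.m_closed[OF assms(1)] by auto
    moreover have "k \<otimes> k' \<in> K" using e subgroup.m_closed[OF assms(2)] by auto
    moreover have "x \<otimes> y = h \<otimes> (k \<otimes> h' \<otimes> inv k) \<otimes> (k \<otimes> k')"
    proof -
      have c: "h \<in> carrier G" "k \<in> carrier G" "h' \<in> carrier G" "k' \<in> carrier G" using e Hc Kc by auto
      then have "inv k \<otimes> (k \<otimes> k') = k'" by (simp add: m_assoc[symmetric])
      then show ?thesis using c e by (simp add: m_assoc)
    qed
    ultimately show "x \<otimes> y \<in> H <#> K" by (auto simp: set_mult_def)
  qed
qed

lemma coprime_Int:
  assumes "subgroup H G" "subgroup K G" "coprime (card H) (card K)"
  shows "H \<inter> K = {\<one>}"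
proof -
  have s: "subgroup (H \<inter> K) G" using assms subgroups_Inter_pair by blast
  have "card (H \<inter> K) dvd card H" "card (H \<inter> K) dvd card K"
    using card_sub_dvd_sub[OF s] assms by auto
  then have "card (H \<inter> K) = 1" using assms(3) by (metis coprime_common_divisor_nat)
  then have "H \<inter> K \<in> subs G 1" by (rule subsI[OF s])
  then show ?thesis unfolding subs_1 by simp
qed

lemma card_set_mult_coprime:
  assumes "subgroup H G" "subgroup K G" "coprime (card H) (card K)"
  shows "card (H <#> K) = card H * card K"
  using card_set_mult[OF assms(1,2)] coprime_Int[OF assms] by simp

end

section \<open>Sylow subgroups\<close>

context fin_group
begin

definition syl :: "nat \<Rightarrow> 'a set set" where
  "syl p = subs G (p ^ multiplicity p (order G))"

lemma sylow_order_dvd: "p ^ multiplicity p (order G) dvd order G"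
  by (rule multiplicity_dvd)

lemma sylow_exists: "nprime p \<Longrightarrow> \<exists>P. P \<in> syl p"
  unfolding syl_def by (rule exists_prime_power_subgroup) (auto simp: sylow_order_dvd)

lemma sylD: "P \<in> syl p \<Longrightarrow> subgroup P G" "P \<in> syl p \<Longrightarrow> card P = p ^ multiplicity p (order G)"
  by (auto simp: syl_def subs_def)

lemma prime_power_dvd_order_le:
  assumes "nprime p" "p ^ c dvd order G" shows "c \<le> multiplicity p (order G)"
proof (rule multiplicity_geI)
  show "order G \<noteq> 0" using order_pos by simp
  show "\<not> is_unit p" using assms(1) by (metis not_prime_unit)
qed fact

text \<open>As K normalizes H, the product H K is a p-subgroup, and it contains the Sylow subgroup
  H; by maximality of the order, H K = H.\<close>

lemma sylow_absorb:
  assumes p: "nprime p" and H: "H \<in> syl p" and K: "K \<in> subs G (p ^ b)" and N: "K \<subseteq> Nm H"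
  shows "K \<subseteq> H"
proof -
  let ?a = "multiplicity p (order G)"
  have Hs: "subgroup H G" "card H = p ^ ?a" using H sylD by auto
  have Ks: "subgroup K G" "card K = p ^ b" using K by (auto simp: subs_def)
  note HK = set_mult_subgroup[OF Hs(1) Ks(1) N]
  have "card (H <#> K) dvd p ^ (?a + b)"
    using card_set_mult[OF Hs(1) Ks(1)] Hs Ks by (simp add: power_add) (metis dvd_triv_left)
  then obtain c where c: "card (H <#> K) = p ^ c" using prime_power_dvd_imp[OF p] by blast
  have "c \<le> ?a" using prime_power_dvd_order_le[OF p] card_sub_dvd[OF HK(1)] c by simp
  then have "p ^ c \<le> p ^ ?a" using prime_gt_0_nat[OF p] by (intro power_increasing) auto
  moreover have "card H \<le> card (H <#> K)" by (rule card_mono[OF sub_finite[OF HK(1)] HK(2)])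
  ultimately have "H = H <#> K" using sub_eqI[OF HK(1,2)] c Hs by simp
  then show ?thesis using HK(3) by simp
qed

lemma syl_cls: "P \<in> syl p \<Longrightarrow> cls P \<subseteq> syl p"
  unfolding syl_def by (rule cls_subs)

text \<open>P acts on its own conjugates, and by \<open>sylow_absorb\<close> the only one that it
  normalizes is P.\<close>

lemma card_cls_sylow_cong:
  assumes p: "nprime p" and P: "P \<in> syl p" shows "[card (cls P) = 1] (mod p)"
proof -
  have Ps: "subgroup P G" "card P = p ^ multiplicity p (order G)" using P sylD by auto
  have "{K \<in> cls P. P \<subseteq> Nm K} = {P}"
  proof (rule subset_antisym; rule subsetI)
    fix K assume "K \<in> {K \<in> cls P. P \<subseteq> Nm K}"
    then have K: "K \<in> syl p" "P \<subseteq> Nm K" using syl_cls[OF P] by auto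
    then have "P \<subseteq> K" using sylow_absorb[OF p K(1) _ K(2)] P unfolding syl_def by blast
    then have "P = K" using sub_eqI[OF sylD(1)[OF K(1)]] Ps(2) sylD(2)[OF K(1)] by simp
    then show "K \<in> {P}" by simp
  next
    fix K assume "K \<in> {P}"
    then show "K \<in> {K \<in> cls P. P \<subseteq> Nm K}" using cls_self Nm_self Ps by auto
  qed
  then show ?thesis using cls_fixed_points[OF p Ps Ps(1)] by simp
qed

text \<open>The number of conjugates of P is 1 modulo p, so the p-group K normalizes at least one of
  them and is absorbed by it.\<close>

lemma sylow_contains:
  assumes p: "nprime p" and P: "P \<in> syl p" and K: "K \<in> subs G (p ^ b)"
  shows "\<exists>Q\<in>cls P. K \<subseteq> Q"
proof -
  have Ps: "subgroup P G" using P sylD by auto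
  have "[card {Q \<in> cls P. K \<subseteq> Nm Q} = 1] (mod p)"
    using cls_fixed_points[OF p subsD[OF K] Ps] card_cls_sylow_cong[OF p P] by (metis cong_sym cong_trans)
  then have "card {Q \<in> cls P. K \<subseteq> Nm Q} mod p = 1"
    using prime_gt_1_nat[OF p] by (simp add: cong_def)
  then have "card {Q \<in> cls P. K \<subseteq> Nm Q} \<noteq> 0" by (intro notI) simp
  then obtain Q where Q: "Q \<in> cls P" "K \<subseteq> Nm Q"
    by (metis (no_types, lifting) card.empty Collect_empty_eq)
  then have "K \<subseteq> Q" using sylow_absorb[OF p _ K Q(2)] syl_cls[OF P] by blast
  then show ?thesis using Q by blast
qed

lemma syl_eq_cls:
  assumes p: "nprime p" and P: "P \<in> syl p" shows "syl p = cls P"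
proof (rule subset_antisym; rule subsetI)
  fix K assume K: "K \<in> syl p"
  then obtain Q where Q: "Q \<in> cls P" "K \<subseteq> Q" using sylow_contains[OF p P] unfolding syl_def by blast
  have Q': "Q \<in> syl p" using Q(1) syl_cls[OF P] by blast
  have "K = Q" using sub_eqI[OF sylD(1)[OF Q'] Q(2)] sylD(2)[OF Q'] sylD(2)[OF K] by simp
  then show "K \<in> cls P" using Q by simp
qed (use syl_cls[OF P] in blast)

lemma card_syl_cong: "nprime p \<Longrightarrow> [card (syl p) = 1] (mod p)"
  using sylow_exists syl_eq_cls card_cls_sylow_cong by metis

lemma card_syl_index: "nprime p \<Longrightarrow> P \<in> syl p \<Longrightarrow> card (syl p) * card (Nm P) = order G"
  using syl_eq_cls card_cls sylD by metis

lemma Nm_eq_carrier_of_unique: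
  assumes H: "H \<in> subs G n" and c: "card (subs G n) = 1" shows "Nm H = carrier G"
proof -
  obtain K where "subs G n = {K}" using c by (rule card_1_singletonE)
  then have "subs G n = {H}" using H by auto
  then have "cj x H = H" if "x \<in> carrier G" for x using cj_subs[OF that H] by auto
  then show ?thesis by (auto simp: Nm_def)
qed

lemma normal_sylow_contains:
  assumes p: "nprime p" and P: "P \<in> syl p" "Nm P = carrier G" and K: "K \<in> subs G (p ^ b)"
  shows "K \<subseteq> P"
  using sylow_absorb[OF p P(1) K] P(2) sub_carrier subsD(1)[OF K] by simp

lemma normal_sylow_card:
  assumes p: "nprime p" and P: "P \<in> syl p" "Nm P = carrier G" shows "card (syl p) = 1"
  using card_syl_index[OF p P(1)] P(2) order_pos by (simp add: order_def)

lemma sub_eq_carrier_of_sylow: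
  assumes H: "subgroup H G"
    and d: "\<And>p. nprime p \<Longrightarrow> p dvd order G \<Longrightarrow> p ^ multiplicity p (order G) dvd card H"
  shows "H = carrier G"
proof -
  have "order G dvd card H"
  proof (rule multiplicity_le_imp_dvd)
    show "order G \<noteq> 0" using order_pos by simp
    fix p :: nat assume p: "Factorial_Ring.prime p"
    show "multiplicity p (order G) \<le> multiplicity p (card H)"
    proof (cases "p dvd order G")
      case True
      have "\<not> is_unit p" using p by (metis not_prime_unit)
      moreover have "card H \<noteq> 0" using sub_card_pos[OF H] by simp
      ultimately show ?thesis using d[OF p True] by (simp add: multiplicity_geI)
    next
      case False then show ?thesis by (simp add: not_dvd_imp_multiplicity_0)
    qed
  qed
  then have "card H = order G" using card_sub_dvd[OF H] by (simp add: dvd_antisym)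
  then show ?thesis using sub_eq_carrierI[OF H] by simp
qed

text \<open>The commutator h k h^-1 k^-1 lies both in H and in K.\<close>

lemma Nm_eq_commute:
  assumes "subgroup H G" "subgroup K G" "H \<inter> K = {\<one>}" "K \<subseteq> Nm H" "H \<subseteq> Nm K" "h \<in> H" "k \<in> K"
  shows "h \<otimes> k = k \<otimes> h"
proof -
  note c = subgroup.mem_carrier[OF assms(1,6)] subgroup.mem_carrier[OF assms(2,7)]
  have "h \<otimes> k \<otimes> inv h \<in> K" using Nm_conj assms by blast
  then have 1: "h \<otimes> k \<otimes> inv h \<otimes> inv k \<in> K" using subgroup.m_closed[OF assms(2)] subgroup.m_inv_closed[OF assms(2,7)] by blast
  have "inv h \<in> H" using subgroup.m_inv_closed[OF assms(1,6)] .
  then have "k \<otimes> inv h \<otimes> inv k \<in> H" using Nm_conj assms by blast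
  then have "h \<otimes> (k \<otimes> inv h \<otimes> inv k) \<in> H" using subgroup.m_closed[OF assms(1,6)] by blast
  then have "h \<otimes> k \<otimes> inv h \<otimes> inv k \<in> H" using c by (simp add: m_assoc)
  then have "h \<otimes> k \<otimes> inv h \<otimes> inv k = \<one>" using 1 assms(3) by blast
  then have "h \<otimes> k \<otimes> inv h = k" using c by (metis inv_closed inv_inv inv_equality m_closed)
  then show ?thesis using c by (metis inv_solve_right m_closed)
qed

section \<open>Cyclic groups and maximal subgroups of p-groups\<close>

definition cyc :: bool where "cyc \<longleftrightarrow> (\<exists>x\<in>carrier G. ord x = order G)"

lemma gen_eq_carrier_iff: "x \<in> carrier G \<Longrightarrow> generate G {x} = carrier G \<longleftrightarrow> ord x = order G"
  using sub_eq_carrierI[OF gen_subgroup] card_gen by (metis order_def)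

lemma cyclic_group_iff_cyc: "cyclic_group G \<longleftrightarrow> cyc"
proof -
  have "subgroup_generated G {x} = G \<longleftrightarrow> ord x = order G" if x: "x \<in> carrier G" for x
  proof -
    have "carrier G \<inter> {x} = {x}" using x by auto
    then have "subgroup_generated G {x} = G\<lparr>carrier := generate G {x}\<rparr>" by (simp add: subgroup_generated_def)
    moreover have "G\<lparr>carrier := generate G {x}\<rparr> = G \<longleftrightarrow> generate G {x} = carrier G"
      by (metis partial_object.select_convs(1) partial_object.surjective partial_object.update_convs(1))
    ultimately show ?thesis using gen_eq_carrier_iff[OF x] by simp
  qed
  then show ?thesis by (auto simp: cyclic_group_def cyc_def)
qed

text \<open>If H were self-normalizing, the number of its conjugates would be its index, a positive
  power of p. Then H, acting on them, would fix a number of them divisible by p; but it fixes only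
  itself.\<close>

lemma pg_normalizer_grows:
  assumes p: "nprime p" and o: "order G = p ^ n" and H: "subgroup H G" "H \<noteq> carrier G"
  shows "Nm H \<noteq> H"
proof
  assume N: "Nm H = H"
  have 1: "card (cls H) * card H = p ^ n" using card_cls[OF H(1)] N o by simp
  obtain i where i: "card (cls H) = p ^ i" using prime_power_dvd_imp[OF p] 1 by (metis dvd_triv_left)
  obtain j where j: "card H = p ^ j" using prime_power_dvd_imp[OF p] 1 by (metis dvd_triv_right)
  have "i \<noteq> 0" using 1 i o sub_eq_carrierI[OF H(1)] H(2) by auto
  then have "p dvd card (cls H)" using i by simp
  then have "p dvd card {K \<in> cls H. H \<subseteq> Nm K}"
    using cls_fixed_points[OF p H(1) j H(1)] by (metis cong_dvd_iff)
  moreover have "{K \<in> cls H. H \<subseteq> Nm K} = {H}"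
  proof (rule subset_antisym; rule subsetI)
    fix K assume "K \<in> {K \<in> cls H. H \<subseteq> Nm K}"
    then obtain x where x: "x \<in> carrier G" "K = cj x H" "H \<subseteq> Nm K" by (auto simp: cls_def)
    \<comment> \<open>H normalizes x H x^-1, so x^-1 H x normalizes H and, as H is self-normalizing,
      coincides with it.\<close>
    have "cj (inv x) H \<subseteq> Nm H"
    proof
      fix y assume "y \<in> cj (inv x) H"
      then obtain h where h: "h \<in> H" "y = inv x \<otimes> h \<otimes> x" using x(1) by (auto simp: cj_def)
      have hc: "h \<in> carrier G" using h sub_carrier[OF H(1)] by blast
      have hK: "cj h (cj x H) = cj x H" using h x by (auto simp: Nm_def)
      have "cj y H = cj (inv x) (cj h (cj x H))"
        using x(1) hc sub_carrier[OF H(1)] cj_carrier unfolding h(2)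
        by (metis cj_mult inv_closed m_closed)
      also have "\<dots> = H" unfolding hK using cj_inv x(1) sub_carrier[OF H(1)] by blast
      finally show "y \<in> Nm H" using hc x(1) h(2) by (simp add: Nm_def)
    qed
    then have "cj (inv x) H \<subseteq> H" using N by simp
    then have "cj (inv x) H = H" using sub_eqI[OF H(1)] cj_card x(1) sub_carrier[OF H(1)] by simp
    then have "K = H" using cj_inv' x sub_carrier[OF H(1)] by metis
    then show "K \<in> {H}" by simp
  qed (use cls_self Nm_self H(1) in auto)
  ultimately show False using prime_gt_1_nat[OF p] by simp
qed

lemma card_sub_prime_power:
  assumes "nprime p" "order G = p ^ n" "subgroup H G" shows "\<exists>i\<le>n. card H = p ^ i"
  using prime_power_dvd_imp[OF assms(1)] card_sub_dvd[OF assms(3)] assms(2) by simp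

text \<open>Choose M maximal among the proper subgroups above H. It is normal because normalizers
  grow, and G = M <y> for some y outside M with y^p in M. Hence p cosets of M cover G, and M has
  index p.\<close>

lemma pg_maximal:
  assumes p: "nprime p" and o: "order G = p ^ n" and H: "subgroup H G" "H \<noteq> carrier G"
  shows "\<exists>M\<in>subs G (p ^ (n - 1)). H \<subseteq> M"
proof -
  let ?A = "{M. subgroup M G \<and> M \<noteq> carrier G \<and> H \<subseteq> M}"
  have "finite ?A" by (rule finite_subset[OF _ finite_subgroups]) auto
  moreover have "H \<in> ?A" using H by auto
  ultimately obtain M where M: "M \<in> ?A" and max: "\<And>K. K \<in> ?A \<Longrightarrow> M \<subseteq> K \<Longrightarrow> M = K"
    by (metis (no_types, lifting) finite_has_maximal2)
  have Ms: "subgroup M G" "M \<noteq> carrier G" using M by auto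
  note Mc = subgroup.mem_carrier[OF Ms(1)]
  have "Nm M = carrier G"
  proof (rule ccontr)
    assume "Nm M \<noteq> carrier G"
    then have "Nm M \<in> ?A" using Nm_subgroup Nm_self[OF Ms(1)] M sub_carrier[OF Ms(1)] by blast
    then show False using max Nm_self[OF Ms(1)] pg_normalizer_grows[OF p o Ms] by blast
  qed
  obtain x where x: "x \<in> carrier G" "x \<notin> M" using Ms sub_carrier by blast
  have "ord x dvd p ^ n" using ord_dvd_group_order[OF x(1)] o by simp
  then have "x [^] (p ^ n) = \<one>" using pow_eq_id[OF x(1)] by blast
  then have "x [^] (p ^ n) \<in> M" using sub_one[OF Ms(1)] by simp
  \<comment> \<open>The first iterated p-th power of x that falls into M; its predecessor y is
    outside M, while y^p is inside.\<close>
  define j where "j = (LEAST j. x [^] (p ^ j) \<in> M)"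
  have j: "x [^] (p ^ j) \<in> M" unfolding j_def by (rule LeastI) fact
  have "j \<noteq> 0" using j x by (auto intro: ccontr)
  define y where "y = x [^] (p ^ (j - 1))"
  have y: "y \<in> carrier G" "y \<notin> M"
    using x not_less_Least[of "j - 1" "\<lambda>j. x [^] (p ^ j) \<in> M"] \<open>j \<noteq> 0\<close> unfolding y_def j_def[symmetric] by auto
  have "y [^] p = x [^] (p ^ j)" using x \<open>j \<noteq> 0\<close> unfolding y_def
    by (simp add: nat_pow_pow power_Suc2[symmetric] del: power_Suc)
  then have yp: "y [^] p \<in> M" using j by simp
  have gM: "generate G {y} \<subseteq> Nm M" using \<open>Nm M = carrier G\<close> gen_subgroup[OF y(1)] sub_carrier by simp
  note HK = set_mult_subgroup[OF Ms(1) gen_subgroup[OF y(1)] gM]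
  have "M <#> generate G {y} = carrier G"
  proof (rule ccontr)
    assume "M <#> generate G {y} \<noteq> carrier G"
    then have "M <#> generate G {y} \<in> ?A" using HK M by blast
    then have "M = M <#> generate G {y}" using max HK(2) by blast
    then show False using HK(3) gen_mem[of y] y(2) by blast
  qed
  moreover have "M <#> generate G {y} \<subseteq> (\<Union>i\<in>{..<p}. (\<lambda>m. m \<otimes> y [^] i) ` M)"
  proof
    fix z assume "z \<in> M <#> generate G {y}"
    then obtain m k where z: "m \<in> M" "z = m \<otimes> y [^] (k::nat)"
      using gen_eq[OF y(1)] by (auto simp: set_mult_def)
    have "y [^] k = (y [^] p) [^] (k div p) \<otimes> y [^] (k mod p)"
      using y(1) by (simp add: nat_pow_pow nat_pow_mult)
    then have "z = (m \<otimes> (y [^] p) [^] (k div p)) \<otimes> y [^] (k mod p)"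
      using z y(1) Mc by (simp add: m_assoc)
    moreover have "m \<otimes> (y [^] p) [^] (k div p) \<in> M"
      using subgroup.m_closed[OF Ms(1) z(1)] sub_pow[OF Ms(1) yp] by blast
    moreover have "k mod p < p" using prime_gt_0_nat[OF p] by simp
    ultimately show "z \<in> (\<Union>i\<in>{..<p}. (\<lambda>m. m \<otimes> y [^] i) ` M)" by blast
  qed
  ultimately have "card (carrier G) \<le> card (\<Union>i\<in>{..<p}. (\<lambda>m. m \<otimes> y [^] i) ` M)"
    using sub_finite[OF Ms(1)] by (intro card_mono) auto
  also have "\<dots> \<le> (\<Sum>i\<in>{..<p}. card ((\<lambda>m. m \<otimes> y [^] i) ` M))" by (rule card_UN_le) simp
  also have "\<dots> \<le> (\<Sum>i\<in>{..<p}. card M)" by (rule sum_mono) (rule card_image_le[OF sub_finite[OF Ms(1)]])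
  finally have le: "p ^ n \<le> p * card M" using o by (simp add: order_def)
  obtain i where i: "i \<le> n" "card M = p ^ i" using card_sub_prime_power[OF p o Ms(1)] by blast
  have "i \<noteq> n" using i Ms sub_eq_carrierI o by auto
  moreover have "n \<le> Suc i"
  proof (rule power_le_imp_le_exp)
    show "1 < p" using prime_gt_1_nat[OF p] .
    show "p ^ n \<le> p ^ Suc i" using le i(2) by simp
  qed
  ultimately have "i = n - 1" using i(1) by simp
  then show ?thesis using i M by (auto simp: subs_def)
qed

lemma pg_index_p_normal:
  assumes p: "nprime p" and o: "order G = p ^ n" and n: "0 < n" and M: "M \<in> subs G (p ^ (n - 1))"
  shows "Nm M = carrier G"
proof -
  have Ms: "subgroup M G" "card M = p ^ (n - 1)" using M by (auto simp: subs_def)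
  have p1: "p > 1" using prime_gt_1_nat[OF p] .
  have "p ^ (n - 1) \<noteq> p ^ n" using p1 n by (subst power_inject_exp) auto
  then have "M \<noteq> carrier G" using Ms(2) o unfolding order_def by metis
  then have ne: "Nm M \<noteq> M" using pg_normalizer_grows[OF p o Ms(1)] by simp
  have Ns: "subgroup (Nm M) G" using Nm_subgroup sub_carrier[OF Ms(1)] by blast
  obtain i where i: "i \<le> n" "card (Nm M) = p ^ i" using card_sub_prime_power[OF p o Ns] by blast
  have "card M < card (Nm M)"
    using psubset_card_mono[OF sub_finite[OF Ns]] Nm_self[OF Ms(1)] ne by blast
  then have "n - 1 < i" using Ms i p1 power_less_imp_less_exp by metis
  then have "i = n" using i n by simp
  then show ?thesis using i o sub_eq_carrierI[OF Ns] by simp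
qed

text \<open>Every element of a noncyclic p-group lies in a maximal subgroup. Apart from the
  identity, p subgroups of order p^(n-1) contain at most p^n - p elements, fewer than p^n - 1, so at
  least p + 1 are needed.\<close>

lemma pg_noncyclic_cover:
  assumes p: "nprime p" and o: "order G = p ^ n" and nc: "\<not> cyc"
  shows "p + 1 \<le> card (subs G (p ^ (n - 1)))" "2 \<le> n"
proof -
  have p1: "p > 1" using prime_gt_1_nat[OF p] .
  have mem: "\<exists>M\<in>subs G (p ^ (n - 1)). x \<in> M" if x: "x \<in> carrier G" for x
  proof -
    have "generate G {x} \<noteq> carrier G" using nc gen_eq_carrier_iff[OF x] x by (auto simp: cyc_def)
    then show ?thesis using pg_maximal[OF p o gen_subgroup[OF x]] gen_mem[of x] by blast
  qed
  let ?S = "subs G (p ^ (n - 1))"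
  have n0: "n \<noteq> 0"
  proof
    assume "n = 0"
    then have "ord \<one> = order G" using o ord_id by simp
    then show False using nc one_closed unfolding cyc_def by blast
  qed
  have cov: "carrier G - {\<one>} \<subseteq> (\<Union>M\<in>?S. M - {\<one>})" using mem by blast
  have "(\<Union>M\<in>?S. M - {\<one>}) \<subseteq> carrier G" using sub_carrier subsD(1) by blast
  then have "finite (\<Union>M\<in>?S. M - {\<one>})" using fin finite_subset by blast
  from card_mono[OF this cov] have "card (carrier G - {\<one>}) \<le> card (\<Union>M\<in>?S. M - {\<one>})" .
  also have "\<dots> \<le> (\<Sum>M\<in>?S. card (M - {\<one>}))" by (rule card_UN_le) simp
  also have "\<dots> = (\<Sum>M\<in>?S. p ^ (n - 1) - 1)"
    by (rule sum.cong) (auto simp: subs_def sub_one card_Diff_subset)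
  finally have le: "p ^ n - 1 \<le> card ?S * (p ^ (n - 1) - 1)"
    using o by (simp add: card_Diff_subset order_def)
  have pn: "p ^ n = p * p ^ (n - 1)" using n0 by (metis power_eq_if)
  have q1: "p ^ (n - 1) \<ge> 1" using p1 by simp
  show "p + 1 \<le> card ?S"
  proof (rule ccontr)
    assume "\<not> p + 1 \<le> card ?S"
    then have "card ?S * (p ^ (n - 1) - 1) \<le> p * (p ^ (n - 1) - 1)" by (intro mult_right_mono) auto
    also have "\<dots> = p ^ n - p" unfolding pn by (simp add: diff_mult_distrib2)
    also have "\<dots> < p ^ n - 1"
    proof (rule diff_less_mono2[OF p1])
      show "1 < p ^ n" using p1 n0 by (intro one_less_power) simp_all
    qed
    finally show False using le by simp
  qed
  show "2 \<le> n"
  proof (rule ccontr)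
    assume "\<not> 2 \<le> n"
    then have "n = 1" using n0 by simp
    then show False using le p1 by simp
  qed
qed

end

lemma iso_card_subs_le:
  assumes "fin_group G" "fin_group H" "h \<in> iso G H"
  shows "card (subs G n) \<le> card (subs H n)" "subgroup_count G \<le> subgroup_count H"
proof -
  interpret G: fin_group G by fact
  interpret H: fin_group H by fact
  interpret gh: group_hom G H h using assms(3) by unfold_locales (auto simp: iso_def)
  have inj: "inj_on h (carrier G)" using assms(3) by (auto simp: iso_def bij_betw_def)
  have cc: "card (h ` K) = card K" if "subgroup K G" for K
    by (rule card_image) (rule inj_on_subset[OF inj G.sub_carrier[OF that]])
  have i: "inj_on ((`) h) {K. subgroup K G}"
    by (rule inj_on_subset[OF inj_on_image_Pow[OF inj]]) (use G.sub_carrier in auto)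
  show "card (subs G n) \<le> card (subs H n)"
  proof (rule card_inj_on_le[of "(`) h"])
    show "inj_on ((`) h) (subs G n)" by (rule inj_on_subset[OF i]) (auto simp: subs_def)
    show "(`) h ` subs G n \<subseteq> subs H n"
      using cc gh.subgroup_img_is_subgroup by (auto simp: subs_def)
  qed simp
  show "subgroup_count G \<le> subgroup_count H"
    unfolding subgroup_count_def
  proof (rule card_inj_on_le[OF i])
    show "(`) h ` {K. subgroup K G} \<subseteq> {K. subgroup K H}"
      using gh.subgroup_img_is_subgroup by auto
  qed (rule H.finite_subgroups)
qed

lemma iso_fin_group:
  assumes "fin_group G" "group H" "G \<cong> H" shows "fin_group H"
proof -
  obtain h where "h \<in> iso G H" using assms by (auto simp: is_iso_def)
  then have "carrier H = h ` carrier G" by (auto simp: iso_def bij_betw_def)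
  moreover have "finite (carrier G)" using assms(1) by (simp add: fin_group_def fin_group_axioms_def)
  ultimately show ?thesis using assms(2) by (simp add: fin_group_def fin_group_axioms_def)
qed

lemma iso_card_subs:
  assumes "fin_group G" "group H" "G \<cong> H"
  shows "card (subs G n) = card (subs H n)" "subgroup_count G = subgroup_count H"
proof -
  have H: "fin_group H" using iso_fin_group assms by blast
  obtain h where h: "h \<in> iso G H" using assms by (auto simp: is_iso_def)
  obtain k where k: "k \<in> iso H G" using group.iso_sym[OF _ assms(3)] assms(1) by (auto simp: is_iso_def fin_group_def)
  show "card (subs G n) = card (subs H n)" "subgroup_count G = subgroup_count H"
    using iso_card_subs_le[OF assms(1) H h] iso_card_subs_le[OF H assms(1) k] by (auto intro: antisym)
qed

section \<open>Normal subgroups and the condition G = tilde G\<close>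

context fin_group
begin

lemma normal_iff_Nm: "N \<lhd> G \<longleftrightarrow> subgroup N G \<and> Nm N = carrier G"
proof
  assume N: "N \<lhd> G"
  then have s: "subgroup N G" by (rule normal_imp_subgroup)
  have "x \<in> Nm N" if "x \<in> carrier G" for x
    using NmI[OF that s] normal.inv_op_closed2[OF N that] by blast
  then show "subgroup N G \<and> Nm N = carrier G" using s Nm_carrier[OF sub_carrier[OF s]] by blast
next
  assume "subgroup N G \<and> Nm N = carrier G"
  then show "N \<lhd> G" using normal_inv_iff Nm_conj by blast
qed

lemma Nm_set_mult:
  assumes "subgroup M G" "subgroup N G" "Nm M = carrier G" "Nm N = carrier G"
  shows "Nm (M <#> N) = carrier G"
proof -
  have s: "subgroup (M <#> N) G" using set_mult_subgroup(1)[OF assms(1,2)] assms(3) sub_carrier[OF assms(2)] by simp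
  have "x \<in> Nm (M <#> N)" if x: "x \<in> carrier G" for x
  proof (rule NmI[OF x s])
    fix h assume "h \<in> M <#> N"
    then obtain m n where h: "m \<in> M" "n \<in> N" "h = m \<otimes> n" by (auto simp: set_mult_def)
    have c: "m \<in> carrier G" "n \<in> carrier G" using h assms sub_carrier by blast+
    have "x \<otimes> m \<otimes> inv x \<in> M" "x \<otimes> n \<otimes> inv x \<in> N" using Nm_conj h x assms by auto
    moreover have "x \<otimes> h \<otimes> inv x = (x \<otimes> m \<otimes> inv x) \<otimes> (x \<otimes> n \<otimes> inv x)"
    proof -
      have "inv x \<otimes> (x \<otimes> (n \<otimes> inv x)) = n \<otimes> inv x" using c x by (simp add: m_assoc[symmetric])
      then show ?thesis using c x h(3) by (simp add: m_assoc)
    qed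
    ultimately show "x \<otimes> h \<otimes> inv x \<in> M <#> N" by (auto simp: set_mult_def)
  qed
  then show ?thesis using Nm_carrier[OF sub_carrier[OF s]] by blast
qed

text \<open>\<^const>\<open>pi_prime_core\<close> is a \<^const>\<open>Greatest\<close>, so its value is meaningful only once the
  existence of a greatest normal \<open>\<pi>'\<close>-subgroup has been established.\<close>

lemma pi_prime_core_props:
  assumes pr: "\<forall>p\<in>\<pi>. nprime p"
  shows "\<forall>p\<in>\<pi>. \<not> p dvd card (pi_prime_core \<pi> G)"
proof -
  let ?P = "\<lambda>N. N \<lhd> G \<and> (\<forall>p\<in>\<pi>. \<not> p dvd card N)"
  have fin: "finite {N. ?P N}" by (rule finite_subset[OF _ finite_subgroups]) (auto dest: normal_imp_subgroup)
  have "\<not> p dvd card {\<one>}" if "p \<in> \<pi>" for p using pr that not_prime_unit[of p] by auto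
  then have "{\<one>} \<in> {N. ?P N}" using one_is_normal by blast
  from finite_has_maximal2[OF fin this] obtain M where M0: "M \<in> {N. ?P N}"
    and max0: "{\<one>} \<subseteq> M \<and> (\<forall>K\<in>{N. ?P N}. M \<subseteq> K \<longrightarrow> M = K)" by (rule bexE)
  have M: "?P M" using M0 by (rule CollectD)
  have max: "M = K" if "?P K" "M \<subseteq> K" for K
    using bspec[OF conjunct2[OF max0] CollectI[of ?P, OF that(1)]] that(2) by (rule mp)
  \<comment> \<open>The product of two normal subgroups of order prime to \<pi> is again one, so a
    maximal such subgroup is the greatest.\<close>
  have "K \<subseteq> M" if K: "?P K" for K
  proof -
    have Ms: "subgroup M G" "Nm M = carrier G" and Ks: "subgroup K G" "Nm K = carrier G"
      using M K normal_iff_Nm by auto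
    note MK = set_mult_subgroup[OF Ms(1) Ks(1)]
    have KN: "K \<subseteq> Nm M" using Ms Ks sub_carrier by simp
    have "card (M <#> K) dvd card M * card K" using card_set_mult[OF Ms(1) Ks(1)] by (metis dvd_triv_left)
    then have "\<forall>p\<in>\<pi>. \<not> p dvd card (M <#> K)" using M K pr by (meson dvd_trans prime_dvd_multD)
    moreover have "M <#> K \<lhd> G" using normal_iff_Nm MK(1)[OF KN] Nm_set_mult Ms Ks by blast
    ultimately have "M = M <#> K" using max MK(2)[OF KN] by blast
    then show ?thesis using MK(3)[OF KN] by blast
  qed
  then have "pi_prime_core \<pi> G = M" unfolding pi_prime_core_def by (intro Greatest_equality) (use M in auto)
  then show ?thesis using M by blast
qed

text \<open>Each prime in \<open>central_cyclic_primes G\<close> divides |G|, whereas the order of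
  the core is prime to all of them. The hypothesis on G is used in the form on the right from here
  on.\<close>

lemma tilde_eq_carrier_iff: "carrier G = tilde G \<longleftrightarrow> central_cyclic_primes G = {}"
proof
  assume t: "carrier G = tilde G"
  have "\<forall>p\<in>central_cyclic_primes G. \<not> p dvd card (carrier G)"
    using pi_prime_core_props[of "central_cyclic_primes G"] t
    by (simp add: tilde_def central_cyclic_primes_def)
  then show "central_cyclic_primes G = {}" by (auto simp: central_cyclic_primes_def order_def)
next
  assume "central_cyclic_primes G = {}"
  then have "tilde G = (GREATEST N. N \<lhd> G)" by (simp add: tilde_def pi_prime_core_def)
  also have "\<dots> = carrier G"
    by (rule Greatest_equality) (use normal_self normal_imp_subgroup sub_carrier in blast)+
  finally show "carrier G = tilde G" by simp
qed

end

section \<open>Metacyclic groups\<close>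

text \<open>\<open>metacyclic G m s r t\<close>: \<open>G\<close> has order \<open>m s\<close> and consists of the products \<open>a\<^sup>i b\<^sup>x\<close>, where
  \<open>b\<^sup>s = 1\<close>, \<open>a\<^sup>-\<^sup>1 b a = b\<^sup>r\<close> and \<open>a\<^sup>m = b\<^sup>t\<close>.\<close>

definition metacyclic_gens ::
  "('a, 'b) monoid_scheme \<Rightarrow> nat \<Rightarrow> nat \<Rightarrow> nat \<Rightarrow> nat \<Rightarrow> 'a \<Rightarrow> 'a \<Rightarrow> bool" where
  "metacyclic_gens G m s r t a b \<longleftrightarrow> 0 < m \<and> 0 < s \<and> order G = m * s \<and> a \<in> carrier G \<and> b \<in> carrier G \<and>
     b [^]\<^bsub>G\<^esub> s = \<one>\<^bsub>G\<^esub> \<and> b \<otimes>\<^bsub>G\<^esub> a = a \<otimes>\<^bsub>G\<^esub> b [^]\<^bsub>G\<^esub> r \<and> a [^]\<^bsub>G\<^esub> m = b [^]\<^bsub>G\<^esub> t \<and>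
     (\<forall>g\<in>carrier G. \<exists>i x. g = a [^]\<^bsub>G\<^esub> (i::nat) \<otimes>\<^bsub>G\<^esub> b [^]\<^bsub>G\<^esub> (x::nat))"

definition metacyclic :: "('a, 'b) monoid_scheme \<Rightarrow> nat \<Rightarrow> nat \<Rightarrow> nat \<Rightarrow> nat \<Rightarrow> bool" where
  "metacyclic G m s r t \<longleftrightarrow> (\<exists>a b. metacyclic_gens G m s r t a b)"

text \<open>The exponent produced by powers: the k-th power of a^d b^y is a^(d k) b^(y geo r d k),
  see \<open>E_pow\<close>.\<close>

definition geo :: "nat \<Rightarrow> nat \<Rightarrow> nat \<Rightarrow> nat" where "geo r d k = (\<Sum>i<k. r ^ (d * i))"

lemma geo_0 [simp]: "geo r d 0 = 0" and geo_Suc: "geo r d (Suc k) = geo r d k + r ^ (d * k)"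
  by (simp_all add: geo_def)

lemma geo_1: "geo r d (Suc 0) = 1" by (simp add: geo_def)

lemma geo_add: "geo r d (k + l) = geo r d k * r ^ (d * l) + geo r d l"
  by (induction k) (simp_all add: geo_Suc algebra_simps power_add)

text \<open>Division with remainder by the least positive member. In the natural numbers closure
  under cancellation takes the place of closure under negation.\<close>

lemma nat_ideal:
  fixes D :: "nat set"
  assumes m: "m \<in> D" "0 < m" and add: "\<And>i j. i \<in> D \<Longrightarrow> j \<in> D \<Longrightarrow> i + j \<in> D"
    and diff: "\<And>i j. i \<in> D \<Longrightarrow> i + j \<in> D \<Longrightarrow> j \<in> D"
  shows "\<exists>d>0. \<forall>i. i \<in> D \<longleftrightarrow> d dvd i"
proof -
  define d where "d = (LEAST d. 0 < d \<and> d \<in> D)"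
  have d: "0 < d \<and> d \<in> D" unfolding d_def by (rule LeastI[of _ m]) (use m in auto)
  have min: "\<not> (0 < k \<and> k \<in> D)" if "k < d" for k using not_less_Least that unfolding d_def by blast
  have mult: "d * k \<in> D" for k
  proof (induction k)
    case 0 show ?case using diff[of m 0] m by simp
  next
    case (Suc k) then show ?case using add[of d "d * k"] d by simp
  qed
  have "d dvd i" if "i \<in> D" for i
  proof -
    have "d * (i div d) + i mod d \<in> D" using that by simp
    then have "i mod d \<in> D" using diff[OF mult] by blast
    then have "i mod d = 0" using min[of "i mod d"] d by auto
    then show ?thesis by auto
  qed
  then show ?thesis using d mult by (metis dvdE)
qed

context fin_group
begin

lemma pow_conj_comm:
  assumes c: "a \<in> carrier G" "b \<in> carrier G" and ba: "b \<otimes> a = a \<otimes> b [^] (r::nat)"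
  shows "b [^] (x::nat) \<otimes> a [^] (j::nat) = a [^] j \<otimes> b [^] (x * r ^ j)"
proof -
  have 1: "b [^] (x::nat) \<otimes> a = a \<otimes> b [^] (x * r)" for x
  proof (induction x)
    case (Suc x)
    have "b [^] Suc x \<otimes> a = b [^] x \<otimes> (a \<otimes> b [^] r)" using c ba by (simp add: m_assoc)
    also have "\<dots> = b [^] x \<otimes> a \<otimes> b [^] r" using c by (simp add: m_assoc)
    also have "\<dots> = a \<otimes> b [^] (x * r) \<otimes> b [^] r" using Suc by simp
    also have "\<dots> = a \<otimes> b [^] (Suc x * r)" using c by (simp add: m_assoc nat_pow_mult add.commute)
    finally show ?case .
  qed (use c in simp)
  show ?thesis
  proof (induction j arbitrary: x)
    case (Suc j)
    have "b [^] x \<otimes> a [^] Suc j = b [^] x \<otimes> a [^] j \<otimes> a" using c by (simp add: m_assoc)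
    also have "\<dots> = a [^] j \<otimes> (b [^] (x * r ^ j) \<otimes> a)" using c Suc by (simp add: m_assoc)
    also have "\<dots> = a [^] Suc j \<otimes> b [^] (x * r ^ Suc j)" using c unfolding 1 by (simp add: m_assoc mult_ac)
    finally show ?case .
  qed (use c in simp)
qed

end

locale metacyclic_group = fin_group G for G (structure) +
  fixes m s r t :: nat and a b
  assumes gens: "metacyclic_gens G m s r t a b"
begin

lemma mpos: "0 < m" and spos: "0 < s" and ord_eq: "order G = m * s"
  and ac: "a \<in> carrier G" and bc: "b \<in> carrier G" and bs: "b [^] s = \<one>"
  and ba: "b \<otimes> a = a \<otimes> b [^] r" and am: "a [^] m = b [^] t"
  using gens by (auto simp: metacyclic_gens_def)

text \<open>The exponents stay unreduced, so that \<open>E_mult\<close> is a plain formula;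
  reduction matters only for deciding equality, in \<open>E_eq\<close>.\<close>

definition E :: "nat \<Rightarrow> nat \<Rightarrow> 'a" where "E i x = a [^] i \<otimes> b [^] x"

lemma Ec [simp]: "E i x \<in> carrier G" using ac bc by (simp add: E_def)

lemma E_cover: "g \<in> carrier G \<Longrightarrow> \<exists>i x. g = E i x"
  using gens by (simp add: metacyclic_gens_def E_def)

lemma E_mult: "E i x \<otimes> E j y = E (i + j) (x * r ^ j + y)"
proof -
  have "E i x \<otimes> E j y = a [^] i \<otimes> (b [^] x \<otimes> a [^] j) \<otimes> b [^] y"
    using ac bc by (simp add: E_def m_assoc)
  also have "\<dots> = E (i + j) (x * r ^ j + y)"
    unfolding pow_conj_comm[OF ac bc ba] using ac bc
    by (simp add: E_def m_assoc nat_pow_mult[symmetric])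
  finally show ?thesis .
qed

lemma E_00: "E 0 0 = \<one>" by (simp add: E_def)

lemma b_mod: "b [^] x = b [^] (x mod s)"
proof -
  have "b [^] x = (b [^] s) [^] (x div s) \<otimes> b [^] (x mod s)"
    using bc by (simp add: nat_pow_pow nat_pow_mult del: bs)
  then show ?thesis using bs bc by simp
qed

lemma E_shift: "E (i + m * q) x = E i (q * t + x)"
proof -
  have "a [^] (i + m * q) = a [^] i \<otimes> b [^] (t * q)"
    using ac bc am by (simp add: nat_pow_mult[symmetric] nat_pow_pow[symmetric])
  then show ?thesis using ac bc by (simp add: E_def m_assoc nat_pow_mult mult.commute)
qed

lemma E_snd_mod: "E i x = E i (x mod s)"
  unfolding E_def using b_mod[of x] by simp

lemma E_snd_cong: "[x = y] (mod s) \<Longrightarrow> E i x = E i y"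
  using E_snd_mod[of i x] E_snd_mod[of i y] by (simp add: cong_def)

lemma E_red: "E i x = E (i mod m) ((i div m * t + x) mod s)"
  using E_shift[of "i mod m" "i div m" x] E_snd_mod by simp

text \<open>The m s reduced products already cover G, which has order m s, so they are
  distinct.\<close>

lemma E_inj: "inj_on (\<lambda>(i, x). E i x) ({..<m} \<times> {..<s})"
proof (rule eq_card_imp_inj_on)
  have "(\<lambda>(i, x). E i x) ` ({..<m} \<times> {..<s}) = carrier G"
  proof (rule subset_antisym; rule subsetI)
    fix g assume "g \<in> carrier G"
    then obtain i x where "g = E i x" using E_cover by blast
    then have "g = E (i mod m) ((i div m * t + x) mod s)" using E_red by simp
    moreover have "(i mod m, (i div m * t + x) mod s) \<in> {..<m} \<times> {..<s}" using mpos spos by simp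
    ultimately show "g \<in> (\<lambda>(i, x). E i x) ` ({..<m} \<times> {..<s})" by (metis (no_types, lifting) case_prod_conv image_eqI)
  qed auto
  then show "card ((\<lambda>(i, x). E i x) ` ({..<m} \<times> {..<s})) = card ({..<m} \<times> {..<s})"
    using ord_eq by (simp add: order_def)
qed simp

lemma E_eq: "E i x = E j y \<longleftrightarrow> i mod m = j mod m \<and> [i div m * t + x = j div m * t + y] (mod s)"
proof
  assume "E i x = E j y"
  then have "E (i mod m) ((i div m * t + x) mod s) = E (j mod m) ((j div m * t + y) mod s)"
    using E_red by metis
  then have "(i mod m, (i div m * t + x) mod s) = (j mod m, (j div m * t + y) mod s)"
    using inj_onD[OF E_inj, of "(i mod m, (i div m * t + x) mod s)" "(j mod m, (j div m * t + y) mod s)"]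
      mpos spos by simp
  then show "i mod m = j mod m \<and> [i div m * t + x = j div m * t + y] (mod s)" by (simp add: cong_def)
next
  assume "i mod m = j mod m \<and> [i div m * t + x = j div m * t + y] (mod s)"
  then show "E i x = E j y" using E_red[of i x] E_red[of j y] by (simp add: cong_def)
qed

lemma E_eq_snd: "E i x = E i y \<longleftrightarrow> [x = y] (mod s)"
  by (simp add: E_eq cong_add_lcancel_nat)

text \<open>a^m is a power of b and so commutes with b, while conjugation by a^m raises b to the
  power r^m.\<close>

lemma r_pow_m: "[r ^ m = 1] (mod s)"
proof -
  have "E 0 1 \<otimes> E m 0 = E m (r ^ m)" by (simp add: E_mult)
  moreover have "E m 0 = E 0 t" using E_shift[of 0 1 0] by simp
  then have "E 0 1 \<otimes> E m 0 = E 0 (t + 1)" by (simp add: E_mult add.commute)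
  moreover have "E m (r ^ m) = E 0 (t + r ^ m)" using E_shift[of 0 1 "r ^ m"] by simp
  ultimately have "[t + r ^ m = t + 1] (mod s)" using E_eq_snd by simp
  then show ?thesis by (simp only: cong_add_lcancel_nat)
qed

text \<open>b^t is a power of a and so commutes with a.\<close>

lemma t_r: "[t * r = t] (mod s)"
proof -
  have e: "E m 0 = E 0 t" using E_shift[of 0 1 0] by simp
  have "E 1 0 \<otimes> E 0 t = E 0 t \<otimes> E 1 0" unfolding e[symmetric] by (simp add: E_mult)
  then show ?thesis using E_eq_snd by (simp add: E_mult cong_sym)
qed

lemma E_pow: "E d y [^] (k::nat) = E (d * k) (y * geo r d k)"
proof (induction k)
  case (Suc k)
  have "geo r d (Suc k) = geo r d k * r ^ d + 1" using geo_add[of r d k "Suc 0"] by (simp add: geo_1)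
  then show ?case using Suc by (simp add: E_mult algebra_simps)
qed (simp add: E_00)

text \<open>In the subgroup of the triple \<open>(d, e, y)\<close>, \<open>a\<^sup>d b\<^sup>y\<close> generates the image in the quotient by \<open>\<langle>b\<rangle>\<close>, and
  \<open>b\<^sup>e\<close> the intersection with \<open>\<langle>b\<rangle>\<close>. The condition \<open>e dvd t + y * geo r d (m div d)\<close> says that the
  power \<open>m div d\<close> of \<open>a\<^sup>d b\<^sup>y\<close> lies in this intersection.\<close>

definition Hs :: "nat \<times> nat \<times> nat \<Rightarrow> 'a set" where
  "Hs = (\<lambda>(d, e, y). {E (d * k) (y * geo r d k + e * l) | k l. True})"

definition trip :: "(nat \<times> nat \<times> nat) set" where
  "trip = {(d, e, y). d dvd m \<and> e dvd s \<and> y < e \<and> e dvd t + y * geo r d (m div d)}"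

lemma Hs_subgroup: "subgroup (Hs (d, e, y)) G"
proof (rule closed_imp_subgroup)
  show "Hs (d, e, y) \<subseteq> carrier G" by (auto simp: Hs_def)
  have "\<one> = E (d * 0) (y * geo r d 0 + e * 0)" by (simp add: E_00)
  then show "\<one> \<in> Hs (d, e, y)" unfolding Hs_def by blast
  fix g h assume "g \<in> Hs (d, e, y)" "h \<in> Hs (d, e, y)"
  then obtain k l k' l' where g: "g = E (d * k) (y * geo r d k + e * l)"
    and h: "h = E (d * k') (y * geo r d k' + e * l')" by (auto simp: Hs_def)
  have "g \<otimes> h = E (d * (k + k')) (y * geo r d (k + k') + e * (l * r ^ (d * k') + l'))"
    unfolding g h E_mult geo_add by (simp add: algebra_simps)
  then show "g \<otimes> h \<in> Hs (d, e, y)" unfolding Hs_def by blast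
qed

text \<open>A full period of \<open>m div d\<close> further terms multiplies the sum by r^m, which
  is 1 modulo e, and adds \<open>geo r d (m div d)\<close>.\<close>

lemma geo_cong:
  assumes "d dvd m" "e dvd s"
  shows "[geo r d (m div d * q + c) = geo r d c + q * geo r d (m div d)] (mod e)"
proof (induction q)
  case (Suc q)
  let ?n = "m div d"
  have "d * ?n = m" using assms(1) by simp
  then have "geo r d (?n * Suc q + c) = geo r d (?n * q + c) * r ^ m + geo r d ?n"
    using geo_add[of r d "?n * q + c" ?n] by (simp add: algebra_simps)
  moreover have "[r ^ m = 1] (mod e)" using r_pow_m assms(2) by (metis cong_dvd_modulus_nat)
  then have "[geo r d (?n * q + c) * r ^ m + geo r d ?n = (geo r d c + q * geo r d ?n) * 1 + geo r d ?n] (mod e)"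
    using Suc by (intro cong_add cong_mult cong_refl)
  ultimately show ?case by (simp add: algebra_simps)
qed (simp add: cong_refl)

text \<open>Different k can describe the same element because a^m = b^t. Each wrap-around changes
  the exponent of b by a multiple of \<open>t + y * geo r d (m div d)\<close>, which e divides, so
  the exponent modulo e is well defined. This lets \<open>Hs_inj\<close> recover the triple from the
  subgroup.\<close>

lemma Hs_mem:
  assumes T: "(d, e, y) \<in> trip" and mem: "E i x \<in> Hs (d, e, y)"
  shows "d dvd i" "i = d * k \<Longrightarrow> [x = y * geo r d k] (mod e)"
proof -
  let ?n = "m div d"
  have d: "d dvd m" and e: "e dvd s" and te: "e dvd t + y * geo r d ?n" using T by (auto simp: trip_def)
  have dn: "d * ?n = m" using d by simp
  have d0: "0 < d" using d mpos by (auto intro: Nat.gr0I)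
  obtain k' l where kl: "E i x = E (d * k') (y * geo r d k' + e * l)" using mem by (auto simp: Hs_def)
  have im: "i mod m = d * k' mod m" using kl E_eq by blast
  then show di: "d dvd i" using d by (metis dvd_mod_iff dvd_triv_left)
  assume ik: "i = d * k"
  have div: "d * j div m = j div ?n" "d * j mod m = d * (j mod ?n)" for j
    using d0 dn by (metis div_mult_mult1 not_gr0) (metis dn mult_mod_right)
  \<comment> \<open>q and q' count the wrap-arounds of k and k'; c is their common
    remainder.\<close>
  define q q' c where "q = k div ?n" "q' = k' div ?n" "c = k mod ?n"
  have "k' mod ?n = c" using im d0 unfolding ik div q_q'_c_def by simp
  then have kk: "k = ?n * q + c" "k' = ?n * q' + c"
    using mult_div_mod_eq[of ?n k] mult_div_mod_eq[of ?n k'] unfolding q_q'_c_def by metis+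
  have z: "[q * (t + y * geo r d ?n) = 0] (mod e)" "[q' * (t + y * geo r d ?n) = 0] (mod e)"
    using te by (simp_all add: cong_0_iff)
  have 1: "[q * t + x = q' * t + (y * geo r d k' + e * l)] (mod e)"
    using kl e unfolding E_eq ik div q_q'_c_def[symmetric] by (meson cong_dvd_modulus_nat)
  have 2: "[q' * t + (y * geo r d k' + e * l) = y * geo r d c] (mod e)"
  proof -
    have "[q' * t + (y * geo r d k' + e * l) = q' * t + (y * (geo r d c + q' * geo r d ?n) + 0)] (mod e)"
      unfolding kk by (intro cong_add cong_mult cong_refl geo_cong d e) (simp add: cong_0_iff)
    also have "q' * t + (y * (geo r d c + q' * geo r d ?n) + 0) = y * geo r d c + q' * (t + y * geo r d ?n)"
      by (simp add: algebra_simps)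
    also have "[y * geo r d c + q' * (t + y * geo r d ?n) = y * geo r d c + 0] (mod e)"
      by (intro cong_add cong_refl z)
    finally show ?thesis by simp
  qed
  have 3: "[q * t + y * geo r d k = y * geo r d c] (mod e)"
  proof -
    have "[q * t + y * geo r d k = q * t + y * (geo r d c + q * geo r d ?n)] (mod e)"
      unfolding kk by (intro cong_add cong_mult cong_refl geo_cong d e)
    also have "q * t + y * (geo r d c + q * geo r d ?n) = y * geo r d c + q * (t + y * geo r d ?n)"
      by (simp add: algebra_simps)
    also have "[y * geo r d c + q * (t + y * geo r d ?n) = y * geo r d c + 0] (mod e)"
      by (intro cong_add cong_refl z)
    finally show ?thesis by simp
  qed
  have "[q * t + x = q * t + y * geo r d k] (mod e)" using 1 2 3 by (meson cong_sym cong_trans)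
  then show "[x = y * geo r d k] (mod e)" by (simp only: cong_add_lcancel_nat)
qed

lemma Hs_inj: "inj_on Hs trip"
proof (rule inj_onI)
  fix u v assume uv: "u \<in> trip" "v \<in> trip" "Hs u = Hs v"
  obtain d e y d' e' y' where u: "u = (d, e, y)" and v: "v = (d', e', y')" by (metis prod_cases3)
  have mem: "E d y \<in> Hs (d, e, y)" "E 0 e \<in> Hs (d, e, y)" for d e y
  proof -
    have "E d y = E (d * Suc 0) (y * geo r d (Suc 0) + e * 0)" by (simp add: geo_1)
    then show "E d y \<in> Hs (d, e, y)" unfolding Hs_def by blast
    have "E 0 e = E (d * 0) (y * geo r d 0 + e * 1)" by simp
    then show "E 0 e \<in> Hs (d, e, y)" unfolding Hs_def by blast
  qed
  have h: "Hs (d, e, y) = Hs (d', e', y')" using uv u v by simp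
  note T = uv(1)[unfolded u] uv(2)[unfolded v]
  have "d' dvd d" "d dvd d'" using Hs_mem(1)[OF T(2)] Hs_mem(1)[OF T(1)] mem h by blast+
  then have d: "d = d'" by (simp add: dvd_antisym)
  have "E 0 e \<in> Hs (d', e', y')" "E 0 e' \<in> Hs (d, e, y)"
    using mem(2)[of e d y] mem(2)[of e' d' y'] h by simp_all
  then have "[e = y' * geo r d' 0] (mod e')" "[e' = y * geo r d 0] (mod e)"
    using Hs_mem(2)[OF T(2), of 0 e 0] Hs_mem(2)[OF T(1), of 0 e' 0] by simp_all
  then have e: "e = e'" by (simp add: cong_0_iff dvd_antisym)
  have "[y = y' * geo r d' (Suc 0)] (mod e')"
    using Hs_mem(2)[OF T(2), of d y "Suc 0"] mem(1)[of d y e] h d by auto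
  then have "y = y'" using T e by (simp add: geo_1 cong_def trip_def)
  then show "u = v" using d e u v by simp
qed

lemma Hs_surj:
  assumes H: "subgroup H G" shows "\<exists>v\<in>trip. H = Hs v"
proof -
  note Hm = subgroup.m_closed[OF H] and Hi = subgroup.m_inv_closed[OF H]
  have snd: "E i (x + s * w) = E i x" for i x w by (rule E_snd_cong) (simp add: cong_def)
  \<comment> \<open>Left division by a^i b^x. Exponents of b are natural numbers that matter modulo
    s, so subtracting a term is replaced by adding s - 1 times it.\<close>
  have quot: "E j (z + (s - 1) * (x * r ^ j)) \<in> H" if "E i x \<in> H" "E (i + j) z \<in> H" for i j x z
  proof -
    let ?w = "z + (s - 1) * (x * r ^ j)"
    have "x * r ^ j + ?w = z + s * (x * r ^ j)" using spos by (cases s) auto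
    then have "E i x \<otimes> E j ?w = E (i + j) z" unfolding E_mult by (simp only: snd)
    then have "E j ?w = inv (E i x) \<otimes> E (i + j) z" by (metis Ec inv_solve_left)
    then show ?thesis using Hm Hi that by simp
  qed
  \<comment> \<open>d generates the exponents of a that occur in H, and e below generates the
    exponents of the powers of b in H. Any y0 with a^d b^y0 in H, reduced modulo e, completes the
    triple.\<close>
  have "\<exists>d>0. \<forall>i. i \<in> {i. \<exists>x. E i x \<in> H} \<longleftrightarrow> d dvd i"
  proof (rule nat_ideal[of m])
    have "E m ((s - 1) * t) = E 0 (0 + s * t)" using E_shift[of 0 1 "(s - 1) * t"] spos by (cases s) auto
    then have "E m ((s - 1) * t) = \<one>" using snd[of 0 0 t] E_00 by simp
    then have "E m ((s - 1) * t) \<in> H" using sub_one[OF H] by simp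
    then show "m \<in> {i. \<exists>x. E i x \<in> H}" by blast
    fix i j assume "i \<in> {i. \<exists>x. E i x \<in> H}" "j \<in> {i. \<exists>x. E i x \<in> H}"
    then obtain x y where "E i x \<in> H" "E j y \<in> H" by blast
    then have "E (i + j) (x * r ^ j + y) \<in> H" using Hm[of "E i x" "E j y"] E_mult by simp
    then show "i + j \<in> {i. \<exists>x. E i x \<in> H}" by blast
  next
    show "\<And>i j. i \<in> {i. \<exists>x. E i x \<in> H} \<Longrightarrow> i + j \<in> {i. \<exists>x. E i x \<in> H} \<Longrightarrow> j \<in> {i. \<exists>x. E i x \<in> H}"
      using quot by blast
  qed (rule mpos)
  then obtain d where d: "0 < d" "\<And>i. (\<exists>x. E i x \<in> H) \<longleftrightarrow> d dvd i" by auto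
  have "\<exists>e>0. \<forall>i. i \<in> {x. E 0 x \<in> H} \<longleftrightarrow> e dvd i"
  proof (rule nat_ideal[of s])
    show "s \<in> {x. E 0 x \<in> H}" using snd[of 0 0 1] E_00 sub_one[OF H] by simp
    show "\<And>i j. i \<in> {x. E 0 x \<in> H} \<Longrightarrow> j \<in> {x. E 0 x \<in> H} \<Longrightarrow> i + j \<in> {x. E 0 x \<in> H}"
    proof -
      fix i j assume "i \<in> {x. E 0 x \<in> H}" "j \<in> {x. E 0 x \<in> H}"
      then show "i + j \<in> {x. E 0 x \<in> H}" using Hm[of "E 0 i" "E 0 j"] by (simp add: E_mult)
    qed
    fix i j assume "i \<in> {x. E 0 x \<in> H}" "i + j \<in> {x. E 0 x \<in> H}"
    then have "E 0 (i + j + (s - 1) * (i * r ^ 0)) \<in> H" using quot[of 0 i 0 "i + j"] by simp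
    moreover have "i + j + (s - 1) * (i * r ^ 0) = j + s * i" using spos by (cases s) auto
    ultimately have "E 0 (j + s * i) \<in> H" by (simp only:)
    then show "j \<in> {x. E 0 x \<in> H}" using snd by simp
  qed (rule spos)
  then obtain e where e: "0 < e" "\<And>x. E 0 x \<in> H \<longleftrightarrow> e dvd x" by auto
  obtain y0 where y0: "E d y0 \<in> H" using d(2)[of d] by auto
  define y where "y = y0 mod e"
  have y: "E d y \<in> H"
  proof -
    let ?w = "(s - 1) * (e * (y0 div e))"
    have "E 0 ?w \<in> H" using e by simp
    then have "E d y0 \<otimes> E 0 ?w \<in> H" using Hm y0 by blast
    moreover have "y0 + ?w = y + s * (e * (y0 div e))" unfolding y_def using spos
      by (cases s) (auto simp: algebra_simps)
    ultimately show ?thesis unfolding E_mult using snd by simp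
  qed
  have dm: "d dvd m"
  proof -
    have "E m ((s - 1) * t) = E 0 (0 + s * t)" using E_shift[of 0 1 "(s - 1) * t"] spos by (cases s) auto
    then have "E m ((s - 1) * t) \<in> H" using snd[of 0 0 t] E_00 sub_one[OF H] by simp
    then show ?thesis using d(2) by blast
  qed
  have es: "e dvd s" using e(2)[of s] snd[of 0 0 1] E_00 sub_one[OF H] by simp
  have pw: "E (d * k) (y * geo r d k) \<in> H" for k using sub_pow[OF H y, of k] E_pow by simp
  \<comment> \<open>The power \<open>m div d\<close> of a^d b^y is b^(t + y geo r d (m div d)), an
    element of H.\<close>
  have "e dvd t + y * geo r d (m div d)"
    using pw[of "m div d"] dm E_shift[of 0 1] e(2) by simp
  then have T: "(d, e, y) \<in> trip" using dm es e(1) unfolding trip_def y_def by simp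
  have "H = Hs (d, e, y)"
  proof (rule subset_antisym; rule subsetI)
    fix h assume h: "h \<in> H"
    obtain i x where ix: "h = E i x" using E_cover sub_carrier[OF H] h by blast
    then obtain k where k: "i = d * k" using d(2) h by blast
    have "E 0 (x + (s - 1) * (y * geo r d k * r ^ 0)) \<in> H" using quot[OF pw[of k], of 0 x] h ix k by simp
    then obtain l where l: "x + (s - 1) * (y * geo r d k * r ^ 0) = e * l" using e(2) by blast
    have "y * geo r d k + e * l = x + s * (y * geo r d k)" unfolding l[symmetric] using spos by (cases s) auto
    then have "h = E (d * k) (y * geo r d k + e * l)" using ix k snd by simp
    then show "h \<in> Hs (d, e, y)" unfolding Hs_def by blast
  next
    fix h assume "h \<in> Hs (d, e, y)"
    then obtain k l where "h = E (d * k) (y * geo r d k + e * l)" by (auto simp: Hs_def)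
    then have "h = E (d * k) (y * geo r d k) \<otimes> E 0 (e * l)" by (simp add: E_mult)
    then show "h \<in> H" using Hm pw e(2) by simp
  qed
  then show ?thesis using T by blast
qed

lemma subgroup_count_trip: "subgroup_count G = card trip"
proof -
  have "{H. subgroup H G} = Hs ` trip" using Hs_surj Hs_subgroup by force
  then show ?thesis unfolding subgroup_count_def using card_image[OF Hs_inj] by simp
qed

end

lemma metacyclic_group_intro:
  "fin_group G \<Longrightarrow> metacyclic_gens G m s r t a b \<Longrightarrow> metacyclic_group G m s r t a b"
  by (simp add: metacyclic_group_def metacyclic_group_axioms_def)

text \<open>The cardinality of \<open>trip\<close>, restated outside the locale because it depends
  on the four parameters alone.\<close>

definition mc_count :: "nat \<Rightarrow> nat \<Rightarrow> nat \<Rightarrow> nat \<Rightarrow> nat" where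
  "mc_count m s r t = card {(d, e, y). d dvd m \<and> e dvd s \<and> y < e \<and> e dvd t + y * geo r d (m div d)}"

lemma metacyclic_count:
  assumes "fin_group G" "metacyclic G m s r t" shows "subgroup_count G = mc_count m s r t"
proof -
  obtain a b where g: "metacyclic_gens G m s r t a b" using assms(2) by (auto simp: metacyclic_def)
  interpret metacyclic_group G m s r t a b by (rule metacyclic_group_intro[OF assms(1) g])
  show ?thesis using subgroup_count_trip by (simp add: trip_def mc_count_def)
qed

lemma metacyclic_constraints:
  assumes "fin_group G" "metacyclic G m s r t"
  shows "[r ^ m = 1] (mod s)" "[t * r = t] (mod s)" "order G = m * s" "0 < m" "0 < s"
proof -
  obtain a b where g: "metacyclic_gens G m s r t a b" using assms(2) by (auto simp: metacyclic_def)
  interpret metacyclic_group G m s r t a b by (rule metacyclic_group_intro[OF assms(1) g])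
  show "[r ^ m = 1] (mod s)" "[t * r = t] (mod s)" "order G = m * s" "0 < m" "0 < s"
    using r_pow_m t_r ord_eq mpos spos by auto
qed

text \<open>Equality and multiplication of the products a^i b^x depend only on the parameters
  (\<open>E_eq\<close>, \<open>E_mult\<close>), so sending generators to generators is a
  well-defined isomorphism.\<close>

lemma metacyclic_iso:
  assumes G: "fin_group G" "metacyclic G m s r t" and H: "fin_group H" "metacyclic H m s r t"
  shows "G \<cong> H"
proof -
  obtain a b where g: "metacyclic_gens G m s r t a b" using G(2) by (auto simp: metacyclic_def)
  interpret G: metacyclic_group G m s r t a b by (rule metacyclic_group_intro[OF G(1) g])
  obtain a' b' where g': "metacyclic_gens H m s r t a' b'" using H(2) by (auto simp: metacyclic_def)
  interpret H: metacyclic_group H m s r t a' b' by (rule metacyclic_group_intro[OF H(1) g'])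
  define f where "f g = (SOME h. \<exists>i x. g = G.E i x \<and> h = H.E i x)" for g
  have f: "f (G.E i x) = H.E i x" for i x
  proof -
    have "\<exists>j y. G.E i x = G.E j y \<and> f (G.E i x) = H.E j y"
      unfolding f_def by (rule someI_ex) blast
    then show ?thesis using G.E_eq H.E_eq by metis
  qed
  have "f \<in> hom G H"
  proof (rule homI)
    fix g assume "g \<in> carrier G"
    then show "f g \<in> carrier H" using G.E_cover f by (metis H.Ec)
  next
    fix g h assume "g \<in> carrier G" "h \<in> carrier G"
    then obtain i x j y where "g = G.E i x" "h = G.E j y" using G.E_cover by metis
    then show "f (g \<otimes>\<^bsub>G\<^esub> h) = f g \<otimes>\<^bsub>H\<^esub> f h" by (simp add: G.E_mult H.E_mult f)
  qed
  moreover have "inj_on f (carrier G)"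
  proof (rule inj_onI)
    fix g h assume gh: "g \<in> carrier G" "h \<in> carrier G" "f g = f h"
    then obtain i x j y where "g = G.E i x" "h = G.E j y" using G.E_cover by metis
    then show "g = h" using gh(3) f G.E_eq H.E_eq by simp
  qed
  moreover have "f ` carrier G = carrier H"
  proof (rule subset_antisym; rule subsetI)
    fix h assume "h \<in> f ` carrier G"
    then show "h \<in> carrier H" using G.E_cover f by (metis H.Ec imageE)
  next
    fix h assume "h \<in> carrier H"
    then obtain i x where "h = H.E i x" using H.E_cover by blast
    then show "h \<in> f ` carrier G" using f G.Ec by (metis image_eqI)
  qed
  ultimately have "f \<in> iso G H" by (simp add: iso_def bij_betw_def)
  then show ?thesis by (auto simp: is_iso_def)
qed

context fin_group
begin

text \<open>By the commutation rule the products a^i b^x are closed under multiplication; they form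
  a subgroup containing a and b, hence everything. Normal forms are thus obtained from mere
  generation.\<close>

lemma metacyclic_gensI:
  assumes o: "order G = m * s" and c: "a \<in> carrier G" "b \<in> carrier G" and bs: "b [^] s = \<one>"
    and ba: "b \<otimes> a = a \<otimes> b [^] r" and am: "a [^] m = b [^] (t::nat)"
    and gen: "\<And>H. subgroup H G \<Longrightarrow> a \<in> H \<Longrightarrow> b \<in> H \<Longrightarrow> H = carrier G"
  shows "metacyclic_gens G m s r t a b"
proof -
  let ?H = "{a [^] (i::nat) \<otimes> b [^] (x::nat) | i x. True}"
  have "?H = carrier G"
  proof (rule gen)
    show "subgroup ?H G"
    proof (rule closed_imp_subgroup)
      have "\<one> = a [^] (0::nat) \<otimes> b [^] (0::nat)" by simp
      then show "\<one> \<in> ?H" by blast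
      fix g h assume "g \<in> ?H" "h \<in> ?H"
      then obtain i x j y where gh: "g = a [^] (i::nat) \<otimes> b [^] (x::nat)" "h = a [^] (j::nat) \<otimes> b [^] (y::nat)" by auto
      have "g \<otimes> h = a [^] i \<otimes> (b [^] x \<otimes> a [^] j) \<otimes> b [^] y" using c gh by (simp add: m_assoc)
      also have "\<dots> = a [^] (i + j) \<otimes> b [^] (x * r ^ j + y)"
        unfolding pow_conj_comm[OF c ba] using c by (simp add: m_assoc nat_pow_mult[symmetric])
      finally show "g \<otimes> h \<in> ?H" by blast
    qed (use c in auto)
    have "a = a [^] (1::nat) \<otimes> b [^] (0::nat)" "b = a [^] (0::nat) \<otimes> b [^] (1::nat)" using c by auto
    then show "a \<in> ?H" "b \<in> ?H" by blast+
  qed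
  then have "\<forall>g\<in>carrier G. \<exists>i x. g = a [^] (i::nat) \<otimes> b [^] (x::nat)" by blast
  moreover have "0 < m" "0 < s" using o order_pos by (auto intro: Nat.gr0I)
  ultimately show ?thesis unfolding metacyclic_gens_def using assms by blast
qed

lemma metacyclicI:
  assumes "order G = m * s" "a \<in> carrier G" "b \<in> carrier G" "b [^] s = \<one>"
    "b \<otimes> a = a \<otimes> b [^] r" "a [^] m = b [^] (t::nat)"
    "\<And>H. subgroup H G \<Longrightarrow> a \<in> H \<Longrightarrow> b \<in> H \<Longrightarrow> H = carrier G"
  shows "metacyclic G m s r t"
  using metacyclic_gensI[OF assms] by (auto simp: metacyclic_def)

text \<open>The defining relation says a^-1 b a = b^r, hence the normalizer condition on
  \<open>inv a\<close>. Reducing r below \<open>ord b\<close> leaves finitely many multipliers to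
  examine later.\<close>

lemma conj_exponent:
  assumes b: "b \<in> carrier G" and N: "a \<in> carrier G" "inv a \<in> Nm (generate G {b})"
  shows "\<exists>r < ord b. b \<otimes> a = a \<otimes> b [^] r"
proof -
  have "inv a \<otimes> b \<otimes> inv (inv a) \<in> generate G {b}" using Nm_conj[OF N(2) gen_mem] .
  then obtain k :: nat where k: "inv a \<otimes> b \<otimes> a = b [^] k" using gen_eq[OF b] N(1) by auto
  have "b \<otimes> a = a \<otimes> (inv a \<otimes> b \<otimes> a)" using b N(1) by (simp add: m_assoc[symmetric])
  then have "b \<otimes> a = a \<otimes> b [^] k" using k by simp
  moreover have "b [^] k = b [^] (k mod ord b)"
  proof -
    have "b [^] k = (b [^] ord b) [^] (k div ord b) \<otimes> b [^] (k mod ord b)"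
      using b by (simp add: nat_pow_pow nat_pow_mult del: pow_ord_eq_1)
    then show ?thesis using b by simp
  qed
  moreover have "k mod ord b < ord b" using ord_pos[OF b] by simp
  ultimately show ?thesis by auto
qed

lemma metacyclic_of_normal:
  assumes "order G = m * ord b" "a \<in> carrier G" "b \<in> carrier G" "Nm (generate G {b}) = carrier G"
    "a [^] m = b [^] (t::nat)" "\<And>H. subgroup H G \<Longrightarrow> a \<in> H \<Longrightarrow> b \<in> H \<Longrightarrow> H = carrier G"
  shows "\<exists>r < ord b. metacyclic_gens G m (ord b) r t a b"
proof -
  obtain r where "r < ord b" "b \<otimes> a = a \<otimes> b [^] r" using conj_exponent[of b a] assms by auto
  then show ?thesis using metacyclic_gensI[OF assms(1-3), of r t] assms by auto
qed

text \<open>The new first generator is a b^y, whose m-th power is b^(t + y geo r 1 m). This often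
  brings t to 0.\<close>

lemma metacyclic_change_t:
  assumes "metacyclic G m s r t" "[t' = t + y * geo r 1 m] (mod s)" "[r' = r] (mod s)"
  shows "metacyclic G m s r' t'"
proof -
  obtain a b where g: "metacyclic_gens G m s r t a b" using assms(1) by (auto simp: metacyclic_def)
  interpret metacyclic_group G m s r t a b by (rule metacyclic_group_intro[OF fin_group_axioms g])
  have b1: "E 0 x = b [^] x" for x using bc by (simp add: E_def)
  have e: "E i (y * geo r 1 i) \<otimes> E 0 (x + (s - 1) * (y * geo r 1 i)) = E i x" for i x
  proof -
    have "y * geo r 1 i + (x + (s - 1) * (y * geo r 1 i)) = x + s * (y * geo r 1 i)" using spos by (cases s) auto
    then have "[y * geo r 1 i + (x + (s - 1) * (y * geo r 1 i)) = x] (mod s)"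
      unfolding cong_def by (simp only: mod_mult_self2)
    then have "E i (y * geo r 1 i + (x + (s - 1) * (y * geo r 1 i))) = E i x" by (rule E_snd_cong)
    then show ?thesis unfolding E_mult by simp
  qed
  have "metacyclic_gens G m s r' t' (E 1 y) b"
    unfolding metacyclic_gens_def
  proof (intro conjI ballI)
    have "b \<otimes> E 1 y = E 0 1 \<otimes> E 1 y" using b1[of 1] bc by simp
    also have "\<dots> = E 1 (y + r)" by (simp add: E_mult add.commute)
    also have "\<dots> = E 1 (y + r')"
      by (rule E_snd_cong) (use assms(3) in \<open>simp add: cong_add_lcancel_nat cong_sym_eq\<close>)
    also have "\<dots> = E 1 y \<otimes> E 0 r'" by (simp add: E_mult)
    finally show "b \<otimes> E 1 y = E 1 y \<otimes> b [^] r'" using b1 by simp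
    have "E 1 y [^] m = E 0 (t + y * geo r 1 m)" using E_pow[of 1 y m] E_shift[of 0 1] by simp
    then show "E 1 y [^] m = b [^] t'" using E_snd_cong[OF assms(2), of 0] b1 by simp
    fix g assume "g \<in> carrier G"
    then obtain i x where "g = E i x" using E_cover by blast
    then have "g = E 1 y [^] i \<otimes> b [^] (x + (s - 1) * (y * geo r 1 i))" using e[of i x] E_pow[of 1 y i] b1 by simp
    then show "\<exists>i x. g = E 1 y [^] (i::nat) \<otimes> b [^] (x::nat)" by blast
  qed (use mpos spos ord_eq bc bs in auto)
  then show ?thesis by (auto simp: metacyclic_def)
qed

text \<open>The new first generator is a^k; it generates the same cyclic group as a because a^m = 1
  and k is invertible modulo m.\<close>

lemma metacyclic_change_r:
  assumes "metacyclic G m s r 0" "coprime k m" "[r' = r ^ k] (mod s)"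
  shows "metacyclic G m s r' 0"
proof -
  obtain a b where g: "metacyclic_gens G m s r 0 a b" using assms(1) by (auto simp: metacyclic_def)
  interpret metacyclic_group G m s r 0 a b by (rule metacyclic_group_intro[OF fin_group_axioms g])
  have am1: "a [^] m = \<one>" using am by simp
  obtain l where l: "[k * l = 1] (mod m)" using assms(2) cong_solve_coprime_nat[of k m] by auto
  have ak: "(a [^] k) [^] (l * i) = a [^] i" for i
  proof -
    have "[k * (l * i) = i] (mod m)" using cong_scalar_right[OF l, of i] by (simp add: mult.assoc)
    then have c: "k * (l * i) mod m = i mod m" by (simp add: cong_def)
    have red: "a [^] j = a [^] (j mod m)" for j
    proof -
      have "a [^] j = (a [^] m) [^] (j div m) \<otimes> a [^] (j mod m)"
        using ac by (simp add: nat_pow_pow nat_pow_mult del: am am1)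
      then show ?thesis using am1 ac by simp
    qed
    have "(a [^] k) [^] (l * i) = a [^] (k * (l * i))" using ac by (simp add: nat_pow_pow)
    then show ?thesis using red[of "k * (l * i)"] red[of i] c by simp
  qed
  have "metacyclic_gens G m s r' 0 (a [^] k) b"
    unfolding metacyclic_gens_def
  proof (intro conjI ballI)
    have "b \<otimes> a [^] k = a [^] k \<otimes> b [^] (r ^ k)" using pow_conj_comm[OF ac bc ba, of 1 k] bc by simp
    also have "b [^] (r ^ k) = b [^] r'" using b_mod[of r'] b_mod[of "r ^ k"] assms(3) by (simp add: cong_def)
    finally show "b \<otimes> a [^] k = a [^] k \<otimes> b [^] r'" .
    have "(a [^] k) [^] m = (a [^] m) [^] k" using ac by (simp add: nat_pow_pow mult.commute del: am1)
    then show "(a [^] k) [^] m = b [^] (0::nat)" using am1 by simp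
    fix g assume "g \<in> carrier G"
    then obtain i x where "g = E i x" using E_cover by blast
    then have "g = (a [^] k) [^] (l * i) \<otimes> b [^] x" using ak by (simp add: E_def)
    then show "\<exists>i x. g = (a [^] k) [^] (i::nat) \<otimes> b [^] (x::nat)" by blast
  qed (use mpos spos ord_eq ac bc bs in auto)
  then show ?thesis by (auto simp: metacyclic_def)
qed

end

section \<open>The listed groups\<close>

lemma image_group_iso:
  assumes "inj_on f (carrier G)" shows "f \<in> iso G (image_group f G)"
  using assms by (auto simp: iso_def hom_def image_group_def bij_betw_def)

lemma image_group_fin_group:
  assumes "fin_group G" "inj_on f (carrier G)" shows "fin_group (image_group f G)"
proof -
  interpret fin_group G by fact
  have "group ((image_group f G)\<lparr>one := f \<one>\<^bsub>G\<^esub>\<rparr>)"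
    by (rule iso_imp_img_group[OF image_group_iso[OF assms(2)]])
  then have "group (image_group f G)" by (simp add: image_group_def)
  then show ?thesis using fin by (simp add: fin_group_def fin_group_axioms_def image_group_def)
qed

lemma metacyclic_transfer:
  assumes "group G" "group H" "G \<cong> H" "metacyclic G m s r t" shows "metacyclic H m s r t"
proof -
  obtain f where f: "f \<in> iso G H" using assms(3) by (auto simp: is_iso_def)
  interpret gh: group_hom G H f
    using assms(1,2) f by (simp add: group_hom_def group_hom_axioms_def iso_def)
  have img: "carrier H = f ` carrier G" using f by (auto simp: iso_def bij_betw_def)
  obtain a b where "metacyclic_gens G m s r t a b" using assms(4) by (auto simp: metacyclic_def)
  then have g: "0 < m" "0 < s" "order G = m * s" "a \<in> carrier G" "b \<in> carrier G" "b [^]\<^bsub>G\<^esub> s = \<one>\<^bsub>G\<^esub>"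
    "b \<otimes>\<^bsub>G\<^esub> a = a \<otimes>\<^bsub>G\<^esub> b [^]\<^bsub>G\<^esub> r" "a [^]\<^bsub>G\<^esub> m = b [^]\<^bsub>G\<^esub> t"
    "\<And>g. g \<in> carrier G \<Longrightarrow> \<exists>i x. g = a [^]\<^bsub>G\<^esub> (i::nat) \<otimes>\<^bsub>G\<^esub> b [^]\<^bsub>G\<^esub> (x::nat)"
    unfolding metacyclic_gens_def by auto
  have pw: "f c [^]\<^bsub>H\<^esub> (n::nat) = f (c [^]\<^bsub>G\<^esub> n)" if "c \<in> carrier G" for c n
    using gh.hom_nat_pow that by simp
  have "metacyclic_gens H m s r t (f a) (f b)"
    unfolding metacyclic_gens_def
  proof (intro conjI ballI)
    show "order H = m * s" using g(3) iso_same_card[OF assms(3)] by (simp add: order_def)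
    show "f b [^]\<^bsub>H\<^esub> s = \<one>\<^bsub>H\<^esub>" using pw[OF g(5)] g(6) by simp
    show "f b \<otimes>\<^bsub>H\<^esub> f a = f a \<otimes>\<^bsub>H\<^esub> f b [^]\<^bsub>H\<^esub> r"
      using g(4,5,7) pw[OF g(5)] by (simp flip: gh.hom_mult)
    show "f a [^]\<^bsub>H\<^esub> m = f b [^]\<^bsub>H\<^esub> t" using pw g(4,5,8) by simp
    fix h assume "h \<in> carrier H"
    then obtain x where x: "x \<in> carrier G" "h = f x" using img by auto
    obtain i y where "x = a [^]\<^bsub>G\<^esub> (i::nat) \<otimes>\<^bsub>G\<^esub> b [^]\<^bsub>G\<^esub> (y::nat)" using g(9)[OF x(1)] by blast
    then have "h = f a [^]\<^bsub>H\<^esub> i \<otimes>\<^bsub>H\<^esub> f b [^]\<^bsub>H\<^esub> y" using pw g(4,5) x(2) by simp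
    then show "\<exists>i x. h = f a [^]\<^bsub>H\<^esub> (i::nat) \<otimes>\<^bsub>H\<^esub> f b [^]\<^bsub>H\<^esub> (x::nat)" by blast
  qed (use g gh.hom_closed in auto)
  then show ?thesis by (auto simp: metacyclic_def)
qed

lemma image_group_metacyclic:
  assumes "fin_group G" "inj_on f (carrier G)" "metacyclic G m s r t"
  shows "fin_group (image_group f G) \<and> metacyclic (image_group f G) m s r t"
proof -
  have F: "fin_group (image_group f G)" by (rule image_group_fin_group[OF assms(1,2)])
  have "G \<cong> image_group f G" using image_group_iso[OF assms(2)] by (auto simp: is_iso_def)
  then show ?thesis using F metacyclic_transfer[of G "image_group f G"] assms by (simp add: fin_group_def)
qed

text \<open>The generators are (1, 0) and (0, 1). The natural number r' represents the integer
  multiplier r, for instance s - 1 in place of -1.\<close>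

lemma metacyclic_cyclic_semidirect:
  assumes m: "1 < m" and s: "1 < s" and r: "r ^ m mod int s = 1 mod int s" and r': "int r' mod int s = r mod int s"
  shows "fin_group (cyclic_semidirect m s r) \<and> metacyclic (cyclic_semidirect m s r) m s r' 0"
proof -
  let ?G = "cyclic_semidirect m s r"
  note simps = cyclic_semidirect_simps[of m s r]
  have ms: "0 < m" "0 < s" using m s by auto
  note simps = cyclic_semidirect_simps[OF ms, of r]
  interpret group ?G by (rule group_cyclic_semidirect[OF ms r])
  have F: "fin_group ?G" by unfold_locales (simp add: simps)
  have pa: "(1, 0) [^]\<^bsub>?G\<^esub> (n::nat) = (int n mod int m, 0)" for n
  proof (induction n)
    case (Suc n)
    have "(1, 0) [^]\<^bsub>?G\<^esub> Suc n = (1, 0) [^]\<^bsub>?G\<^esub> n \<otimes>\<^bsub>?G\<^esub> (1, 0)" by (rule nat_pow_Suc)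
    then show ?case unfolding Suc simps by (simp add: mod_add_left_eq mod_add_right_eq add.commute)
  qed (simp add: simps)
  have pb: "(0, 1) [^]\<^bsub>?G\<^esub> (n::nat) = (0, int n mod int s)" for n
  proof (induction n)
    case (Suc n)
    have "(0, 1) [^]\<^bsub>?G\<^esub> Suc n = (0, 1) [^]\<^bsub>?G\<^esub> n \<otimes>\<^bsub>?G\<^esub> (0, 1)" by (rule nat_pow_Suc)
    then show ?case unfolding Suc simps by (simp add: mod_add_left_eq mod_add_right_eq add.commute)
  qed (simp add: simps)
  have "metacyclic_gens ?G m s r' 0 (1, 0) (0, 1)"
    unfolding metacyclic_gens_def pa pb
  proof (intro conjI ballI)
    show "order ?G = m * s" by (simp add: order_def simps)
    show "(0, 1) \<otimes>\<^bsub>?G\<^esub> (1, 0) = (1, 0) \<otimes>\<^bsub>?G\<^esub> (0, int r' mod int s)"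
      unfolding simps using m r' by simp
    fix g assume "g \<in> carrier ?G"
    then obtain i x where g: "g = (i, x)" "0 \<le> i" "i < int m" "0 \<le> x" "x < int s" by (cases g) (auto simp: simps)
    have "g = (int (nat i) mod int m, 0) \<otimes>\<^bsub>?G\<^esub> (0, int (nat x) mod int s)"
      unfolding simps using g by simp
    then show "\<exists>i x. g = (int i mod int m, 0) \<otimes>\<^bsub>?G\<^esub> (0, int x mod int s)" by blast
  qed (use m s in \<open>simp_all add: simps\<close>)
  then show ?thesis using F by (auto simp: metacyclic_def)
qed

lemma DirProd_Zmod: "Zmod m \<times>\<times> Zmod s = cyclic_semidirect m s 1"
  by (auto simp: cyclic_semidirect_def DirProd_def)

text \<open>With y = (0, 1) as first and x = (1, 0) as second generator, y^2 = x^m accounts for the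
  parameter t = m, and 2 m - 1 represents the multiplier -1.\<close>

lemma metacyclic_dicyclic:
  assumes m: "0 < m" shows "fin_group (dicyclic_group m) \<and> metacyclic (dicyclic_group m) 2 (2 * m) (2 * m - 1) m"
proof -
  let ?G = "dicyclic_group m"
  interpret group ?G by (rule group_dicyclic_group[OF m])
  have car: "carrier ?G = {0..<2 * int m} \<times> {0..<2}" and one: "\<one>\<^bsub>?G\<^esub> = (0, 0)"
    and mult: "(i, a) \<otimes>\<^bsub>?G\<^esub> (j, b) = ((i + (-1) ^ nat a * j + int m * a * b) mod (2 * int m), (a + b) mod 2)"
    for i a j b by (simp_all add: dicyclic_group_def)
  have F: "fin_group ?G" by unfold_locales (simp add: car)
  have pb: "(1, 0) [^]\<^bsub>?G\<^esub> (n::nat) = (int n mod (2 * int m), 0)" for n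
  proof (induction n)
    case (Suc n)
    have "(1, 0) [^]\<^bsub>?G\<^esub> Suc n = (1, 0) [^]\<^bsub>?G\<^esub> n \<otimes>\<^bsub>?G\<^esub> (1, 0)" by (rule nat_pow_Suc)
    then show ?case unfolding Suc mult by (simp add: mod_add_left_eq mod_add_right_eq add.commute)
  qed (simp add: one)
  have ac: "(0, 1) \<in> carrier ?G" using m by (simp add: car)
  have a2: "(0, 1) [^]\<^bsub>?G\<^esub> (2::nat) = (int m, 0)"
    using m ac by (simp add: numeral_2_eq_2 mult)
  have "metacyclic_gens ?G 2 (2 * m) (2 * m - 1) m (0, 1) (1, 0)"
    unfolding metacyclic_gens_def pb a2
  proof (intro conjI ballI)
    show "order ?G = 2 * (2 * m)" using m by (simp add: order_def car)
    show "(1, 0) \<otimes>\<^bsub>?G\<^esub> (0, 1) = (0, 1) \<otimes>\<^bsub>?G\<^esub> (int (2 * m - 1) mod (2 * int m), 0)"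
    proof -
      have "(- (int (2 * m - 1) mod (2 * int m))) mod (2 * int m) = 1 mod (2 * int m)"
      proof -
        have "(- (int (2 * m - 1) mod (2 * int m))) mod (2 * int m) = (- int (2 * m - 1)) mod (2 * int m)"
          by (rule mod_minus_eq)
        also have "- int (2 * m - 1) = 1 + 2 * int m * (-1)" using m by simp
        also have "(1 + 2 * int m * (-1)) mod (2 * int m) = 1 mod (2 * int m)" by (rule mod_mult_self2)
        finally show ?thesis .
      qed
      then show ?thesis unfolding mult by simp
    qed
    show "(int m, 0) = (int m mod (2 * int m), 0)" using m by simp
    fix g assume "g \<in> carrier ?G"
    then obtain i c where g: "g = (i, c)" "0 \<le> i" "i < 2 * int m" "0 \<le> c" "c < 2" by (cases g) (auto simp: car)
    then have "c = 0 \<or> c = 1" by linarith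
    then show "\<exists>i x. g = (0, 1) [^]\<^bsub>?G\<^esub> (i::nat) \<otimes>\<^bsub>?G\<^esub> (int x mod (2 * int m), 0)"
    proof
      assume "c = 0"
      then have "g = (0, 1) [^]\<^bsub>?G\<^esub> (0::nat) \<otimes>\<^bsub>?G\<^esub> (int (nat i) mod (2 * int m), 0)"
        using g by (simp add: one mult)
      then show ?thesis by blast
    next
      assume c: "c = 1"
      \<comment> \<open>The first component of y x^j is -j modulo 2 m, so the exponent 2 m - i is
        the one that yields i.\<close>
      have "(- (int (nat (2 * int m - i)) mod (2 * int m))) mod (2 * int m) = i"
      proof -
        have "(- (int (nat (2 * int m - i)) mod (2 * int m))) mod (2 * int m) = (- int (nat (2 * int m - i))) mod (2 * int m)"
          by (rule mod_minus_eq)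
        also have "- int (nat (2 * int m - i)) = i + 2 * int m * (-1)" using g by simp
        also have "(i + 2 * int m * (-1)) mod (2 * int m) = i mod (2 * int m)" by (rule mod_mult_self2)
        finally show ?thesis using g by simp
      qed
      then have "g = (0, 1) \<otimes>\<^bsub>?G\<^esub> (int (nat (2 * int m - i)) mod (2 * int m), 0)"
        using g c by (simp add: mult)
      then have "g = (0, 1) [^]\<^bsub>?G\<^esub> (1::nat) \<otimes>\<^bsub>?G\<^esub> (int (nat (2 * int m - i)) mod (2 * int m), 0)"
        using ac by simp
      then show ?thesis by blast
    qed
  qed (use m in \<open>simp_all add: car one\<close>)
  then show ?thesis using F by (auto simp: metacyclic_def)
qed

lemma metacyclic_singleton:
  "fin_group (singleton_group (0::int, 0::int)) \<and> metacyclic (singleton_group (0::int, 0::int)) 1 1 1 0"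
proof -
  let ?G = "singleton_group (0::int, 0::int)"
  interpret group ?G by simp
  have F: "fin_group ?G" by unfold_locales simp
  have o: "\<one>\<^bsub>?G\<^esub> = (0, 0)" using one_closed by simp
  have pw: "(0, 0) [^]\<^bsub>?G\<^esub> (n::nat) = (0, 0)" for n using nat_pow_one[of n] unfolding o .
  have mu: "(0, 0) \<otimes>\<^bsub>?G\<^esub> (0, 0) = (0, 0)" using m_closed[of "(0, 0)" "(0, 0)"] by simp
  have "metacyclic_gens ?G 1 1 1 0 (0, 0) (0, 0)"
    unfolding metacyclic_gens_def pw mu by (simp add: order_def o)
  then show ?thesis using F by (auto simp: metacyclic_def)
qed

context fin_group
begin

lemma ord_prime: "x \<in> carrier G \<Longrightarrow> x \<noteq> \<one> \<Longrightarrow> x [^] p = \<one> \<Longrightarrow> nprime p \<Longrightarrow> ord x = p"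
  using pow_eq_id[of x p] ord_eq_1[of x] by (metis prime_nat_iff)

lemma nat_pow_2: "x \<in> carrier G \<Longrightarrow> x [^] (2::nat) = x \<otimes> x"
  by (simp add: numeral_2_eq_2)

lemma nat_pow_3: "x \<in> carrier G \<Longrightarrow> x [^] (3::nat) = x \<otimes> x \<otimes> x"
  by (simp add: numeral_3_eq_3)

end

text \<open>A transposition a inverts the 3-cycle b. Their orders 2 and 3 show that they generate a
  group of order 6.\<close>

lemma metacyclic_sym_3: "fin_group (sym_group 3) \<and> metacyclic (sym_group 3) 2 3 2 0"
proof -
  let ?G = "sym_group 3"
  interpret group ?G by (rule sym_group_is_group)
  have six: "card (carrier ?G) = 6" using sym_group_card_carrier[of 3] by (simp add: fact_numeral)
  then have "finite (carrier ?G)" by (rule_tac ccontr) simp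
  then interpret fin_group ?G by unfold_locales
  define a :: "nat \<Rightarrow> nat" where "a = transpose 1 2"
  define b :: "nat \<Rightarrow> nat" where "b = transpose 1 2 \<circ> transpose 2 3"
  have ac: "a \<in> carrier ?G" unfolding a_def sym_group_carrier by (rule permutes_swap_id) auto
  have bc: "b \<in> carrier ?G" unfolding b_def sym_group_carrier
    by (rule permutes_compose; rule permutes_swap_id) auto
  have one: "\<one>\<^bsub>?G\<^esub> = id" and mu: "x \<otimes>\<^bsub>?G\<^esub> y = x \<circ> y" for x y
    by (simp_all add: sym_group_one sym_group_mult)
  have a2: "a [^]\<^bsub>?G\<^esub> (2::nat) = \<one>\<^bsub>?G\<^esub>"
    unfolding nat_pow_2[OF ac] mu one by (auto simp: a_def)
  have b3: "b [^]\<^bsub>?G\<^esub> (3::nat) = \<one>\<^bsub>?G\<^esub>"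
    unfolding nat_pow_3[OF bc] mu one by (auto simp: b_def fun_eq_iff transpose_def)
  have ne: "a \<noteq> \<one>\<^bsub>?G\<^esub>" "b \<noteq> \<one>\<^bsub>?G\<^esub>"
    by (auto simp: a_def b_def one fun_eq_iff transpose_def intro: exI[of _ 1])
  have "metacyclic ?G 2 3 2 0"
  proof (rule metacyclicI[OF _ ac bc b3])
    show "order ?G = 2 * 3" using six by (simp add: order_def)
    show "b \<otimes>\<^bsub>?G\<^esub> a = a \<otimes>\<^bsub>?G\<^esub> b [^]\<^bsub>?G\<^esub> (2::nat)"
      unfolding nat_pow_2[OF bc] mu by (auto simp: a_def b_def fun_eq_iff transpose_def)
    show "a [^]\<^bsub>?G\<^esub> (2::nat) = b [^]\<^bsub>?G\<^esub> (0::nat)" using a2 by simp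
    fix H assume H: "subgroup H ?G" "a \<in> H" "b \<in> H"
    have "2 dvd card H" using ord_dvd_sub[OF H(1,2)] ord_prime[OF ac ne(1) a2] by simp
    moreover have "3 dvd card H" using ord_dvd_sub[OF H(1,3)] ord_prime[OF bc ne(2) b3] by simp
    ultimately have "6 dvd card H" by presburger
    then have "card H = order ?G" using card_sub_dvd[OF H(1)] six by (simp add: order_def dvd_antisym)
    then show "H = carrier ?G" by (rule sub_eq_carrierI[OF H(1)])
  qed
  then show ?thesis using fin_group_axioms by blast
qed

text \<open>u and v generate a Klein four-group whose involutions are permuted cyclically by t: t^-1
  u t = v and t^-1 v t = u v. The order and the inequalities exclude degenerate solutions of these
  relations.\<close>

definition a4_gens :: "('a, 'b) monoid_scheme \<Rightarrow> 'a \<Rightarrow> 'a \<Rightarrow> 'a \<Rightarrow> bool" where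
  "a4_gens G u v t \<longleftrightarrow> order G = 12 \<and> u \<in> carrier G \<and> v \<in> carrier G \<and> t \<in> carrier G \<and>
     u \<noteq> \<one>\<^bsub>G\<^esub> \<and> v \<noteq> \<one>\<^bsub>G\<^esub> \<and> u \<noteq> v \<and> t \<noteq> \<one>\<^bsub>G\<^esub> \<and>
     u \<otimes>\<^bsub>G\<^esub> u = \<one>\<^bsub>G\<^esub> \<and> v \<otimes>\<^bsub>G\<^esub> v = \<one>\<^bsub>G\<^esub> \<and> u \<otimes>\<^bsub>G\<^esub> v = v \<otimes>\<^bsub>G\<^esub> u \<and> t \<otimes>\<^bsub>G\<^esub> t \<otimes>\<^bsub>G\<^esub> t = \<one>\<^bsub>G\<^esub> \<and>
     u \<otimes>\<^bsub>G\<^esub> t = t \<otimes>\<^bsub>G\<^esub> v \<and> v \<otimes>\<^bsub>G\<^esub> t = t \<otimes>\<^bsub>G\<^esub> (u \<otimes>\<^bsub>G\<^esub> v)"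

definition a4_like :: "('a, 'b) monoid_scheme \<Rightarrow> bool" where
  "a4_like G \<longleftrightarrow> (\<exists>u v t. a4_gens G u v t)"

lemma a4_transfer:
  assumes "group G" "group H" "G \<cong> H" "a4_like G" shows "a4_like H"
proof -
  obtain f where f: "f \<in> iso G H" using assms(3) by (auto simp: is_iso_def)
  interpret gh: group_hom G H f
    using assms(1,2) f by (simp add: group_hom_def group_hom_axioms_def iso_def)
  have inj: "inj_on f (carrier G)" using f by (auto simp: iso_def bij_betw_def)
  have i: "f x = f y \<longleftrightarrow> x = y" if "x \<in> carrier G" "y \<in> carrier G" for x y
    using inj that by (auto simp: inj_on_def)
  have i1: "f x = \<one>\<^bsub>H\<^esub> \<longleftrightarrow> x = \<one>\<^bsub>G\<^esub>" if "x \<in> carrier G" for x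
    using i[OF that gh.G.one_closed] gh.hom_one by simp
  obtain u v t where g: "a4_gens G u v t" using assms(4) by (auto simp: a4_like_def)
  then have c: "u \<in> carrier G" "v \<in> carrier G" "t \<in> carrier G" by (auto simp: a4_gens_def)
  have o: "order H = order G" using iso_same_card[OF assms(3)] by (simp add: order_def)
  have "a4_gens H (f u) (f v) (f t)"
    using g c i i1 unfolding a4_gens_def o by (simp flip: gh.hom_mult)
  then show ?thesis by (auto simp: a4_like_def)
qed

lemma a4_alt: "fin_group (alt_group 4) \<and> a4_like (alt_group 4)"
proof -
  let ?G = "alt_group 4"
  interpret group ?G by (rule alt_group_is_group)
  have tw: "card (carrier ?G) = 12" using alt_group_card_carrier[of 4] by (simp add: fact_numeral)
  then have "finite (carrier ?G)" by (rule_tac ccontr) simp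
  then interpret fin_group ?G by unfold_locales
  have one: "\<one>\<^bsub>?G\<^esub> = id" and mu: "x \<otimes>\<^bsub>?G\<^esub> y = x \<circ> y" for x y
    by (simp_all add: alt_group_one alt_group_mult)
  have mem: "transpose i j \<circ> transpose k l \<in> carrier ?G"
    if "i \<in> {1..4}" "j \<in> {1..4}" "k \<in> {1..4}" "l \<in> {1..4}" "i \<noteq> j" "k \<noteq> l" for i j k l :: nat
    unfolding alt_group_carrier
  proof
    show "transpose i j \<circ> transpose k l permutes {1..4}"
      using that by (intro permutes_compose permutes_swap_id) auto
    show "evenperm (transpose i j \<circ> transpose k l)"
      using that by (simp add: evenperm_comp permutation_swap_id evenperm_swap)
  qed
  define u :: "nat \<Rightarrow> nat" where "u = transpose 1 2 \<circ> transpose 3 4"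
  define v :: "nat \<Rightarrow> nat" where "v = transpose 1 3 \<circ> transpose 2 4"
  define t :: "nat \<Rightarrow> nat" where "t = transpose 1 2 \<circ> transpose 2 3"
  have "a4_gens ?G u v t"
    unfolding a4_gens_def mu one
  proof (intro conjI)
    show "order ?G = 12" using tw by (simp add: order_def)
    show "u \<in> carrier ?G" "v \<in> carrier ?G" "t \<in> carrier ?G" unfolding u_def v_def t_def by (rule mem; simp)+
    have "u 1 \<noteq> 1" "v 1 \<noteq> 1" "u 1 \<noteq> v 1" "t 1 \<noteq> 1" by (simp_all add: u_def v_def t_def transpose_def)
    then show "u \<noteq> id" "v \<noteq> id" "u \<noteq> v" "t \<noteq> id" by auto
  qed (auto simp: u_def v_def t_def fun_eq_iff transpose_def)
  then show ?thesis using fin_group_axioms by (auto simp: a4_like_def)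
qed

text \<open>Moving t to the left past u^j v^k changes the exponents (j, k) into (k, j + k), a matrix
  of order 3 modulo 2; the first argument counts the factors t. As in the metacyclic case, exponents
  stay unreduced.\<close>

fun a4_act :: "nat \<Rightarrow> nat \<times> nat \<Rightarrow> nat \<times> nat" where
  "a4_act 0 w = w" | "a4_act (Suc i) (j, k) = a4_act i (k, j + k)"

locale a4_group = fin_group G for G (structure) + fixes u v t assumes gens: "a4_gens G u v t"
begin

lemma gens_carrier [simp]: "u \<in> carrier G" "v \<in> carrier G" "t \<in> carrier G"
  and o12: "order G = 12" and ne: "u \<noteq> \<one>" "v \<noteq> \<one>" "u \<noteq> v" "t \<noteq> \<one>"
  and uu: "u \<otimes> u = \<one>" and vv: "v \<otimes> v = \<one>" and uv: "u \<otimes> v = v \<otimes> u" and ttt: "t \<otimes> t \<otimes> t = \<one>"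
  and ut: "u \<otimes> t = t \<otimes> v" and vt: "v \<otimes> t = t \<otimes> (u \<otimes> v)"
  using gens by (auto simp: a4_gens_def)

definition E :: "nat \<Rightarrow> nat \<times> nat \<Rightarrow> 'a" where "E i w = t [^] i \<otimes> (u [^] fst w \<otimes> v [^] snd w)"

lemma Ec [simp]: "E i w \<in> carrier G" by (simp add: E_def)

lemma uv_pow: "v [^] (k::nat) \<otimes> u [^] (j::nat) = u [^] j \<otimes> v [^] k"
proof -
  have 1: "v [^] (k::nat) \<otimes> u = u \<otimes> v [^] k" for k
  proof (induction k)
    case (Suc k)
    have "v [^] Suc k \<otimes> u = v [^] k \<otimes> u \<otimes> v" using uv by (simp add: m_assoc)
    then show ?case using Suc by (simp add: m_assoc)
  qed simp
  show ?thesis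
  proof (induction j)
    case (Suc j)
    have "v [^] k \<otimes> u [^] Suc j = v [^] k \<otimes> u [^] j \<otimes> u" by (simp add: m_assoc)
    also have "\<dots> = u [^] j \<otimes> (v [^] k \<otimes> u)" using Suc by (simp add: m_assoc)
    finally show ?case using 1 by (simp add: m_assoc)
  qed simp
qed

lemma w_t: "u [^] (j::nat) \<otimes> v [^] (k::nat) \<otimes> t = t \<otimes> (u [^] k \<otimes> v [^] (j + k))"
proof -
  have 1: "u [^] (j::nat) \<otimes> t = t \<otimes> v [^] j" for j
  proof (induction j)
    case (Suc j)
    have "u [^] Suc j \<otimes> t = u [^] j \<otimes> t \<otimes> v" using ut by (simp add: m_assoc)
    then show ?case using Suc by (simp add: m_assoc)
  qed simp
  have 2: "v [^] (k::nat) \<otimes> t = t \<otimes> (u [^] k \<otimes> v [^] k)" for k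
  proof (induction k)
    case (Suc k)
    have "v [^] Suc k \<otimes> t = v [^] k \<otimes> t \<otimes> (u \<otimes> v)" using vt by (simp add: m_assoc)
    also have "\<dots> = t \<otimes> (u [^] k \<otimes> (v [^] k \<otimes> u [^] (1::nat)) \<otimes> v)" using Suc by (simp add: m_assoc)
    also have "\<dots> = t \<otimes> (u [^] Suc k \<otimes> v [^] Suc k)" unfolding uv_pow by (simp add: m_assoc)
    finally show ?case .
  qed simp
  have "u [^] j \<otimes> v [^] k \<otimes> t = u [^] j \<otimes> t \<otimes> (u [^] k \<otimes> v [^] k)" using 2 by (simp add: m_assoc)
  also have "\<dots> = t \<otimes> (v [^] j \<otimes> u [^] k \<otimes> v [^] k)" using 1 by (simp add: m_assoc)
  also have "\<dots> = t \<otimes> (u [^] k \<otimes> v [^] (j + k))" unfolding uv_pow by (simp add: m_assoc nat_pow_mult)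
  finally show ?thesis .
qed

lemma w_ti: "u [^] j \<otimes> v [^] k \<otimes> t [^] (i::nat) = t [^] i \<otimes> (u [^] fst (a4_act i (j, k)) \<otimes> v [^] snd (a4_act i (j, k)))"
proof (induction i arbitrary: j k)
  case (Suc i)
  have "u [^] j \<otimes> v [^] k \<otimes> t [^] Suc i = u [^] j \<otimes> v [^] k \<otimes> t \<otimes> t [^] i"
    using nat_pow_Suc2[of t i] by (simp add: m_assoc)
  also have "\<dots> = t \<otimes> (u [^] k \<otimes> v [^] (j + k) \<otimes> t [^] i)" unfolding w_t by (simp add: m_assoc)
  also have "\<dots> = t [^] Suc i \<otimes> (u [^] fst (a4_act i (k, j + k)) \<otimes> v [^] snd (a4_act i (k, j + k)))"
    unfolding Suc nat_pow_Suc2[OF gens_carrier(3)] by (simp add: m_assoc)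
  finally show ?case by simp
qed simp

lemma E_mult: "E i w \<otimes> E i' w' = E (i + i') (fst (a4_act i' w) + fst w', snd (a4_act i' w) + snd w')"
proof -
  have "E i w \<otimes> E i' w' = t [^] i \<otimes> (u [^] fst w \<otimes> v [^] snd w \<otimes> t [^] i') \<otimes> (u [^] fst w' \<otimes> v [^] snd w')"
    by (simp add: E_def m_assoc)
  also have "\<dots> = t [^] (i + i') \<otimes> (u [^] fst (a4_act i' w) \<otimes> (v [^] snd (a4_act i' w) \<otimes> u [^] fst w') \<otimes> v [^] snd w')"
    unfolding w_ti by (simp add: m_assoc nat_pow_mult[symmetric])
  also have "\<dots> = E (i + i') (fst (a4_act i' w) + fst w', snd (a4_act i' w) + snd w')"
    unfolding uv_pow by (simp add: E_def m_assoc nat_pow_mult[symmetric])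
  finally show ?thesis .
qed

lemma pow_mod: "x \<in> carrier G \<Longrightarrow> x [^] n = \<one> \<Longrightarrow> x [^] (k::nat) = x [^] (k mod n)"
proof -
  assume x: "x \<in> carrier G" "x [^] n = \<one>"
  have "x [^] k = (x [^] n) [^] (k div n) \<otimes> x [^] (k mod n)"
    using x(1) by (simp add: nat_pow_pow nat_pow_mult)
  then show ?thesis using x by simp
qed

lemma E_red: "E i w = E (i mod 3) (fst w mod 2, snd w mod 2)"
  unfolding E_def
  using pow_mod[of t 3 i] pow_mod[of u 2 "fst w"] pow_mod[of v 2 "snd w"]
  by (simp add: nat_pow_2 nat_pow_3 uu vv ttt)

lemma K4: "subgroup {\<one>, u, v, u \<otimes> v} G" "card {\<one>, u, v, u \<otimes> v} = 4"
proof -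
  have uuv: "u \<otimes> (u \<otimes> v) = v" "u \<otimes> (v \<otimes> v) = u" by (simp_all add: m_assoc[symmetric] uu vv)
  have vu: "v \<otimes> u = u \<otimes> v" using uv by simp
  have vuv: "v \<otimes> (u \<otimes> v) = u" by (simp add: m_assoc[symmetric] vu) (simp add: m_assoc vv)
  have uvuv: "u \<otimes> (v \<otimes> u) = v" "u \<otimes> v \<otimes> (u \<otimes> v) = \<one>" by (simp_all add: vu uuv) (simp add: m_assoc vuv uu)
  show "subgroup {\<one>, u, v, u \<otimes> v} G"
    by (rule closed_imp_subgroup) (auto simp: uu vv uuv vu vuv uvuv m_assoc)
  have "u \<otimes> v \<noteq> \<one>" using ne uu by (metis gens_carrier(1,2) inv_unique' m_closed uv inv_equality)
  moreover have "u \<otimes> v \<noteq> u" "u \<otimes> v \<noteq> v" using ne by auto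
  ultimately show "card {\<one>, u, v, u \<otimes> v} = 4" using ne by (simp add: eq_commute[of \<one>] eq_commute[of _ "u \<otimes> v"])
qed

lemma ord_t: "ord t = 3"
  by (rule ord_prime) (use ne in \<open>simp_all add: nat_pow_3 ttt\<close>)

lemma gen_all: "subgroup H G \<Longrightarrow> t \<in> H \<Longrightarrow> u \<in> H \<Longrightarrow> v \<in> H \<Longrightarrow> H = carrier G"
proof -
  assume H: "subgroup H G" "t \<in> H" "u \<in> H" "v \<in> H"
  have "{\<one>, u, v, u \<otimes> v} \<subseteq> H" using H sub_one subgroup.m_closed[OF H(1)] by auto
  then have "4 dvd card H" using card_sub_dvd_sub[OF K4(1) H(1)] K4(2) by simp
  moreover have "3 dvd card H" using ord_dvd_sub[OF H(1,2)] ord_t by simp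
  ultimately have "12 dvd card H" by presburger
  then have "card H = order G" using card_sub_dvd[OF H(1)] o12 by (simp add: dvd_antisym)
  then show ?thesis by (rule sub_eq_carrierI[OF H(1)])
qed

lemma E_cover: "g \<in> carrier G \<Longrightarrow> \<exists>i w. g = E i w"
proof -
  have "{E i w | i w. True} = carrier G"
  proof (rule gen_all)
    have e: "E 0 (0, 0) = \<one>" "E 1 (0, 0) = t" "E 0 (1, 0) = u" "E 0 (0, 1) = v" by (simp_all add: E_def)
    then show "t \<in> {E i w | i w. True}" "u \<in> {E i w | i w. True}" "v \<in> {E i w | i w. True}"
      using e[symmetric] by blast+
    show "subgroup {E i w | i w. True} G"
    proof (rule closed_imp_subgroup)
      show "\<one> \<in> {E i w | i w. True}" using e(1)[symmetric] by blast
      show "\<And>x y. x \<in> {E i w | i w. True} \<Longrightarrow> y \<in> {E i w | i w. True} \<Longrightarrow> x \<otimes> y \<in> {E i w | i w. True}"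
        using E_mult by blast
    qed auto
  qed
  then show "g \<in> carrier G \<Longrightarrow> \<exists>i w. g = E i w" by blast
qed

lemma E_inj: "inj_on (\<lambda>(i, w). E i w) ({..<3} \<times> ({..<2} \<times> {..<2}))"
proof (rule eq_card_imp_inj_on)
  have "(\<lambda>(i, w). E i w) ` ({..<3} \<times> ({..<2} \<times> {..<2})) = carrier G"
  proof (rule subset_antisym; rule subsetI)
    fix g assume "g \<in> carrier G"
    then obtain i w where "g = E i w" using E_cover by blast
    then have "g = E (i mod 3) (fst w mod 2, snd w mod 2)" using E_red by simp
    then show "g \<in> (\<lambda>(i, w). E i w) ` ({..<3} \<times> ({..<2} \<times> {..<2}))"
      by (intro image_eqI[where x = "(i mod 3, (fst w mod 2, snd w mod 2))"]) simp_all
  qed auto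
  then show "card ((\<lambda>(i, w). E i w) ` ({..<3} \<times> ({..<2} \<times> {..<2}))) = card ({..<3::nat} \<times> ({..<2::nat} \<times> {..<2::nat}))"
    using o12 by (simp add: order_def card_cartesian_product)
qed simp

lemma E_eq: "E i w = E i' w' \<longleftrightarrow> i mod 3 = i' mod 3 \<and> fst w mod 2 = fst w' mod 2 \<and> snd w mod 2 = snd w' mod 2"
proof
  assume "E i w = E i' w'"
  then have "E (i mod 3) (fst w mod 2, snd w mod 2) = E (i' mod 3) (fst w' mod 2, snd w' mod 2)"
    using E_red by metis
  then have "(i mod 3, (fst w mod 2, snd w mod 2)) = (i' mod 3, (fst w' mod 2, snd w' mod 2))"
    using inj_onD[OF E_inj, of "(i mod 3, (fst w mod 2, snd w mod 2))" "(i' mod 3, (fst w' mod 2, snd w' mod 2))"]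
    by simp
  then show "i mod 3 = i' mod 3 \<and> fst w mod 2 = fst w' mod 2 \<and> snd w mod 2 = snd w' mod 2" by simp
next
  assume "i mod 3 = i' mod 3 \<and> fst w mod 2 = fst w' mod 2 \<and> snd w mod 2 = snd w' mod 2"
  then show "E i w = E i' w'" using E_red[of i w] E_red[of i' w'] by simp
qed

end

text \<open>As in \<open>metacyclic_iso\<close>, equality and products of the normal forms
  \<open>E i w\<close> obey the same rules in both groups.\<close>

lemma a4_iso:
  assumes G: "fin_group G" "a4_like G" and H: "fin_group H" "a4_like H" shows "G \<cong> H"
proof -
  obtain u v t where g: "a4_gens G u v t" using G(2) by (auto simp: a4_like_def)
  interpret G: a4_group G u v t using G(1) g by (simp add: a4_group_def a4_group_axioms_def)
  obtain u' v' t' where g': "a4_gens H u' v' t'" using H(2) by (auto simp: a4_like_def)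
  interpret H: a4_group H u' v' t' using H(1) g' by (simp add: a4_group_def a4_group_axioms_def)
  define f where "f g = (SOME h. \<exists>i x. g = G.E i x \<and> h = H.E i x)" for g
  have f: "f (G.E i x) = H.E i x" for i x
  proof -
    have "\<exists>j y. G.E i x = G.E j y \<and> f (G.E i x) = H.E j y"
      unfolding f_def by (rule someI_ex) blast
    then show ?thesis using G.E_eq H.E_eq by metis
  qed
  have "f \<in> hom G H"
  proof (rule homI)
    fix g assume "g \<in> carrier G"
    then show "f g \<in> carrier H" using G.E_cover f by (metis H.Ec)
  next
    fix g h assume "g \<in> carrier G" "h \<in> carrier G"
    then obtain i x j y where "g = G.E i x" "h = G.E j y" using G.E_cover by metis
    then show "f (g \<otimes>\<^bsub>G\<^esub> h) = f g \<otimes>\<^bsub>H\<^esub> f h" by (simp add: G.E_mult H.E_mult f)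
  qed
  moreover have "inj_on f (carrier G)"
  proof (rule inj_onI)
    fix g h assume gh: "g \<in> carrier G" "h \<in> carrier G" "f g = f h"
    then obtain i x j y where "g = G.E i x" "h = G.E j y" using G.E_cover by metis
    then show "g = h" using gh(3) f G.E_eq H.E_eq by simp
  qed
  moreover have "f ` carrier G = carrier H"
  proof (rule subset_antisym; rule subsetI)
    fix h assume "h \<in> f ` carrier G"
    then show "h \<in> carrier H" using G.E_cover f by (metis H.Ec imageE)
  next
    fix h assume "h \<in> carrier H"
    then obtain i x where "h = H.E i x" using H.E_cover by blast
    then show "h \<in> f ` carrier G" using f G.Ec by (metis image_eqI)
  qed
  ultimately have "f \<in> iso G H" by (simp add: iso_def bij_betw_def)
  then show ?thesis by (auto simp: is_iso_def)
qed

section \<open>The listed groups have no central cyclic Sylow subgroup\<close>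

context fin_group
begin

text \<open>A central Sylow subgroup is normal and so contains all elements of p-power order. To
  exclude p it suffices to exhibit such an element outside the center or, in a p-group, to show that
  the group is not cyclic.\<close>

lemma central_cyclic_primeD:
  assumes p: "p \<in> central_cyclic_primes G"
  shows "nprime p" "p dvd order G" "x \<in> carrier G \<Longrightarrow> x [^] (p ^ k) = \<one> \<Longrightarrow> x \<in> center G"
    "order G = p ^ n \<Longrightarrow> cyc"
proof -
  obtain P where P: "nprime p" "p dvd order G" "sylow_subgroup p P G"
    "cyclic_group (G\<lparr>carrier := P\<rparr>)" "P \<subseteq> center G"
    using p unfolding central_cyclic_primes_def by blast
  show "nprime p" "p dvd order G" by fact+
  have Ps: "P \<in> syl p" using P(3) by (simp add: sylow_subgroup_def syl_def subs_def)
  have Pg: "subgroup P G" using sylD(1)[OF Ps] .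
  have N: "Nm P = carrier G"
  proof -
    have "x \<in> Nm P" if x: "x \<in> carrier G" for x
    proof (rule NmI[OF x Pg])
      fix h assume h: "h \<in> P"
      then have "x \<otimes> h = h \<otimes> x" "h \<in> carrier G" using P(5) x by (auto simp: center_def)
      then have "x \<otimes> h \<otimes> inv x = h" using x by (simp add: m_assoc)
      then show "x \<otimes> h \<otimes> inv x \<in> P" using h by simp
    qed
    then show ?thesis using Nm_carrier[OF sub_carrier[OF Pg]] by blast
  qed
  show "x \<in> center G" if x: "x \<in> carrier G" "x [^] (p ^ k) = \<one>"
  proof -
    have "ord x dvd p ^ k" using x pow_eq_id by blast
    then obtain i where "ord x = p ^ i" using prime_power_dvd_imp[OF P(1)] by blast
    then have "generate G {x} \<in> subs G (p ^ i)" using gen_subgroup card_gen x(1) by (simp add: subs_def)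
    then have "generate G {x} \<subseteq> P" by (rule normal_sylow_contains[OF P(1) Ps N])
    then show ?thesis using gen_mem[of x] P(5) by blast
  qed
  show cyc if o: "order G = p ^ n"
  proof -
    have "card P = order G" using sylD(2)[OF Ps] o P(1) by simp
    then have "P = carrier G" by (rule sub_eq_carrierI[OF Pg])
    then have "cyclic_group G" using P(4) by simp
    then show ?thesis using cyclic_group_iff_cyc by simp
  qed
qed

lemma noncentral: "x \<in> carrier G \<Longrightarrow> y \<in> carrier G \<Longrightarrow> x \<otimes> y \<noteq> y \<otimes> x \<Longrightarrow> x \<notin> center G \<and> y \<notin> center G"
  unfolding center_def by (simp, metis)

text \<open>As r is not 1 modulo s, the generators do not commute, so neither is central. The order
  of b is a power of q and, by the last hypothesis, that of a is a power of p; no other primes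
  divide |G|.\<close>

lemma metacyclic_no_central_cyclic_primes:
  assumes mc: "metacyclic G (p ^ i) (q ^ j) r t" and p: "nprime p" and q: "nprime q"
    and r: "\<not> [r = 1] (mod (q ^ j))" and t: "p = q \<or> t = 0"
  shows "central_cyclic_primes G = {}"
proof (rule ccontr)
  assume "central_cyclic_primes G \<noteq> {}"
  then obtain l where l: "l \<in> central_cyclic_primes G" by blast
  obtain a b where g: "metacyclic_gens G (p ^ i) (q ^ j) r t a b" using mc by (auto simp: metacyclic_def)
  interpret M: metacyclic_group G "p ^ i" "q ^ j" r t a b by (rule metacyclic_group_intro[OF fin_group_axioms g])
  have "M.E 0 1 \<otimes> M.E 1 0 \<noteq> M.E 1 0 \<otimes> M.E 0 1"
    using r M.E_eq_snd[of 1 r 1] by (simp add: M.E_mult)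
  then have nc: "a \<notin> center G" "b \<notin> center G"
    using noncentral[OF M.ac M.bc] M.ac M.bc by (auto simp: M.E_def)
  have o: "order G = p ^ i * q ^ j" by (rule M.ord_eq)
  have "l = p \<or> l = q" using central_cyclic_primeD(1,2)[OF l] p q unfolding o
    by (metis prime_dvd_mult_iff prime_dvd_power primes_dvd_imp_eq)
  then show False
  proof
    assume lq: "l = q"
    have "b [^] (l ^ j) = \<one>" using M.bs lq by simp
    then show False using central_cyclic_primeD(3)[OF l M.bc] nc by blast
  next
    assume lp: "l = p"
    show False
    proof (cases "p = q")
      case True
      then have "a [^] (l ^ (i + j)) = \<one>" using pow_order_eq_1[OF M.ac] o lp by (simp add: power_add)
      then show False using central_cyclic_primeD(3)[OF l M.ac] nc by blast
    next
      case False
      then have "a [^] (l ^ i) = \<one>" using M.am t lp by simp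
      then show False using central_cyclic_primeD(3)[OF l M.ac] nc by blast
    qed
  qed
qed

text \<open>A p-group is its own Sylow subgroup. This one has order p^(j+1), but all its p^j-th
  powers are trivial, so it is not cyclic.\<close>

lemma metacyclic_abelian_no_central_cyclic_primes:
  assumes mc: "metacyclic G p (p ^ j) 1 0" and p: "nprime p" and j: "0 < j"
  shows "central_cyclic_primes G = {}"
proof (rule ccontr)
  assume "central_cyclic_primes G \<noteq> {}"
  then obtain l where l: "l \<in> central_cyclic_primes G" by blast
  obtain a b where g: "metacyclic_gens G p (p ^ j) 1 0 a b" using mc by (auto simp: metacyclic_def)
  interpret M: metacyclic_group G p "p ^ j" 1 0 a b by (rule metacyclic_group_intro[OF fin_group_axioms g])
  have o: "order G = p ^ Suc j" using M.ord_eq by simp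
  have "l dvd p ^ Suc j" using central_cyclic_primeD(2)[OF l] unfolding o .
  then have "l dvd p" using central_cyclic_primeD(1)[OF l] prime_dvd_power by blast
  then have "l = p" using central_cyclic_primeD(1)[OF l] p primes_dvd_imp_eq by blast
  then have cyc using central_cyclic_primeD(4)[OF l] o by blast
  then obtain x where x: "x \<in> carrier G" "ord x = order G" by (auto simp: cyc_def)
  obtain i y where iy: "x = M.E i y" using M.E_cover x(1) by blast
  have ge: "geo 1 i k = k" for k by (simp add: geo_def)
  \<comment> \<open>Since j > 0, the exponent of a is a multiple of p, and a^p = 1 because t =
    0.\<close>
  have "x [^] (p ^ j) = M.E (p * (i * p ^ (j - 1))) (y * p ^ j)"
    unfolding iy M.E_pow ge using j by (cases j) (simp_all add: mult_ac)
  also have "\<dots> = M.E 0 (y * p ^ j)" using M.E_shift[of 0 "i * p ^ (j - 1)"] by simp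
  also have "\<dots> = M.E 0 0" by (rule M.E_snd_cong) (simp add: cong_0_iff)
  finally have "x [^] (p ^ j) = \<one>" by (simp add: M.E_00)
  then have "p ^ Suc j dvd p ^ j" using pow_eq_id[OF x(1)] x(2) o by simp
  then show False using power_dvd_imp_le[of p "Suc j" j] prime_gt_1_nat[OF p] by simp
qed

end

lemma (in a4_group) no_central_cyclic_primes: "central_cyclic_primes G = {}"
proof (rule ccontr)
  assume "central_cyclic_primes G \<noteq> {}"
  then obtain l where l: "l \<in> central_cyclic_primes G" by blast
  have "u \<otimes> t \<noteq> t \<otimes> u" using ut ne by simp
  then have nc: "u \<notin> center G" "t \<notin> center G" using noncentral[of u t] by simp_all
  have "l dvd 2 * 2 * 3" using central_cyclic_primeD(2)[OF l] o12 by simp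
  then have "l dvd 2 \<or> l dvd 3"
    using prime_dvd_multD[OF central_cyclic_primeD(1)[OF l]] by blast
  then have "l = 2 \<or> l = 3" using primes_dvd_imp_eq[OF central_cyclic_primeD(1)[OF l]] by auto
  then show False
    using central_cyclic_primeD(3)[OF l, of u 1] central_cyclic_primeD(3)[OF l, of t 1] nc
    by (auto simp: nat_pow_2 nat_pow_3 uu ttt)
qed

text \<open>The orders 1, 2, 3, 4, 6, 12 contribute 1 + 3 + 4 + 1 + 0 + 1. The Klein four-group is
  the normal Sylow 2-subgroup. There are four Sylow 3-subgroups, since a normal one would make u and
  t commute. A subgroup of order 6 would normalize its Sylow 3-subgroup, whose normalizer in G has
  order 3.\<close>

lemma (in a4_group) count_10: "subgroup_count G = 10"
proof -
  let ?K = "{\<one>, u, v, u \<otimes> v}" and ?P = "generate G {t}"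
  have K: "subgroup ?K G" "card ?K = 4" by (rule K4)+
  have p2: "nprime 2" and p3: "nprime 3" by simp_all
  have m2: "multiplicity 2 (order G) = 2" unfolding o12
    by (rule multiplicity_eqI) simp_all
  have m3: "multiplicity 3 (order G) = 1" unfolding o12
    by (rule multiplicity_eqI) simp_all
  have Ks: "?K \<in> syl 2" using K unfolding syl_def m2 by (intro subsI) simp_all
  have s2: "syl 2 = subs G 4" unfolding syl_def m2 by simp
  have s3: "syl 3 = subs G 3" unfolding syl_def m3 by simp
  have N: "Nm ?K = carrier G"
  proof (rule gen_all)
    show "subgroup (Nm ?K) G" by (rule Nm_subgroup[OF sub_carrier[OF K(1)]])
    show "u \<in> Nm ?K" "v \<in> Nm ?K" using Nm_self[OF K(1)] by blast+
    have "inv t \<in> Nm ?K"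
    proof (rule NmI[OF _ K(1)])
      fix h assume h: "h \<in> ?K"
      have 1: "inv t \<otimes> u \<otimes> t = v" "inv t \<otimes> v \<otimes> t = u \<otimes> v" using ut vt by (simp_all add: m_assoc) (simp_all add: m_assoc[symmetric])
      have "inv t \<otimes> (u \<otimes> v) \<otimes> t = (inv t \<otimes> u \<otimes> t) \<otimes> (inv t \<otimes> v \<otimes> t)"
      proof -
        have "t \<otimes> (inv t \<otimes> (v \<otimes> t)) = v \<otimes> t" by (simp add: m_assoc[symmetric])
        then show ?thesis by (simp add: m_assoc)
      qed
      also have "\<dots> = u" unfolding 1
      proof -
        have "v \<otimes> (u \<otimes> v) = v \<otimes> u \<otimes> v" by (simp add: m_assoc)
        also have "\<dots> = u \<otimes> (v \<otimes> v)" unfolding uv[symmetric] by (simp add: m_assoc)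
        finally show "v \<otimes> (u \<otimes> v) = u" by (simp add: vv)
      qed
      finally have "inv t \<otimes> (u \<otimes> v) \<otimes> t = u" .
      then show "inv t \<otimes> h \<otimes> inv (inv t) \<in> ?K" using h 1 by auto
    qed simp
    then show "t \<in> Nm ?K" using subgroup.m_inv_closed[OF Nm_subgroup[OF sub_carrier[OF K(1)]]] by fastforce
  qed
  have c4: "card (subs G 4) = 1" using normal_sylow_card[OF p2 Ks N] s2 by simp
  have c2: "card (subs G 2) = 3"
  proof -
    have "u \<otimes> (u \<otimes> v) = v" by (simp add: m_assoc[symmetric] uu)
    then have "u \<otimes> v \<noteq> \<one>" using ne(3) by auto
    moreover have "u \<otimes> v \<noteq> u" "u \<otimes> v \<noteq> v" using ne by simp_all
    ultimately have uvne: "u \<otimes> v \<noteq> \<one>" "u \<otimes> v \<noteq> u" "u \<otimes> v \<noteq> v" by blast+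
    have uvuv: "u \<otimes> v \<otimes> (u \<otimes> v) = \<one>"
    proof -
      have "u \<otimes> v \<otimes> (u \<otimes> v) = u \<otimes> (v \<otimes> u) \<otimes> v" by (simp add: m_assoc)
      also have "\<dots> = (u \<otimes> u) \<otimes> (v \<otimes> v)" unfolding uv[symmetric] by (simp add: m_assoc)
      finally show ?thesis by (simp add: uu vv)
    qed
    have two: "{\<one>, x} \<in> subs G 2" if "x \<in> carrier G" "x \<noteq> \<one>" "x \<otimes> x = \<one>" for x
      by (rule subsI, rule closed_imp_subgroup) (use that in auto)
    have "subs G 2 = {{\<one>, u}, {\<one>, v}, {\<one>, u \<otimes> v}}"
    proof (rule subset_antisym; rule subsetI)
      fix H assume H: "H \<in> subs G 2"
      have HK: "H \<subseteq> ?K" using normal_sylow_contains[OF p2 Ks N, of H 1] H by simp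
      have H1: "\<one> \<in> H" "card H = 2" using H sub_one by (auto simp: subs_def)
      then obtain x where "H = {\<one>, x}" "x \<noteq> \<one>" by (metis card_2_iff insertE singletonD insert_commute)
      then show "H \<in> {{\<one>, u}, {\<one>, v}, {\<one>, u \<otimes> v}}" using HK by auto
    qed (use two uu vv uvuv ne uvne in auto)
    moreover have "{\<one>, u} \<noteq> {\<one>, v}" "{\<one>, u} \<noteq> {\<one>, u \<otimes> v}" "{\<one>, v} \<noteq> {\<one>, u \<otimes> v}"
      using ne uvne by (auto simp: doubleton_eq_iff)
    ultimately show ?thesis by simp
  qed
  have Ps: "?P \<in> syl 3" unfolding s3 using gen_subgroup card_gen ord_t by (intro subsI) simp_all
  have c3: "card (subs G 3) = 4"
  proof -
    have d: "card (syl 3) * card (Nm ?P) = 12" using card_syl_index[OF p3 Ps] o12 by simp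
    have "3 dvd card (Nm ?P)"
      using card_sub_dvd_sub[OF gen_subgroup Nm_subgroup Nm_self, of t] card_gen ord_t gen_subgroup sub_carrier by simp
    then obtain k where k: "card (Nm ?P) = 3 * k" by (rule dvdE)
    then have "card (syl 3) * k = 4" using d by (simp add: mult.commute)
    then have "card (syl 3) dvd 4" by (metis dvd_triv_left)
    then have "card (syl 3) = 1 \<or> card (syl 3) = 2 \<or> card (syl 3) = 4"
    proof -
      have "card (syl 3) \<le> 4" using \<open>card (syl 3) dvd 4\<close> by (simp add: dvd_imp_le)
      then show ?thesis using \<open>card (syl 3) dvd 4\<close> by (cases "card (syl 3) = 3"; cases "card (syl 3) = 0") auto
    qed
    moreover have "card (syl 3) \<noteq> 2" using card_syl_cong[OF p3] by (auto simp: cong_def)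
    moreover have "card (syl 3) \<noteq> 1"
    proof
      assume c31: "card (syl 3) = 1"
      have NP: "Nm ?P = carrier G" using Nm_eq_carrier_of_unique Ps c31 unfolding s3 by blast
      have "coprime (card ?K) (card ?P)"
        unfolding K(2) card_gen[OF gens_carrier(3)] ord_t using coprime_Suc_left_nat[of 3] by simp
      then have "?K \<inter> ?P = {\<one>}" using coprime_Int[OF K(1) gen_subgroup] by simp
      then have "u \<otimes> t = t \<otimes> u"
        by (intro Nm_eq_commute[OF K(1) gen_subgroup[of t]]) (use N NP gen_mem sub_carrier[OF K(1)] sub_carrier[OF gen_subgroup[of t]] in auto)
      then show False using ut ne by simp
    qed
    ultimately show ?thesis unfolding s3 by blast
  qed
  have c6: "subs G 6 = {}"
  proof (rule ccontr)
    assume "subs G 6 \<noteq> {}"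
    then obtain H where H: "subgroup H G" "card H = 6" by (auto simp: subs_def)
    interpret H: fin_group "G\<lparr>carrier := H\<rparr>" by (rule sub_fin_group[OF H(1)])
    have hm: "multiplicity 3 (order (G\<lparr>carrier := H\<rparr>)) = 1" unfolding order_restrict H(2)
      by (rule multiplicity_eqI) simp_all
    obtain Q where Q: "Q \<in> H.syl 3" using H.sylow_exists[OF p3] by blast
    have sq: "H.syl 3 = subs (G\<lparr>carrier := H\<rparr>) 3" unfolding H.syl_def hm by simp
    have Q': "Q \<in> subs G 3" "Q \<subseteq> H" using Q unfolding sq subs_restrict[OF H(1)] by auto
    have "card (H.syl 3) * card (H.Nm Q) = 6" using H.card_syl_index[OF p3 Q] H(2) by simp
    then have "card (H.syl 3) dvd 6" by (metis dvd_triv_left)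
    then have "card (H.syl 3) \<le> 6" "card (H.syl 3) dvd 6" by (auto simp: dvd_imp_le)
    moreover have "card (H.syl 3) mod 3 = 1" using H.card_syl_cong[OF p3] by (simp add: cong_def)
    moreover have "n = 1" if "n \<le> 6" "n dvd 6" "n mod 3 = 1" for n :: nat
    proof -
      have "n = 1 \<or> n = 4" using that(1,3) by presburger
      then show ?thesis using that(2) by auto
    qed
    ultimately have "card (H.syl 3) = 1" by blast
    then have "H.Nm Q = H" using H.Nm_eq_carrier_of_unique[of Q 3] Q unfolding sq by simp
    moreover have "H.Nm Q \<subseteq> Nm Q"
    proof
      fix x assume x: "x \<in> H.Nm Q"
      then have xH: "x \<in> H" using H.Nm_carrier[of Q] Q' by auto
      show "x \<in> Nm Q"
      proof (rule NmI)
        show "x \<in> carrier G" using xH sub_carrier[OF H(1)] by blast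
        show "subgroup Q G" using Q' by (simp add: subs_def)
        fix h assume "h \<in> Q"
        then have "x \<otimes> h \<otimes> inv\<^bsub>G\<lparr>carrier := H\<rparr>\<^esub> x \<in> Q" using H.Nm_conj[OF x] by simp
        then show "x \<otimes> h \<otimes> inv x \<in> Q" using m_inv_consistent[OF H(1) xH] by simp
      qed
    qed
    ultimately have sub: "H \<subseteq> Nm Q" by simp
    have Qs: "Q \<in> syl 3" using Q'(1) s3 by simp
    have "card (Nm Q) = 3" using card_syl_index[OF p3 Qs] o12 c3 unfolding s3 by simp
    then show False using card_mono[OF sub_finite[OF Nm_subgroup] sub] H(2) Q' sub_carrier subsD(1) by fastforce
  qed
  have div: "{d::nat. d dvd 12} = {1, 2, 3, 4, 6, 12}"
  proof -
    have "d \<in> {1, 2, 3, 4, 6, 12}" if "d dvd 12" for d :: nat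
    proof -
      have "d \<le> 12" using that by (simp add: dvd_imp_le)
      then have "d = 0 \<or> d = 1 \<or> d = 2 \<or> d = 3 \<or> d = 4 \<or> d = 5 \<or> d = 6 \<or> d = 7 \<or> d = 8 \<or> d = 9 \<or> d = 10 \<or> d = 11 \<or> d = 12" by presburger
      then show ?thesis using that by auto
    qed
    then show ?thesis by auto
  qed
  show ?thesis using c2 c3 c4 c6 subs_1 subs_order
    unfolding subgroup_count_eq_sum o12 div by simp
qed

section \<open>Codes of the listed groups and their subgroup counts\<close>

text \<open>\<^const>\<open>None\<close> stands for \<open>A\<^sub>4\<close>, the only listed group that is not metacyclic.\<close>

type_synonym group_code = "(nat \<times> nat \<times> nat \<times> nat) option"

definition has_code :: "('a, 'b) monoid_scheme \<Rightarrow> group_code \<Rightarrow> bool" where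
  "has_code G c = (case c of None \<Rightarrow> a4_like G | Some (m, s, r, t) \<Rightarrow> metacyclic G m s r t)"

text \<open>Position by position the codes of \<open>listed_groups n\<close>, see
  \<open>listed_coded\<close>. A multiplier -1 becomes s - 1, and the last parameter is nonzero only
  for Q_8 and Q_16.\<close>

definition listed_codes :: "nat \<Rightarrow> group_code list" where
  "listed_codes n =
    (if n = 1 then [Some (1, 1, 1, 0)]
     else if n = 5 then [Some (2, 2, 1, 0)]
     else if n = 6 then [Some (3, 3, 1, 0), Some (2, 3, 2, 0), Some (2, 4, 3, 2)]
     else if n = 8 then [Some (2, 4, 1, 0), Some (5, 5, 1, 0), Some (2, 5, 4, 0), Some (4, 3, 2, 0)]
     else if n = 10 then
       [Some (3, 9, 1, 0), Some (7, 7, 1, 0), Some (2, 7, 6, 0), None, Some (3, 7, 2, 0),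
        Some (4, 5, 4, 0), Some (8, 3, 2, 0), Some (2, 4, 3, 0), Some (3, 9, 4, 0)]
     else if n = 11 then [Some (2, 8, 1, 0), Some (2, 8, 7, 4), Some (2, 8, 5, 0)]
     else if n = 12 then [Some (4, 7, 6, 0), Some (9, 7, 2, 0), Some (8, 5, 4, 0), Some (16, 3, 2, 0)]
     else [])"

definition coded :: "('a, 'b) monoid_scheme \<Rightarrow> group_code \<Rightarrow> bool" where
  "coded G c \<longleftrightarrow> fin_group G \<and> has_code G c"

lemma coded_of_pairs_metacyclic:
  "fin_group G \<and> metacyclic G m s r t \<Longrightarrow> coded (of_pairs G) (Some (m, s, r, t))"
  using image_group_metacyclic[of G Inl m s r t] by (simp add: coded_def has_code_def)

lemma coded_of_perms_metacyclic:
  "fin_group G \<and> metacyclic G m s r t \<Longrightarrow> coded (of_perms G) (Some (m, s, r, t))"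
  using image_group_metacyclic[of G Inr m s r t] by (simp add: coded_def has_code_def)

lemma coded_of_perms_a4: "coded (of_perms (alt_group 4)) None"
proof -
  have i: "inj_on Inr (carrier (alt_group 4))" by simp
  have F: "fin_group (of_perms (alt_group 4))" using image_group_fin_group[OF _ i] a4_alt by blast
  have "alt_group 4 \<cong> of_perms (alt_group 4)" using image_group_iso[OF i] by (auto simp: is_iso_def)
  then have "a4_like (of_perms (alt_group 4))"
    using a4_transfer[of "alt_group 4" "of_perms (alt_group 4)"] F a4_alt by (simp add: fin_group_def)
  then show ?thesis using F by (simp add: coded_def has_code_def)
qed

lemma coded_cyclic_semidirect:
  assumes "1 < m" "1 < s" "r ^ m mod int s = 1 mod int s" "int r' mod int s = r mod int s"
  shows "coded (of_pairs (cyclic_semidirect m s r)) (Some (m, s, r', 0))"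
  by (rule coded_of_pairs_metacyclic[OF metacyclic_cyclic_semidirect[OF assms]])

lemma coded_DirProd:
  assumes "1 < m" "1 < s" shows "coded (of_pairs (Zmod m \<times>\<times> Zmod s)) (Some (m, s, 1, 0))"
  unfolding DirProd_Zmod by (rule coded_cyclic_semidirect) (use assms in auto)

lemma coded_dicyclic:
  "0 < m \<Longrightarrow> s = 2 * m \<Longrightarrow> r = 2 * m - 1 \<Longrightarrow> coded (of_pairs (dicyclic_group m)) (Some (2, s, r, m))"
  using coded_of_pairs_metacyclic[OF metacyclic_dicyclic] by blast

lemma listed_coded: "list_all2 coded (listed_groups n) (listed_codes n)"
proof -
  note C = coded_cyclic_semidirect
  show ?thesis
    unfolding listed_groups_def listed_codes_def dihedral_group_def E27_def
    by (simp add: coded_DirProd[unfolded One_nat_def] coded_dicyclic coded_of_perms_metacyclic[OF metacyclic_sym_3]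
        coded_of_perms_a4 coded_of_pairs_metacyclic[OF metacyclic_singleton, unfolded One_nat_def] coded_cyclic_semidirect)
qed

text \<open>\<open>mc_count\<close> with lists and explicit ranges, so that \<open>code_simp\<close>
  can evaluate it.\<close>

definition mc_eval :: "nat \<Rightarrow> nat \<Rightarrow> nat \<Rightarrow> nat \<Rightarrow> nat" where
  "mc_eval m s r t = sum_list (map (\<lambda>d. if d dvd m then sum_list (map (\<lambda>e. if e dvd s then
     length (filter (\<lambda>y. e dvd t + y * sum_list (map (\<lambda>i. r ^ (d * i)) [0..<m div d])) [0..<e]) else 0)
     [1..<Suc s]) else 0) [1..<Suc m])"

lemma mc_count_eq_mc_eval:
  assumes "0 < m" "0 < s" shows "mc_count m s r t = mc_eval m s r t"
proof -
  let ?F = "\<lambda>d e. {y. y < e \<and> e dvd t + y * geo r d (m div d)}"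
  have S: "{(d, e, y). d dvd m \<and> e dvd s \<and> y < e \<and> e dvd t + y * geo r d (m div d)} =
      Sigma {d. d dvd m} (\<lambda>d. Sigma {e. e dvd s} (\<lambda>e. ?F d e))" by auto
  have fin: "finite {d. d dvd m}" "finite {e. e dvd s}" using assms by auto
  have "mc_count m s r t = (\<Sum>d | d dvd m. \<Sum>e | e dvd s. card (?F d e))"
    unfolding mc_count_def S using fin by (simp add: card_SigmaI finite_SigmaI)
  also have "\<dots> = (\<Sum>d\<in>{1..<Suc m}. if d dvd m then (\<Sum>e\<in>{1..<Suc s}. if e dvd s then card (?F d e) else 0) else 0)"
  proof -
    have D: "{d. d dvd n} = {d \<in> {1..<Suc n}. d dvd n}" if n: "0 < n" for n :: nat
    proof -
      have "1 \<le> d \<and> d \<le> n" if "d dvd n" for d using that n dvd_imp_le[OF that n] by (cases d) auto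
      then show ?thesis by (auto simp: less_Suc_eq_le)
    qed
    show ?thesis unfolding D[OF assms(1)] D[OF assms(2)]
      by (simp only: sum.inter_filter finite_atLeastLessThan)
  qed
  finally have 1: "mc_count m s r t = \<dots>" .
  have 2: "card (?F d e) = length (filter (\<lambda>y. e dvd t + y * sum_list (map (\<lambda>i. r ^ (d * i)) [0..<m div d])) [0..<e])" for d e
  proof -
    have "geo r d (m div d) = sum_list (map (\<lambda>i. r ^ (d * i)) [0..<m div d])"
      by (simp add: geo_def interv_sum_list_conv_sum_set_nat lessThan_atLeast0)
    then have "?F d e = set (filter (\<lambda>y. e dvd t + y * sum_list (map (\<lambda>i. r ^ (d * i)) [0..<m div d])) [0..<e])" by auto
    then show ?thesis using distinct_card[of "filter (\<lambda>y. e dvd t + y * sum_list (map (\<lambda>i. r ^ (d * i)) [0..<m div d])) [0..<e]"] by simp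
  qed
  show ?thesis unfolding 1 2 mc_eval_def by (simp only: interv_sum_list_conv_sum_set_nat set_upt)
qed

lemma listed_codes_eval:
  "list_all (\<lambda>n. list_all (\<lambda>c. case c of None \<Rightarrow> True | Some (m, s, r, t) \<Rightarrow> 0 < m \<and> 0 < s \<and> mc_eval m s r t = n)
    (listed_codes n)) [0..<13]"
  by code_simp

lemma listed_codes_count:
  assumes "n \<in> {1..12}" "Some (m, s, r, t) \<in> set (listed_codes n)"
  shows "mc_count m s r t = n"
proof -
  have "n \<in> set [0..<13]" using assms(1) by auto
  then have "0 < m \<and> 0 < s \<and> mc_eval m s r t = n"
    using listed_codes_eval assms(2) unfolding list_all_iff by fastforce
  then show ?thesis using mc_count_eq_mc_eval by simp
qed

text \<open>Apart from A_4 and the trivial group, m and s are always prime powers, and either r is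
  not 1 modulo s or the group is Z_p x Z_(p^j); one criterion above covers each kind.\<close>

lemma listed_codes_no_central_cyclic_primes:
  assumes "c \<in> set (listed_codes n)" "coded G c" shows "central_cyclic_primes G = {}"
proof -
  have F: "fin_group G" using assms(2) by (simp add: coded_def)
  interpret fin_group G by (rule F)
  have nonab: "central_cyclic_primes G = {}"
    if "c = Some (p ^ i, q ^ j, r, t)" "nprime p" "nprime q" "\<not> [r = 1] (mod (q ^ j))" "p = q \<or> t = 0" for p i q j r t
    using metacyclic_no_central_cyclic_primes[of p i q j r t] that assms(2) by (simp add: coded_def has_code_def)
  have ab: "central_cyclic_primes G = {}"
    if "c = Some (p, p ^ j, 1, 0)" "nprime p" "0 < j" for p j
    using metacyclic_abelian_no_central_cyclic_primes[of p j] that assms(2) by (simp add: coded_def has_code_def)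
  have nonab_code: "c = Some (p ^ i, q ^ j, r, t) \<and> nprime p \<and> nprime q \<and> \<not> [r = 1] (mod (q ^ j)) \<and> (p = q \<or> t = 0) \<Longrightarrow> central_cyclic_primes G = {}" for p i q j r t
    using nonab by blast
  have ab_code: "c = Some (p, p ^ j, 1, 0) \<and> nprime p \<and> 0 < j \<Longrightarrow> central_cyclic_primes G = {}" for p j
    using ab by blast
  have a4: "central_cyclic_primes G = {}" if cN: "c = None"
  proof -
    obtain u v t where "a4_gens G u v t" using cN assms(2) by (auto simp: coded_def has_code_def a4_like_def)
    then interpret a4_group G u v t by unfold_locales
    show ?thesis by (rule no_central_cyclic_primes)
  qed
  have triv: "central_cyclic_primes G = {}" if "c = Some (1, 1, 1, 0)"
  proof -
    have "metacyclic G 1 1 1 0" using that assms(2) by (simp add: coded_def has_code_def)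
    then have "order G = 1" using metacyclic_constraints(3)[OF F] by simp
    then have "l \<notin> central_cyclic_primes G" for l
      using central_cyclic_primeD(1,2)[of l] not_prime_unit[of l] by auto
    then show ?thesis by blast
  qed
  note A = ab_code[unfolded One_nat_def] and N = nonab_code[unfolded One_nat_def]
  consider "n = 1" | "n = 5" | "n = 6" | "n = 8" | "n = 10" | "n = 11" | "n = 12"
    using assms(1) by (auto simp: listed_codes_def split: if_splits)
  then show ?thesis
  proof cases
    case 1 then show ?thesis using assms(1) triv by (simp add: listed_codes_def)
  next
    case 2 then show ?thesis using assms(1) A[of 2 1] by (simp add: listed_codes_def)
  next
    case 3 then show ?thesis using assms(1) A[of 3 1] N[of 2 1 3 1 2 0] N[of 2 1 2 2 3 2]
      by (auto simp: listed_codes_def cong_def)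
  next
    case 4 then show ?thesis using assms(1) A[of 2 2] A[of 5 1] N[of 2 1 5 1 4 0] N[of 2 2 3 1 2 0]
      by (auto simp: listed_codes_def cong_def)
  next
    case 5
    then have "c = Some (3, 9, 1, 0) \<or> c = Some (7, 7, 1, 0) \<or> c = Some (2, 7, 6, 0) \<or> c = None \<or> c = Some (3, 7, 2, 0) \<or> c = Some (4, 5, 4, 0) \<or> c = Some (8, 3, 2, 0) \<or> c = Some (2, 4, 3, 0) \<or> c = Some (3, 9, 4, 0)"
      using assms(1) by (simp add: listed_codes_def)
    then show ?thesis
    proof (elim disjE)
      assume "c = Some (3, 9, 1, 0)" then show ?thesis using A[of 3 2] by (simp add: cong_def)
    next
      assume "c = Some (7, 7, 1, 0)" then show ?thesis using A[of 7 1] by (simp add: cong_def)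
    next
      assume "c = Some (2, 7, 6, 0)" then show ?thesis using N[of 2 1 7 1 6 0] by (simp add: cong_def)
    next
      assume "c = None" then show ?thesis using a4 by (simp add: cong_def)
    next
      assume "c = Some (3, 7, 2, 0)" then show ?thesis using N[of 3 1 7 1 2 0] by (simp add: cong_def)
    next
      assume "c = Some (4, 5, 4, 0)" then show ?thesis using N[of 2 2 5 1 4 0] by (simp add: cong_def)
    next
      assume "c = Some (8, 3, 2, 0)" then show ?thesis using N[of 2 3 3 1 2 0] by (simp add: cong_def)
    next
      assume "c = Some (2, 4, 3, 0)" then show ?thesis using N[of 2 1 2 2 3 0] by (simp add: cong_def)
    next
      assume "c = Some (3, 9, 4, 0)" then show ?thesis using N[of 3 1 3 2 4 0] by (simp add: cong_def)
    qed
  next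
    case 6 then show ?thesis using assms(1) A[of 2 3] N[of 2 1 2 3 7 4] N[of 2 1 2 3 5 0]
      by (auto simp: listed_codes_def cong_def)
  next
    case 7 then show ?thesis using assms(1) N[of 2 2 7 1 6 0] N[of 3 2 7 1 2 0] N[of 2 3 5 1 4 0] N[of 2 4 3 1 2 0]
      by (auto simp: listed_codes_def cong_def)
  qed
qed

section \<open>Noncyclic p-groups with few subgroups\<close>

definition small_type :: "('a, 'b) monoid_scheme \<Rightarrow> bool" where
  "small_type G \<longleftrightarrow> (\<exists>k\<in>{1..12}. \<exists>c\<in>set (listed_codes k). has_code G c)"

lemma small_typeI:
  "metacyclic G m s r t \<Longrightarrow> k \<in> {1..12} \<Longrightarrow> Some (m, s, r, t) \<in> set (listed_codes k) \<Longrightarrow> small_type G"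
  unfolding small_type_def has_code_def by (rule bexI[of _ k], rule bexI[of _ "Some (m, s, r, t)"]) simp_all

context fin_group
begin

lemma pow_mod_eq:
  assumes "x \<in> carrier G" "x [^] (n::nat) = \<one>" shows "x [^] (k::nat) = x [^] (k mod n)"
proof -
  have "x [^] k = (x [^] n) [^] (k div n) \<otimes> x [^] (k mod n)"
    using assms(1) by (simp add: nat_pow_pow nat_pow_mult)
  then show ?thesis using assms by simp
qed

lemma ord_eq_of_gen:
  assumes "x \<in> carrier G" "y \<in> generate G {x}" "ord y = ord x" shows "generate G {y} = generate G {x}"
proof -
  have y: "y \<in> carrier G" using assms(1,2) sub_carrier[OF gen_subgroup] by blast
  show ?thesis
    by (rule sub_eqI[OF gen_subgroup gen_sub[OF gen_subgroup]]) (use assms y card_gen in auto)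
qed

text \<open>The quotient of G by M has order k.\<close>

lemma index_pow_mem:
  assumes M: "subgroup M G" "Nm M = carrier G" and o: "order G = k * card M" and a: "a \<in> carrier G"
  shows "a [^] k \<in> M"
proof -
  have N: "M \<lhd> G" using M normal_iff_Nm by blast
  interpret N: normal M G by (rule N)
  interpret Q: group "G Mod M" by (rule N.factorgroup_is_group)
  have "card (rcosets M) * card M = k * card M" using lagrange[OF M(1)] o by simp
  then have oQ: "order (G Mod M) = k" using sub_card_pos[OF M(1)] by (simp add: order_def FactGroup_def)
  have "M #> a \<in> carrier (G Mod M)" using a by (auto simp: carrier_FactGroup)
  then have "(M #> a) [^]\<^bsub>G Mod M\<^esub> k = M" using Q.pow_order_eq_1[of "M #> a"] oQ by simp
  then have "M #> (a [^] k) = M" using N.FactGroup_pow[OF a, of k] by simp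
  then show ?thesis using rcos_self[OF _ M(1), of "a [^] k"] a by simp
qed

text \<open>The maximal subgroup <b> is normal of index p, so a^p = b^t. If p did not divide t, then
  b would be a power of a^p and a would generate G.\<close>

lemma p_power_metacyclic:
  assumes p: "nprime p" and o: "order G = p ^ n" and n: "0 < n" and nc: "\<not> cyc"
    and b: "b \<in> carrier G" "ord b = p ^ (n - 1)" and a: "a \<in> carrier G" "a \<notin> generate G {b}"
  shows "\<exists>r t. r < p ^ (n - 1) \<and> t < p ^ (n - 1) \<and> p dvd t \<and> metacyclic_gens G p (p ^ (n - 1)) r t a b"
proof -
  let ?M = "generate G {b}" and ?s = "p ^ (n - 1)"
  have pn: "p ^ n = p * ?s" using n by (metis power_eq_if not_gr0)
  have M: "subgroup ?M G" "card ?M = ?s" using gen_subgroup card_gen b by auto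
  have N: "Nm ?M = carrier G" by (rule pg_index_p_normal[OF p o n subsI[OF M]])
  have "a [^] p \<in> ?M" by (rule index_pow_mem[OF M(1) N _ a(1)]) (simp add: o pn M(2))
  then obtain t0 :: nat where t0: "a [^] p = b [^] t0" using gen_eq[OF b(1)] by auto
  define t where "t = t0 mod ?s"
  have bs: "b [^] ?s = \<one>" using pow_ord_eq_1[OF b(1)] b(2) by simp
  have t: "a [^] p = b [^] t" "t < ?s" unfolding t_def
    using t0 pow_mod_eq[OF b(1) bs] prime_gt_0_nat[OF p] by auto
  have gen: "H = carrier G" if H: "subgroup H G" "a \<in> H" "b \<in> H" for H
  proof -
    have MH: "?M \<subseteq> H" by (rule gen_sub[OF H(1,3)])
    then have "?M \<subset> H" using H(2) a(2) by blast
    then have lt: "card ?M < card H" by (rule psubset_card_mono[OF sub_finite[OF H(1)]])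
    obtain i where i: "i \<le> n" "card H = p ^ i" using card_sub_prime_power[OF p o H(1)] by blast
    then have "n - 1 < i" using lt M(2) prime_gt_1_nat[OF p] power_less_imp_less_exp by metis
    then have "i = n" using i n by simp
    then show ?thesis using sub_eq_carrierI[OF H(1)] i o by simp
  qed
  have "p dvd t"
  proof (rule ccontr)
    assume "\<not> p dvd t"
    then have "coprime p t" using prime_imp_coprime[OF p] by blast
    then have "coprime t ?s" by (simp add: coprime_commute)
    then obtain l where l: "[t * l = Suc 0] (mod ?s)" using cong_solve_coprime_nat by blast
    let ?A = "generate G {a}"
    have A: "subgroup ?A G" "a \<in> ?A" using gen_subgroup[OF a(1)] gen_mem[of a] by auto
    have "(a [^] p) [^] l \<in> ?A" by (intro sub_pow A)
    moreover have "(a [^] p) [^] l = b"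
    proof -
      have "(a [^] p) [^] l = b [^] (t * l)" using b(1) by (simp add: t nat_pow_pow)
      also have "\<dots> = b [^] (1::nat)"
        using pow_mod_eq[OF b(1) bs, of "t * l"] pow_mod_eq[OF b(1) bs, of 1] l by (simp add: cong_def)
      finally show ?thesis using b(1) by simp
    qed
    ultimately have "?A = carrier G" using gen[OF A] by simp
    then show False using nc gen_eq_carrier_iff[OF a(1)] a(1) by (auto simp: cyc_def)
  qed
  moreover have "\<exists>r < ord b. metacyclic_gens G p (ord b) r t a b"
    by (rule metacyclic_of_normal) (use o pn b a N t gen in auto)
  ultimately show ?thesis using t(2) b(2) by auto
qed

lemma p_power_metacyclic':
  assumes p: "nprime p" and o: "order G = p ^ n" and n: "0 < n" and nc: "\<not> cyc"
    and b: "b \<in> carrier G" "ord b = p ^ (n - 1)"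
  shows "\<exists>r t. r < p ^ (n - 1) \<and> t < p ^ (n - 1) \<and> p dvd t \<and> metacyclic G p (p ^ (n - 1)) r t"
proof -
  have "card (generate G {b}) \<noteq> card (carrier G)"
    using card_gen[OF b(1)] nc b(1) unfolding cyc_def order_def by auto
  then have "generate G {b} \<noteq> carrier G" by metis
  then obtain a where a: "a \<in> carrier G" "a \<notin> generate G {b}" using sub_carrier[OF gen_subgroup[OF b(1)]] by blast
  from p_power_metacyclic[OF assms a] obtain r t where
    rt: "r < p ^ (n - 1)" "t < p ^ (n - 1)" "p dvd t" "metacyclic_gens G p (p ^ (n - 1)) r t a b" by (elim exE conjE)
  have "metacyclic G p (p ^ (n - 1)) r t" unfolding metacyclic_def by (rule exI, rule exI, rule rt(4))
  then show ?thesis by (intro exI[of _ r] exI[of _ t] conjI rt)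
qed

text \<open>In a cyclic group the elements whose order divides \<open>ord v\<close> form the only
  subgroup of order \<open>ord v\<close>; the power h of g generates it, and so does v.\<close>

lemma cyclic_subgroup_contains:
  assumes g: "g \<in> carrier G" and uv: "u \<in> generate G {g}" "v \<in> generate G {g}" and d: "ord u dvd ord v"
  shows "u \<in> generate G {v}"
proof -
  note gs = gen_subgroup[OF g]
  have c: "u \<in> carrier G" "v \<in> carrier G" using uv sub_carrier[OF gs] by blast+
  define h where "h = g [^] (ord g div ord v)"
  have hc: "h \<in> carrier G" using g by (simp add: h_def)
  have dv: "ord v dvd ord g" using ord_dvd_sub[OF gs uv(2)] card_gen[OF g] by simp
  have k0: "ord g div ord v \<noteq> 0" using dv ord_pos[OF g] ord_pos[OF c(2)] by (auto simp: div_eq_0_iff dvd_imp_le)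
  have oh: "ord h = ord v"
  proof -
    have "ord h = ord g div (ord g div ord v)" unfolding h_def
      by (rule ord_pow[OF g _ k0]) (metis dv dvd_div_mult_self dvd_triv_left)
    then show ?thesis using dv ord_pos[OF g] by (metis div_div_div_same dvd_refl div_by_1 div_self k0 div_mult_self1_is_m dvd_mult_div_cancel mult.commute not_gr0 nonzero_mult_div_cancel_right)
  qed
  have mem: "w \<in> generate G {h}" if w: "w \<in> generate G {g}" "ord w dvd ord v" for w
  proof -
    obtain i :: nat where i: "w = g [^] i" using gen_eq[OF g] w(1) by auto
    have "w [^] ord v = \<one>" using pow_eq_id w(2) sub_carrier[OF gs] w(1) by blast
    then have "g [^] (i * ord v) = \<one>" using i g by (simp add: nat_pow_pow)
    then have "ord g dvd i * ord v" using pow_eq_id[OF g] by blast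
    then have "(ord g div ord v) * ord v dvd i * ord v" using dv by simp
    then have "ord g div ord v dvd i" using ord_pos[OF c(2)] by simp
    then obtain j where "i = (ord g div ord v) * j" by (rule dvdE)
    then have "w = h [^] j" using i g by (simp add: h_def nat_pow_pow)
    then show ?thesis using sub_pow[OF gen_subgroup[OF hc] gen_mem[of h]] by simp
  qed
  have "generate G {v} = generate G {h}"
    by (rule ord_eq_of_gen[OF hc mem]) (use uv oh in auto)
  then show ?thesis using mem[OF uv(1) d] by simp
qed

lemma restrict_ord:
  assumes H: "subgroup H G" and x: "x \<in> H" shows "group.ord (G\<lparr>carrier := H\<rparr>) x = ord x"
proof -
  interpret H: fin_group "G\<lparr>carrier := H\<rparr>" by (rule sub_fin_group[OF H])
  have "x [^]\<^bsub>G\<lparr>carrier := H\<rparr>\<^esub> (n::nat) = x [^] n" for n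
    using nat_pow_consistent by metis
  then show ?thesis using H.ord_unique[of x "ord x"] x pow_eq_id[of x] sub_carrier[OF H] by auto
qed

lemma restrict_cyc_iff:
  assumes H: "subgroup H G" shows "fin_group.cyc (G\<lparr>carrier := H\<rparr>) \<longleftrightarrow> (\<exists>x\<in>H. ord x = card H)"
proof -
  interpret H: fin_group "G\<lparr>carrier := H\<rparr>" by (rule sub_fin_group[OF H])
  show ?thesis unfolding H.cyc_def using restrict_ord[OF H] by simp
qed

text \<open>Besides the subgroups of M there are at least p further maximal subgroups and G
  itself.\<close>

lemma noncyclic_maximal_count:
  assumes p: "nprime p" and o: "order G = p ^ n" and nc: "\<not> cyc" and M: "M \<in> subs G (p ^ (n - 1))"
  shows "subgroup_count (G\<lparr>carrier := M\<rparr>) + p + 1 \<le> subgroup_count G"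
proof -
  have Ms: "subgroup M G" "card M = p ^ (n - 1)" using M by (auto simp: subs_def)
  note cov = pg_noncyclic_cover[OF p o nc]
  have p1: "1 < p" using prime_gt_1_nat[OF p] .
  let ?A = "{H. subgroup H G \<and> H \<subseteq> M}" and ?B = "subs G (p ^ (n - 1)) - {M}"
  have "subgroup_count (G\<lparr>carrier := M\<rparr>) = card ?A"
    unfolding subgroup_count_def using subgroup_restrict_iff[OF Ms(1)] by simp
  moreover have "p \<le> card ?B" using cov(1) M by simp
  moreover have "card (?A \<union> ?B \<union> {carrier G}) = card ?A + card ?B + 1"
  proof -
    have fA: "finite ?A" by (rule finite_subset[OF _ finite_subgroups]) auto
    have "?A \<inter> ?B = {}" using sub_eqI[OF Ms(1)] Ms(2) by (auto simp: subs_def)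
    moreover have lt: "p ^ (n - 1) < p ^ n" using p1 cov(2) by simp
    then have "carrier G \<notin> ?A \<union> ?B" using card_mono[OF sub_finite[OF Ms(1)], of "carrier G"] Ms(2) o
      by (auto simp: subs_def order_def)
    ultimately show ?thesis using fA by (simp add: card_Un_disjoint)
  qed
  moreover have "card (?A \<union> ?B \<union> {carrier G}) \<le> subgroup_count G"
    unfolding subgroup_count_def by (rule card_mono[OF finite_subgroups]) (auto simp: subs_def subgroup_self)
  ultimately show ?thesis by linarith
qed

text \<open>The trivial group, at least p + 1 maximal subgroups, and G.\<close>

lemma noncyclic_count:
  assumes p: "nprime p" and o: "order G = p ^ n" and nc: "\<not> cyc" shows "p + 3 \<le> subgroup_count G"
proof -
  note cov = pg_noncyclic_cover[OF p o nc]
  have p1: "1 < p" using prime_gt_1_nat[OF p] .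
  have "1 < p ^ (n - 1)" by (rule one_less_power[OF p1]) (use cov(2) in simp)
  moreover have "p ^ (n - 1) < p ^ n" using p1 cov(2) by simp
  ultimately have d: "1 < p ^ (n - 1)" "p ^ (n - 1) < p ^ n" by blast+
  have "(\<Sum>m\<in>{1, p ^ (n - 1), p ^ n}. card (subs G m)) \<le> subgroup_count G" by (rule sum_subs_le) simp
  moreover have "card (subs G (p ^ n)) = 1" using subs_order o by simp
  ultimately show ?thesis using d cov(1) subs_1 by simp
qed

end

text \<open>As J^2 vanishes modulo s, the expansion of (1 + J)^i stops at 1 + i J; summing over i
  gives a triangular number.\<close>

lemma geo_one_plus:
  fixes J :: nat
  assumes "s dvd J * J" shows "[geo (1 + J) 1 k = k + J * (k * (k - 1) div 2)] (mod s)"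
proof -
  have pw: "[(1 + J) ^ i = 1 + i * J] (mod s)" for i
  proof (induction i)
    case (Suc i)
    have "[(1 + J) ^ Suc i = (1 + J) * (1 + i * J)] (mod s)"
      unfolding power_Suc by (rule cong_mult[OF cong_refl Suc])
    moreover have "(1 + J) * (1 + i * J) = 1 + Suc i * J + i * (J * J)" by (simp add: algebra_simps)
    moreover have "[1 + Suc i * J + i * (J * J) = 1 + Suc i * J + 0] (mod s)"
      using assms by (intro cong_add cong_refl) (simp add: cong_0_iff)
    ultimately show ?case by (metis cong_trans add_0_right)
  qed simp
  show ?thesis
  proof (induction k)
    case (Suc k)
    have "[geo (1 + J) 1 (Suc k) = (k + J * (k * (k - 1) div 2)) + (1 + k * J)] (mod s)"
      unfolding geo_Suc using pw[of k] by (intro cong_add Suc) simp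
    moreover have "(k + J * (k * (k - 1) div 2)) + (1 + k * J) = Suc k + J * (Suc k * (Suc k - 1) div 2)"
    proof -
      have "Suc k * (Suc k - 1) div 2 = k * (k - 1) div 2 + k"
      proof (cases k)
        case (Suc l)
        have "Suc k * (Suc k - 1) = k * (k - 1) + k * 2" using Suc by (simp add: algebra_simps)
        then show ?thesis by simp
      qed simp
      then show ?thesis by (simp add: algebra_simps)
    qed
    ultimately show ?case by (simp only:)
  qed simp
qed

context fin_group
begin

text \<open>Suppose all maximal subgroups are cyclic and take two of them, <x> and <y>. Then x^p
  commutes with y, so r is 1 modulo p^(n-2), and y can be modified by a power of x to some w whose
  order divides p^(n-2). The product <w> <x^p> is proper, hence inside a cyclic group, where the
  orders force w into <x^p>, although w is not in <x>. For p = 2 one only gets w^4 = 1, whence 4 <=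
  n; all maximal subgroups of Q_8 are indeed cyclic.\<close>

lemma exists_noncyclic_maximal:
  assumes p: "nprime p" and o: "order G = p ^ n" and nc: "\<not> cyc" and n: "3 \<le> n" "p = 2 \<Longrightarrow> 4 \<le> n"
  shows "\<exists>M\<in>subs G (p ^ (n - 1)). \<not> (\<exists>x\<in>M. ord x = card M)"
proof (rule ccontr)
  assume contra: "\<not> ?thesis"
  let ?s = "p ^ (n - 1)"
  have p1: "1 < p" using prime_gt_1_nat[OF p] .
  have n0: "0 < n" using n by simp
  note cov = pg_noncyclic_cover[OF p o nc]
  have cy: "\<exists>x\<in>carrier G. M = generate G {x} \<and> ord x = ?s" if M: "M \<in> subs G ?s" for M
  proof -
    obtain x where x: "x \<in> M" "ord x = card M" using contra M by blast
    have Ms: "subgroup M G" "card M = ?s" using M by (auto simp: subs_def)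
    have xc: "x \<in> carrier G" using x sub_carrier[OF Ms(1)] by blast
    have "generate G {x} = M" by (rule sub_eqI[OF Ms(1) gen_sub[OF Ms(1) x(1)]]) (use card_gen[OF xc] x in simp)
    then show ?thesis using xc x Ms by auto
  qed
  have "\<not> card (subs G ?s) \<le> Suc 0" using cov(1) p1 by simp
  then obtain A B where AB: "A \<in> subs G ?s" "B \<in> subs G ?s" "A \<noteq> B" using card_le_Suc0_iff_eq[of "subs G ?s"] by auto
  obtain x where x: "x \<in> carrier G" "A = generate G {x}" "ord x = ?s" using cy[OF AB(1)] by blast
  obtain y where y: "y \<in> carrier G" "B = generate G {y}" "ord y = ?s" using cy[OF AB(2)] by blast
  have As: "subgroup A G" "card A = ?s" and Bs: "subgroup B G" "card B = ?s" using AB by (auto simp: subs_def)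
  have yA: "y \<notin> A"
  proof
    assume "y \<in> A"
    then have "B \<subseteq> A" using gen_sub[OF As(1)] y(2) by simp
    then have "B = A" by (rule sub_eqI[OF As(1)]) (simp add: As Bs)
    then show False using AB(3) by simp
  qed
  obtain r t where rt: "r < ?s" "t < ?s" "p dvd t" "metacyclic_gens G p ?s r t y x"
    using p_power_metacyclic[OF p o n0 nc x(1,3) y(1)] yA x(2) by blast
  interpret M: metacyclic_group G p ?s r t y x by (rule metacyclic_group_intro[OF fin_group_axioms rt(4)])
  have Em: "M.E 0 k = x [^] k" for k using x(1) by (simp add: M.E_def)
  have E1: "M.E 1 k = y \<otimes> x [^] k" for k using y(1) by (simp add: M.E_def)
  obtain k where k: "t = p * k" using rt(3) by (rule dvdE)
  have "Suc (n - 2) = n - 1" using n by simp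
  then have ps: "p * p ^ (n - 2) = ?s" by (metis power_Suc)
  txt \<open>\<open>x\<^sup>p\<close> lies in both abelian groups \<open>A\<close> and \<open>B\<close>, hence commutes with \<open>y\<close>.\<close>
  have xpB: "x [^] p \<in> B"
    by (rule index_pow_mem[OF Bs(1) pg_index_p_normal[OF p o n0 AB(2)] _ x(1)])
      (use o Bs(2) n0 in \<open>simp add: power_eq_if\<close>)
  then obtain j :: nat where "x [^] p = y [^] j" using gen_eq[OF y(1)] y(2) by auto
  then have comm: "x [^] p \<otimes> y = y \<otimes> x [^] p" using nat_pow_comm[of y j 1] y(1) by simp
  have "M.E 0 p \<otimes> M.E 1 0 = M.E 1 0 \<otimes> M.E 0 p" unfolding Em E1 using comm y(1) x(1) by simp
  then have "[p * r = p] (mod ?s)" using M.E_eq_snd by (simp add: M.E_mult)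
  then have "[p * r = p * 1] (mod p * p ^ (n - 2))" using ps by simp
  then have r1: "[r = 1] (mod p ^ (n - 2))" using p1
    by (simp add: cong_def mult_mod_right[symmetric])
  have r0: "r \<noteq> 0"
  proof
    assume "r = 0"
    then have "p ^ (n - 2) dvd 1" using r1 by (simp add: cong_def dvd_eq_mod_eq_0)
    then show False using p1 n by simp
  qed
  define J where "J = r - 1"
  have J1: "r = 1 + J" using r0 unfolding J_def by simp
  then have "[J + 1 = 0 + 1] (mod p ^ (n - 2))" using r1 by (simp add: add.commute)
  then have "[J = 0] (mod p ^ (n - 2))" by (simp only: cong_add_rcancel_nat)
  then have "p ^ (n - 2) dvd J" by (simp add: cong_def mod_eq_0_iff_dvd)
  note J = J1 this
  \<comment> \<open>n >= 3 gives 2 (n - 2) >= n - 1.\<close>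
  have sJ: "?s dvd J * J"
  proof -
    have "p ^ (n - 2) * p ^ (n - 2) dvd J * J" by (rule mult_dvd_mono[OF J(2) J(2)])
    moreover have "?s dvd p ^ (n - 2) * p ^ (n - 2)"
      unfolding power_add[symmetric] using n by (intro le_imp_power_dvd) simp
    ultimately show ?thesis by (rule dvd_trans[rotated])
  qed
  have spJ: "?s dvd p * J" unfolding ps[symmetric] using J(2) by (rule mult_dvd_mono[OF dvd_refl])
  have g: "[geo r 1 p = p + J * (p * (p - 1) div 2)] (mod ?s)" unfolding J(1) by (rule geo_one_plus[OF sJ])
  \<comment> \<open>e stands for -k modulo the order of x, where y^p = x^t = x^(p k): if x and y
    commuted, w = y x^e would satisfy w^p = 1.\<close>
  define e where "e = (?s - 1) * k"
  define w where "w = M.E 1 e"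
  have wc: "w \<in> carrier G" by (simp add: w_def)
  have wp: "w [^] p = x [^] (t + e * geo r 1 p)"
    unfolding w_def M.E_pow using M.E_shift[of 0 1] Em by simp
  have xs: "x [^] ?s = \<one>" using pow_ord_eq_1[OF x(1)] x(3) by simp
  have ke: "p * k + e * p = ?s * (k * p)"
    unfolding e_def using p1 by (cases ?s) (simp_all add: algebra_simps)
  have xpow1: "x [^] (i::nat) = \<one>" if "?s dvd i" for i
    using pow_eq_id[OF x(1)] x(3) that by simp
  \<comment> \<open>Modulo the order of x, \<open>geo r 1 p\<close> is p + J p (p - 1) / 2, and p J
    vanishes. For odd p only p is left and w^p = 1. For p = 2 the term J survives, and only the
    doubled exponent vanishes.\<close>
  have wpp: "w [^] (p ^ (n - 2)) = \<one>"
  proof (cases "p = 2")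
    case False
    then have "odd p" using prime_odd_nat[OF p] p1 by simp
    then obtain h where h: "p - 1 = 2 * h" using odd_two_times_div_two_nat by metis
    have "p * (p - 1) div 2 = p * h" unfolding h by simp
    then have "[geo r 1 p = p + h * (p * J)] (mod ?s)" using g by (simp add: mult_ac)
    also have "[p + h * (p * J) = p + 0] (mod ?s)"
      by (intro cong_add cong_refl) (use spJ in \<open>simp add: cong_0_iff\<close>)
    finally have "[t + e * geo r 1 p = p * k + e * p] (mod ?s)"
      unfolding k by (intro cong_add cong_refl cong_mult) simp
    then have "?s dvd t + e * geo r 1 p" unfolding ke by (metis cong_dvd_iff dvd_triv_left)
    then have "w [^] p = \<one>" using wp xpow1 by simp
    moreover have "p dvd p ^ (n - 2)" using n by simp
    ultimately show ?thesis using pow_eq_id[OF wc] by (meson dvd_trans)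
  next
    case True
    have "[2 * geo r 1 p = 2 * (p + J)] (mod ?s)" using g True by (intro cong_scalar_left) simp
    also have "2 * (p + J) = 2 * p + p * J" using True by simp
    also have "[2 * p + p * J = 2 * p + 0] (mod ?s)"
      by (intro cong_add cong_refl) (use spJ in \<open>simp add: cong_0_iff\<close>)
    finally have "[2 * geo r 1 p = 2 * p] (mod ?s)" by simp
    then have "[2 * t + e * (2 * geo r 1 p) = 2 * t + e * (2 * p)] (mod ?s)"
      by (rule cong_add[OF cong_refl cong_scalar_left])
    moreover have "2 * t + e * (2 * p) = 2 * (p * k + e * p)" unfolding k by (simp add: algebra_simps)
    ultimately have "?s dvd 2 * t + e * (2 * geo r 1 p)" unfolding ke by (metis cong_dvd_iff dvd_triv_left dvd_mult)
    then have "?s dvd (t + e * geo r 1 p) * 2" by (simp add: algebra_simps)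
    moreover have "w [^] (p * 2) = x [^] ((t + e * geo r 1 p) * 2)"
      using wp wc x(1) by (metis nat_pow_pow)
    ultimately have "w [^] (p * 2) = \<one>" using xpow1 by simp
    moreover have "p * 2 dvd p ^ (n - 2)"
    proof -
      have "p ^ 2 dvd p ^ (n - 2)" using n True by (intro le_imp_power_dvd) simp
      then show ?thesis using True by (simp add: power2_eq_square)
    qed
    ultimately show ?thesis using pow_eq_id[OF wc] by (meson dvd_trans)
  qed
  have wA: "w \<notin> A"
  proof
    assume wA: "w \<in> A"
    have "x [^] e \<in> A" using sub_pow[OF As(1)] gen_mem[of x] x(2) by simp
    then have "w \<otimes> inv (x [^] e) \<in> A" using wA subgroup.m_closed[OF As(1)] subgroup.m_inv_closed[OF As(1)] by blast
    moreover have "w \<otimes> inv (x [^] e) = y" unfolding w_def E1 using x(1) y(1) by (simp add: m_assoc)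
    ultimately show False using yA by simp
  qed
  define Z where "Z = generate G {x [^] p}"
  have xp: "x [^] p \<in> carrier G" using x(1) by simp
  have Zs: "subgroup Z G" unfolding Z_def by (rule gen_subgroup[OF xp])
  have oxp: "ord (x [^] p) = p ^ (n - 2)"
  proof -
    have "p dvd ord x" unfolding x(3) ps[symmetric] by simp
    then have "ord (x [^] p) = ?s div p" using ord_pow[OF x(1), of p] p1 x(3) by simp
    then show ?thesis unfolding ps[symmetric] using p1 by simp
  qed
  have cZ: "card Z = p ^ (n - 2)" unfolding Z_def using card_gen[OF xp] oxp by simp
  have ZA: "Z \<subseteq> A" unfolding Z_def by (rule gen_sub[OF As(1)]) (use sub_pow[OF As(1)] gen_mem[of x] x(2) in simp)
  have geop: "p dvd geo r 1 p"
  proof -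
    have d: "p dvd ?s" unfolding ps[symmetric] by simp
    have "p dvd p ^ (n - 2)" using n by simp
    then have "p dvd J" using J(2) by (rule dvd_trans)
    then have "p dvd p + J * (p * (p - 1) div 2)" by simp
    then show ?thesis using cong_dvd_iff[OF cong_dvd_modulus_nat[OF g d]] by simp
  qed
  have wpZ: "w [^] p \<in> Z"
  proof -
    have "p dvd t + e * geo r 1 p" using rt(3) geop by simp
    then obtain i where "t + e * geo r 1 p = p * i" by (rule dvdE)
    then have "w [^] p = (x [^] p) [^] i" using wp x(1) by (simp add: nat_pow_pow)
    then show ?thesis unfolding Z_def using sub_pow[OF gen_subgroup[OF xp] gen_mem[of "x [^] p"]] by simp
  qed
  let ?W = "generate G {w}"
  have Ws: "subgroup ?W G" by (rule gen_subgroup[OF wc])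
  have ZN: "Z \<subseteq> Nm ?W"
  proof -
    have "x [^] p \<in> Nm ?W"
    proof (rule NmI[OF xp Ws])
      fix h assume "h \<in> ?W"
      then obtain i :: nat where i: "h = w [^] i" using gen_eq[OF wc] by auto
      have "x [^] p \<otimes> w = w \<otimes> x [^] p"
      proof -
        have "x [^] p \<otimes> w = (x [^] p \<otimes> y) \<otimes> x [^] e" unfolding w_def E1 using x(1) y(1) by (simp add: m_assoc)
        also have "\<dots> = y \<otimes> (x [^] p \<otimes> x [^] e)" unfolding comm using x(1) y(1) by (simp add: m_assoc)
        also have "\<dots> = w \<otimes> x [^] p" unfolding w_def E1 using x(1) y(1) by (simp add: m_assoc nat_pow_mult add.commute)
        finally show ?thesis .
      qed
      then have "x [^] p \<otimes> h = h \<otimes> x [^] p"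
        unfolding i using pow_conj_comm[OF xp wc, of 1 i 1] pow_conj_comm[of "x [^] p" w 1 i 1] xp wc by simp
      then have "x [^] p \<otimes> h \<otimes> inv (x [^] p) = h" using xp wc i by (simp add: m_assoc)
      then show "x [^] p \<otimes> h \<otimes> inv (x [^] p) \<in> ?W" using \<open>h \<in> ?W\<close> by simp
    qed
    then show ?thesis unfolding Z_def by (rule gen_sub[OF Nm_subgroup[OF sub_carrier[OF Ws]]])
  qed
  note WZ = set_mult_subgroup[OF Ws Zs ZN]
  \<comment> \<open>w^p lies in both <w> and Z, so their intersection has at least ord w / p
    elements.\<close>
  have "card (?W <#> Z) \<le> ?s"
  proof -
    have pw: "p dvd ord w"
    proof -
      have "w \<noteq> \<one>" using wA sub_one[OF As(1)] by blast
      then have "ord w \<noteq> 1" using ord_eq_1[OF wc] by simp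
      moreover obtain i where "ord w = p ^ i" using prime_power_dvd_imp[OF p] ord_dvd_group_order[OF wc] o by metis
      ultimately show ?thesis by (cases i) auto
    qed
    have "w [^] p \<in> ?W \<inter> Z" using wpZ sub_pow[OF Ws gen_mem[of w]] by simp
    then have "ord (w [^] p) dvd card (?W \<inter> Z)" using ord_dvd_sub subgroups_Inter_pair[OF Ws Zs] by blast
    moreover have "ord (w [^] p) = ord w div p" using ord_pow[OF wc pw] p1 by simp
    moreover have "0 < card (?W \<inter> Z)" using sub_card_pos[OF subgroups_Inter_pair[OF Ws Zs]] .
    ultimately have "ord w div p \<le> card (?W \<inter> Z)" by (simp add: dvd_imp_le)
    then have "card (?W <#> Z) * (ord w div p) \<le> card (?W <#> Z) * card (?W \<inter> Z)" by simp
    also have "\<dots> = ord w * p ^ (n - 2)" using card_set_mult[OF Ws Zs] card_gen[OF wc] cZ by simp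
    also have "\<dots> = (ord w div p) * ?s" unfolding ps[symmetric] using pw by (metis dvd_div_mult_self mult.assoc)
    finally have "(ord w div p) * card (?W <#> Z) \<le> (ord w div p) * ?s" by (simp add: mult.commute)
    moreover have "0 < ord w div p" using pw ord_pos[OF wc] p1 by (simp add: div_greater_zero_iff dvd_imp_le)
    ultimately show ?thesis by simp
  qed
  then have "?W <#> Z \<noteq> carrier G"
  proof -
    have "?s < p ^ n" using p1 n0 by simp
    then show "card (?W <#> Z) \<le> ?s \<Longrightarrow> ?W <#> Z \<noteq> carrier G" using o by (auto simp: order_def)
  qed
  then obtain K where K: "K \<in> subs G ?s" "?W <#> Z \<subseteq> K" using pg_maximal[OF p o WZ(1)] by blast
  obtain g where gg: "g \<in> carrier G" "K = generate G {g}" using cy[OF K(1)] by blast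
  have "w \<in> generate G {x [^] p}"
  proof (rule cyclic_subgroup_contains[OF gg(1)])
    show "w \<in> generate G {g}" using WZ(2) K(2) gen_mem[of w] gg(2) by blast
    show "x [^] p \<in> generate G {g}" using WZ(3) K(2) gen_mem[of "x [^] p"] gg(2) unfolding Z_def by blast
    show "ord w dvd ord (x [^] p)" unfolding oxp using pow_eq_id[OF wc] wpp by blast
  qed
  then show False using ZA wA unfolding Z_def by blast
qed

end

section \<open>Noncyclic p-groups of small order\<close>

context fin_group
begin

text \<open>Every element of order d lies in the subgroup of order d that it generates.\<close>

lemma card_ord_le:
  assumes "\<And>H. H \<in> subs G d \<Longrightarrow> card {x \<in> H. ord x = d} \<le> c"
  shows "card {x \<in> carrier G. ord x = d} \<le> c * card (subs G d)"
proof (rule card_le_mult_fibres)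
  show "finite {x \<in> carrier G. ord x = d}" using fin by simp
  show "(\<lambda>x. generate G {x}) ` {x \<in> carrier G. ord x = d} \<subseteq> subs G d"
    using gen_subgroup card_gen by (auto simp: subs_def)
  fix H assume H: "H \<in> subs G d"
  have "{x \<in> {x \<in> carrier G. ord x = d}. generate G {x} = H} \<subseteq> {x \<in> H. ord x = d}" using gen_mem by auto
  then have "card {x \<in> {x \<in> carrier G. ord x = d}. generate G {x} = H} \<le> card {x \<in> H. ord x = d}"
    using sub_finite[OF subsD(1)[OF H]] by (intro card_mono) auto
  then show "card {x \<in> {x \<in> carrier G. ord x = d}. generate G {x} = H} \<le> c" using assms[OF H] by simp
qed simp

lemma card_ord_prime_le: "1 < d \<Longrightarrow> card {x \<in> carrier G. ord x = d} \<le> (d - 1) * card (subs G d)"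
proof (rule card_ord_le)
  fix H assume d: "1 < d" and H: "H \<in> subs G d"
  have Hs: "subgroup H G" "card H = d" using H by (auto simp: subs_def)
  have "{x \<in> H. ord x = d} \<subseteq> H - {\<one>}" using d by (auto simp: ord_id)
  then have "card {x \<in> H. ord x = d} \<le> card (H - {\<one>})" using sub_finite[OF Hs(1)] by (intro card_mono) auto
  also have "\<dots> = d - 1" using sub_one[OF Hs(1)] sub_finite[OF Hs(1)] Hs(2) by (simp add: card_Diff_subset)
  finally show "card {x \<in> H. ord x = d} \<le> d - 1" .
qed

text \<open>If H contains an element x of order 4, then 1 and x^2 are two elements of H of smaller
  order.\<close>

lemma card_ord_4_le: "card {x \<in> carrier G. ord x = 4} \<le> 2 * card (subs G 4)"
proof (rule card_ord_le)
  fix H assume H: "H \<in> subs G 4"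
  have Hs: "subgroup H G" "card H = 4" using H by (auto simp: subs_def)
  show "card {x \<in> H. ord x = 4} \<le> 2"
  proof (cases "{x \<in> H. ord x = 4} = {}")
    case True then show ?thesis by (simp only: card.empty)
  next
    case False
    then obtain x where x: "x \<in> H" "ord x = 4" by blast
    have xc: "x \<in> carrier G" using x sub_carrier[OF Hs(1)] by blast
    have o2: "ord (x [^] (2::nat)) = 2" using ord_pow[OF xc, of 2] x(2) by simp
    have x2: "x [^] (2::nat) \<in> H" using sub_pow[OF Hs(1) x(1)] .
    have ne: "x [^] (2::nat) \<noteq> \<one>" using o2 by (metis ord_id numeral_One numeral_eq_iff semiring_norm(85))
    have "{x \<in> H. ord x = 4} \<subseteq> H - {\<one>, x [^] (2::nat)}" using o2 by (auto simp: ord_id)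
    then have "card {x \<in> H. ord x = 4} \<le> card (H - {\<one>, x [^] (2::nat)})" using sub_finite[OF Hs(1)] by (intro card_mono) auto
    also have "\<dots> = card H - card {\<one>, x [^] (2::nat)}" by (rule card_Diff_subset) (use sub_one[OF Hs(1)] x2 in auto)
    also have "\<dots> = 2" using ne Hs(2) by simp
    finally show ?thesis .
  qed
qed

text \<open>Seven involutions give seven subgroups of order 2. Each of the 42 ordered pairs of
  distinct involutions generates a subgroup of order 4, and such a subgroup arises from at most six
  pairs, so there are at least seven of these as well.\<close>

lemma exponent_two_order_8:
  assumes o: "order G = 8" and ex: "\<And>x. x \<in> carrier G \<Longrightarrow> x \<otimes> x = \<one>"
  shows "13 \<le> subgroup_count G"
proof -
  let ?A = "carrier G - {\<one>}"
  have comm: "x \<otimes> y = y \<otimes> x" if "x \<in> carrier G" "y \<in> carrier G" for x y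
  proof -
    have i: "inv z = z" if "z \<in> carrier G" for z using ex[OF that] that by (simp add: inv_equality)
    have "x \<otimes> y = inv (x \<otimes> y)" using i that by simp
    also have "\<dots> = inv y \<otimes> inv x" by (rule inv_mult_group[OF that])
    also have "\<dots> = y \<otimes> x" using i[OF that(1)] i[OF that(2)] by simp
    finally show ?thesis .
  qed
  have cA: "card ?A = 7" using o fin by (simp add: order_def card_Diff_subset)
  have "{x \<in> carrier G. ord x = 2} = ?A"
    using ord_prime[of _ 2] ex by (auto simp: ord_id nat_pow_2)
  then have c2: "7 \<le> card (subs G 2)" using card_ord_prime_le[of 2] cA by simp
  let ?S = "?A \<times> ?A - Id"
  let ?f = "\<lambda>(x, y). {\<one>, x, y, x \<otimes> y}"
  have dcard: "card (A \<times> A - Id) = card A * card A - card A" if "finite A" for A :: "'a set"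
  proof -
    have "A \<times> A - Id = A \<times> A - (\<lambda>x. (x, x)) ` A" by auto
    moreover have "card ((\<lambda>x. (x, x)) ` A) = card A" by (rule card_image) (auto simp: inj_on_def)
    moreover have "(\<lambda>x. (x, x)) ` A \<subseteq> A \<times> A" by auto
    ultimately show ?thesis using that by (simp add: card_Diff_subset card_cartesian_product)
  qed
  have fA: "finite ?A" using fin by simp
  have "card ?S \<le> 6 * card (subs G 4)"
  proof (rule card_le_mult_fibres)
    show "finite ?S" using fA by simp
    show "?f ` ?S \<subseteq> subs G 4"
    proof
      fix H assume "H \<in> ?f ` ?S"
      then obtain x y where xy: "x \<in> carrier G" "y \<in> carrier G" "x \<noteq> \<one>" "y \<noteq> \<one>" "x \<noteq> y" "H = {\<one>, x, y, x \<otimes> y}" by auto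
      have a: "x \<otimes> (x \<otimes> y) = y" "y \<otimes> (x \<otimes> y) = x" "x \<otimes> y \<otimes> x = y" "x \<otimes> y \<otimes> y = x" "x \<otimes> y \<otimes> (x \<otimes> y) = \<one>"
      proof -
        show 1: "x \<otimes> (x \<otimes> y) = y" using xy ex by (simp add: m_assoc[symmetric])
        show 2: "x \<otimes> y \<otimes> y = x" using xy ex by (simp add: m_assoc)
        show "y \<otimes> (x \<otimes> y) = x" using 2 comm[of y "x \<otimes> y"] xy by simp
        show "x \<otimes> y \<otimes> x = y" using 1 comm[of "x \<otimes> y" x] xy by simp
        show "x \<otimes> y \<otimes> (x \<otimes> y) = \<one>" using ex xy by simp
      qed
      have "subgroup H G" by (rule closed_imp_subgroup) (use xy a ex comm[of y x] in auto)
      moreover have "x \<otimes> y \<noteq> \<one>" using a(1) xy by auto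
      then have "card H = 4" using xy by (simp add: eq_commute[of \<one>] eq_commute[of _ "x \<otimes> y"])
      ultimately show "H \<in> subs G 4" by (rule subsI)
    qed
    fix H assume H: "H \<in> subs G 4"
    have Hs: "subgroup H G" "card H = 4" using H by (auto simp: subs_def)
    have "{w \<in> ?S. ?f w = H} \<subseteq> (H - {\<one>}) \<times> (H - {\<one>}) - Id" by auto
    then have "card {w \<in> ?S. ?f w = H} \<le> card ((H - {\<one>}) \<times> (H - {\<one>}) - Id)"
      using sub_finite[OF Hs(1)] by (intro card_mono) auto
    also have "\<dots> = 6" using dcard[of "H - {\<one>}"] Hs sub_finite[OF Hs(1)] sub_one[OF Hs(1)] by (simp add: card_Diff_subset)
    finally show "card {w \<in> ?S. ?f w = H} \<le> 6" .
  qed simp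
  moreover have "card ?S = 42" using dcard[OF fA] cA by simp
  ultimately have c4: "7 \<le> card (subs G 4)" by linarith
  have "(\<Sum>m\<in>{2, 4}. card (subs G m)) \<le> subgroup_count G" by (rule sum_subs_le) simp
  then show ?thesis using c2 c4 by simp
qed

text \<open>The 26 nontrivial elements lie in subgroups of order 3, at most two in each; this makes
  13 subgroups besides the trivial one.\<close>

lemma exponent_three_order_27:
  assumes o: "order G = 27" and ex: "\<And>x. x \<in> carrier G \<Longrightarrow> x \<noteq> \<one> \<Longrightarrow> ord x = 3"
  shows "13 < subgroup_count G"
proof -
  have "{x \<in> carrier G. ord x = 3} = carrier G - {\<one>}" using ex by (auto simp: ord_id)
  then have "26 \<le> 2 * card (subs G 3)" using card_ord_prime_le[of 3] o fin by (simp add: order_def card_Diff_subset)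
  moreover have "(\<Sum>m\<in>{1, 3}. card (subs G m)) \<le> subgroup_count G" by (rule sum_subs_le) simp
  ultimately show ?thesis using subs_1 by simp
qed

text \<open>Let i and j be the numbers of subgroups of orders 2 and 4. The 15 nontrivial elements
  give i + 2 j >= 15, so i + j >= 8 because i >= 1. The trivial group, three maximal subgroups and G
  bring the total to 13.\<close>

lemma exponent_four_order_16:
  assumes o: "order G = 16" and nc: "\<not> cyc"
    and ex: "\<And>x. x \<in> carrier G \<Longrightarrow> x \<noteq> \<one> \<Longrightarrow> ord x = 2 \<or> ord x = 4"
  shows "13 \<le> subgroup_count G"
proof -
  have o': "order G = 2 ^ 4" using o by simp
  let ?I = "{x \<in> carrier G. ord x = 2}" and ?J = "{x \<in> carrier G. ord x = 4}"
  have "carrier G - {\<one>} = ?I \<union> ?J" using ex by (auto simp: ord_id)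
  moreover have "card (?I \<union> ?J) = card ?I + card ?J" 
  proof (rule card_Un_disjoint)
    show "finite ?I" "finite ?J" using fin by simp_all
    show "?I \<inter> ?J = {}" by auto
  qed
  moreover have "card (carrier G - {\<one>}) = 15" using o fin by (simp add: order_def card_Diff_subset)
  ultimately have "card ?I + card ?J = 15" by simp
  moreover have "card ?I \<le> card (subs G 2)" using card_ord_prime_le[of 2] by simp
  moreover have "card ?J \<le> 2 * card (subs G 4)" by (rule card_ord_4_le)
  moreover have "1 \<le> card (subs G 2)" using card_subs_prime_power_pos[of 2 1] o by simp
  moreover have "3 \<le> card (subs G 8)" using pg_noncyclic_cover(1)[OF _ o' nc] by simp
  moreover have "(\<Sum>m\<in>{1, 2, 4, 8, 16}. card (subs G m)) \<le> subgroup_count G" by (rule sum_subs_le) simp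
  moreover have "card (subs G 16) = 1" using subs_order o by simp
  ultimately show ?thesis using subs_1 by simp
qed

lemma p_group_ord: "nprime p \<Longrightarrow> order G = p ^ n \<Longrightarrow> x \<in> carrier G \<Longrightarrow> \<exists>i\<le>n. ord x = p ^ i"
  using prime_power_dvd_imp ord_dvd_group_order by metis

lemma p_group_not_cyc_ord: "nprime p \<Longrightarrow> order G = p ^ n \<Longrightarrow> \<not> cyc \<Longrightarrow> x \<in> carrier G \<Longrightarrow> \<exists>i<n. ord x = p ^ i"
  using p_group_ord[of p n x] unfolding cyc_def by (metis le_neq_implies_less)

text \<open>p + 3 <= 12 leaves p in {2, 3, 5, 7}. As t < p is divisible by p, it is 0, and r^p = 1
  modulo p forces r = 1 by Fermat, checked here value by value.\<close>

lemma p_squared_small_type: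
  assumes p: "nprime p" and o: "order G = p ^ 2" and nc: "\<not> cyc" and s: "subgroup_count G \<le> 12"
  shows "small_type G"
proof -
  have "p \<le> 9" using noncyclic_count[OF p o nc] s by simp
  moreover have "p \<noteq> 4" "p \<noteq> 6" "p \<noteq> 8" "p \<noteq> 9" "p \<noteq> 0" "p \<noteq> 1" using p by auto
  ultimately have pc: "p = 2 \<or> p = 3 \<or> p = 5 \<or> p = 7" by presburger
  have "card (carrier G) \<noteq> 1" using o prime_gt_1_nat[OF p] by (simp add: order_def)
  then obtain b where b: "b \<in> carrier G" "b \<noteq> \<one>" using one_closed by (metis is_singletonI' is_singleton_altdef empty_iff)
  obtain i where i: "i < 2" "ord b = p ^ i" using p_group_not_cyc_ord[OF p o nc b(1)] by blast
  have "i \<noteq> 0" using i b ord_eq_1[OF b(1)] by (auto intro: ccontr)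
  then have "ord b = p ^ (2 - 1)" using i by (cases i) (auto simp: less_Suc_eq numeral_2_eq_2)
  then obtain r t where rt: "r < p ^ (2 - 1)" "t < p ^ (2 - 1)" "p dvd t" "metacyclic G p (p ^ (2 - 1)) r t"
    using p_power_metacyclic'[OF p o _ nc b(1)] by auto
  have t: "t = 0" using rt(2,3) by (auto dest: dvd_imp_le)
  have "[r ^ p = 1] (mod p)" using metacyclic_constraints(1)[OF fin_group_axioms rt(4)] by simp
  moreover have "r = 0 \<or> r = 1 \<or> r = 2 \<or> r = 3 \<or> r = 4 \<or> r = 5 \<or> r = 6" using rt(1) pc by auto
  ultimately have "r = 1" using rt(1) pc by (auto simp: cong_def)
  then have "metacyclic G p p 1 0" using rt(4) t by simp
  then show ?thesis using pc
    by (elim disjE) (auto intro: small_typeI[of G _ _ _ _ 5] small_typeI[of G _ _ _ _ 6] small_typeI[of G _ _ _ _ 8]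
        small_typeI[of G _ _ _ _ 10] simp: listed_codes_def)
qed

lemma order_8_small_type:
  assumes o: "order G = 2 ^ 3" and nc: "\<not> cyc" and s: "subgroup_count G \<le> 12"
  shows "small_type G"
proof -
  have p: "nprime 2" by simp
  have "\<exists>b\<in>carrier G. ord b = 4"
  proof (rule ccontr)
    assume c: "\<not> ?thesis"
    have "x \<otimes> x = \<one>" if x: "x \<in> carrier G" for x
    proof -
      obtain i where i: "i < 3" "ord x = 2 ^ i" using p_group_not_cyc_ord[OF p o nc x] by blast
      moreover have "i \<noteq> 2" using c x i by auto
      ultimately have "i = 0 \<or> i = 1" by linarith
      then have "ord x dvd 2" using i by auto
      then show ?thesis using pow_eq_id[OF x, of 2] nat_pow_2[OF x] by simp
    qed
    then show False using exponent_two_order_8 o s by simp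
  qed
  then obtain b where b: "b \<in> carrier G" "ord b = 2 ^ (3 - 1)" by auto
  obtain r t where rt: "r < 2 ^ (3 - 1)" "t < 2 ^ (3 - 1)" "2 dvd t" "metacyclic G 2 (2 ^ (3 - 1)) r t"
    using p_power_metacyclic'[OF p o _ nc b] by auto
  have m: "metacyclic G 2 4 r t" and r4: "r < 4" and t4: "t < 4" using rt by simp_all
  note mc = metacyclic_constraints(1,2)[OF fin_group_axioms m]
  have r: "r = 0 \<or> r = 1 \<or> r = 2 \<or> r = 3" and t: "t = 0 \<or> t = 2" using r4 t4 rt(3) by presburger+
  have r13: "r = 1 \<or> r = 3" using r mc(1) by (auto simp: cong_def)
  \<comment> \<open>For r = 1 the sum \<open>geo r 1 2\<close> is 2 and moves t = 2 to 0 modulo 4.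
    For r = 3 it is 0 modulo 4, so t stays: t = 0 is D_8 and t = 2 is Q_8.\<close>
  consider "r = 1" | "r = 3" "t = 0" | "r = 3" "t = 2" using r13 t by blast
  then show ?thesis
  proof cases
    case 1
    have "metacyclic G 2 4 1 0"
      by (rule metacyclic_change_t[OF m, of _ "if t = 0 then 0 else 1"])
        (use t 1 in \<open>auto simp: cong_def geo_def numeral_2_eq_2\<close>)
    then show ?thesis by (rule small_typeI[of _ _ _ _ _ 8]) (simp_all add: listed_codes_def)
  next
    case 2
    then show ?thesis using m by (intro small_typeI[of _ 2 4 3 0 10]) (simp_all add: listed_codes_def)
  next
    case 3
    then show ?thesis using m by (intro small_typeI[of _ 2 4 3 2 6]) (simp_all add: listed_codes_def)
  qed
qed

lemma order_27_small_type:
  assumes o: "order G = 3 ^ 3" and nc: "\<not> cyc" and s: "subgroup_count G \<le> 12"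
  shows "small_type G"
proof -
  have p: "nprime 3" by simp
  have "\<exists>b\<in>carrier G. ord b = 9"
  proof (rule ccontr)
    assume c: "\<not> ?thesis"
    have "ord x = 3" if x: "x \<in> carrier G" "x \<noteq> \<one>" for x
    proof -
      obtain i where i: "i < 3" "ord x = 3 ^ i" using p_group_not_cyc_ord[OF p o nc x(1)] by blast
      moreover have "i \<noteq> 2" using c x i by auto
      moreover have "i \<noteq> 0" using i x ord_eq_1[OF x(1)] by (auto intro: ccontr)
      ultimately have "i = 1" by linarith
      then show ?thesis using i by simp
    qed
    then show False using exponent_three_order_27 o s by simp
  qed
  then obtain b where b: "b \<in> carrier G" "ord b = 3 ^ (3 - 1)" by auto
  obtain r t where rt: "r < 3 ^ (3 - 1)" "t < 3 ^ (3 - 1)" "3 dvd t" "metacyclic G 3 (3 ^ (3 - 1)) r t"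
    using p_power_metacyclic'[OF p o _ nc b] by auto
  have m: "metacyclic G 3 9 r t" and r9: "r < 9" and t9: "t < 9" using rt by simp_all
  note mc = metacyclic_constraints(1,2)[OF fin_group_axioms m]
  have "r = 0 \<or> r = 1 \<or> r = 2 \<or> r = 3 \<or> r = 4 \<or> r = 5 \<or> r = 6 \<or> r = 7 \<or> r = 8" using r9 by presburger
  then have r: "r = 1 \<or> r = 4 \<or> r = 7" using mc(1) by (auto simp: cong_def)
  have t: "t = 0 \<or> t = 3 \<or> t = 6" using t9 rt(3) by presburger
  have m0: "metacyclic G 3 9 r 0"
  proof -
    \<comment> \<open>For r in {1, 4, 7} the sum 1 + r + r^2 is 3 modulo 9, so y has to solve t + 3
      y = 0 modulo 9.\<close>
    define y where "y = (if t = 0 then 0 else if t = 3 then 2 else 1 :: nat)"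
    have "geo r 1 3 = 1 + r + r * r" by (simp add: geo_def lessThan_nat_numeral lessThan_Suc power2_eq_square)
    then have "[geo r 1 3 = 3] (mod 9)" using r by (elim disjE) (simp_all add: cong_def)
    then have "[t + y * geo r 1 3 = t + y * 3] (mod 9)" by (rule cong_add[OF cong_refl cong_scalar_left])
    moreover have "[t + y * 3 = 0] (mod 9)" using t by (elim disjE) (simp_all add: y_def cong_def)
    ultimately have "[0 = t + y * geo r 1 3] (mod 9)" by (metis cong_sym cong_trans)
    then show ?thesis by (rule metacyclic_change_t[OF m _ cong_refl])
  qed
  from r show ?thesis
  proof (elim disjE)
    assume "r = 1"
    then show ?thesis using m0 by (intro small_typeI[of _ 3 9 1 0 10]) (simp_all add: listed_codes_def)
  next
    assume "r = 4"
    then show ?thesis using m0 by (intro small_typeI[of _ 3 9 4 0 10]) (simp_all add: listed_codes_def)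
  next
    \<comment> \<open>7^2 = 4 modulo 9, so the square of the first generator acts by the multiplier
      4.\<close>
    assume "r = 7"
    then have "metacyclic G 3 9 7 0" using m0 by simp
    moreover have "coprime (2::nat) 3" using coprime_Suc_right_nat[of 2] by simp
    moreover have "[4 = 7 ^ 2] (mod 9::nat)" by (simp add: cong_def)
    ultimately have "metacyclic G 3 9 4 0" by (rule metacyclic_change_r)
    then show ?thesis by (intro small_typeI[of _ 3 9 4 0 10]) (simp_all add: listed_codes_def)
  qed
qed

lemma order_16_small_type:
  assumes o: "order G = 2 ^ 4" and nc: "\<not> cyc" and s: "subgroup_count G \<le> 12"
  shows "small_type G" "subgroup_count G = 11"
proof -
  have p: "nprime 2" by simp
  have "\<exists>b\<in>carrier G. ord b = 8"
  proof (rule ccontr)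
    assume c: "\<not> ?thesis"
    have "ord x = 2 \<or> ord x = 4" if x: "x \<in> carrier G" "x \<noteq> \<one>" for x
    proof -
      obtain i where i: "i < 4" "ord x = 2 ^ i" using p_group_not_cyc_ord[OF p o nc x(1)] by blast
      moreover have "i \<noteq> 3" using c x i by auto
      moreover have "i \<noteq> 0" using i x ord_eq_1[OF x(1)] by (auto intro: ccontr)
      ultimately have "i = 1 \<or> i = 2" by linarith
      then show ?thesis using i by auto
    qed
    then show False using exponent_four_order_16 o s nc by force
  qed
  then obtain b where b: "b \<in> carrier G" "ord b = 2 ^ (4 - 1)" by auto
  obtain r t where rt: "r < 2 ^ (4 - 1)" "t < 2 ^ (4 - 1)" "2 dvd t" "metacyclic G 2 (2 ^ (4 - 1)) r t"
    using p_power_metacyclic'[OF p o _ nc b] by auto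
  have m: "metacyclic G 2 8 r t" and r8: "r < 8" and t8: "t < 8" using rt by simp_all
  note mc = metacyclic_constraints(1,2)[OF fin_group_axioms m]
  have "r = 0 \<or> r = 1 \<or> r = 2 \<or> r = 3 \<or> r = 4 \<or> r = 5 \<or> r = 6 \<or> r = 7" using r8 by presburger
  then have r: "r = 1 \<or> r = 3 \<or> r = 5 \<or> r = 7" using mc(1) by (auto simp: cong_def)
  have t: "t = 0 \<or> t = 2 \<or> t = 4 \<or> t = 6" using t8 rt(3) by presburger
  \<comment> \<open>The semidihedral and the dihedral group of order 16; both have too many
    subgroups.\<close>
  have big: "mc_eval 2 8 3 0 = 15" "mc_eval 2 8 7 0 = 19" by code_simp+
  have cnt: "subgroup_count G = mc_eval m s r t" if "metacyclic G m s r t" for m s r t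
    using metacyclic_count[OF fin_group_axioms that] metacyclic_constraints(4,5)[OF fin_group_axioms that]
    by (simp add: mc_count_eq_mc_eval)
  have "metacyclic G 2 8 1 0 \<or> metacyclic G 2 8 5 0 \<or> metacyclic G 2 8 7 4"
    using r
  proof (elim disjE)
    assume r1: "r = 1"
    \<comment> \<open>Here and in the next cases the witness y solves t + y (1 + r) = 0 modulo
      8.\<close>
    have "metacyclic G 2 8 1 0"
      by (rule metacyclic_change_t[OF m, of _ "if t = 0 then 0 else if t = 2 then 3 else if t = 4 then 2 else 1"])
        (use t r1 in \<open>auto simp: cong_def geo_def numeral_2_eq_2\<close>)
    then show ?thesis by blast
  next
    assume r5: "r = 5"
    have "metacyclic G 2 8 5 0"
      by (rule metacyclic_change_t[OF m, of _ "if t = 0 then 0 else if t = 2 then 1 else if t = 4 then 2 else 3"])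
        (use t r5 in \<open>auto simp: cong_def geo_def numeral_2_eq_2\<close>)
    then show ?thesis by blast
  next
    assume r3: "r = 3"
    have t04: "t = 0 \<or> t = 4" using t mc(2) r3 by (auto simp: cong_def)
    have "metacyclic G 2 8 3 0"
      by (rule metacyclic_change_t[OF m, of _ "if t = 0 then 0 else 1"])
        (use t04 r3 in \<open>auto simp: cong_def geo_def numeral_2_eq_2\<close>)
    then show ?thesis using cnt big(1) s by fastforce
  next
    assume r7: "r = 7"
    have t04: "t = 0 \<or> t = 4" using t mc(2) r7 by (auto simp: cong_def)
    moreover have "t \<noteq> 0"
    proof
      assume "t = 0"
      then have "subgroup_count G = mc_eval 2 8 7 0" using cnt[OF m] r7 by simp
      then show False using big(2) s by simp
    qed
    ultimately show ?thesis using m r7 by simp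
  qed
  then obtain r t where k: "metacyclic G 2 8 r t" "Some (2, 8, r, t) \<in> set (listed_codes 11)"
    by (auto simp: listed_codes_def)
  show "small_type G" by (rule small_typeI[OF k(1) _ k(2)]) simp
  have "mc_count 2 8 r t = 11" by (rule listed_codes_count[OF _ k(2)]) simp
  then show "subgroup_count G = 11" using metacyclic_count[OF fin_group_axioms k(1)] by simp
qed

lemma noncyclic_maximal_induct:
  assumes p: "nprime p" and o: "order G = p ^ n" and nc: "\<not> cyc" and n: "3 \<le> n" "p = 2 \<Longrightarrow> 4 \<le> n"
  shows "\<exists>M. order (G\<lparr>carrier := M\<rparr>) = p ^ (n - 1) \<and> fin_group (G\<lparr>carrier := M\<rparr>) \<and>
    \<not> fin_group.cyc (G\<lparr>carrier := M\<rparr>) \<and> subgroup_count (G\<lparr>carrier := M\<rparr>) + p + 1 \<le> subgroup_count G"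
proof -
  obtain M where M: "M \<in> subs G (p ^ (n - 1))" "\<not> (\<exists>x\<in>M. ord x = card M)"
    using exists_noncyclic_maximal[OF assms] by blast
  have Ms: "subgroup M G" "card M = p ^ (n - 1)" using M by (auto simp: subs_def)
  show ?thesis
    by (intro exI[of _ M] conjI sub_fin_group[OF Ms(1)] noncyclic_maximal_count[OF p o nc M(1)])
      (use Ms(2) M(2) restrict_cyc_iff[OF Ms(1)] in auto)
qed

end

text \<open>A noncyclic group of order 16 with at most 12 subgroups has exactly 11, and each further
  factor 2 adds at least three subgroups to those of a noncyclic maximal subgroup.\<close>

lemma two_group_count:
  assumes "fin_group G" "order G = 2 ^ n" "\<not> fin_group.cyc G" "4 \<le> n"
  shows "11 \<le> subgroup_count G \<and> (5 \<le> n \<longrightarrow> 14 \<le> subgroup_count G)"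
  using assms(4,1,2,3)
proof (induction n arbitrary: G rule: dec_induct)
  case base
  then interpret fin_group G by simp
  have "subgroup_count G \<le> 12 \<Longrightarrow> subgroup_count G = 11" using order_16_small_type(2) base by blast
  then show ?case by linarith
next
  case (step k)
  interpret fin_group G by (rule step.prems(1))
  have "3 \<le> Suc k" "4 \<le> Suc k" using step.hyps by simp_all
  then obtain M where M: "order (G\<lparr>carrier := M\<rparr>) = 2 ^ (Suc k - 1) \<and> fin_group (G\<lparr>carrier := M\<rparr>) \<and>
    \<not> fin_group.cyc (G\<lparr>carrier := M\<rparr>) \<and> subgroup_count (G\<lparr>carrier := M\<rparr>) + 2 + 1 \<le> subgroup_count G"
    using noncyclic_maximal_induct[OF _ step.prems(2,3)] by auto
  then have "11 \<le> subgroup_count (G\<lparr>carrier := M\<rparr>)" using step.IH[of "G\<lparr>carrier := M\<rparr>"] by simp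
  then show ?case using M by simp
qed

text \<open>A noncyclic maximal subgroup has at least 3 + 3 subgroups, and passing from it to the
  whole group adds four: 10 from order 27 on, and 14 from order 81 on.\<close>

lemma three_group_count:
  assumes G: "fin_group G" "order G = 3 ^ n" "\<not> fin_group.cyc G" "3 \<le> n"
  shows "10 \<le> subgroup_count G" "4 \<le> n \<Longrightarrow> 14 \<le> subgroup_count G"
proof -
  have p: "nprime 3" by simp
  have 1: "10 \<le> subgroup_count H" if H: "fin_group H" "order H = 3 ^ k" "\<not> fin_group.cyc H" "3 \<le> k"
    for H :: "('a, 'b) monoid_scheme" and k
  proof -
    obtain M where M: "order (H\<lparr>carrier := M\<rparr>) = 3 ^ (k - 1) \<and> fin_group (H\<lparr>carrier := M\<rparr>) \<and>
      \<not> fin_group.cyc (H\<lparr>carrier := M\<rparr>) \<and> subgroup_count (H\<lparr>carrier := M\<rparr>) + 3 + 1 \<le> subgroup_count H"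
      using fin_group.noncyclic_maximal_induct[OF H(1) p H(2,3,4)] by auto
    then have "3 + 3 \<le> subgroup_count (H\<lparr>carrier := M\<rparr>)"
      using fin_group.noncyclic_count[of "H\<lparr>carrier := M\<rparr>" 3 "k - 1"] p by simp
    then show ?thesis using M by simp
  qed
  show "10 \<le> subgroup_count G" by (rule 1[OF G])
  assume n: "4 \<le> n"
  obtain M where M: "order (G\<lparr>carrier := M\<rparr>) = 3 ^ (n - 1) \<and> fin_group (G\<lparr>carrier := M\<rparr>) \<and>
    \<not> fin_group.cyc (G\<lparr>carrier := M\<rparr>) \<and> subgroup_count (G\<lparr>carrier := M\<rparr>) + 3 + 1 \<le> subgroup_count G"
    using fin_group.noncyclic_maximal_induct[OF G(1) p G(2,3,4)] by auto
  then have "10 \<le> subgroup_count (G\<lparr>carrier := M\<rparr>)" using 1[of "G\<lparr>carrier := M\<rparr>" "n - 1"] n by simp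
  then show "14 \<le> subgroup_count G" using M by simp
qed

theorem p_group_classification:
  assumes G: "fin_group G" "order G = p ^ n" "\<not> fin_group.cyc G" and p: "nprime p" and s: "subgroup_count G \<le> 12"
  shows "small_type G"
proof -
  interpret fin_group G by fact
  have n2: "2 \<le> n" by (rule pg_noncyclic_cover(2)[OF p G(2,3)])
  have p2: "2 \<le> p" using prime_ge_2_nat[OF p] .
  \<comment> \<open>For p >= 5 a noncyclic maximal subgroup has at least p + 3 subgroups, so G has
    at least 2 p + 4 >= 14.\<close>
  have n3: "p \<le> 3" if n3: "3 \<le> n"
  proof (rule ccontr)
    assume p4: "\<not> p \<le> 3"
    have "p \<noteq> 4" using p by auto
    then have p5: "5 \<le> p" using p4 by simp
    then have "p \<noteq> 2" by simp
    then obtain M where M: "order (G\<lparr>carrier := M\<rparr>) = p ^ (n - 1) \<and> fin_group (G\<lparr>carrier := M\<rparr>) \<and>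
      \<not> fin_group.cyc (G\<lparr>carrier := M\<rparr>) \<and> subgroup_count (G\<lparr>carrier := M\<rparr>) + p + 1 \<le> subgroup_count G"
      using noncyclic_maximal_induct[OF p G(2,3) n3] by blast
    then have "p + 3 \<le> subgroup_count (G\<lparr>carrier := M\<rparr>)"
      using fin_group.noncyclic_count[of "G\<lparr>carrier := M\<rparr>" p "n - 1"] p by blast
    then show False using M s p5 by simp
  qed
  have p23: "p = 2 \<or> p = 3" if "3 \<le> n" using n3[OF that] p2 by linarith
  consider "n = 2" | "3 \<le> n" "p = 2" | "3 \<le> n" "p = 3" using n2 p23 by linarith
  then show ?thesis
  proof cases
    case 1 then show ?thesis using p_squared_small_type[OF p _ G(3) s] G(2) by simp
  next
    case 2
    have "n \<le> 4"
    proof (rule ccontr)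
      assume "\<not> n \<le> 4"
      then show False using two_group_count[OF G(1) _ G(3), of n] G(2) 2 s by simp
    qed
    then have "n = 3 \<or> n = 4" using 2 by linarith
    then show ?thesis using order_8_small_type[OF _ G(3) s] order_16_small_type(1)[OF _ G(3) s] G(2) 2 by auto
  next
    case 3
    have "\<not> 4 \<le> n"
    proof
      assume "4 \<le> n"
      then show False using three_group_count(2)[OF G(1) _ G(3), of n] G(2) 3 s by simp
    qed
    then have "n = 3" using 3 by simp
    then show ?thesis using order_27_small_type[OF _ G(3) s] G(2) 3 by simp
  qed
qed

section \<open>Non-normal Sylow subgroups\<close>

text \<open>r^n - 1 is the product of r - 1 and 1 + r + ... + r^(n-1); the second factor is n modulo
  q, hence prime to q.\<close>

lemma cong_one_of_coprime_exponent:
  fixes r n q c :: nat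
  assumes n: "[r ^ n = 1] (mod q ^ c)" and r: "[r = 1] (mod q)" and co: "coprime n q"
  shows "[r = 1] (mod q ^ c)"
proof -
  have "int q dvd int r - 1" using r by (metis cong_iff_dvd_diff cong_int_iff of_nat_1)
  then have 1: "[int r = 1] (mod int q)" by (simp add: cong_iff_dvd_diff)
  have "[(\<Sum>i<n. int r ^ i) = (\<Sum>i<n. 1)] (mod int q)"
    by (rule cong_sum) (use cong_pow[OF 1] in simp)
  then have "[(\<Sum>i<n. int r ^ i) = int n] (mod int q)" by simp
  then have "coprime (\<Sum>i<n. int r ^ i) (int q)" using co cong_imp_coprime cong_sym coprime_int_iff by blast
  then have "coprime (int q ^ c) (\<Sum>i<n. int r ^ i)" by (simp add: coprime_commute)
  moreover have "int q ^ c dvd int r ^ n - 1"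
    using n by (metis cong_iff_dvd_diff cong_int_iff of_nat_1 of_nat_power)
  then have "int q ^ c dvd (int r - 1) * (\<Sum>i<n. int r ^ i)" by (simp only: power_diff_1_eq)
  ultimately have "int q ^ c dvd int r - 1" by (simp add: coprime_dvd_mult_left_iff)
  then show ?thesis by (metis cong_iff_dvd_diff cong_int_iff of_nat_1 of_nat_power)
qed

context fin_group
begin

text \<open>x acts on the cyclic q-group <b> by b to b^r with r^n = 1 modulo q^c and n prime to q.
  Fixing an element of order q makes r congruent to 1 modulo q, which for q = 2 is automatic since r
  is odd; \<open>cong_one_of_coprime_exponent\<close> does the rest.\<close>

lemma coprime_automorphism_cyclic:
  assumes b: "b \<in> carrier G" "ord b = q ^ c" "0 < c" and x: "x \<in> carrier G" "inv x \<in> Nm (generate G {b})"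
    and n: "x [^] (n::nat) = \<one>" "coprime n q" and q: "nprime q"
    and z: "q = 2 \<or> (\<exists>z\<in>generate G {b}. ord z = q \<and> z \<otimes> x = x \<otimes> z)"
  shows "b \<otimes> x = x \<otimes> b"
proof -
  obtain r where r: "r < ord b" "b \<otimes> x = x \<otimes> b [^] r" using conj_exponent[OF b(1) x] by blast
  have pw: "[i = j] (mod q ^ c)" if "b [^] (i::nat) = b [^] (j::nat)" for i j
  proof -
    have "int (q ^ c) dvd int j - int i"
      using int_pow_eq[OF b(1), of "int i" "int j"] that b(2) by (simp add: int_pow_int)
    then show ?thesis by (metis cong_iff_dvd_diff cong_int_iff cong_sym)
  qed
  have "b [^] (1::nat) \<otimes> x [^] n = x [^] n \<otimes> b [^] (1 * r ^ n)" by (rule pow_conj_comm[OF x(1) b(1) r(2)])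
  then have "b [^] (r ^ n) = b [^] (1::nat)" using n(1) b(1) by simp
  then have rn: "[r ^ n = 1] (mod q ^ c)" by (rule pw)
  have qc: "q dvd q ^ c" using b(3) by simp
  have rq: "[r = 1] (mod q)"
    using z
  proof
    assume q2: "q = 2"
    have "n \<noteq> 0" using n(2) q by (auto intro: ccontr)
    moreover have "[r ^ n = 1] (mod 2)" using cong_dvd_modulus_nat[OF rn qc] q2 by simp
    then have "r ^ n mod 2 = 1" by (simp add: cong_def)
    then have "odd (r ^ n)" by presburger
    ultimately have "odd r" by simp
    then have "r mod 2 = 1" by presburger
    then show ?thesis using q2 by (simp add: cong_def)
  next
    assume "\<exists>z\<in>generate G {b}. ord z = q \<and> z \<otimes> x = x \<otimes> z"
    then obtain z where z: "z \<in> generate G {b}" "ord z = q" "z \<otimes> x = x \<otimes> z" by blast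
    then obtain i :: nat where i: "z = b [^] i" using gen_eq[OF b(1)] by auto
    have "z \<otimes> x = x \<otimes> z [^] r"
      using pow_conj_comm[OF x(1) b(1) r(2), of i 1] x(1) b(1) unfolding i by (simp add: nat_pow_pow)
    then have "z [^] r = z [^] (1::nat)" using z(3) x(1) b(1) i by simp
    moreover have "z \<in> carrier G" using i b(1) by simp
    ultimately have "int q dvd 1 - int r" using int_pow_eq[of z "int r" "int 1"] z(2) by (simp add: int_pow_int)
    then show ?thesis by (metis cong_iff_dvd_diff cong_int_iff cong_sym of_nat_1)
  qed
  have "[r = 1] (mod q ^ c)" by (rule cong_one_of_coprime_exponent[OF rn rq n(2)])
  then have "r mod ord b = 1 mod ord b" using b(2) by (simp add: cong_def)
  then have "b [^] r = b [^] (1::nat)" using pow_mod_eq[OF b(1) pow_ord_eq_1[OF b(1)]] by metis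
  then show ?thesis using r(2) b(1) by simp
qed

lemma ord_conj: "x \<in> carrier G \<Longrightarrow> y \<in> carrier G \<Longrightarrow> ord (x \<otimes> y \<otimes> inv x) = ord y"
proof -
  assume c: "x \<in> carrier G" "y \<in> carrier G"
  have pw: "(x \<otimes> y \<otimes> inv x) [^] (n::nat) = x \<otimes> y [^] n \<otimes> inv x" for n
  proof (induction n)
    case (Suc n)
    have "inv x \<otimes> (x \<otimes> (y \<otimes> inv x)) = y \<otimes> inv x" using c by (simp add: m_assoc[symmetric])
    then show ?case using Suc c by (simp add: m_assoc)
  qed (use c in simp)
  have "x \<otimes> y [^] n \<otimes> inv x = \<one> \<longleftrightarrow> y [^] n = \<one>" for n :: nat
  proof
    assume "x \<otimes> y [^] n \<otimes> inv x = \<one>"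
    then have "x \<otimes> y [^] n = \<one> \<otimes> x" using c inv_solve_right[of \<one> "x \<otimes> y [^] n" x] by simp
    then show "y [^] n = \<one>" using c by simp
  qed (use c in simp)
  then show ?thesis using ord_unique[of "x \<otimes> y \<otimes> inv x" "ord y"] pw c pow_eq_id[of y] by simp
qed

lemma sylow_commute:
  assumes "nprime p" "nprime q" "p \<noteq> q" "P \<in> syl p" "Q \<in> syl q" "P \<subseteq> Nm Q" "Q \<subseteq> Nm P" "x \<in> P" "y \<in> Q"
  shows "x \<otimes> y = y \<otimes> x"
proof -
  have "coprime (card P) (card Q)" using assms(1-5) by (simp add: sylD(2) primes_coprime)
  then have "P \<inter> Q = {\<one>}" by (rule coprime_Int[OF sylD(1)[OF assms(4)] sylD(1)[OF assms(5)]])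
  then show ?thesis using Nm_eq_commute[OF sylD(1)[OF assms(4)] sylD(1)[OF assms(5)] _ assms(7,6,8,9)] by simp
qed

lemma centralizer_subgroup: "g \<in> carrier G \<Longrightarrow> subgroup {x \<in> carrier G. x \<otimes> g = g \<otimes> x} G"
proof (rule closed_imp_subgroup)
  assume g: "g \<in> carrier G"
  fix x y assume "x \<in> {x \<in> carrier G. x \<otimes> g = g \<otimes> x}" "y \<in> {x \<in> carrier G. x \<otimes> g = g \<otimes> x}"
  then have c: "x \<in> carrier G" "y \<in> carrier G" "x \<otimes> g = g \<otimes> x" "y \<otimes> g = g \<otimes> y" by auto
  have "x \<otimes> y \<otimes> g = x \<otimes> g \<otimes> y" using c(1,2,4) g by (simp add: m_assoc)
  also have "\<dots> = g \<otimes> (x \<otimes> y)" unfolding c(3) using c(1,2) g by (simp add: m_assoc)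
  finally show "x \<otimes> y \<in> {x \<in> carrier G. x \<otimes> g = g \<otimes> x}" using c by simp
qed auto

text \<open>The centralizer of g contains a Sylow subgroup for every prime divisor of |G|, so it is
  all of G.\<close>

lemma central_cyclic_primeI:
  assumes r: "nprime r" "r dvd order G" and g: "g \<in> carrier G" "generate G {g} \<in> syl r"
    and comm: "\<And>l. nprime l \<Longrightarrow> l dvd order G \<Longrightarrow> \<exists>L\<in>syl l. \<forall>x\<in>L. x \<otimes> g = g \<otimes> x"
  shows "r \<in> central_cyclic_primes G"
proof -
  let ?C = "{x \<in> carrier G. x \<otimes> g = g \<otimes> x}" and ?R = "generate G {g}"
  have C: "subgroup ?C G" by (rule centralizer_subgroup[OF g(1)])
  have "?C = carrier G"
  proof (rule sub_eq_carrier_of_sylow[OF C])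
    fix p assume "nprime p" "p dvd order G"
    then obtain L where L: "L \<in> syl p" "\<forall>x\<in>L. x \<otimes> g = g \<otimes> x" using comm by blast
    then have "L \<subseteq> ?C" using sub_carrier[OF sylD(1)[OF L(1)]] by blast
    then show "p ^ multiplicity p (order G) dvd card ?C"
      using card_sub_dvd_sub[OF sylD(1)[OF L(1)] C] sylD(2)[OF L(1)] by simp
  qed
  then have "x \<otimes> g = g \<otimes> x" if "x \<in> carrier G" for x using that by blast
  then have gc: "g \<in> center G" using g(1) by (simp add: center_def)
  have R: "subgroup ?R G" by (rule gen_subgroup[OF g(1)])
  have "?R \<subseteq> center G"
  proof
    fix y assume "y \<in> ?R"
    then obtain k :: nat where k: "y = g [^] k" using gen_eq[OF g(1)] by auto
    have "y \<otimes> x = x \<otimes> y" if x: "x \<in> carrier G" for x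
    proof -
      have "g \<otimes> x = x \<otimes> g [^] (1::nat)" using gc x g(1) by (simp add: center_def)
      from pow_conj_comm[OF x g(1) this, of k 1] show ?thesis unfolding k using x g(1) by simp
    qed
    then show "y \<in> center G" using k g(1) by (simp add: center_def)
  qed
  moreover have "cyclic_group (G\<lparr>carrier := ?R\<rparr>)"
  proof -
    interpret R: fin_group "G\<lparr>carrier := ?R\<rparr>" by (rule sub_fin_group[OF R])
    show ?thesis unfolding R.cyclic_group_iff_cyc restrict_cyc_iff[OF R]
      using gen_mem[of g] card_gen[OF g(1)] by auto
  qed
  moreover have "sylow_subgroup r ?R G" using g(2) by (simp add: sylow_subgroup_def syl_def subs_def)
  ultimately show ?thesis using r unfolding central_cyclic_primes_def by blast
qed

text \<open>P acts on R by conjugation. An element of R fixed by P normalizes P, so it lies in P and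
  is trivial because the orders are coprime; 1 is the only fixed point.\<close>

lemma self_normalizing_sylow_normal:
  assumes p: "nprime p" and P: "P \<in> syl p" "Nm P = P" and R: "subgroup R G" "Nm R = carrier G" "\<not> p dvd card R"
  shows "[card R = 1] (mod p)"
proof -
  have Ps: "subgroup P G" "card P = p ^ multiplicity p (order G)" using P sylD by auto
  note Rc = sub_carrier[OF R(1)] and Pc = sub_carrier[OF Ps(1)]
  have "[card R = card {h \<in> R. \<forall>g\<in>P. g \<otimes> h \<otimes> inv g = h}] (mod p)"
  proof (rule p_group_fixed_points[OF p Ps sub_finite[OF R(1)]])
    fix g h assume gh: "g \<in> P" "h \<in> R"
    then show "g \<otimes> h \<otimes> inv g \<in> R" using Nm_conj[of g R h] R(2) Pc by blast
  next
    fix h assume "h \<in> R" then show "\<one> \<otimes> h \<otimes> inv \<one> = h" using Rc by auto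
  next
    fix g g' h assume "g \<in> P" "g' \<in> P" "h \<in> R"
    then have "g \<in> carrier G" "g' \<in> carrier G" "h \<in> carrier G" using Pc Rc by blast+
    then show "g \<otimes> g' \<otimes> h \<otimes> inv (g \<otimes> g') = g \<otimes> (g' \<otimes> h \<otimes> inv g') \<otimes> inv g"
      by (simp add: m_assoc inv_mult_group)
  qed
  moreover have "{h \<in> R. \<forall>g\<in>P. g \<otimes> h \<otimes> inv g = h} = {\<one>}"
  proof (rule subset_antisym; rule subsetI)
    fix h assume "h \<in> {h \<in> R. \<forall>g\<in>P. g \<otimes> h \<otimes> inv g = h}"
    then have h: "h \<in> R" "\<And>g. g \<in> P \<Longrightarrow> g \<otimes> h \<otimes> inv g = h" by auto
    have hc: "h \<in> carrier G" using h Rc by blast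
    have "h \<in> Nm P"
    proof (rule NmI[OF hc Ps(1)])
      fix g assume g: "g \<in> P"
      then have gc: "g \<in> carrier G" using Pc by blast
      have "g \<otimes> h = h \<otimes> g" using h(2)[OF g] gc hc by (metis inv_solve_right m_closed)
      then have "h \<otimes> g \<otimes> inv h = g" using gc hc by (metis inv_solve_right m_closed)
      then show "h \<otimes> g \<otimes> inv h \<in> P" using g by simp
    qed
    moreover have "coprime (card R) (card P)" using R(3) Ps(2) p by (simp add: prime_imp_coprime coprime_commute)
    then have "R \<inter> P = {\<one>}" by (rule coprime_Int[OF R(1) Ps(1)])
    ultimately show "h \<in> {\<one>}" using h(1) P(2) by blast
  qed (use sub_one[OF R(1)] Pc in auto)
  ultimately show ?thesis by simp
qed

text \<open>A conjugate of P inside \<open>Nm P\<close> is absorbed by P, so whatever normalizes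
  \<open>Nm P\<close> normalizes P.\<close>

lemma Nm_Nm_sylow:
  assumes p: "nprime p" and P: "P \<in> syl p" shows "Nm (Nm P) = Nm P"
proof (rule subset_antisym)
  have Ps: "subgroup P G" using P sylD by auto
  note Pc = sub_carrier[OF Ps]
  have Ns: "subgroup (Nm P) G" by (rule Nm_subgroup[OF Pc])
  show "Nm P \<subseteq> Nm (Nm P)" by (rule Nm_self[OF Ns])
  show "Nm (Nm P) \<subseteq> Nm P"
  proof
    fix x assume x: "x \<in> Nm (Nm P)"
    then have xc: "x \<in> carrier G" by (simp add: Nm_def)
    have "cj x P \<subseteq> Nm P" using x cj_mono[OF Nm_self[OF Ps], of x] by (auto simp: Nm_def)
    moreover have K: "cj x P \<in> subs G (p ^ multiplicity p (order G))" using cj_subs[OF xc] P unfolding syl_def .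
    ultimately have "cj x P \<subseteq> P" using sylow_absorb[OF p P K] by blast
    then have "cj x P = P" by (rule sub_eqI[OF Ps _ cj_card[OF xc Pc]])
    then show "x \<in> Nm P" using xc by (simp add: Nm_def)
  qed
qed

text \<open>\<open>Nm P\<close> is its own normalizer and therefore has as many conjugates as
  P.\<close>

lemma card_syl_le_subs_Nm:
  assumes p: "nprime p" and P: "P \<in> syl p" shows "card (syl p) \<le> card (subs G (card (Nm P)))"
proof -
  have Ns: "subgroup (Nm P) G" using Nm_subgroup sub_carrier sylD(1)[OF P] by blast
  have "card (cls (Nm P)) * card (Nm P) = card (syl p) * card (Nm P)"
    using card_cls[OF Ns] card_syl_index[OF p P] Nm_Nm_sylow[OF p P] by simp
  then have "card (cls (Nm P)) = card (syl p)" using sub_card_pos[OF Ns] by simp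
  moreover have "cls (Nm P) \<subseteq> subs G (card (Nm P))" by (rule cls_subs[OF subsI[OF Ns refl]])
  ultimately show ?thesis using card_mono[OF finite_subs, of "cls (Nm P)" "card (Nm P)"] by simp
qed

text \<open>D is recovered from Q D as its intersection with P.\<close>

lemma card_subs_mult_normal:
  assumes P: "subgroup P G" and Q: "subgroup Q G" "Nm Q = carrier G" and co: "coprime (card P) (card Q)"
  shows "card {D \<in> subs G d. D \<subseteq> P} \<le> card (subs G (d * card Q))"
proof (rule card_inj_on_le[of "\<lambda>D. Q <#> D"])
  have QP: "Q \<inter> P = {\<one>}" using coprime_Int[OF P Q(1) co] by blast
  note Qc = sub_carrier[OF Q(1)] and Pc = sub_carrier[OF P]
  have int: "(Q <#> D) \<inter> P = D" if D: "subgroup D G" "D \<subseteq> P" for D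
  proof (rule subset_antisym; rule subsetI)
    fix y assume "y \<in> (Q <#> D) \<inter> P"
    then obtain a d where a: "a \<in> Q" "d \<in> D" "y = a \<otimes> d" "y \<in> P" by (auto simp: set_mult_def)
    have "y \<otimes> inv d \<in> P" using a D subgroup.m_closed[OF P] subgroup.m_inv_closed[OF P] by blast
    moreover have "y \<otimes> inv d = a" using a Qc Pc D by (auto simp: m_assoc subset_iff)
    ultimately have "a = \<one>" using a QP by blast
    then show "y \<in> D" using a D sub_carrier[OF D(1)] by auto
  next
    fix y assume "y \<in> D"
    then show "y \<in> (Q <#> D) \<inter> P"
      using set_mult_subgroup(3)[OF Q(1) D(1)] Q(2) sub_carrier[OF D(1)] D(2) by blast
  qed
  show "inj_on (\<lambda>D. Q <#> D) {D \<in> subs G d. D \<subseteq> P}"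
  proof (rule inj_onI)
    fix D K assume DK: "D \<in> {D \<in> subs G d. D \<subseteq> P}" "K \<in> {D \<in> subs G d. D \<subseteq> P}" and e: "Q <#> D = Q <#> K"
    have "D = (Q <#> D) \<inter> P" by (rule int[symmetric]) (use DK(1) in \<open>auto simp: subs_def\<close>)
    also have "\<dots> = (Q <#> K) \<inter> P" unfolding e ..
    also have "\<dots> = K" by (rule int) (use DK(2) in \<open>auto simp: subs_def\<close>)
    finally show "D = K" .
  qed
  show "(\<lambda>D. Q <#> D) ` {D \<in> subs G d. D \<subseteq> P} \<subseteq> subs G (d * card Q)"
  proof (rule image_subsetI)
    fix D assume "D \<in> {D \<in> subs G d. D \<subseteq> P}"
    then have D: "subgroup D G" "card D = d" "D \<subseteq> P" by (auto simp: subs_def)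
    have "card D dvd card P" by (rule card_sub_dvd_sub[OF D(1) P D(3)])
    then have "coprime (card D) (card Q)" using coprime_divisors[OF _ dvd_refl co] by blast
    then have "coprime (card Q) (card D)" by (simp add: coprime_commute)
    then have "card (Q <#> D) = d * card Q" using card_set_mult_coprime[OF Q(1) D(1)] D(2) by simp
    moreover have "subgroup (Q <#> D) G"
      using set_mult_subgroup(1)[OF Q(1) D(1)] Q(2) sub_carrier[OF D(1)] by blast
    ultimately show "Q <#> D \<in> subs G (d * card Q)" by (simp add: subs_def)
  qed
qed simp

lemma noncyclic_sub_maximals:
  assumes p: "nprime p" and P: "subgroup P G" "card P = p ^ a" "\<not> (\<exists>x\<in>P. ord x = card P)"
  shows "p + 1 \<le> card {D \<in> subs G (p ^ (a - 1)). D \<subseteq> P}" "2 \<le> a"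
    "\<And>y. y \<in> P \<Longrightarrow> \<exists>D\<in>subs G (p ^ (a - 1)). D \<subseteq> P \<and> y \<in> D"
proof -
  interpret P: fin_group "G\<lparr>carrier := P\<rparr>" by (rule sub_fin_group[OF P(1)])
  have nc: "\<not> P.cyc" using restrict_cyc_iff[OF P(1)] P(3) by simp
  have o: "order (G\<lparr>carrier := P\<rparr>) = p ^ a" using P(2) by simp
  show "p + 1 \<le> card {D \<in> subs G (p ^ (a - 1)). D \<subseteq> P}" "2 \<le> a"
    using P.pg_noncyclic_cover[OF p o nc] subs_restrict[OF P(1)] by simp_all
  fix y assume y: "y \<in> P"
  have "generate (G\<lparr>carrier := P\<rparr>) {y} \<noteq> carrier (G\<lparr>carrier := P\<rparr>)"
    using P.gen_eq_carrier_iff[of y] nc y unfolding P.cyc_def by auto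
  then obtain D where D: "D \<in> subs (G\<lparr>carrier := P\<rparr>) (p ^ (a - 1))" "generate (G\<lparr>carrier := P\<rparr>) {y} \<subseteq> D"
    using P.pg_maximal[OF p o P.gen_subgroup[of y]] y by auto
  have "D \<in> subs G (p ^ (a - 1))" "D \<subseteq> P" using D(1) unfolding subs_restrict[OF P(1)] by simp_all
  moreover have "y \<in> D" using D(2) P.gen_mem[of y] by (rule subsetD)
  ultimately show "\<exists>D\<in>subs G (p ^ (a - 1)). D \<subseteq> P \<and> y \<in> D" by (intro bexI conjI)
qed

end

section \<open>Self-normalizing Sylow subgroups of prime index\<close>

context fin_group
begin

lemma count_list_le: "distinct ms \<Longrightarrow> sum_list (map (\<lambda>m. card (subs G m)) ms) \<le> subgroup_count G"
  using sum_subs_le[of "set ms"] by (simp add: sum_list_distinct_conv_sum_set)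

text \<open>A noncyclic P has p + 1 maximal subgroups, another Sylow p-subgroup supplies one more of
  the same order, and multiplying by Q gives p + 1 of order p^(a-1) q. With the trivial group, the q
  Sylow p-subgroups, Q and G this makes q + 2 p + 6 >= 13.\<close>

lemma self_normalizing_cyclic_sylow:
  assumes p: "nprime p" and q: "nprime q" "p \<noteq> q" "3 \<le> q" and o: "order G = p ^ a * q"
    and P: "P \<in> syl p" "Nm P = P" "card P = p ^ a" and Q: "Q \<in> subs G q" "Nm Q = carrier G"
    and s: "subgroup_count G \<le> 12"
  shows "\<exists>t\<in>P. ord t = p ^ a"
proof (rule ccontr)
  assume nc: "\<not> ?thesis"
  have Ps: "subgroup P G" using P sylD by auto
  have Qs: "subgroup Q G" "card Q = q" using Q by (auto simp: subs_def)
  have p2: "2 \<le> p" by (rule prime_ge_2_nat[OF p])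
  have syl: "syl p = subs G (p ^ a)" using sylD(2)[OF P(1)] P(3) by (simp add: syl_def)
  have "card (syl p) * p ^ a = q * p ^ a"
    using card_syl_index[OF p P(1)] unfolding P(2,3) o by (simp only: mult.commute)
  then have cq: "card (subs G (p ^ a)) = q" using p2 syl by simp
  have nc': "\<not> (\<exists>x\<in>P. ord x = card P)" using nc P(3) by simp
  note mx = noncyclic_sub_maximals[OF p Ps P(3) nc']
  have "\<not> card (subs G (p ^ a)) \<le> Suc 0" using cq q(3) by simp
  then obtain A B where "A \<in> subs G (p ^ a)" "B \<in> subs G (p ^ a)" "A \<noteq> B" using card_le_Suc0_iff_eq[of "subs G (p ^ a)"] by auto
  then obtain P' where P': "P' \<in> subs G (p ^ a)" "P' \<noteq> P" by metis
  have P's: "subgroup P' G" "card P' = p ^ a" using P' by (auto simp: subs_def)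
  have "\<not> P' \<subseteq> P" using sub_eqI[OF Ps] P' P's P(3) by metis
  then obtain y where y: "y \<in> P'" "y \<notin> P" by blast
  have nc2: "\<not> (\<exists>x\<in>P'. ord x = card P')"
  proof
    assume "\<exists>x\<in>P'. ord x = card P'"
    then obtain x where x: "x \<in> P'" "ord x = p ^ a" using P's by auto
    obtain g where g: "g \<in> carrier G" "P' = cj g P" using P'(1) syl_eq_cls[OF p P(1)] syl by (auto simp: cls_def)
    then obtain h where h: "h \<in> P" "x = g \<otimes> h \<otimes> inv g" using x(1) by (auto simp: cj_def)
    then have "ord h = p ^ a" using x(2) ord_conj[OF g(1)] sub_carrier[OF Ps] by auto
    then show False using nc h(1) by blast
  qed
  obtain D' where D': "D' \<in> subs G (p ^ (a - 1))" "y \<in> D'"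
    using noncyclic_sub_maximals(3)[OF p P's nc2 y(1)] by blast
  let ?S = "{D \<in> subs G (p ^ (a - 1)). D \<subseteq> P}"
  have "card (insert D' ?S) \<le> card (subs G (p ^ (a - 1)))" by (rule card_mono) (use D'(1) in auto)
  moreover have "card (insert D' ?S) = Suc (card ?S)" using D'(2) y(2) by (intro card_insert_disjoint) auto
  ultimately have c1: "p + 2 \<le> card (subs G (p ^ (a - 1)))" using mx(1) by simp
  have "coprime (card P) (card Q)" using P(3) Qs(2) p q(1,2) by (simp add: primes_coprime)
  then have c2: "p + 1 \<le> card (subs G (p ^ (a - 1) * q))"
    using card_subs_mult_normal[OF Ps Qs(1) Q(2), of "p ^ (a - 1)"] mx(1) Qs(2) by simp
  have c3: "1 \<le> card (subs G q)" using card_subs_pos[OF Qs(1)] Qs(2) by simp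
  have c4: "card (subs G (p ^ a * q)) = 1" using subs_order o by simp
  define u where "u = p ^ (a - 1)"
  have pu: "p ^ a = p * u" unfolding u_def using mx(2) by (simp add: power_eq_if)
  have u1: "1 < u" unfolding u_def by (rule one_less_power) (use p2 mx(2) in auto)
  have pnq: "\<not> p dvd q" using primes_dvd_imp_eq[OF p q(1)] q(2) by blast
  have pdu: "p dvd u" unfolding u_def using mx(2) by simp
  have ne: "q \<noteq> u" "q \<noteq> p * u" using pnq pdu by auto
  have ne2: "u \<noteq> p * u" "u \<noteq> u * q" "q \<noteq> u * q" "p * u \<noteq> u * q" "p * u \<noteq> p * u * q" "u * q \<noteq> p * u * q"
    "u \<noteq> p * u * q" "q \<noteq> p * u * q" "1 \<noteq> p * u * q" "1 \<noteq> u * q" "1 \<noteq> p * u"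
    using u1 p2 q(2,3) by auto
  have "distinct [1, p * u, q, p * u * q, u, u * q]" using u1 q(3) ne ne2 by simp
  then have "sum_list (map (\<lambda>m. card (subs G m)) [1, p * u, q, p * u * q, u, u * q]) \<le> subgroup_count G"
    by (rule count_list_le)
  moreover have "q + 2 * p + 6 \<le> sum_list (map (\<lambda>m. card (subs G m)) [1, p * u, q, p * u * q, u, u * q])"
    using c1 c2 c3 c4 cq subs_1 unfolding pu u_def[symmetric] by simp
  ultimately show False using s p2 q(3) by simp
qed

text \<open>A generator t of P and a generator b of Q generate G, and r = 1 would make b normalize
  P. For the bound: the q Sylow subgroups, together with at least one subgroup of each order p^j
  with j < a and p^j q with j <= a, give 2 a + 1 + q <= 12.\<close>

lemma self_normalizing_sylow_metacyclic:
  assumes p: "nprime p" and q: "nprime q" "p \<noteq> q" "3 \<le> q" and o: "order G = p ^ a * q"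
    and P: "P \<in> syl p" "Nm P = P" "card P = p ^ a" and Q: "Q \<in> subs G q" "Nm Q = carrier G"
    and s: "subgroup_count G \<le> 12"
  shows "\<exists>r<q. r \<noteq> 1 \<and> metacyclic G (p ^ a) q r 0" "2 * a + q \<le> 11"
proof -
  have Ps: "subgroup P G" using P sylD by auto
  have Qs: "subgroup Q G" "card Q = q" using Q by (auto simp: subs_def)
  have p2: "2 \<le> p" by (rule prime_ge_2_nat[OF p])
  have syl: "syl p = subs G (p ^ a)" using sylD(2)[OF P(1)] P(3) by (simp add: syl_def)
  have "card (syl p) * p ^ a = q * p ^ a"
    using card_syl_index[OF p P(1)] unfolding P(2,3) o by (simp only: mult.commute)
  then have cq: "card (subs G (p ^ a)) = q" using p2 syl by simp
  have co: "coprime (card P) (card Q)" using P(3) Qs(2) p q(1,2) by (simp add: primes_coprime)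
  obtain t where t: "t \<in> P" "ord t = p ^ a" using self_normalizing_cyclic_sylow[OF assms] by blast
  have tc: "t \<in> carrier G" using t sub_carrier[OF Ps] by blast
  have gt: "generate G {t} = P" by (rule sub_eqI[OF Ps gen_sub[OF Ps t(1)]]) (use card_gen[OF tc] t P in simp)
  have "Q \<noteq> {\<one>}" using Qs(2) q(3) by auto
  then obtain b where b: "b \<in> Q" "b \<noteq> \<one>" using sub_one[OF Qs(1)] by blast
  have bc: "b \<in> carrier G" using b sub_carrier[OF Qs(1)] by blast
  have "ord b dvd q" using ord_dvd_sub[OF Qs(1) b(1)] Qs(2) by simp
  then have ob: "ord b = q" using ord_eq_1[OF bc] b(2) q(1) by (metis prime_nat_iff)
  have gb: "generate G {b} = Q" by (rule sub_eqI[OF Qs(1) gen_sub[OF Qs(1) b(1)]]) (use card_gen[OF bc] ob Qs in simp)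
  have gen: "H = carrier G" if H: "subgroup H G" "t \<in> H" "b \<in> H" for H
  proof -
    have "p ^ a dvd card H" "q dvd card H" using ord_dvd_sub[OF H(1,2)] ord_dvd_sub[OF H(1,3)] t ob by auto
    moreover have "coprime (p ^ a) q" using co P(3) Qs(2) by simp
    ultimately have "p ^ a * q dvd card H" by (rule divides_mult)
    then have "card H = order G" using card_sub_dvd[OF H(1)] o by (simp add: dvd_antisym)
    then show ?thesis by (rule sub_eq_carrierI[OF H(1)])
  qed
  have "\<exists>r < ord b. metacyclic_gens G (p ^ a) (ord b) r 0 t b"
    by (rule metacyclic_of_normal) (use o ob tc bc gb Q(2) t(2) pow_ord_eq_1[OF tc] gen in auto)
  then obtain r where r: "r < q" "metacyclic_gens G (p ^ a) q r 0 t b" using ob by auto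
  have "r \<noteq> 1"
  proof
    assume "r = 1"
    then have "b \<otimes> t = t \<otimes> b [^] (1::nat)" using r(2) by (simp add: metacyclic_gens_def)
    then have tb: "t \<otimes> b = b \<otimes> t [^] (1::nat)" using bc tc by simp
    have "b \<in> Nm P"
    proof (rule NmI[OF bc Ps])
      fix h assume h: "h \<in> P"
      then obtain k :: nat where k: "h = t [^] k" using gt gen_eq[OF tc] by auto
      have "b \<otimes> h = h \<otimes> b" using pow_conj_comm[OF bc tc tb, of k 1] k bc tc by simp
      then have "b \<otimes> h \<otimes> inv b = h" using bc tc k by (simp add: m_assoc)
      then show "b \<otimes> h \<otimes> inv b \<in> P" using h by simp
    qed
    then have "b \<in> P \<inter> Q" using P(2) b(1) by simp
    then show False using coprime_Int[OF Ps Qs(1) co] b(2) by blast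
  qed
  then show "\<exists>r<q. r \<noteq> 1 \<and> metacyclic G (p ^ a) q r 0" using r unfolding metacyclic_def by blast
  let ?A = "(\<lambda>j. p ^ j) ` {..<a}" and ?B = "(\<lambda>j. p ^ j * q) ` {..a}"
  have pnq: "\<not> q dvd p" using primes_dvd_imp_eq[OF q(1) p] q(2) by blast
  have pj: "\<not> q dvd p ^ j" for j using pnq q(1) prime_dvd_power by blast
  have inj: "p ^ i = p ^ j \<longleftrightarrow> i = j" for i j using p2 by simp
  have cA: "card ?A = a" by (subst card_image) (auto simp: inj_on_def inj)
  have q0: "0 < q" using q(3) by simp
  have cB: "card ?B = Suc a" by (subst card_image) (use q0 in \<open>auto simp: inj_on_def inj\<close>)
  have dAB: "?A \<inter> ?B = {}" using pj by auto (metis dvd_triv_right)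
  have nin: "p ^ a \<notin> ?A \<union> ?B" using pj by (auto simp: inj) (metis dvd_triv_right)
  have pos: "1 \<le> card (subs G m)" if "m \<in> ?A \<union> ?B" for m
    using that
  proof
    assume "m \<in> ?A"
    then obtain j where j: "j < a" "m = p ^ j" by auto
    have "p ^ j dvd p ^ a" using j by (simp add: le_imp_power_dvd)
    then have "p ^ j dvd order G" unfolding o by simp
    then show ?thesis unfolding j(2) by (rule card_subs_prime_power_pos[OF p])
  next
    assume "m \<in> ?B"
    then obtain j where j: "j \<le> a" "m = p ^ j * q" by auto
    have "p ^ j dvd card P" using j P(3) by (simp add: le_imp_power_dvd)
    then obtain D where "D \<in> {D \<in> subs G (p ^ j). D \<subseteq> P}" using exists_prime_power_subgroup_in[OF p Ps] by blast
    then have "0 < card {D \<in> subs G (p ^ j). D \<subseteq> P}" using card_gt_0_iff finite_subs by (metis (no_types, lifting) empty_iff finite_Collect_conjI mem_Collect_eq finite_subset subsetI)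
    then show ?thesis using card_subs_mult_normal[OF Ps Qs(1) Q(2) co, of "p ^ j"] Qs(2) j(2) by simp
  qed
  have "a + Suc a = card (?A \<union> ?B)" using cA cB dAB by (subst card_Un_disjoint) auto
  also have "\<dots> = (\<Sum>m\<in>?A \<union> ?B. 1)" by simp
  also have "\<dots> \<le> (\<Sum>m\<in>?A \<union> ?B. card (subs G m))" by (rule sum_mono) (use pos in blast)
  finally have "a + Suc a + q \<le> (\<Sum>m\<in>insert (p ^ a) (?A \<union> ?B). card (subs G m))" using nin cq by simp
  also have "\<dots> \<le> subgroup_count G" by (rule sum_subs_le) simp
  finally show "2 * a + q \<le> 11" using s by simp
qed

text \<open>2 a + q <= 11 bounds a. Then r^(p^a) = 1 modulo q and, for q = 5, the subgroup count
  leave only the listed multipliers, up to replacing a generator.\<close>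

lemma self_normalizing_sylow_small_type:
  assumes o: "order G = p ^ a * q"
    and pq: "(p, q) \<in> {(2, 3), (2, 5), (2, 7), (3, 7)}"
    and P: "P \<in> syl p" "Nm P = P" "card P = p ^ a" and Q: "Q \<in> subs G q" "Nm Q = carrier G"
    and s: "subgroup_count G \<le> 12"
  shows "small_type G"
proof -
  have "nprime p" "nprime q" "p \<noteq> q" "3 \<le> q" using pq by auto
  note S = self_normalizing_sylow_metacyclic[OF this o P Q s]
  obtain r where r: "r < q" "r \<noteq> 1" "metacyclic G (p ^ a) q r 0" using S(1) by blast
  have rn: "[r ^ p ^ a = 1] (mod q)" using metacyclic_constraints(1)[OF fin_group_axioms r(3)] .
  have cnt: "mc_eval (p ^ a) q r 0 \<le> 12"
    using metacyclic_count[OF fin_group_axioms r(3)] metacyclic_constraints(4,5)[OF fin_group_axioms r(3)] s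
    by (simp add: mc_count_eq_mc_eval)
  have a0: "a \<noteq> 0"
  proof
    assume "a = 0"
    then have "[r = 1] (mod q)" using rn by simp
    then show False using r(1,2) \<open>3 \<le> q\<close> by (simp add: cong_def)
  qed
  have r0: "r \<noteq> 0"
  proof
    assume "r = 0"
    then have "[0 = 1] (mod q)" using rn \<open>nprime p\<close> by (simp add: power_0_left)
    then show False using \<open>3 \<le> q\<close> by (simp add: cong_def)
  qed
  have mt: "small_type G" if "m = p ^ a" "q' = q" "r' = r" "k \<in> {1..12}" "Some (m, q', r', 0) \<in> set (listed_codes k)" for m q' r' k
    using small_typeI[OF r(3), of k] that by simp
  from pq consider "p = 2" "q = 3" | "p = 2" "q = 5" | "p = 2" "q = 7" | "p = 3" "q = 7" by blast
  then show ?thesis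
  proof cases
    case 1
    then have r2: "r = 2" and "a = 1 \<or> a = 2 \<or> a = 3 \<or> a = 4" using r r0 a0 S(2) by auto
    from this(2) show ?thesis
    proof (elim disjE)
      assume "a = 1"
      then show ?thesis by (intro mt[of 2 3 2 6]) (use 1 r2 in \<open>simp_all add: listed_codes_def\<close>)
    next
      assume "a = 2"
      then show ?thesis by (intro mt[of 4 3 2 8]) (use 1 r2 in \<open>simp_all add: listed_codes_def\<close>)
    next
      assume "a = 3"
      then show ?thesis by (intro mt[of 8 3 2 10]) (use 1 r2 in \<open>simp_all add: listed_codes_def\<close>)
    next
      assume "a = 4"
      then show ?thesis by (intro mt[of 16 3 2 12]) (use 1 r2 in \<open>simp_all add: listed_codes_def\<close>)
    qed
  next
    case 2
    \<comment> \<open>2 and 3 have order 4 modulo 5; acting by them produces too many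
      subgroups.\<close>
    have ev: "mc_eval 4 5 2 0 = 14" "mc_eval 4 5 3 0 = 14" "mc_eval 8 5 2 0 = 16" "mc_eval 8 5 3 0 = 16" by code_simp+
    have a: "a = 1 \<or> a = 2 \<or> a = 3" and rr: "r = 2 \<or> r = 3 \<or> r = 4" using 2 r r0 a0 S(2) by auto
    have "r = 4"
      using a rr
    proof (elim disjE)
      assume "a = 1" "r = 2" then show ?thesis using rn 2 by (simp add: cong_def)
    next
      assume "a = 1" "r = 3" then show ?thesis using rn 2 by (simp add: cong_def)
    next
      assume "a = 2" "r = 2" then show ?thesis using cnt 2 ev(1) by simp
    next
      assume "a = 2" "r = 3" then show ?thesis using cnt 2 ev(2) by simp
    next
      assume "a = 3" "r = 2" then show ?thesis using cnt 2 ev(3) by simp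
    next
      assume "a = 3" "r = 3" then show ?thesis using cnt 2 ev(4) by simp
    qed simp_all
    note r4 = this
    from a show ?thesis
    proof (elim disjE)
      assume "a = 1"
      then show ?thesis by (intro mt[of 2 5 4 8]) (use 2 r4 in \<open>simp_all add: listed_codes_def\<close>)
    next
      assume "a = 2"
      then show ?thesis by (intro mt[of 4 5 4 10]) (use 2 r4 in \<open>simp_all add: listed_codes_def\<close>)
    next
      assume "a = 3"
      then show ?thesis by (intro mt[of 8 5 4 12]) (use 2 r4 in \<open>simp_all add: listed_codes_def\<close>)
    qed
  next
    case 3
    have a: "a = 1 \<or> a = 2" and rr: "r = 2 \<or> r = 3 \<or> r = 4 \<or> r = 5 \<or> r = 6" using 3 r r0 a0 S(2) by auto
    have "r = 6" using a rr rn 3 by (elim disjE) (simp_all add: cong_def)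
    note r6 = this
    from a show ?thesis
    proof
      assume "a = 1"
      then show ?thesis by (intro mt[of 2 7 6 10]) (use 3 r6 in \<open>simp_all add: listed_codes_def\<close>)
    next
      assume "a = 2"
      then show ?thesis by (intro mt[of 4 7 6 12]) (use 3 r6 in \<open>simp_all add: listed_codes_def\<close>)
    qed
  next
    case 4
    have a: "a = 1 \<or> a = 2" and rr: "r = 2 \<or> r = 3 \<or> r = 4 \<or> r = 5 \<or> r = 6" using 4 r r0 a0 S(2) by auto
    have r24: "r = 2 \<or> r = 4" using a rr rn 4 by (elim disjE) (simp_all add: cong_def)
    have m2: "metacyclic G (3 ^ a) 7 2 0"
      using r24
    proof
      assume "r = 2" then show ?thesis using r(3) 4 by simp
    next
      \<comment> \<open>4^2 = 2 modulo 7, so the square of the first generator acts by the listed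
        multiplier.\<close>
      assume r4: "r = 4"
      have m4: "metacyclic G (3 ^ a) 7 4 0" using r(3) 4 r4 by simp
      have "coprime (2::nat) 3" using coprime_Suc_right_nat[of 2] by simp
      then have "coprime (2::nat) (3 ^ a)" by simp
      moreover have "[2 = 4 ^ 2] (mod 7::nat)" by (simp add: cong_def)
      ultimately show ?thesis by (rule metacyclic_change_r[OF m4])
    qed
    from a show ?thesis
    proof
      assume "a = 1"
      then show ?thesis using m2 by (intro small_typeI[of G 3 7 2 0 10]) (simp_all add: listed_codes_def)
    next
      assume "a = 2"
      then show ?thesis using m2 by (intro small_typeI[of G 9 7 2 0 12]) (simp_all add: listed_codes_def)
    qed
  qed
qed

lemma card_syl_ge:
  assumes "nprime p" "card (syl p) \<noteq> 1"
  shows "p + 1 \<le> card (syl p)" "card (syl p) mod p = 1" "p dvd order G"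
proof -
  have p1: "1 < p" by (rule prime_gt_1_nat[OF assms(1)])
  show m: "card (syl p) mod p = 1" using card_syl_cong[OF assms(1)] p1 by (simp add: cong_def)
  then have "card (syl p) = p * (card (syl p) div p) + 1" by (metis mult_div_mod_eq)
  moreover have "card (syl p) div p \<noteq> 0" using calculation assms(2) by (intro notI) simp
  then have "p * 1 \<le> p * (card (syl p) div p)" by (intro mult_le_mono2) simp
  ultimately show "p + 1 \<le> card (syl p)" by linarith
  show "p dvd order G"
  proof (rule ccontr)
    assume "\<not> p dvd order G"
    then have "syl p = subs G 1" by (simp add: syl_def not_dvd_imp_multiplicity_0)
    then show False using assms(2) subs_1 by simp
  qed
qed

text \<open>The subgroups \<open>1\<close>, \<open>G\<close>, the \<open>k\<close> Sylow \<open>p\<close>-subgroups, a subgroup of prime order dividing \<open>k\<close>,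
  and, if the normalizers are larger than the Sylow subgroups, the \<open>k\<close> normalizers all differ.\<close>

lemma nonnormal_sylow:
  assumes p: "nprime p" and P: "P \<in> syl p" and k: "card (syl p) \<noteq> 1" and s: "subgroup_count G \<le> 12"
  shows "card (syl p) \<le> 9" "5 \<le> card (syl p) \<Longrightarrow> Nm P = P"
proof -
  let ?k = "card (syl p)" and ?pa = "p ^ multiplicity p (order G)" and ?c = "card (Nm P)"
  note k' = card_syl_ge[OF p k]
  have p2: "2 \<le> p" by (rule prime_ge_2_nat[OF p])
  have Ps: "subgroup P G" "card P = ?pa" using P sylD by auto
  have Ns: "subgroup (Nm P) G" by (rule Nm_subgroup[OF sub_carrier[OF Ps(1)]])
  have n: "?k * ?c = order G" by (rule card_syl_index[OF p P])
  have pac: "?pa dvd ?c" using card_sub_dvd_sub[OF Ps(1) Ns Nm_self[OF Ps(1)]] Ps(2) by simp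
  have m0: "multiplicity p (order G) \<noteq> 0" using prime_power_dvd_order_le[OF p, of 1] k'(3) by simp
  have pd: "p dvd ?pa" using m0 by simp
  obtain q where q: "nprime q" "q dvd ?k" using prime_factor_nat[OF k] by blast
  have "\<not> p dvd ?k" using k'(2) p2 by (simp add: dvd_eq_mod_eq_0)
  then have qp: "q \<noteq> p" using q by blast
  have npq: "\<not> p dvd q" using primes_dvd_imp_eq[OF p q(1)] qp by blast
  have c0: "0 < ?c" using sub_card_pos[OF Ns] .
  have pa2: "2 \<le> ?pa" using pd p2 by (metis dvd_imp_le le_trans sub_card_pos[OF Ps(1)] Ps(2))
  have cpa: "?pa \<le> ?c" using pac c0 by (rule dvd_imp_le)
  have kk: "3 \<le> ?k" "q \<le> ?k" using k'(1) p2 q(2) by (auto intro: dvd_imp_le)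
  have nc: "?c < order G" "q < order G" "1 < order G"
  proof -
    have "3 * ?c \<le> order G" unfolding n[symmetric] using kk(1) by (rule mult_le_mono1)
    then show 1: "?c < order G" using c0 by simp
    then show "1 < order G" using c0 by simp
    have "q * 2 \<le> ?k * ?c" using kk(2) pa2 cpa by (intro mult_le_mono) simp_all
    then show "q < order G" unfolding n using prime_gt_0_nat[OF q(1)] by simp
  qed
  have ne: "?pa \<noteq> q" "?c \<noteq> q" using npq pd pac by auto
  have q1: "1 < q" by (rule prime_gt_1_nat[OF q(1)])
  have cq: "1 \<le> card (subs G q)" using card_subs_prime_power_pos[OF q(1), of 1] q(2) n by (metis dvd_mult2 power_one_right)
  have cs: "card (subs G ?pa) = ?k" by (simp add: syl_def)
  have co: "card (subs G (order G)) = 1" using subs_order by simp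
  have "distinct [1, ?pa, q, order G]" using pa2 cpa nc ne(1) q1 by auto
  then have "sum_list (map (\<lambda>m. card (subs G m)) [1, ?pa, q, order G]) \<le> subgroup_count G" by (rule count_list_le)
  moreover have "sum_list (map (\<lambda>m. card (subs G m)) [1, ?pa, q, order G]) = 2 + ?k + card (subs G q)"
    using cs co subs_1 by simp
  ultimately show "?k \<le> 9" using cq s by linarith
  \<comment> \<open>Counting the k normalizers as well gives 2 + k + 1 + k >= 13 as soon as k >=
    5.\<close>
  show "Nm P = P" if k5: "5 \<le> ?k"
  proof (rule ccontr)
    assume "Nm P \<noteq> P"
    then have "?pa \<noteq> ?c" using sub_eqI[OF Ns Nm_self[OF Ps(1)]] Ps(2) by auto
    then have "distinct [1, ?pa, q, order G, ?c]" using pa2 cpa nc ne q1 by auto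
    then have "sum_list (map (\<lambda>m. card (subs G m)) [1, ?pa, q, order G, ?c]) \<le> subgroup_count G" by (rule count_list_le)
    moreover have "sum_list (map (\<lambda>m. card (subs G m)) [1, ?pa, q, order G, ?c]) = 2 + ?k + card (subs G q) + card (subs G ?c)"
      using cs co subs_1 by simp
    ultimately show False using cq s card_syl_le_subs_Nm[OF p P] k5 by linarith
  qed
qed

end

section \<open>Excluding and identifying the possible numbers of Sylow subgroups\<close>

context fin_group
begin

lemma syl_prime_factor:
  assumes p: "nprime p" "nprime q" "p \<noteq> q" and o: "order G = p ^ a * q" shows "syl q = subs G q"
proof -
  have "\<not> q dvd p ^ a" using primes_dvd_imp_eq[OF p(2,1)] p(2,3) prime_dvd_power by blast
  then have "\<not> q ^ Suc 1 dvd order G" unfolding o using prime_gt_0_nat[OF p(2)] by simp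
  moreover have "q ^ 1 dvd order G" unfolding o by simp
  ultimately have "multiplicity q (order G) = 1" by (intro multiplicity_eqI)
  then show ?thesis by (simp add: syl_def)
qed

lemma order_of_self_normalizing_sylow:
  "nprime p \<Longrightarrow> P \<in> syl p \<Longrightarrow> Nm P = P \<Longrightarrow> order G = p ^ multiplicity p (order G) * card (syl p)"
  using card_syl_index[of p P] sylD(2)[of P p] by (metis mult.commute)

text \<open>P is self-normalizing, so |G| = p^a q with q prime. A nonnormal Sylow q-subgroup would
  have at least q + 1 conjugates, making 1 + q + (q + 1) + 1 >= 13 subgroups.\<close>

lemma nonnormal_sylow_5_7:
  assumes p: "nprime p" and P: "P \<in> syl p" and k: "card (syl p) = q" "q = 5 \<or> q = 7"
    and s: "subgroup_count G \<le> 12"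
  shows "Nm P = P" "order G = p ^ multiplicity p (order G) * q" "syl q = subs G q" "card (syl q) = 1" "p \<noteq> q" "nprime q"
proof -
  let ?a = "multiplicity p (order G)"
  have k1: "card (syl p) \<noteq> 1" using k by auto
  note ge = card_syl_ge[OF p k1]
  show q: "nprime q" using k(2) by auto
  show N: "Nm P = P" by (rule nonnormal_sylow(2)[OF p P k1 s]) (use k in auto)
  show o: "order G = p ^ ?a * q" using order_of_self_normalizing_sylow[OF p P N] k(1) by simp
  show pq: "p \<noteq> q" using ge(1) k(1) by auto
  show sq: "syl q = subs G q" by (rule syl_prime_factor[OF p q pq o])
  show "card (syl q) = 1"
  proof (rule ccontr)
    assume "card (syl q) \<noteq> 1"
    then have c: "q + 1 \<le> card (subs G q)" using card_syl_ge(1)[OF q] sq by simp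
    have a0: "?a \<noteq> 0" using prime_power_dvd_order_le[OF p, of 1] ge(3) by simp
    define u where "u = p ^ ?a"
    have u1: "1 < u" unfolding u_def using a0 prime_gt_1_nat[OF p] by (intro one_less_power) auto
    have "p dvd u" unfolding u_def using a0 by simp
    then have "u \<noteq> q" using primes_dvd_imp_eq[OF p q] pq by auto
    moreover have "q \<noteq> u * q" "u \<noteq> u * q" "1 \<noteq> u * q" using u1 k(2) by auto
    ultimately have "distinct [1, u, q, u * q]" using u1 k(2) by auto
    then have "sum_list (map (\<lambda>m. card (subs G m)) [1, u, q, u * q]) \<le> subgroup_count G" by (rule count_list_le)
    moreover have "card (subs G u) = q" using k(1) unfolding syl_def u_def .
    moreover have "card (subs G (u * q)) = 1" using subs_order o unfolding u_def by simp
    ultimately show False using subs_1 c s k(2) by auto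
  qed
qed

text \<open>The congruence modulo p leaves (k, p) = (6, 5), (8, 7), (9, 2). For 8 and 9 the
  subgroups of orders 2, 4, 8 or 3, 9 raise the total to 13. For 6, at least four Sylow 3-subgroups
  and one subgroup of order 2 do so, while a normal Sylow 3-subgroup would require 3 = 1 modulo
  5.\<close>

lemma nonnormal_sylow_not_6_8_9:
  assumes p: "nprime p" and P: "P \<in> syl p" and k: "card (syl p) = 6 \<or> card (syl p) = 8 \<or> card (syl p) = 9"
    and s: "subgroup_count G \<le> 12"
  shows False
proof -
  let ?a = "multiplicity p (order G)"
  have k1: "card (syl p) \<noteq> 1" using k by auto
  note ge = card_syl_ge[OF p k1]
  have N: "Nm P = P" by (rule nonnormal_sylow(2)[OF p P k1 s]) (use k in auto)
  define u where "u = p ^ ?a"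
  have o: "order G = u * card (syl p)" using order_of_self_normalizing_sylow[OF p P N] unfolding u_def by simp
  have a0: "?a \<noteq> 0" using prime_power_dvd_order_le[OF p, of 1] ge(3) by simp
  have u1: "1 < u" unfolding u_def using a0 prime_gt_1_nat[OF p] by (intro one_less_power) auto
  have pu: "p dvd u" unfolding u_def using a0 by simp
  have cu: "card (subs G u) = card (syl p)" unfolding syl_def u_def ..
  have co: "card (subs G (order G)) = 1" using subs_order by simp
  have "p \<le> 8" using ge(1) k by auto
  moreover have "p \<noteq> 0" "p \<noteq> 1" "p \<noteq> 4" "p \<noteq> 6" "p \<noteq> 8" using p by auto
  ultimately have "p = 2 \<or> p = 3 \<or> p = 5 \<or> p = 7" by presburger
  then have "card (syl p) = 6 \<and> p = 5 \<or> card (syl p) = 8 \<and> p = 7 \<or> card (syl p) = 9 \<and> p = 2"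
    using k ge(2) by auto
  then show False
  proof (elim disjE conjE)
    assume c6: "card (syl p) = 6" and p5: "p = 5"
    have o6: "order G = 2 * 3 * u" using o c6 by simp
    have c2: "1 \<le> card (subs G 2)" using card_subs_prime_power_pos[of 2 1] o6 by simp
    have s3: "syl 3 = subs G 3"
    proof -
      have "\<not> 3 dvd u"
      proof
        assume "3 dvd u"
        then have "3 dvd p" unfolding u_def by (rule prime_dvd_power[rotated]) simp
        then show False using p5 by simp
      qed
      then have "\<not> 9 dvd 6 * u" by presburger
      then have "\<not> 3 ^ Suc 1 dvd order G" unfolding o6 by simp
      moreover have "3 ^ 1 dvd order G" unfolding o6 by simp
      ultimately have "multiplicity 3 (order G) = 1" by (intro multiplicity_eqI)
      then show ?thesis by (simp add: syl_def)
    qed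
    show False
    proof (cases "card (syl 3) = 1")
      case False
      then have c3: "4 \<le> card (subs G 3)" using card_syl_ge(1)[of 3] s3 by simp
      have "u \<noteq> 2" "u \<noteq> 3" using pu p5 by auto
      then have "distinct [1, u, 2, 3, order G]" using u1 unfolding o6 by auto
      then have "sum_list (map (\<lambda>m. card (subs G m)) [1, u, 2, 3, order G]) \<le> subgroup_count G" by (rule count_list_le)
      then show False using subs_1 cu c6 c2 c3 co s by simp
    next
      case True
      obtain R where R: "R \<in> syl 3" using sylow_exists[of 3] by auto
      then have Rs: "subgroup R G" "card R = 3" unfolding s3 by (auto simp: subs_def)
      have "Nm R = carrier G" using Nm_eq_carrier_of_unique[of R 3] R True unfolding s3 by blast
      then have "[card R = 1] (mod p)" by (intro self_normalizing_sylow_normal[OF p P N Rs(1)]) (simp_all add: Rs(2) p5)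
      then show False using Rs(2) p5 by (simp add: cong_def)
    qed
  next
    assume c8: "card (syl p) = 8" and p7: "p = 7"
    have "u \<noteq> 2" "u \<noteq> 4" "u \<noteq> 8" using pu p7 by auto
    then have "distinct [1, u, 2, 4, 8, order G]" using u1 unfolding o c8 by auto
    then have "sum_list (map (\<lambda>m. card (subs G m)) [1, u, 2, 4, 8, order G]) \<le> subgroup_count G" by (rule count_list_le)
    moreover have "1 \<le> card (subs G 2)" "1 \<le> card (subs G 4)" "1 \<le> card (subs G 8)"
      using card_subs_prime_power_pos[of 2 1] card_subs_prime_power_pos[of 2 2] card_subs_prime_power_pos[of 2 3]
      unfolding o c8 by (simp_all add: dvd_mult2)
    ultimately show False using subs_1 cu c8 co s by simp
  next
    assume c9: "card (syl p) = 9" and p2: "p = 2"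
    have "u \<noteq> 3" "u \<noteq> 9" using pu p2 by auto
    then have "distinct [1, u, 3, 9, order G]" using u1 unfolding o c9 by auto
    then have "sum_list (map (\<lambda>m. card (subs G m)) [1, u, 3, 9, order G]) \<le> subgroup_count G" by (rule count_list_le)
    moreover have "1 \<le> card (subs G 3)" "1 \<le> card (subs G 9)"
      using card_subs_prime_power_pos[of 3 1] card_subs_prime_power_pos[of 3 2] unfolding o c9 by simp_all
    ultimately show False using subs_1 cu c9 co s by simp
  qed
qed

text \<open>The Sylow 3-subgroup is normal. Otherwise \<open>G\<close> would have order 12, with four subgroups of
  order 3; the four elements outside their union then form the only subgroup of order 4.\<close>

lemma nonnormal_sylow_two_3_normal:
  assumes P: "P \<in> syl 2" and k: "card (syl 2) = 3" and s: "subgroup_count G \<le> 12"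
  shows "card (syl 3) = 1"
proof (rule ccontr)
  assume nn: "card (syl 3) \<noteq> 1"
  have p: "nprime 2" and p3: "nprime 3" by simp_all
  define a where "a = multiplicity 2 (order G)"
  define mu where "mu = multiplicity 3 (order G)"
  let ?c = "card (Nm P)"
  have n3: "4 \<le> card (syl 3)" using card_syl_ge(1)[OF p3 nn] by simp
  have n: "order G = 3 * ?c" using card_syl_index[OF p P] k by simp
  have Ps: "subgroup P G" "card P = 2 ^ a" using sylD[OF P] unfolding a_def by auto
  have Ns: "subgroup (Nm P) G" by (rule Nm_subgroup[OF sub_carrier[OF Ps(1)]])
  have pac: "2 ^ a dvd ?c" using card_sub_dvd_sub[OF Ps(1) Ns Nm_self[OF Ps(1)]] Ps(2) by simp
  have "2 dvd order G" using card_syl_ge(3)[OF p] k by simp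
  then have a1: "1 \<le> a" using prime_power_dvd_order_le[OF p, of 1] unfolding a_def by simp
  have m1: "1 \<le> mu" using prime_power_dvd_order_le[OF p3, of 1] n unfolding mu_def by simp
  define u where "u = (2::nat) ^ a"
  define v where "v = (3::nat) ^ mu"
  have u: "even u" "2 \<le> u" unfolding u_def using a1 power_increasing[of 1 a "2::nat"] by auto
  have v: "odd v" "3 \<le> v" unfolding v_def using m1 power_increasing[of 1 mu "3::nat"] by auto
  have ce: "even ?c" using pac u(1) unfolding u_def by (rule dvd_trans[rotated])
  have c0: "0 < ?c" by (rule sub_card_pos[OF Ns])
  have uc: "u \<le> ?c" using pac c0 unfolding u_def by (rule dvd_imp_le)
  have cu: "card (subs G u) = 3" using k unfolding syl_def u_def a_def .
  have cv: "card (subs G v) = card (syl 3)" unfolding syl_def v_def mu_def ..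
  have co: "card (subs G (3 * ?c)) = 1" using subs_order n by simp
  obtain Q where Q: "Q \<in> syl 3" using sylow_exists[OF p3] by blast
  \<comment> \<open>Otherwise an odd prime r divides the index of P in its normalizer, and the
    orders 1, |G|, |P|, |Nm P|, v, r contribute at least 1 + 1 + 3 + 3 + 4 + 1 = 13.\<close>
  have N: "Nm P = P"
  proof (rule ccontr)
    assume "Nm P \<noteq> P"
    then have uc': "u \<noteq> ?c" using sub_eqI[OF Ns Nm_self[OF Ps(1)]] Ps(2) unfolding u_def by auto
    obtain w where w: "?c = u * w" using pac unfolding u_def by (rule dvdE)
    then have "w \<noteq> 1" using uc' by auto
    then obtain r where r: "nprime r" "r dvd w" using prime_factor_nat by blast
    have r2: "r \<noteq> 2"
    proof
      assume "r = 2"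
      then obtain w' where "w = 2 * w'" using r(2) by (auto elim: dvdE)
      then have "order G = 2 ^ Suc a * (3 * w')" using n w u_def by simp
      then have "2 ^ Suc a dvd order G" by (metis dvd_triv_left)
      then have "Suc a \<le> a" unfolding a_def by (rule prime_power_dvd_order_le[OF p])
      then show False by simp
    qed
    then have ro: "odd r" using prime_odd_nat[OF r(1)] prime_ge_2_nat[OF r(1)] by linarith
    \<comment> \<open>r = v would mean r = v = 3; but then 3 divides both the index of
      \<open>Nm P\<close> and w, so that 9 divides v.\<close>
    have rv: "r \<noteq> v"
    proof
      assume e: "r = v"
      have "3 dvd v" unfolding v_def using m1 by simp
      then have "r = 3" using primes_dvd_imp_eq[OF p3 r(1)] e by simp
      then have "3 ^ 2 dvd order G" unfolding n w using r(2) by (auto simp: power2_eq_square intro: mult_dvd_mono)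
      then have "2 \<le> mu" unfolding mu_def by (rule prime_power_dvd_order_le[OF p3])
      then have "(3::nat) ^ 2 \<le> v" unfolding v_def by (rule power_increasing) simp
      then show False using e \<open>r = 3\<close> by simp
    qed
    have "r dvd order G" unfolding n w using r(2) by simp
    then have cr: "1 \<le> card (subs G r)" using card_subs_prime_power_pos[OF r(1), of 1] by simp
    have "distinct [1, 3 * ?c, u, ?c, v, r]"
    proof -
      have "r \<noteq> 1" using r(1) by auto
      moreover have "r \<noteq> 3 * ?c" "r \<noteq> u" "r \<noteq> ?c" "v \<noteq> 3 * ?c" "v \<noteq> u" "v \<noteq> ?c" using ro v(1) u(1) ce by auto
      moreover have "3 * ?c \<noteq> u" "3 * ?c \<noteq> ?c" "1 \<noteq> 3 * ?c" "1 \<noteq> u" "1 \<noteq> ?c" "1 \<noteq> v"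
        using u(2) v(2) uc c0 by linarith+
      ultimately show ?thesis using uc' rv by simp
    qed
    then have "sum_list (map (\<lambda>m. card (subs G m)) [1, 3 * ?c, u, ?c, v, r]) \<le> subgroup_count G" by (rule count_list_le)
    moreover have "3 \<le> card (subs G ?c)" using card_syl_le_subs_Nm[OF p P] k by simp
    ultimately show False using subs_1 co cu cv n3 cr s by simp
  qed
  have cu': "?c = u" using N Ps(2) unfolding u_def by simp
  have no: "order G = 2 ^ a * 3" using n cu' unfolding u_def by simp
  have s3: "syl 3 = subs G 3" by (rule syl_prime_factor[OF p p3 _ no]) simp
  have Qs: "subgroup Q G" "card Q = 3" using Q unfolding s3 by (auto simp: subs_def)
  have NQ: "subgroup (Nm Q) G" by (rule Nm_subgroup[OF sub_carrier[OF Qs(1)]])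
  have "3 dvd card (Nm Q)" using card_sub_dvd_sub[OF Qs(1) NQ Nm_self[OF Qs(1)]] Qs(2) by simp
  then obtain w where w: "card (Nm Q) = 3 * w" by (rule dvdE)
  have "card (syl 3) * (3 * w) = 2 ^ a * 3" using card_syl_index[OF p3 Q] w no by simp
  then have nw: "card (syl 3) * w = 2 ^ a" by simp
  \<comment> \<open>The number of Sylow 3-subgroups is a power of 2 between 4 and 7, hence
    4.\<close>
  then obtain i where i: "card (syl 3) = 2 ^ i" using prime_power_dvd_imp[OF p] by (metis dvd_triv_left)
  have ev3: "u \<noteq> 3" "3 \<noteq> 3 * u" using u by auto
  have "distinct [1, 3 * u, u, 3]" using u ev3 by auto
  then have "sum_list (map (\<lambda>m. card (subs G m)) [1, 3 * u, u, 3]) \<le> subgroup_count G" by (rule count_list_le)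
  then have "card (syl 3) \<le> 7" using subs_1 co cu s unfolding cu' s3 by simp
  then have "(2::nat) ^ i < 2 ^ 3" "(2::nat) ^ 1 < 2 ^ i" using i n3 by simp_all
  then have "i < 3" "1 < i" using power_less_imp_less_exp[of "2::nat"] by (metis one_less_numeral_iff semiring_norm(76))+
  then have "i = 2" by simp
  then have c4: "card (syl 3) = 4" using i by simp
  have w4: "u = 4 * w" using nw c4 unfolding u_def by simp
  have w0: "0 < w" using w4 u by (cases w) auto
  show False
  proof (cases "w = 1")
    case False
    \<comment> \<open>For w > 1 the normalizers of the Sylow 3-subgroups are four new subgroups: 1 +
      1 + 3 + 4 + 4 = 13.\<close>
    then have "distinct [1, 3 * u, u, 3, 3 * w]" unfolding w4 using w0 by auto
    then have "sum_list (map (\<lambda>m. card (subs G m)) [1, 3 * u, u, 3, 3 * w]) \<le> subgroup_count G" by (rule count_list_le)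
    moreover have "4 \<le> card (subs G (3 * w))" using card_syl_le_subs_Nm[OF p3 Q] c4 w by simp
    ultimately show False using subs_1 co cu c4 s unfolding cu' s3 by simp
  next
    case True
    then have u4: "u = 4" using w4 by simp
    let ?U = "\<Union>R\<in>subs G 3. R - {\<one>}"
    have "card ?U = (\<Sum>R\<in>subs G 3. card (R - {\<one>}))"
    proof (rule card_UN_disjoint)
      show "\<forall>R\<in>subs G 3. finite (R - {\<one>})" using sub_finite subsD(1) by blast
      show "\<forall>R\<in>subs G 3. \<forall>S\<in>subs G 3. R \<noteq> S \<longrightarrow> (R - {\<one>}) \<inter> (S - {\<one>}) = {}"
      proof (intro ballI impI)
        fix R S assume RS: "R \<in> subs G 3" "S \<in> subs G 3" "R \<noteq> S"
        have R: "subgroup R G" "card R = 3" and S: "subgroup S G" "card S = 3" using RS by (auto simp: subs_def)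
        have I: "subgroup (R \<inter> S) G" by (rule subgroups_Inter_pair[OF R(1) S(1)])
        have "card (R \<inter> S) dvd 3" using card_sub_dvd_sub[OF I R(1)] R(2) by simp
        then have "card (R \<inter> S) = 1 \<or> card (R \<inter> S) = 3" using p3 by (metis prime_nat_iff)
        moreover have "card (R \<inter> S) \<noteq> 3"
        proof
          assume "card (R \<inter> S) = 3"
          then have "R \<inter> S = R" "R \<inter> S = S" using sub_eqI[OF R(1), of "R \<inter> S"] sub_eqI[OF S(1), of "R \<inter> S"] R(2) S(2) by auto
          then show False using RS(3) by simp
        qed
        ultimately have "R \<inter> S \<in> subs G 1" using I by (auto simp: subs_def)
        then show "(R - {\<one>}) \<inter> (S - {\<one>}) = {}" unfolding subs_1 by blast
      qed
    qed simp
    also have "\<dots> = (\<Sum>R\<in>subs G 3. 2)"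
      by (rule sum.cong) (auto simp: subs_def sub_one sub_finite card_Diff_subset)
    also have "\<dots> = 8" using c4 unfolding s3 by simp
    finally have U8: "card ?U = 8" .
    have Uc: "?U \<subseteq> carrier G" using sub_carrier subsD(1) by blast
    have cD: "card (carrier G - ?U) = 4"
      using card_Diff_subset[OF finite_subset[OF Uc fin] Uc] U8 n cu' u4 by (simp add: order_def)
    have "P' = carrier G - ?U" if P': "P' \<in> syl 2" for P'
    proof (rule card_subset_eq)
      have P's: "subgroup P' G" "card P' = 4" using sylD[OF P'] u4 unfolding u_def a_def by auto
      show "finite (carrier G - ?U)" using fin by simp
      show "card P' = card (carrier G - ?U)" using P's(2) cD by simp
      show "P' \<subseteq> carrier G - ?U"
      proof
        fix x assume x: "x \<in> P'"
        have "x \<notin> R - {\<one>}" if R: "R \<in> subs G 3" for R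
        proof -
          have "coprime (4::nat) 3" using coprime_Suc_left_nat[of 3] by simp
          then have "P' \<inter> R = {\<one>}" using coprime_Int[OF P's(1) subsD(1)[OF R]] P's(2) subsD(2)[OF R] by simp
          then show ?thesis using x by blast
        qed
        then show "x \<in> carrier G - ?U" using x sub_carrier[OF P's(1)] by blast
      qed
    qed
    then have "syl 2 \<subseteq> {carrier G - ?U}" by blast
    then have "card (syl 2) \<le> card {carrier G - ?U}" by (rule card_mono[rotated]) simp
    then show False using k by simp
  qed
qed

text \<open>Suppose \<open>Nm P\<close> is larger than P. The subgroups known so far leave at most
  three for any further odd order (\<open>few\<close>). Hence the normal Sylow 3-subgroup Q is
  cyclic, and it turns out to have order 3; the Sylow subgroups for primes above 3 are normal. A
  prime r dividing the index of P in \<open>Nm P\<close> is at least 5, and its Sylow subgroup is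
  cyclic and contained in \<open>Nm P\<close>, so it commutes with all Sylow subgroups: r is a
  central cyclic prime.\<close>

lemma nonnormal_sylow_two_3:
  assumes P: "P \<in> syl 2" and k: "card (syl 2) = 3" and s: "subgroup_count G \<le> 12"
    and pi: "central_cyclic_primes G = {}"
  shows "Nm P = P"
proof (rule ccontr)
  assume NP: "Nm P \<noteq> P"
  have p: "nprime 2" and p3: "nprime 3" by simp_all
  define a where "a = multiplicity 2 (order G)"
  define mu where "mu = multiplicity 3 (order G)"
  let ?c = "card (Nm P)"
  have n3: "card (syl 3) = 1" by (rule nonnormal_sylow_two_3_normal[OF P k s])
  have n: "order G = 3 * ?c" using card_syl_index[OF p P] k by simp
  have Ps: "subgroup P G" "card P = 2 ^ a" using sylD[OF P] unfolding a_def by auto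
  note Pc = sub_carrier[OF Ps(1)]
  have Ns: "subgroup (Nm P) G" by (rule Nm_subgroup[OF Pc])
  have pac: "2 ^ a dvd ?c" using card_sub_dvd_sub[OF Ps(1) Ns Nm_self[OF Ps(1)]] Ps(2) by simp
  have "2 dvd order G" using card_syl_ge(3)[OF p] k by simp
  then have a1: "1 \<le> a" using prime_power_dvd_order_le[OF p, of 1] unfolding a_def by simp
  have m1: "1 \<le> mu" using prime_power_dvd_order_le[OF p3, of 1] n unfolding mu_def by simp
  define u where "u = (2::nat) ^ a"
  define v where "v = (3::nat) ^ mu"
  have u: "even u" "2 \<le> u" unfolding u_def using a1 power_increasing[of 1 a "2::nat"] by auto
  have v: "odd v" "3 \<le> v" unfolding v_def using m1 power_increasing[of 1 mu "3::nat"] by auto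
  have ce: "even ?c" using pac u(1) unfolding u_def by (rule dvd_trans[rotated])
  have c0: "0 < ?c" by (rule sub_card_pos[OF Ns])
  have uc: "u \<le> ?c" using pac c0 unfolding u_def by (rule dvd_imp_le)
  have uc': "u \<noteq> ?c" using sub_eqI[OF Ns Nm_self[OF Ps(1)]] Ps(2) NP unfolding u_def by auto
  have cu: "card (subs G u) = 3" using k unfolding syl_def u_def a_def .
  have cv: "card (subs G v) = 1" using n3 unfolding syl_def v_def mu_def .
  have co: "card (subs G (3 * ?c)) = 1" using subs_order n by simp
  have cc: "3 \<le> card (subs G ?c)" using card_syl_le_subs_Nm[OF p P] k by simp
  \<comment> \<open>The orders 1, |G|, |P|, |Nm P|, v already account for 1 + 1 + 3 + 3 + 1
    subgroups.\<close>
  have few: "card (subs G w) \<le> 3" if w: "odd w" "w \<noteq> 1" "w \<noteq> v" for w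
  proof -
    have "distinct [1, 3 * ?c, u, ?c, v, w]"
    proof -
      have "w \<noteq> 3 * ?c" "w \<noteq> u" "w \<noteq> ?c" "v \<noteq> 3 * ?c" "v \<noteq> u" "v \<noteq> ?c" using w(1) v(1) u(1) ce by auto
      moreover have "3 * ?c \<noteq> u" "3 * ?c \<noteq> ?c" "1 \<noteq> 3 * ?c" "1 \<noteq> u" "1 \<noteq> ?c" "1 \<noteq> v"
        using u(2) v(2) uc c0 by linarith+
      ultimately show ?thesis using uc' w(2,3) by simp
    qed
    then have "sum_list (map (\<lambda>m. card (subs G m)) [1, 3 * ?c, u, ?c, v, w]) \<le> subgroup_count G" by (rule count_list_le)
    then show ?thesis using subs_1 co cu cv cc s by simp
  qed
  obtain Q where Q: "Q \<in> syl 3" using sylow_exists[OF p3] by blast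
  have Qs: "subgroup Q G" "card Q = v" using sylD[OF Q] unfolding v_def mu_def by auto
  have NQ: "Nm Q = carrier G" using Nm_eq_carrier_of_unique[of Q v] Q n3 unfolding syl_def v_def mu_def by blast
  have PQ: "P \<inter> Q = {\<one>}"
  proof (rule coprime_Int[OF Ps(1) Qs(1)])
    show "coprime (card P) (card Q)" unfolding Ps(2) Qs(2) v_def by simp
  qed
  have "\<exists>x\<in>Q. ord x = card Q"
  proof (rule ccontr)
    assume nc: "\<not> ?thesis"
    note mx = noncyclic_sub_maximals[OF p3 Qs(1) Qs(2)[unfolded v_def] nc]
    have "card {D \<in> subs G (3 ^ (mu - 1)). D \<subseteq> Q} \<le> card (subs G (3 ^ (mu - 1)))" by (rule card_mono) auto
    then have "4 \<le> card (subs G (3 ^ (mu - 1)))" using mx(1) by simp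
    moreover have "(3::nat) ^ (mu - 1) \<noteq> v" unfolding v_def using m1 by (simp add: power_inject_exp)
    moreover have "(3::nat) ^ (mu - 1) \<noteq> 1" using mx(2) by simp
    ultimately show False using few[of "3 ^ (mu - 1)"] by simp
  qed
  then obtain b where b: "b \<in> Q" "ord b = 3 ^ mu" using Qs(2) unfolding v_def by auto
  have bc: "b \<in> carrier G" using b(1) sub_carrier[OF Qs(1)] by blast
  have gb: "generate G {b} = Q" by (rule sub_eqI[OF Qs(1) gen_sub[OF Qs(1) b(1)]]) (use card_gen[OF bc] b(2) Qs(2) v_def in simp)
  \<comment> \<open>If 9 divided |G|, the subgroup \<open>Nm P\<close>, of index 3, would contain a
    subgroup of order 3. This commutes with P, hence so does the whole cyclic group Q; then Q lies
    in \<open>Nm P\<close>, and 3 divides |G| once too often.\<close>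
  have m: "mu = 1"
  proof (rule ccontr)
    assume "mu \<noteq> 1"
    then have m2: "2 \<le> mu" using m1 by simp
    have "3 ^ mu dvd order G" unfolding mu_def by (rule sylow_order_dvd)
    moreover have "3 ^ mu = 3 * (3::nat) ^ (mu - 1)" using m1 by (simp add: power_eq_if)
    ultimately have "3 * 3 ^ (mu - 1) dvd 3 * ?c" using n by simp
    then have "3 ^ (mu - 1) dvd ?c" by simp
    moreover have "3 ^ 1 dvd (3::nat) ^ (mu - 1)" by (rule le_imp_power_dvd) (use m2 in simp)
    ultimately have "3 ^ 1 dvd ?c" by (rule dvd_trans[rotated])
    then obtain R where R: "R \<in> subs G (3 ^ 1)" "R \<subseteq> Nm P" using exists_prime_power_subgroup_in[OF p3 Ns] by blast
    have RQ: "R \<subseteq> Q" by (rule normal_sylow_contains[OF p3 Q NQ R(1)])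
    have Rs: "subgroup R G" "card R = 3" using R(1) by (auto simp: subs_def)
    have "R \<noteq> {\<one>}" using Rs(2) by auto
    then obtain z where z: "z \<in> R" "z \<noteq> \<one>" using sub_one[OF Rs(1)] by blast
    have zc: "z \<in> carrier G" using z(1) sub_carrier[OF Rs(1)] by blast
    have oz: "ord z = 3" using ord_dvd_sub[OF Rs(1) z(1)] Rs(2) ord_eq_1[OF zc] z(2) p3 by (metis prime_nat_iff)
    \<comment> \<open>This group and P normalize each other and meet trivially, so they commute
      elementwise.\<close>
    let ?M = "Q \<inter> Nm P"
    have Ms: "subgroup ?M G" by (rule subgroups_Inter_pair[OF Qs(1) Ns])
    have PM: "P \<subseteq> Nm ?M"
    proof
      fix x assume x: "x \<in> P"
      have xN: "x \<in> Nm P" using x Nm_self[OF Ps(1)] by blast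
      show "x \<in> Nm ?M"
      proof (rule NmI[OF _ Ms])
        show xc: "x \<in> carrier G" using x Pc by blast
        fix h assume h: "h \<in> ?M"
        have "x \<otimes> h \<otimes> inv x \<in> Q" using Nm_conj[of x Q h] NQ xc h by blast
        moreover have "x \<otimes> h \<otimes> inv x \<in> Nm P"
          using subgroup.m_closed[OF Ns] subgroup.m_inv_closed[OF Ns] xN h by blast
        ultimately show "x \<otimes> h \<otimes> inv x \<in> ?M" by blast
      qed
    qed
    have comm: "z \<otimes> x = x \<otimes> z" if x: "x \<in> P" for x
      by (rule Nm_eq_commute[OF Ms Ps(1) _ PM]) (use PQ sub_one[OF Ms] sub_one[OF Ps(1)] z(1) RQ R(2) x in auto)
    have bx: "b \<otimes> x = x \<otimes> b" if x: "x \<in> P" for x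
    proof (rule coprime_automorphism_cyclic[OF bc b(2) _ _ _ _ _ p3])
      show xc: "x \<in> carrier G" using x Pc by blast
      show "inv x \<in> Nm (generate G {b})" unfolding gb NQ using xc by simp
      show "x [^] (2 ^ a :: nat) = \<one>" using ord_dvd_sub[OF Ps(1) x] Ps(2) pow_eq_id[OF xc] by simp
      show "coprime (2 ^ a) (3::nat)" by simp
      show "3 = (2::nat) \<or> (\<exists>z\<in>generate G {b}. ord z = 3 \<and> z \<otimes> x = x \<otimes> z)"
        unfolding gb using z(1) RQ oz comm[OF x] by blast
    qed (use m1 in simp)
    have "b \<in> Nm P"
    proof (rule NmI[OF bc Ps(1)])
      fix h assume h: "h \<in> P"
      then have "h \<in> carrier G" using Pc by blast
      then have "b \<otimes> h \<otimes> inv b = h" using bx[OF h] bc by (simp add: m_assoc)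
      then show "b \<otimes> h \<otimes> inv b \<in> P" using h by simp
    qed
    then have "3 ^ mu dvd ?c" using ord_dvd_sub[OF Ns] b(2) by metis
    then have "3 ^ Suc mu dvd order G" unfolding n by simp
    then have "Suc mu \<le> mu" unfolding mu_def by (rule prime_power_dvd_order_le[OF p3])
    then show False by simp
  qed
  have v3: "v = 3" unfolding v_def m by simp
  have nor: "card (syl l) = 1" if l: "nprime l" "l \<noteq> 2" "l \<noteq> 3" for l
  proof (rule ccontr)
    assume nl: "card (syl l) \<noteq> 1"
    have lo: "odd l" using prime_odd_nat[OF l(1)] prime_ge_2_nat[OF l(1)] l(2) by linarith
    have "l dvd order G" by (rule card_syl_ge(3)[OF l(1) nl])
    then have e: "1 \<le> multiplicity l (order G)" using prime_power_dvd_order_le[OF l(1), of 1] by simp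
    have "l ^ multiplicity l (order G) \<noteq> 1" using e prime_gt_1_nat[OF l(1)] by simp
    moreover have "l ^ multiplicity l (order G) \<noteq> v"
    proof
      assume "l ^ multiplicity l (order G) = v"
      then have "l dvd 3" using e v3 by (metis dvd_power less_le_trans zero_less_one)
      then show False using primes_dvd_imp_eq[OF l(1) p3] l(3) by simp
    qed
    ultimately have "card (syl l) \<le> 3" unfolding syl_def using few[of "l ^ multiplicity l (order G)"] lo by simp
    then show False using card_syl_ge(1)[OF l(1) nl] prime_ge_2_nat[OF l(1)] l(2,3) by linarith
  qed
  obtain w where w: "?c = u * w" using pac unfolding u_def by (rule dvdE)
  then have "w \<noteq> 1" using uc' by auto
  then obtain r where r: "nprime r" "r dvd w" using prime_factor_nat by blast
  have r2: "r \<noteq> 2"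
  proof
    assume "r = 2"
    then obtain w' where "w = 2 * w'" using r(2) by (auto elim: dvdE)
    then have "order G = 2 ^ Suc a * (3 * w')" using n w u_def by simp
    then have "2 ^ Suc a dvd order G" by (metis dvd_triv_left)
    then have "Suc a \<le> a" unfolding a_def by (rule prime_power_dvd_order_le[OF p])
    then show False by simp
  qed
  have r3: "r \<noteq> 3"
  proof
    assume "r = 3"
    then have "3 ^ 2 dvd order G" unfolding n w using r(2) by (auto simp: power2_eq_square intro: mult_dvd_mono)
    then have "2 \<le> mu" unfolding mu_def by (rule prime_power_dvd_order_le[OF p3])
    then show False using m by simp
  qed
  have ro: "odd r" using prime_odd_nat[OF r(1)] prime_ge_2_nat[OF r(1)] r2 by linarith
  have rn: "r dvd order G" unfolding n w using r(2) by simp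
  let ?e = "multiplicity r (order G)"
  have e1: "1 \<le> ?e" using prime_power_dvd_order_le[OF r(1), of 1] rn by simp
  have norm: "L \<in> syl l \<Longrightarrow> nprime l \<Longrightarrow> l \<noteq> 2 \<Longrightarrow> Nm L = carrier G" for l L
    using Nm_eq_carrier_of_unique[of L] nor[of l] n3 unfolding syl_def by metis
  obtain R where R: "R \<in> syl r" using sylow_exists[OF r(1)] by blast
  have Rs: "subgroup R G" "card R = r ^ ?e" using sylD[OF R] by auto
  have NR: "Nm R = carrier G" by (rule norm[OF R r(1) r2])
  have "\<exists>x\<in>R. ord x = card R"
  proof (rule ccontr)
    assume nc: "\<not> ?thesis"
    note mx = noncyclic_sub_maximals[OF r(1) Rs nc]
    have "card {D \<in> subs G (r ^ (?e - 1)). D \<subseteq> R} \<le> card (subs G (r ^ (?e - 1)))" by (rule card_mono) auto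
    then have "4 \<le> card (subs G (r ^ (?e - 1)))" using mx(1) prime_ge_2_nat[OF r(1)] r2 by linarith
    moreover have "r ^ (?e - 1) \<noteq> v"
    proof
      assume "r ^ (?e - 1) = v"
      then have "r dvd 3" using mx(2) v3 by (metis dvd_power less_le_trans zero_less_diff zero_less_one one_less_numeral_iff semiring_norm(76))
      then show False using primes_dvd_imp_eq[OF r(1) p3] r3 by simp
    qed
    moreover have "r ^ (?e - 1) \<noteq> 1" using mx(2) prime_gt_1_nat[OF r(1)] by simp
    ultimately show False using few[of "r ^ (?e - 1)"] ro by simp
  qed
  then obtain g where g: "g \<in> R" "ord g = card R" by blast
  have gc: "g \<in> carrier G" using g(1) sub_carrier[OF Rs(1)] by blast
  have gg: "generate G {g} = R" by (rule sub_eqI[OF Rs(1) gen_sub[OF Rs(1) g(1)]]) (use card_gen[OF gc] g(2) in simp)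
  \<comment> \<open>\<open>Nm P\<close> has index 3, prime to r, so it contains a full Sylow
    r-subgroup, which can only be R.\<close>
  have RN: "R \<subseteq> Nm P"
  proof -
    have "r ^ ?e dvd 3 * ?c" using sylow_order_dvd[of r] n by simp
    moreover have "coprime (r ^ ?e) 3" using primes_coprime[OF r(1) p3] r3 by simp
    ultimately have "r ^ ?e dvd ?c" by (simp add: coprime_dvd_mult_right_iff)
    then obtain R' where R': "R' \<in> subs G (r ^ ?e)" "R' \<subseteq> Nm P" using exists_prime_power_subgroup_in[OF r(1) Ns] by blast
    have "R' \<subseteq> R" by (rule normal_sylow_contains[OF r(1) R NR R'(1)])
    then have "R' = R" using sub_eqI[OF Rs(1)] Rs(2) R'(1) by (auto simp: subs_def)
    then show ?thesis using R'(2) by simp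
  qed
  have "r \<in> central_cyclic_primes G"
  proof (rule central_cyclic_primeI[OF r(1) rn gc])
    show "generate G {g} \<in> syl r" using gg R by simp
    fix l assume l: "nprime l" "l dvd order G"
    show "\<exists>L\<in>syl l. \<forall>x\<in>L. x \<otimes> g = g \<otimes> x"
    proof (cases "l = r")
      case True
      have "x \<otimes> g = g \<otimes> x" if xR: "x \<in> R" for x
      proof -
        obtain k :: nat where "x = g [^] k" using xR gg gen_eq[OF gc] by auto
        then show ?thesis using nat_pow_comm[OF gc, of k 1] gc by simp
      qed
      then show ?thesis using R True by blast
    next
      case False
      show ?thesis
      proof (cases "l = 2")
        case True
        have "x \<otimes> g = g \<otimes> x" if "x \<in> P" for x
          by (rule sylow_commute[OF p r(1) _ P R _ RN that g(1)]) (use r2 NR Pc in auto)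
        then show ?thesis using P True by blast
      next
        case l2: False
        obtain L where L: "L \<in> syl l" using sylow_exists[OF l(1)] by blast
        have "x \<otimes> g = g \<otimes> x" if "x \<in> L" for x
          by (rule sylow_commute[OF l(1) r(1) False L R _ _ that g(1)])
            (use norm[OF L l(1) l2] NR sub_carrier[OF sylD(1)[OF L]] sub_carrier[OF Rs(1)] in auto)
        then show ?thesis using L by blast
      qed
    qed
  qed
  then show False using pi by simp
qed

end

context fin_group
begin

text \<open>The number of conjugates is odd, at least 3, at most 9 and not 9. For 3 the hypothesis
  on central Sylow subgroups is what makes P self-normalizing.\<close>

lemma nonnormal_sylow_two:
  assumes P: "P \<in> syl 2" and k: "card (syl 2) \<noteq> 1" and s: "subgroup_count G \<le> 12"
    and pi: "central_cyclic_primes G = {}"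
  shows "\<exists>q a. q \<in> {3, 5, 7} \<and> card (syl 2) = q \<and> card P = 2 ^ a \<and> order G = 2 ^ a * q \<and> Nm P = P \<and>
    card (syl q) = 1 \<and> syl q = subs G q"
proof -
  have p: "nprime 2" and p3: "nprime 3" by simp_all
  note ge = card_syl_ge[OF p k]
  have "card (syl 2) \<le> 9" by (rule nonnormal_sylow(1)[OF p P k s])
  moreover have "3 \<le> card (syl 2)" "odd (card (syl 2))" using ge(1,2) by (simp_all add: odd_iff_mod_2_eq_one)
  moreover have "card (syl 2) \<noteq> 9" using nonnormal_sylow_not_6_8_9[OF p P _ s] by blast
  ultimately have "card (syl 2) = 3 \<or> card (syl 2) = 5 \<or> card (syl 2) = 7" by presburger
  then show ?thesis
  proof
    assume k3: "card (syl 2) = 3"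
    have N: "Nm P = P" by (rule nonnormal_sylow_two_3[OF P k3 s pi])
    have o: "order G = 2 ^ multiplicity 2 (order G) * 3" using order_of_self_normalizing_sylow[OF p P N] k3 by simp
    have "syl 3 = subs G 3" by (rule syl_prime_factor[OF p p3 _ o]) simp
    then show ?thesis using N o k3 sylD(2)[OF P] nonnormal_sylow_two_3_normal[OF P k3 s]
      by (intro exI[of _ 3] exI[of _ "multiplicity 2 (order G)"] conjI) (assumption | simp)+
  next
    assume k57: "card (syl 2) = 5 \<or> card (syl 2) = 7"
    note N = nonnormal_sylow_5_7[OF p P refl k57 s]
    have "card (syl 2) \<in> {3, 5, 7}" using k57 by auto
    then show ?thesis using N sylD(2)[OF P]
      by (intro exI[of _ "card (syl 2)"] exI[of _ "multiplicity 2 (order G)"] conjI) (assumption | rule refl)+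
  qed
qed

text \<open>A Sylow 2-subgroup Q is normal, since otherwise \<open>nonnormal_sylow_two\<close> would
  make the Sylow 3-subgroup normal. It is not cyclic: a 3-group acts trivially on a cyclic 2-group,
  and Q would then lie in \<open>Nm P\<close>, of index 4. Counting gives \<open>Nm P = P\<close>,
  so Q is a Klein four-group and |G| = 4 times 3^a. For a = 1 this is A_4; for a >= 2 the
  centralizer in P of an involution of Q yields too many subgroups.\<close>

lemma nonnormal_sylow_three_4:
  assumes P: "P \<in> syl 3" and k: "card (syl 3) = 4" and s: "subgroup_count G \<le> 12"
    and pi: "central_cyclic_primes G = {}"
  shows "small_type G"
proof -
  have p: "nprime 3" and p2: "nprime 2" by simp_all
  define a where "a = multiplicity 3 (order G)"
  define mu where "mu = multiplicity 2 (order G)"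
  let ?c = "card (Nm P)"
  have n: "order G = 4 * ?c" using card_syl_index[OF p P] k by simp
  have Ps: "subgroup P G" "card P = 3 ^ a" using sylD[OF P] unfolding a_def by auto
  note Pc = sub_carrier[OF Ps(1)]
  have Ns: "subgroup (Nm P) G" by (rule Nm_subgroup[OF Pc])
  have pac: "3 ^ a dvd ?c" using card_sub_dvd_sub[OF Ps(1) Ns Nm_self[OF Ps(1)]] Ps(2) by simp
  have "3 dvd order G" using card_syl_ge(3)[OF p] k by simp
  then have a1: "1 \<le> a" using prime_power_dvd_order_le[OF p, of 1] unfolding a_def by simp
  have mu2: "2 \<le> mu" unfolding mu_def by (rule prime_power_dvd_order_le[OF p2]) (simp add: n)
  define u where "u = (3::nat) ^ a"
  have u: "3 dvd u" "2 \<le> u" unfolding u_def using a1 power_increasing[of 1 a "3::nat"] by auto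
  have ce: "3 dvd ?c" using pac u(1) unfolding u_def by (rule dvd_trans[rotated])
  have c0: "0 < ?c" by (rule sub_card_pos[OF Ns])
  have uc: "u \<le> ?c" using pac c0 unfolding u_def by (rule dvd_imp_le)
  have cu: "card (subs G u) = 4" using k unfolding syl_def u_def a_def .
  have co: "card (subs G (4 * ?c)) = 1" using subs_order n by simp
  obtain Q where Q: "Q \<in> syl 2" using sylow_exists[OF p2] by blast
  have n2: "card (syl 2) = 1"
  proof (rule ccontr)
    assume k2: "card (syl 2) \<noteq> 1"
    obtain q b where q: "q \<in> {3, 5, 7}" "order G = 2 ^ b * q" "card (syl q) = 1"
      using nonnormal_sylow_two[OF Q k2 s pi] by blast
    have "3 dvd 2 ^ b * q" using \<open>3 dvd order G\<close> q(2) by simp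
    moreover have "\<not> 3 dvd (2::nat) ^ b" using prime_dvd_power[OF p, of 2 b] by auto
    ultimately have "3 dvd q" using p by (simp add: prime_dvd_mult_iff)
    then have "q = 3" using q(1) by auto
    then show False using q(3) k by simp
  qed
  have Qs: "subgroup Q G" "card Q = 2 ^ mu" using sylD[OF Q] unfolding mu_def by auto
  note Qc = sub_carrier[OF Qs(1)]
  have NQ: "Nm Q = carrier G" using Nm_eq_carrier_of_unique[of Q "card Q"] Q n2 sylD(2)[OF Q] unfolding syl_def by simp
  have coPQ: "coprime (card P) (card Q)" unfolding Ps(2) Qs(2) by simp
  have PQ: "P \<inter> Q = {\<one>}" by (rule coprime_Int[OF Ps(1) Qs(1) coPQ])
  have commP: "y \<in> Nm P" if y: "y \<in> carrier G" "\<And>x. x \<in> P \<Longrightarrow> y \<otimes> x = x \<otimes> y" for y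
  proof (rule NmI[OF y(1) Ps(1)])
    fix h assume h: "h \<in> P"
    then have "h \<in> carrier G" using Pc by blast
    then have "y \<otimes> h \<otimes> inv y = h" using y(2)[OF h] y(1) by (simp add: m_assoc)
    then show "y \<otimes> h \<otimes> inv y \<in> P" using h by simp
  qed
  have ncQ: "\<not> (\<exists>x\<in>Q. ord x = card Q)"
  proof
    assume "\<exists>x\<in>Q. ord x = card Q"
    then obtain g where g: "g \<in> Q" "ord g = 2 ^ mu" using Qs(2) by auto
    have gc: "g \<in> carrier G" using g(1) Qc by blast
    have gg: "generate G {g} = Q" by (rule sub_eqI[OF Qs(1) gen_sub[OF Qs(1) g(1)]]) (use card_gen[OF gc] g(2) Qs(2) in simp)
    have "g \<otimes> x = x \<otimes> g" if x: "x \<in> P" for x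
    proof (rule coprime_automorphism_cyclic[OF gc g(2) _ _ _ _ _ p2])
      show xc: "x \<in> carrier G" using x Pc by blast
      show "inv x \<in> Nm (generate G {g})" unfolding gg NQ using xc by simp
      show "x [^] (3 ^ a :: nat) = \<one>" using ord_dvd_sub[OF Ps(1) x] Ps(2) pow_eq_id[OF xc] by simp
      show "coprime (3 ^ a) (2::nat)" by simp
    qed (use mu2 in simp_all)
    then have "g \<in> Nm P" by (rule commP[OF gc])
    then have "2 ^ mu dvd ?c" using ord_dvd_sub[OF Ns] g(2) by metis
    then have "2 * 2 ^ mu dvd 2 * (2 * ?c)" by (intro mult_dvd_mono dvd_refl dvd_mult)
    then have "2 ^ Suc mu dvd order G" using n by simp
    then have "Suc mu \<le> mu" unfolding mu_def by (rule prime_power_dvd_order_le[OF p2])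
    then show False by simp
  qed
  note mx = noncyclic_sub_maximals[OF p2 Qs ncQ]
  have "card {D \<in> subs G (2 ^ (mu - 1)). D \<subseteq> Q} \<le> card (subs G (2 ^ (mu - 1)))" by (rule card_mono) auto
  then have c3: "3 \<le> card (subs G (2 ^ (mu - 1)))" using mx(1) by simp
  have cQ: "card (subs G (2 ^ mu)) = 1" using n2 unfolding syl_def mu_def .
  have n32: "\<not> 3 dvd (2::nat) ^ i" for i using prime_dvd_power[OF p, of 2 i] by auto
  \<comment> \<open>Otherwise the orders 1, |G|, |P|, |Nm P|, |Q|, |Q| / 2 contribute at least 1 + 1
    + 4 + 4 + 1 + 3 = 14.\<close>
  have N: "Nm P = P"
  proof (rule ccontr)
    assume "Nm P \<noteq> P"
    then have uc': "u \<noteq> ?c" using sub_eqI[OF Ns Nm_self[OF Ps(1)]] Ps(2) unfolding u_def by auto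
    define e where "e = (2::nat) ^ (mu - 1)"
    have e2: "2 ^ mu = 2 * e" unfolding e_def using mu2 by (simp add: power_eq_if)
    have e1: "1 < e" unfolding e_def by (rule one_less_power) (use mu2 in auto)
    have "\<not> 3 dvd e" "\<not> 3 dvd 2 * e" using n32[of "mu - 1"] n32[of mu] unfolding e_def[symmetric] e2 by auto
    then have "e \<noteq> 4 * ?c" "e \<noteq> u" "e \<noteq> ?c" "2 * e \<noteq> 4 * ?c" "2 * e \<noteq> u" "2 * e \<noteq> ?c"
      using u(1) ce by (metis dvd_mult)+
    moreover have "4 * ?c \<noteq> u" "4 * ?c \<noteq> ?c" "1 \<noteq> 4 * ?c" "1 \<noteq> u" "1 \<noteq> ?c" "1 \<noteq> e" "1 \<noteq> 2 * e" "2 * e \<noteq> e"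
      using u(2) uc c0 e1 by linarith+
    ultimately have "distinct [1, 4 * ?c, u, ?c, 2 * e, e]" using uc' by auto
    then have "sum_list (map (\<lambda>m. card (subs G m)) [1, 4 * ?c, u, ?c, 2 * e, e]) \<le> subgroup_count G"
      by (rule count_list_le)
    moreover have "4 \<le> card (subs G ?c)" using card_syl_le_subs_Nm[OF p P] k by simp
    ultimately show False using subs_1 co cu cQ c3 s unfolding e2 e_def[symmetric] by simp
  qed
  have cc: "?c = u" using N Ps(2) unfolding u_def by simp
  have nu: "order G = 4 * u" using n cc by simp
  have mu: "mu = 2"
  proof -
    have "2 ^ mu dvd 4 * u" using sylow_order_dvd[of 2] nu unfolding mu_def by simp
    moreover have "coprime ((2::nat) ^ mu) u" unfolding u_def by simp
    ultimately have "(2::nat) ^ mu dvd 2 ^ 2" by (simp add: coprime_dvd_mult_left_iff)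
    then have "mu \<le> 2" by (rule power_dvd_imp_le) simp
    then show ?thesis using mu2 by simp
  qed
  have Q4: "card Q = 4" using Qs(2) mu by simp
  have Qsq: "x \<otimes> x = \<one>" if x: "x \<in> Q" for x
  proof -
    have xc: "x \<in> carrier G" using x Qc by blast
    have "ord x dvd 2 ^ 2" using ord_dvd_sub[OF Qs(1) x] Q4 by simp
    then obtain i where i: "i \<le> 2" "ord x = 2 ^ i" using prime_power_dvd_imp[OF p2] by blast
    moreover have "i \<noteq> 2" using ncQ x i(2) Q4 by auto
    ultimately have "i \<le> 1" by simp
    then have "ord x dvd 2 ^ 1" unfolding i(2) by (rule le_imp_power_dvd)
    then show ?thesis using pow_eq_id[OF xc, of 2] nat_pow_2[OF xc] by simp
  qed
  have "Q \<noteq> {\<one>}" using Q4 by auto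
  then obtain w where w: "w \<in> Q" "w \<noteq> \<one>" using sub_one[OF Qs(1)] by blast
  have wc: "w \<in> carrier G" using w Qc by blast
  have nofix: "\<not> (\<forall>x\<in>P. y \<otimes> x = x \<otimes> y)" if y: "y \<in> Q" "y \<noteq> \<one>" for y
  proof
    assume "\<forall>x\<in>P. y \<otimes> x = x \<otimes> y"
    then have "y \<in> Nm P" using commP[of y] y Qc by blast
    then show False using N PQ y by blast
  qed
  show ?thesis
  proof (cases "a = 1")
    case True
    have o12: "order G = 12" using nu True unfolding u_def by simp
    have P3: "card P = 3" using Ps(2) True by simp
    then have "P \<noteq> {\<one>}" by auto
    then obtain t where t: "t \<in> P" "t \<noteq> \<one>" using sub_one[OF Ps(1)] by blast
    have tc: "t \<in> carrier G" using t Pc by blast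
    have ot: "ord t = 3" using ord_dvd_sub[OF Ps(1) t(1)] P3 ord_eq_1[OF tc] t(2) p by (metis prime_nat_iff)
    have gt: "generate G {t} = P" by (rule sub_eqI[OF Ps(1) gen_sub[OF Ps(1) t(1)]]) (use card_gen[OF tc] ot P3 in simp)
    have ttt: "t \<otimes> t \<otimes> t = \<one>" using pow_ord_eq_1[OF tc] ot nat_pow_3[OF tc] by simp
    have ncomm: "y \<otimes> t \<noteq> t \<otimes> y" if y: "y \<in> Q" "y \<noteq> \<one>" for y
    proof
      assume c: "y \<otimes> t = t \<otimes> y"
      have yc: "y \<in> carrier G" using y Qc by blast
      have ty: "t \<otimes> y = y \<otimes> t [^] (1::nat)" using c tc by simp
      have "y \<otimes> x = x \<otimes> y" if xP: "x \<in> P" for x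
      proof -
        obtain i :: nat where "x = t [^] i" using xP gt gen_eq[OF tc] by auto
        then show ?thesis using pow_conj_comm[OF yc tc ty, of i 1] yc tc by simp
      qed
      then show False using nofix[OF y] by blast
    qed
    have cjQ: "inv t \<otimes> y \<otimes> t \<in> Q" if "y \<in> Q" for y
      using Nm_conj[of "inv t" Q y] NQ tc that by simp
    \<comment> \<open>w, v, z are the conjugates of w by powers of t and turn out to be the three
      involutions of Q. Neighbours differ because no involution of Q commutes with t, and z = w
      would give v = w by t^3 = 1.\<close>
    define v where "v = inv t \<otimes> w \<otimes> t"
    define z where "z = inv t \<otimes> v \<otimes> t"
    have vQ: "v \<in> Q" and zQ: "z \<in> Q" unfolding v_def z_def using cjQ w(1) by auto
    have vc: "v \<in> carrier G" and zc: "z \<in> carrier G" using vQ zQ Qc by auto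
    have tv: "t \<otimes> v = w \<otimes> t" and tz: "t \<otimes> z = v \<otimes> t"
      using tc wc vc unfolding v_def z_def by (simp_all add: m_assoc[symmetric])
    have v1: "v \<noteq> \<one>"
    proof
      assume "v = \<one>"
      then have "w \<otimes> t = \<one> \<otimes> t" using tv tc by simp
      then show False using w(2) wc tc by simp
    qed
    have vw: "v \<noteq> w" using ncomm[OF w] tv by auto
    have z1: "z \<noteq> \<one>"
    proof
      assume "z = \<one>"
      then have "v \<otimes> t = \<one> \<otimes> t" using tz tc by simp
      then show False using v1 vc tc by simp
    qed
    have zv: "z \<noteq> v" using ncomm[OF vQ v1] tz by auto
    have zw: "z \<noteq> w"
    proof
      assume "z = w"
      then have tw: "t \<otimes> w = v \<otimes> t" using tz by simp
      have "w \<otimes> (t \<otimes> t \<otimes> t) = t \<otimes> v \<otimes> t \<otimes> t" using tv tc wc vc by (simp add: m_assoc[symmetric])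
      also have "\<dots> = t \<otimes> (v \<otimes> t) \<otimes> t" using tc vc by (simp add: m_assoc)
      also have "\<dots> = t \<otimes> (t \<otimes> (w \<otimes> t))" unfolding tw[symmetric] using tc wc by (simp add: m_assoc)
      also have "\<dots> = t \<otimes> t \<otimes> t \<otimes> v" unfolding tv[symmetric] using tc vc by (simp add: m_assoc)
      finally show False using ttt wc vc vw by simp
    qed
    have wvc: "w \<otimes> v = v \<otimes> w"
    proof -
      have i: "inv y = y" if "y \<in> Q" for y using Qsq[OF that] Qc that by (intro inv_equality) auto
      have wvQ: "w \<otimes> v \<in> Q" using subgroup.m_closed[OF Qs(1) w(1) vQ] .
      have "w \<otimes> v = inv (w \<otimes> v)" using i[OF wvQ] by simp
      also have "\<dots> = inv v \<otimes> inv w" by (rule inv_mult_group[OF wc vc])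
      finally show ?thesis using i[OF vQ] i[OF w(1)] by simp
    qed
    have Qeq: "Q = {\<one>, w, v, z}"
    proof (rule card_subset_eq[symmetric])
      show "card {\<one>, w, v, z} = card Q" using w(2) v1 z1 vw zv zw Q4 by auto
    qed (use sub_finite[OF Qs(1)] sub_one[OF Qs(1)] w vQ zQ in auto)
    have "w \<otimes> v \<in> Q" using subgroup.m_closed[OF Qs(1) w(1) vQ] .
    moreover have "w \<otimes> v \<noteq> w" "w \<otimes> v \<noteq> v" using w(2) v1 wc vc by auto
    moreover have "w \<otimes> v \<noteq> \<one>"
    proof
      assume "w \<otimes> v = \<one>"
      then have "w \<otimes> v = w \<otimes> w" using Qsq[OF w(1)] by simp
      then show False using wc vc vw by simp
    qed
    ultimately have "z = w \<otimes> v" using Qeq by blast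
    then have "a4_gens G w v t"
      unfolding a4_gens_def using o12 wc vc tc w(2) v1 vw t(2) Qsq[OF w(1)] Qsq[OF vQ] wvc ttt tv tz by simp
    then have "has_code G None" by (auto simp: has_code_def a4_like_def)
    then show ?thesis unfolding small_type_def
      by (intro bexI[of _ 10] bexI[of _ None]) (simp_all add: listed_codes_def)
  next
    case False
    then have a2: "2 \<le> a" using a1 by simp
    define x where "x = (3::nat) ^ (a - 1)"
    have ux: "u = 3 * x" unfolding u_def x_def using a2 by (simp add: power_eq_if)
    \<comment> \<open>P permutes the three involutions of Q and fixes none, so the orbit
      \<open>?O\<close> of w, of 3-power length, has length 3, and the stabilizer \<open>?D\<close>
      has order x = 3^(a-1).\<close>
    let ?act = "\<lambda>g y. g \<otimes> y \<otimes> inv g"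
    let ?D = "{g \<in> P. ?act g w = w}" and ?O = "(\<lambda>g. ?act g w) ` P"
    have card_eq: "card P = card ?O * card ?D"
    proof (rule orbit_stabilizer_card[OF Ps(1)])
      show "?act \<one> w = w" using wc by simp
      fix g h assume gh: "g \<in> P" "h \<in> P"
      then have c: "g \<in> carrier G" "h \<in> carrier G" using Pc by auto
      show "?act (g \<otimes> h) w = ?act g (?act h w)" using c wc by (simp add: m_assoc inv_mult_group)
      assume "?act g (?act h w) = ?act g w"
      then show "?act h w = w" using c wc by simp
    qed
    have act_iff: "?act g w = w \<longleftrightarrow> g \<otimes> w = w \<otimes> g" if "g \<in> P" for g
    proof -
      have gc: "g \<in> carrier G" using that Pc by blast
      show ?thesis using inv_solve_right[of w "g \<otimes> w" g] gc wc by (auto simp: eq_commute)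
    qed
    have Dcomm: "?D = P \<inter> {g \<in> carrier G. g \<otimes> w = w \<otimes> g}"
    proof (intro equalityI subsetI)
      fix g assume "g \<in> ?D"
      then show "g \<in> P \<inter> {g \<in> carrier G. g \<otimes> w = w \<otimes> g}" using act_iff[of g] Pc by blast
    next
      fix g assume "g \<in> P \<inter> {g \<in> carrier G. g \<otimes> w = w \<otimes> g}"
      then show "g \<in> ?D" using act_iff[of g] by blast
    qed
    have Ds: "subgroup ?D G" unfolding Dcomm
      by (rule subgroups_Inter_pair[OF Ps(1) centralizer_subgroup[OF wc]])
    have "?O \<subseteq> Q - {\<one>}"
    proof
      fix y assume "y \<in> ?O"
      then obtain g where g: "g \<in> P" "y = ?act g w" by auto
      have gc: "g \<in> carrier G" using g Pc by blast
      have "y \<in> Q" using Nm_conj[of g Q w] NQ gc w(1) g(2) by simp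
      moreover have "y \<noteq> \<one>"
      proof
        assume "y = \<one>"
        then have "g \<otimes> w = \<one> \<otimes> g" using g(2) gc wc inv_solve_right[of \<one> "g \<otimes> w" g] by simp
        then show False using gc wc w(2) by simp
      qed
      ultimately show "y \<in> Q - {\<one>}" by simp
    qed
    then have "card ?O \<le> card (Q - {\<one>})" using sub_finite[OF Qs(1)] by (intro card_mono) auto
    then have O3: "card ?O \<le> 3" using Q4 sub_one[OF Qs(1)] sub_finite[OF Qs(1)] by (simp add: card_Diff_subset)
    define k where "k = card ?O"
    have "k dvd 3 ^ a" unfolding k_def Ps(2)[symmetric] card_eq by (rule dvd_triv_left)
    then obtain i where i: "card ?O = 3 ^ i" using prime_power_dvd_imp[OF p] unfolding k_def by blast
    have "i \<noteq> 0"
    proof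
      assume "i = 0"
      then obtain y where y: "?O = {y}" using i card_1_singletonE by (metis power_0)
      have "?act \<one> w \<in> ?O" using sub_one[OF Ps(1)] by blast
      then have "?O = {w}" using y wc by simp
      then have "?D = P" by blast
      have "\<forall>g\<in>P. w \<otimes> g = g \<otimes> w"
      proof
        fix g assume g: "g \<in> P"
        then have "g \<in> ?D" using \<open>?D = P\<close> by blast
        then show "w \<otimes> g = g \<otimes> w" using act_iff[OF g] by simp
      qed
      then show False using nofix[OF w] by blast
    qed
    moreover have "i \<le> 1"
    proof (rule power_le_imp_le_exp)
      show "1 < (3::nat)" by simp
      show "(3::nat) ^ i \<le> 3 ^ 1" using O3 i by simp
    qed
    ultimately have "card ?O = 3" using i by (cases i) auto
    then have cD: "card ?D = x" using card_eq Ps(2) ux unfolding u_def by simp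
    have x3: "3 dvd x" unfolding x_def using a2 by simp
    have x0: "0 < x" unfolding x_def by simp
    have xo: "odd x" unfolding x_def by simp
    have c1: "1 \<le> card (subs G x)" using card_subs_pos[OF Ds] cD by simp
    have "?D \<in> {D \<in> subs G x. D \<subseteq> P}" using Ds cD by (auto simp: subs_def)
    then have "0 < card {D \<in> subs G x. D \<subseteq> P}" using card_gt_0_iff finite_subs by (metis (no_types, lifting) empty_iff finite_Collect_conjI mem_Collect_eq finite_subset subsetI)
    then have c4: "1 \<le> card (subs G (4 * x))" using card_subs_mult_normal[OF Ps(1) Qs(1) NQ coPQ, of x] Q4 by (simp add: mult.commute)
    have W: "subgroup (generate G {w}) G" by (rule gen_subgroup[OF wc])
    have "ord w = 2" using ord_prime[OF wc w(2), of 2] Qsq[OF w(1)] nat_pow_2[OF wc] by simp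
    then have cW: "card (generate G {w}) = 2" using card_gen[OF wc] by simp
    have DW: "?D \<subseteq> Nm (generate G {w})"
    proof
      fix g assume g: "g \<in> ?D"
      then have gc: "g \<in> carrier G" using Pc by blast
      show "g \<in> Nm (generate G {w})"
      proof (rule NmI[OF gc W])
        fix h assume h: "h \<in> generate G {w}"
        then obtain j :: nat where j: "h = w [^] j" using gen_eq[OF wc] by auto
        have gw: "w \<otimes> g = g \<otimes> w [^] (1::nat)" using g Dcomm wc by auto
        have "h \<otimes> g = g \<otimes> h" using pow_conj_comm[OF gc wc gw, of j 1] gc wc j by simp
        then have "g \<otimes> h \<otimes> inv g = h" using gc wc j by (metis inv_solve_right m_closed nat_pow_closed)
        then show "g \<otimes> h \<otimes> inv g \<in> generate G {w}" using h by simp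
      qed
    qed
    have "coprime (card (generate G {w})) (card ?D)" unfolding cW cD using xo by simp
    then have "card (generate G {w} <#> ?D) = 2 * x" using card_set_mult_coprime[OF W Ds] cW cD by simp
    then have c2: "1 \<le> card (subs G (2 * x))" using card_subs_pos[OF set_mult_subgroup(1)[OF W Ds DW]] by simp
    have c3': "3 \<le> card (subs G 2)" using c3 mu by simp
    have cQ': "card (subs G 4) = 1" using cQ mu by simp
    have cux: "card (subs G (3 * x)) = 4" using cu ux by simp
    have co': "card (subs G (12 * x)) = 1" using co cc ux by simp
    have "x \<noteq> 1" "x \<noteq> 2" "x \<noteq> 4" using x3 by auto
    \<comment> \<open>The stabilizer and its products with <w> and Q have orders x, 2 x, 4 x. In the
      order of the list the contributions are at least 1 + 1 + 4 + 1 + 3 + 1 + 1 + 1 = 13.\<close>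
    then have "distinct [1, 12 * x, 3 * x, 4, 2, x, 4 * x, 2 * x]" using x0 by auto
    then have "sum_list (map (\<lambda>m. card (subs G m)) [1, 12 * x, 3 * x, 4, 2, x, 4 * x, 2 * x]) \<le> subgroup_count G"
      by (rule count_list_le)
    then have False using subs_1 co' cux cQ' c3' c1 c4 c2 s by simp
    then show ?thesis ..
  qed
qed

text \<open>A cyclic Sylow subgroup would commute with all the others and yield a central cyclic
  prime, so none is cyclic. With x = p^(a-1) and y = q^(b-1) the orders 1, x, y, p x, q y, x q y
  contribute at least 1 + (p + 1) + (q + 1) + 1 + 1 + (p + 1) = 2 p + q + 6 >= 13.\<close>

lemma normal_sylows_p_group:
  assumes nor: "\<And>l. nprime l \<Longrightarrow> card (syl l) = 1" and pi: "central_cyclic_primes G = {}"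
    and s: "subgroup_count G \<le> 12" and p: "nprime p" "p dvd order G" and q: "nprime q" "q dvd order G"
  shows "p = q"
proof (rule ccontr)
  assume pq: "p \<noteq> q"
  have norm: "Nm L = carrier G" if "L \<in> syl l" "nprime l" for l L
    using Nm_eq_carrier_of_unique[of L] nor[OF that(2)] that(1) unfolding syl_def by metis
  have nc: "\<not> (\<exists>x\<in>R. ord x = card R)" if r: "nprime r" "r dvd order G" and R: "R \<in> syl r" for r R
  proof
    assume "\<exists>x\<in>R. ord x = card R"
    then obtain g where g: "g \<in> R" "ord g = card R" by blast
    have Rs: "subgroup R G" by (rule sylD(1)[OF R])
    have gc: "g \<in> carrier G" using g(1) sub_carrier[OF Rs] by blast
    have gg: "generate G {g} = R" by (rule sub_eqI[OF Rs gen_sub[OF Rs g(1)]]) (use card_gen[OF gc] g(2) in simp)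
    have "r \<in> central_cyclic_primes G"
    proof (rule central_cyclic_primeI[OF r gc])
      show "generate G {g} \<in> syl r" using gg R by simp
      fix l assume l: "nprime l" "l dvd order G"
      obtain L where L: "L \<in> syl l" using sylow_exists[OF l(1)] by blast
      show "\<exists>L\<in>syl l. \<forall>x\<in>L. x \<otimes> g = g \<otimes> x"
      proof (cases "l = r")
        case True
        have "x \<otimes> g = g \<otimes> x" if xR: "x \<in> R" for x
        proof -
          obtain k :: nat where "x = g [^] k" using xR gg gen_eq[OF gc] by auto
          then show ?thesis using nat_pow_comm[OF gc, of k 1] gc by simp
        qed
        then show ?thesis using R True by blast
      next
        case False
        have "x \<otimes> g = g \<otimes> x" if xL: "x \<in> L" for x
          by (rule sylow_commute[OF l(1) r(1) False L R _ _ xL g(1)])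
            (use norm[OF L l(1)] norm[OF R r(1)] sub_carrier[OF sylD(1)[OF L]] sub_carrier[OF Rs] in auto)
        then show ?thesis using L by blast
      qed
    qed
    then show False using pi by simp
  qed
  obtain P where P: "P \<in> syl p" using sylow_exists[OF p(1)] by blast
  obtain Q where Q: "Q \<in> syl q" using sylow_exists[OF q(1)] by blast
  define a where "a = multiplicity p (order G)"
  define b where "b = multiplicity q (order G)"
  have Ps: "subgroup P G" "card P = p ^ a" using sylD[OF P] unfolding a_def by auto
  have Qs: "subgroup Q G" "card Q = q ^ b" using sylD[OF Q] unfolding b_def by auto
  note mp = noncyclic_sub_maximals[OF p(1) Ps nc[OF p P]] and mq = noncyclic_sub_maximals[OF q(1) Qs nc[OF q Q]]
  have co: "coprime (card P) (card Q)" unfolding Ps(2) Qs(2) using p(1) q(1) pq by (simp add: primes_coprime)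
  have p1: "1 < p" and q1: "1 < q" using prime_gt_1_nat p(1) q(1) by auto
  define x where "x = p ^ (a - 1)"
  define y where "y = q ^ (b - 1)"
  have pa: "p ^ a = p * x" unfolding x_def using mp(2) by (simp add: power_eq_if)
  have qb: "q ^ b = q * y" unfolding y_def using mq(2) by (simp add: power_eq_if)
  have x1: "1 < x" unfolding x_def by (rule one_less_power[OF p1]) (use mp(2) in simp)
  have y1: "1 < y" unfolding y_def by (rule one_less_power[OF q1]) (use mq(2) in simp)
  have px: "p dvd x" unfolding x_def using mp(2) by simp
  have qy: "q dvd y" unfolding y_def using mq(2) by simp
  have npy: "\<not> p dvd y" "\<not> p dvd q * y"
    using primes_dvd_imp_eq[OF p(1) q(1)] pq prime_dvd_power[OF p(1), of q] prime_dvd_multD[OF p(1), of q y] unfolding y_def by blast+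
  have nqx: "\<not> q dvd x" "\<not> q dvd p * x"
    using primes_dvd_imp_eq[OF q(1) p(1)] pq prime_dvd_power[OF q(1), of p] prime_dvd_multD[OF q(1), of p x] unfolding x_def by blast+
  have "card {D \<in> subs G x. D \<subseteq> P} \<le> card (subs G x)" "card {D \<in> subs G y. D \<subseteq> Q} \<le> card (subs G y)"
    by (rule card_mono; auto)+
  then have cx: "p + 1 \<le> card (subs G x)" and cy: "q + 1 \<le> card (subs G y)" using mp(1) mq(1) unfolding x_def y_def by simp_all
  have cp: "1 \<le> card (subs G (p * x))" using card_subs_pos[OF Ps(1)] Ps(2) pa by simp
  have cq: "1 \<le> card (subs G (q * y))" using card_subs_pos[OF Qs(1)] Qs(2) qb by simp
  have cpq: "p + 1 \<le> card (subs G (x * (q * y)))"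
    using card_subs_mult_normal[OF Ps(1) Qs(1) norm[OF Q q(1)] co, of x] mp(1) Qs(2) qb unfolding x_def by simp
  have "distinct [1, x, y, p * x, q * y, x * (q * y)]"
  proof -
    have "x \<noteq> y" "p * x \<noteq> y" "x \<noteq> q * y" using px npy by auto
    moreover have "p * x \<noteq> q * y"
    proof
      assume e: "p * x = q * y"
      have "p dvd p * x" by (rule dvd_triv_left)
      then show False using npy(2) unfolding e by (rule notE[rotated])
    qed
    moreover have "q dvd x * (q * y)" "p dvd x * (q * y)" using px by (simp_all add: dvd_mult2)
    then have "x * (q * y) \<noteq> x" "x * (q * y) \<noteq> p * x" "x * (q * y) \<noteq> y" "x * (q * y) \<noteq> q * y"
      using nqx npy by metis+
    moreover have "p * x \<noteq> x" "q * y \<noteq> y" "1 \<noteq> p * x" "1 \<noteq> q * y" "1 \<noteq> x * (q * y)" using x1 y1 p1 q1 by auto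
    ultimately show ?thesis using x1 y1 by auto
  qed
  then have "sum_list (map (\<lambda>m. card (subs G m)) [1, x, y, p * x, q * y, x * (q * y)]) \<le> subgroup_count G" by (rule count_list_le)
  moreover have "5 \<le> p + q" using p1 q1 pq by linarith
  ultimately show False using subs_1 cx cy cp cq cpq p1 s by simp
qed

theorem small_subgroup_count_classification:
  assumes pi: "central_cyclic_primes G = {}" and s: "subgroup_count G \<le> 12"
  shows "small_type G"
proof (cases "order G = 1")
  case True
  have one: "carrier G = {\<one>}" using True order_one_triv_iff by blast
  have "metacyclic_gens G 1 1 1 0 \<one> \<one>" unfolding metacyclic_gens_def using True one by simp
  then have "metacyclic G 1 1 1 0" by (auto simp: metacyclic_def)
  then show ?thesis by (rule small_typeI[of _ _ _ _ _ 1]) (simp_all add: listed_codes_def)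
next
  case ne1: False
  show ?thesis
  proof (cases "\<exists>p. nprime p \<and> card (syl p) \<noteq> 1")
    case True
    then obtain p where p: "nprime p" "card (syl p) \<noteq> 1" by blast
    obtain P where P: "P \<in> syl p" using sylow_exists[OF p(1)] by blast
    have st: "small_type G" if "(p, q) \<in> {(2, 3), (2, 5), (2, 7), (3, 7)}" "order G = p ^ a * q" "Nm P = P" "card P = p ^ a"
      "card (syl q) = 1" "syl q = subs G q" "nprime q" for q a
    proof -
      note h = that
      obtain Q where Q: "Q \<in> syl q" using sylow_exists[OF h(7)] by blast
      have "Nm Q = carrier G" using Nm_eq_carrier_of_unique[of Q q] Q h(5,6) by simp
      then show ?thesis using self_normalizing_sylow_small_type[OF h(2,1) P h(3,4) _ _ s, of Q] Q h(6) by simp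
    qed
    note ge = card_syl_ge[OF p]
    show ?thesis
    proof (cases "p = 2")
      case True
      obtain q a where q: "q \<in> {3, 5, 7}" "card P = 2 ^ a" "order G = 2 ^ a * q" "Nm P = P" "card (syl q) = 1" "syl q = subs G q"
        using nonnormal_sylow_two[OF P[unfolded True] p(2)[unfolded True] s pi] by blast
      show ?thesis by (rule st[of q a]) (use q True in auto)
    next
      case False
      have k9: "card (syl p) \<le> 9" by (rule nonnormal_sylow(1)[OF p(1) P p(2) s])
      have "p \<noteq> 0" "p \<noteq> 1" "p \<noteq> 4" "p \<noteq> 6" "p \<noteq> 8" using p(1) by auto
      then have p357: "p = 3 \<or> p = 5 \<or> p = 7" using ge(1) k9 False by presburger
      have k: "card (syl p) = 4 \<or> card (syl p) = 5 \<or> card (syl p) = 6 \<or> card (syl p) = 7 \<or> card (syl p) = 8 \<or> card (syl p) = 9"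
      proof -
        have "4 \<le> card (syl p)" using ge(1) p357 by auto
        then show ?thesis using k9 by linarith
      qed
      \<comment> \<open>By the congruence modulo p, p = 3 leaves 4 and 7, p = 5 leaves 6, and p = 7
        leaves 8.\<close>
      have "p = 3 \<and> card (syl p) = 4 \<or> p = 3 \<and> card (syl p) = 7 \<or> card (syl p) = 6 \<or> card (syl p) = 8"
        using k p357 ge(2) by auto
      then show ?thesis
      proof (elim disjE conjE)
        assume "p = 3" "card (syl p) = 4"
        then show ?thesis using nonnormal_sylow_three_4[OF _ _ s pi] P by blast
      next
        assume p3: "p = 3" and k7: "card (syl p) = 7"
        note N = nonnormal_sylow_5_7[OF p(1) P k7 _ s]
        show ?thesis by (rule st[of 7 "multiplicity p (order G)"]) (use N sylD(2)[OF P] p3 in auto)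
      next
        assume "card (syl p) = 6"
        then show ?thesis using nonnormal_sylow_not_6_8_9[OF p(1) P _ s] by blast
      next
        assume "card (syl p) = 8"
        then show ?thesis using nonnormal_sylow_not_6_8_9[OF p(1) P _ s] by blast
      qed
    qed
  next
    case False
    then have nor: "\<And>l. nprime l \<Longrightarrow> card (syl l) = 1" by blast
    obtain p where p: "nprime p" "p dvd order G" using prime_factor_nat[OF ne1] by blast
    have "order G = p ^ multiplicity p (order G)"
    proof -
      obtain w where w: "order G = p ^ multiplicity p (order G) * w" using sylow_order_dvd[of p] by (rule dvdE)
      have "w = 1"
      proof (rule ccontr)
        assume "w \<noteq> 1"
        then obtain q where q: "nprime q" "q dvd w" using prime_factor_nat by blast
        then have "q dvd order G" using w by (metis dvd_mult)
        then have "p = q" using normal_sylows_p_group[OF nor pi s p(1) p(2) q(1)] by blast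
        then obtain w' where "w = p * w'" using q(2) by (auto elim: dvdE)
        then have "order G = p ^ Suc (multiplicity p (order G)) * w'" using w by (metis mult.assoc mult.commute power_Suc)
        then have "p ^ Suc (multiplicity p (order G)) dvd order G" by (metis dvd_triv_left)
        then have "Suc (multiplicity p (order G)) \<le> multiplicity p (order G)" by (rule prime_power_dvd_order_le[OF p(1)])
        then show False by simp
      qed
      then show ?thesis using w by simp
    qed
    \<comment> \<open>A cyclic p-group is its own central cyclic Sylow subgroup.\<close>
    moreover have "\<not> cyc"
    proof
      assume cyc
      then obtain g where g: "g \<in> carrier G" "ord g = order G" by (auto simp: cyc_def)
      have gg: "generate G {g} = carrier G" using gen_eq_carrier_iff[OF g(1)] g(2) by simp
      have cs: "carrier G \<in> syl p" using calculation subgroup_self unfolding syl_def by (intro subsI) (simp_all add: order_def)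
      have "p \<in> central_cyclic_primes G"
      proof (rule central_cyclic_primeI[OF p g(1)])
        show "generate G {g} \<in> syl p" using gg cs by simp
        fix l assume l: "nprime l" "l dvd order G"
        have "l = p" by (rule normal_sylows_p_group[OF nor pi s l p])
        moreover have "x \<otimes> g = g \<otimes> x" if x: "x \<in> carrier G" for x
        proof -
          obtain k :: nat where "x = g [^] k" using x gg gen_eq[OF g(1)] by auto
          then show ?thesis using nat_pow_comm[OF g(1), of k 1] g(1) by simp
        qed
        ultimately show "\<exists>L\<in>syl l. \<forall>x\<in>L. x \<otimes> g = g \<otimes> x" using cs by blast
      qed
      then show False using pi by simp
    qed
    ultimately show ?thesis using p_group_classification[OF fin_group_axioms _ _ p(1) s] by blast
  qed
qed

end

section \<open>Isomorphism classes\<close>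

lemma coded_fin_group: "coded G c \<Longrightarrow> fin_group G"
  by (simp add: coded_def)

lemma coded_iso: "coded G c \<Longrightarrow> coded H c \<Longrightarrow> G \<cong> H"
  by (cases c) (auto simp: coded_def has_code_def intro: a4_iso metacyclic_iso)

lemma coded_transfer:
  assumes "coded G c" "group H" "G \<cong> H" shows "coded H c"
proof -
  have F: "fin_group H" by (rule iso_fin_group[OF coded_fin_group[OF assms(1)] assms(2,3)])
  have g: "group G" using coded_fin_group[OF assms(1)] by (simp add: fin_group_def)
  show ?thesis
    using assms(1) F a4_transfer[OF g assms(2,3)] metacyclic_transfer[OF g assms(2,3)]
    by (cases c) (auto simp: coded_def has_code_def)
qed

lemma coded_count:
  assumes "coded G c" "c \<in> set (listed_codes n)" "n \<in> {1..12}" shows "subgroup_count G = n"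
proof (cases c)
  case None
  then obtain u v t where g: "a4_gens G u v t" using assms(1) by (auto simp: coded_def has_code_def a4_like_def)
  interpret a4_group G u v t
    using coded_fin_group[OF assms(1)] g by (simp add: a4_group_def a4_group_axioms_def)
  have "n = 10" using assms(2) None by (simp add: listed_codes_def split: if_splits)
  then show ?thesis using count_10 by simp
next
  case (Some w)
  then obtain m s r t where w: "c = Some (m, s, r, t)" by (metis prod_cases4)
  then have "metacyclic G m s r t" using assms(1) by (simp add: coded_def has_code_def)
  then show ?thesis
    using metacyclic_count[OF coded_fin_group[OF assms(1)]] listed_codes_count[OF assms(3)] assms(2) w by simp
qed

text \<open>The classification only provides a code in some row k; \<open>coded_count\<close> shows
  that k = n.\<close>

lemma tilde_group_iff_coded:
  assumes "n \<in> {1..12}"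
  shows "group G \<and> finite (carrier G) \<and> carrier G = tilde G \<and> subgroup_count G = n \<longleftrightarrow>
    (\<exists>c\<in>set (listed_codes n). coded G c)"
proof
  assume G: "group G \<and> finite (carrier G) \<and> carrier G = tilde G \<and> subgroup_count G = n"
  then have F: "fin_group G" unfolding fin_group_def fin_group_axioms_def by blast
  have pi: "central_cyclic_primes G = {}" using G fin_group.tilde_eq_carrier_iff[OF F] by simp
  have "small_type G" by (rule fin_group.small_subgroup_count_classification[OF F pi]) (use G assms in simp)
  then obtain k c where k: "k \<in> {1..12}" "c \<in> set (listed_codes k)" "coded G c"
    using F by (auto simp: small_type_def coded_def)
  then have "k = n" using coded_count[OF k(3,2,1)] G by simp
  then show "\<exists>c\<in>set (listed_codes n). coded G c" using k by blast
next
  assume "\<exists>c\<in>set (listed_codes n). coded G c"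
  then obtain c where c: "c \<in> set (listed_codes n)" "coded G c" by blast
  have F: "fin_group G" by (rule coded_fin_group[OF c(2)])
  have "carrier G = tilde G"
    using listed_codes_no_central_cyclic_primes[OF c] fin_group.tilde_eq_carrier_iff[OF F] by simp
  then show "group G \<and> finite (carrier G) \<and> carrier G = tilde G \<and> subgroup_count G = n"
    using F coded_count[OF c(2,1) assms] by (simp add: fin_group_def fin_group_axioms_def)
qed

fun code_order :: "group_code \<Rightarrow> nat" where
  "code_order None = 12" | "code_order (Some (m, s, r, t)) = m * s"

lemma order_coded: "coded G c \<Longrightarrow> order G = code_order c"
  by (cases c rule: code_order.cases)
    (auto simp: coded_def has_code_def a4_like_def a4_gens_def metacyclic_def metacyclic_gens_def)

text \<open>Commutativity is an invariant that separates most codes of equal order, see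
  \<open>code_unique\<close>.\<close>

lemma metacyclic_commutative_iff:
  assumes "fin_group G" "metacyclic G m s r t"
  shows "(\<forall>x\<in>carrier G. \<forall>y\<in>carrier G. x \<otimes>\<^bsub>G\<^esub> y = y \<otimes>\<^bsub>G\<^esub> x) \<longleftrightarrow> [r = 1] (mod s)"
proof -
  obtain a b where g: "metacyclic_gens G m s r t a b" using assms(2) by (auto simp: metacyclic_def)
  interpret metacyclic_group G m s r t a b by (rule metacyclic_group_intro[OF assms(1) g])
  show ?thesis
  proof
    assume "\<forall>x\<in>carrier G. \<forall>y\<in>carrier G. x \<otimes>\<^bsub>G\<^esub> y = y \<otimes>\<^bsub>G\<^esub> x"
    then have "E 0 1 \<otimes>\<^bsub>G\<^esub> E 1 0 = E 1 0 \<otimes>\<^bsub>G\<^esub> E 0 1" by simp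
    then show "[r = 1] (mod s)" using E_eq_snd[of 1 r 1] by (simp add: E_mult)
  next
    assume r: "[r = 1] (mod s)"
    show "\<forall>x\<in>carrier G. \<forall>y\<in>carrier G. x \<otimes>\<^bsub>G\<^esub> y = y \<otimes>\<^bsub>G\<^esub> x"
    proof (intro ballI)
      fix x y assume "x \<in> carrier G" "y \<in> carrier G"
      then obtain i k j l where e: "x = E i k" "y = E j l" using E_cover by metis
      have m: "[k * r ^ j + l = k + l] (mod s)" for k j l
        using cong_add[OF cong_mult[OF cong_refl cong_pow[OF r, of j], of k] cong_refl, of l] by simp
      have "E i k \<otimes>\<^bsub>G\<^esub> E j l = E (i + j) (k + l)" unfolding E_mult by (rule E_snd_cong[OF m])
      also have "\<dots> = E (j + i) (l + k)" by (simp add: add.commute)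
      also have "\<dots> = E j l \<otimes>\<^bsub>G\<^esub> E i k" unfolding E_mult by (rule E_snd_cong[OF m, symmetric])
      finally show "x \<otimes>\<^bsub>G\<^esub> y = y \<otimes>\<^bsub>G\<^esub> x" unfolding e .
    qed
  qed
qed

text \<open>Every involution of the group with parameters \<open>(2, 8, 7, 4)\<close> (that is, \<open>Q\<^bsub>16\<^esub>\<close>) is central,
  in contrast to the group with parameters \<open>(2, 8, 5, 0)\<close>.\<close>

lemma not_both_2_8:
  assumes "fin_group G" "metacyclic G 2 8 7 4" "metacyclic G 2 8 5 0" shows False
proof -
  obtain a b where g: "metacyclic_gens G 2 8 7 4 a b" using assms(2) by (auto simp: metacyclic_def)
  interpret Q: metacyclic_group G 2 8 7 4 a b by (rule metacyclic_group_intro[OF assms(1) g])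
  obtain c d where h: "metacyclic_gens G 2 8 5 0 c d" using assms(3) by (auto simp: metacyclic_def)
  interpret M: metacyclic_group G 2 8 5 0 c d by (rule metacyclic_group_intro[OF assms(1) h])
  have "M.E 1 0 \<otimes>\<^bsub>G\<^esub> M.E 1 0 = M.E 0 0" using M.E_shift[of 0 1 0] by (simp add: M.E_mult)
  then have sq: "M.E 1 0 \<otimes>\<^bsub>G\<^esub> M.E 1 0 = \<one>\<^bsub>G\<^esub>" by (simp add: M.E_00)
  obtain i x where ix: "M.E 1 0 = Q.E i x" using Q.E_cover[OF M.Ec] by blast
  define j y where "j = i mod 2" and "y = (i div 2 * 4 + x) mod 8"
  have jy: "M.E 1 0 = Q.E j y" using ix Q.E_red[of i x] by (simp add: j_def y_def)
  have e: "Q.E (j + j) (y * 7 ^ j + y) = Q.E 0 0" using sq unfolding jy by (simp add: Q.E_mult Q.E_00)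
  have "j = 0 \<or> j = 1" by (auto simp: j_def)
  \<comment> \<open>In the first presentation the square of a b^y is b^(4 + 8 y) = b^4, not 1, so an
    element of square 1 lies in <b> and is 1 or b^4.\<close>
  then have "j = 0 \<and> 4 dvd y"
  proof
    assume j: "j = 0"
    then have "[y + y = 0] (mod 8)" using e Q.E_eq_snd[of 0] by simp
    then have "8 dvd y + y" by (simp add: cong_0_iff)
    then show ?thesis using j by presburger
  next
    assume j: "j = 1"
    then have "Q.E 0 (4 + (y * 7 + y)) = Q.E 0 0" using e Q.E_shift[of 0 1] by simp
    then have "[4 + (y * 7 + y) = 0] (mod 8)" using Q.E_eq_snd by blast
    then have "8 dvd 4 + (y * 7 + y)" by (simp add: cong_0_iff)
    then show ?thesis by presburger
  qed
  then obtain z where z: "y = 4 * z" and j0: "j = 0" by (auto elim: dvdE)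
  have cen: "Q.E 0 y \<otimes>\<^bsub>G\<^esub> Q.E k l = Q.E k l \<otimes>\<^bsub>G\<^esub> Q.E 0 y" for k l
  proof -
    have "[y * 7 ^ k = y] (mod 8)"
    proof (induction k)
      case (Suc k)
      have "[y * 7 ^ Suc k = y * 7] (mod 8)" using cong_mult[OF Suc cong_refl, of 7] by (simp add: mult_ac)
      also have "y * 7 = y + 8 * (3 * z)" unfolding z by simp
      also have "[y + 8 * (3 * z) = y] (mod 8)" unfolding cong_def by (rule mod_mult_self2)
      finally show ?case .
    qed simp
    then have "[y * 7 ^ k + l = l + y] (mod 8)" using cong_add[OF _ cong_refl, of "y * 7 ^ k" y 8 l] by (simp add: add.commute)
    then show ?thesis using Q.E_snd_cong by (simp add: Q.E_mult)
  qed
  have "M.E 0 1 \<otimes>\<^bsub>G\<^esub> M.E 1 0 = M.E 1 0 \<otimes>\<^bsub>G\<^esub> M.E 0 1"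
  proof -
    obtain k l where "M.E 0 1 = Q.E k l" using Q.E_cover[OF M.Ec] by blast
    then show ?thesis using cen[of k l] unfolding jy j0 by simp
  qed
  then have "M.E 1 5 = M.E 1 1" by (simp add: M.E_mult)
  then show False using M.E_eq_snd[of 1 5 1] by (simp add: cong_def)
qed

text \<open>Within a row, the order separates all codes but these four pairs. The first three pairs
  differ in commutativity; the last is handled by \<open>not_both_2_8\<close>.\<close>

lemma same_order_codes:
  "list_all (\<lambda>n. list_all (\<lambda>c. list_all (\<lambda>c'. c = c' \<or> code_order c \<noteq> code_order c' \<or>
     {c, c'} \<in> {{Some (3, 9, 1, 0), Some (3, 9, 4, 0)}, {Some (2, 8, 1, 0), Some (2, 8, 7, 4)},
       {Some (2, 8, 1, 0), Some (2, 8, 5, 0)}, {Some (2, 8, 7, 4), Some (2, 8, 5, 0)}})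
     (listed_codes n)) (listed_codes n)) [1..<13]"
  by code_simp

lemma code_unique:
  assumes n: "n \<in> {1..12}" and c: "c \<in> set (listed_codes n)" "c' \<in> set (listed_codes n)"
    and G: "coded G c" "coded G c'"
  shows "c = c'"
proof (rule ccontr)
  assume ne: "c \<noteq> c'"
  have F: "fin_group G" by (rule coded_fin_group[OF G(1)])
  have comm: False if "coded G (Some (m, s, 1, 0))" "coded G (Some (m, s, r, t))" "\<not> [r = 1] (mod s)" for m s r t
    using that metacyclic_commutative_iff[OF F, of m s 1 0] metacyclic_commutative_iff[OF F, of m s r t]
    by (simp add: coded_def has_code_def)
  have "n \<in> set [1..<13]" using n by auto
  from bspec[OF bspec[OF bspec[OF same_order_codes[unfolded list_all_iff] this] c(1)] c(2)]
  have "{c, c'} \<in> {{Some (3, 9, 1, 0), Some (3, 9, 4, 0)}, {Some (2, 8, 1, 0), Some (2, 8, 7, 4)},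
       {Some (2, 8, 1, 0), Some (2, 8, 5, 0)}, {Some (2, 8, 7, 4), Some (2, 8, 5, 0)}}"
  proof (elim disjE)
    assume "c = c'"
    then show ?thesis using ne by contradiction
  next
    assume "code_order c \<noteq> code_order c'"
    moreover have "code_order c = code_order c'" using order_coded[OF G(1)] order_coded[OF G(2)] by simp
    ultimately show ?thesis by contradiction
  qed
  moreover have "coded G d" if "d \<in> {c, c'}" for d using that G by blast
  ultimately have "coded G (Some (3, 9, 1, 0)) \<and> coded G (Some (3, 9, 4, 0)) \<or>
      coded G (Some (2, 8, 1, 0)) \<and> coded G (Some (2, 8, 7, 4)) \<or>
      coded G (Some (2, 8, 1, 0)) \<and> coded G (Some (2, 8, 5, 0)) \<or>
      coded G (Some (2, 8, 7, 4)) \<and> coded G (Some (2, 8, 5, 0))"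
    by (elim insertE emptyE) (metis insertI1 insertI2 singletonI)+
  then show False
  proof (elim disjE conjE)
    assume "coded G (Some (3, 9, 1, 0))" "coded G (Some (3, 9, 4, 0))"
    then show False by (rule comm) (simp add: cong_def)
  next
    assume "coded G (Some (2, 8, 1, 0))" "coded G (Some (2, 8, 7, 4))"
    then show False by (rule comm) (simp add: cong_def)
  next
    assume "coded G (Some (2, 8, 1, 0))" "coded G (Some (2, 8, 5, 0))"
    then show False by (rule comm) (simp add: cong_def)
  next
    assume "coded G (Some (2, 8, 7, 4))" "coded G (Some (2, 8, 5, 0))"
    then show False using not_both_2_8[OF F] by (simp add: coded_def has_code_def)
  qed
qed

lemma listed_group_coded: "H \<in> set (listed_groups n) \<Longrightarrow> \<exists>c\<in>set (listed_codes n). coded H c"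
  using listed_coded[of n] unfolding list_all2_conv_all_nth by (metis in_set_conv_nth)

lemma listed_code_group: "c \<in> set (listed_codes n) \<Longrightarrow> \<exists>H\<in>set (listed_groups n). coded H c"
  using listed_coded[of n] unfolding list_all2_conv_all_nth by (metis in_set_conv_nth)

lemma iso_listed_iff:
  assumes n: "n \<in> {1..12}" and G: "group G" "finite (carrier G)" "carrier G = tilde G"
  shows "subgroup_count G = n \<longleftrightarrow> (\<exists>H\<in>set (listed_groups n). G \<cong> H)"
proof
  assume "subgroup_count G = n"
  then have "group G \<and> finite (carrier G) \<and> carrier G = tilde G \<and> subgroup_count G = n" by (intro conjI G)
  then obtain c where c: "c \<in> set (listed_codes n)" "coded G c" using iffD1[OF tilde_group_iff_coded[OF n]] by blast
  obtain H where "H \<in> set (listed_groups n)" "coded H c" using listed_code_group[OF c(1)] by blast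
  then show "\<exists>H\<in>set (listed_groups n). G \<cong> H" using coded_iso[OF c(2)] by blast
next
  assume "\<exists>H\<in>set (listed_groups n). G \<cong> H"
  then obtain H where iso: "G \<cong> H" and L: "H \<in> set (listed_groups n)" by blast
  obtain c where c: "c \<in> set (listed_codes n)" "coded H c" using listed_group_coded[OF L] by blast
  have F: "fin_group G" using G unfolding fin_group_def fin_group_axioms_def by blast
  have "group H" using coded_fin_group[OF c(2)] by (simp add: fin_group_def)
  then show "subgroup_count G = n" using iso_card_subs(2)[OF F _ iso] coded_count[OF c(2,1) n] by simp
qed

text \<open>The codes in the order of the concatenated list of groups, each with its row number, so
  that positions in the two lists correspond.\<close>

abbreviation all_codes :: "(nat \<times> group_code) list" where
  "all_codes \<equiv> concat (map (\<lambda>n. map (Pair n) (listed_codes n)) [1..<13])"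

lemma distinct_all_codes: "distinct all_codes"
  by code_simp

lemma all_groups_coded:
  "list_all2 (\<lambda>H (n, c). n \<in> {1..12} \<and> c \<in> set (listed_codes n) \<and> coded H c)
     (concat (map listed_groups [1..<13])) all_codes"
proof -
  have L: "list_all2 (\<lambda>H (n, c). n \<in> {1..12} \<and> c \<in> set (listed_codes n) \<and> coded H c)
      (concat (map listed_groups ns)) (concat (map (\<lambda>n. map (Pair n) (listed_codes n)) ns))"
    if "set ns \<subseteq> {1..12}" for ns
    using that
  proof (induction ns)
    case (Cons n ns)
    have "list_all2 (\<lambda>H (n, c). n \<in> {1..12} \<and> c \<in> set (listed_codes n) \<and> coded H c)
        (listed_groups n) (map (Pair n) (listed_codes n))"
      using listed_coded[of n] Cons.prems by (auto simp: list_all2_conv_all_nth)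
    then show ?case using Cons by (auto intro: list_all2_appendI)
  qed simp
  show ?thesis by (rule L) auto
qed

text \<open>Isomorphic entries share a code; equal subgroup counts put them in the same row, and
  \<open>code_unique\<close> makes them the same entry.\<close>

lemma listed_groups_not_iso:
  assumes L: "L = concat (map listed_groups [1..<13])" and ij: "i < length L" "j < length L" "i \<noteq> j"
  shows "\<not> L ! i \<cong> L ! j"
proof
  assume iso: "L ! i \<cong> L ! j"
  have len: "length L = length all_codes" using all_groups_coded list_all2_lengthD unfolding L by blast
  obtain n c where nc: "all_codes ! i = (n, c)" by (rule prod.exhaust)
  obtain n' c' where nc': "all_codes ! j = (n', c')" by (rule prod.exhaust)
  have I: "n \<in> {1..12}" "c \<in> set (listed_codes n)" "coded (L ! i) c"
    using list_all2_nthD[OF all_groups_coded, of i] ij(1) nc unfolding L by auto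
  have J: "n' \<in> {1..12}" "c' \<in> set (listed_codes n')" "coded (L ! j) c'"
    using list_all2_nthD[OF all_groups_coded, of j] ij(2) nc' unfolding L by auto
  have g: "group (L ! j)" using coded_fin_group[OF J(3)] by (simp add: fin_group_def)
  have t: "coded (L ! j) c" by (rule coded_transfer[OF I(3) g iso])
  have n: "n = n'" using coded_count[OF t I(2,1)] coded_count[OF J(3,2,1)] by simp
  then have "c = c'" using code_unique[OF I(1,2) _ t J(3)] J(2) by simp
  then show False using nth_eq_iff_index_eq[OF distinct_all_codes, of i j] nc nc' n ij len by simp
qed

lemma listed_codes_lengths:
  "list_all (\<lambda>n. distinct (listed_codes n) \<and>
     length (listed_codes n) = [1, 0, 0, 0, 1, 3, 0, 4, 0, 9, 3, 4] ! (n - 1)) [1..<13]"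
  by code_simp

text \<open>\<open>tilde_classes\<close> is about groups over \<open>nat\<close>; a listed group is
  copied there along an injection of its finite carrier.\<close>

lemma ex_nat_group_coded:
  assumes "c \<in> set (listed_codes n)" shows "\<exists>N :: nat monoid. coded N c"
proof -
  obtain H where "H \<in> set (listed_groups n)" and c: "coded H c" using listed_code_group[OF assms] by blast
  note H = c coded_fin_group[OF c]
  have fin: "finite (carrier H)" using H(2) by (simp add: fin_group_def fin_group_axioms_def)
  obtain f :: "_ \<Rightarrow> nat" where f: "inj_on f (carrier H)" using finite_imp_inj_to_nat_seg[OF fin] by blast
  have "H \<cong> image_group f H" using image_group_iso[OF f] by (auto simp: is_iso_def)
  moreover have "group (image_group f H)" using image_group_fin_group[OF H(2) f] by (simp add: fin_group_def)
  ultimately show ?thesis using coded_transfer[OF H(1)] by blast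
qed

text \<open>The classes are the sets of all groups with a given code. They are nonempty by
  \<open>ex_nat_group_coded\<close> and differ for different codes by \<open>code_unique\<close>, so
  there are as many as codes in the row.\<close>

lemma card_tilde_classes:
  assumes n: "n \<in> {1..12}"
  shows "finite (tilde_classes n)" "card (tilde_classes n) = [1, 0, 0, 0, 1, 3, 0, 4, 0, 9, 3, 4] ! (n - 1)"
proof -
  let ?R = "{(G, H). G \<in> tilde_groups n \<and> H \<in> tilde_groups n \<and> G \<cong> H}"
  have mem: "G \<in> tilde_groups n \<longleftrightarrow> (\<exists>c\<in>set (listed_codes n). coded G c)" for G
    unfolding tilde_groups_def using tilde_group_iff_coded[OF n] by blast
  have cls: "?R `` {G} = {H. coded H c}" if c: "c \<in> set (listed_codes n)" "coded G c" for G c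
  proof (rule subset_antisym; rule subsetI)
    fix H :: "nat monoid" assume "H \<in> ?R `` {G}"
    then have "group H" "G \<cong> H" by (auto simp: tilde_groups_def)
    then show "H \<in> {H. coded H c}" using coded_transfer[OF c(2)] by blast
  next
    fix H :: "nat monoid" assume "H \<in> {H. coded H c}"
    then show "H \<in> ?R `` {G}" using mem c coded_iso[OF c(2)] by blast
  qed
  have quot: "tilde_classes n = (\<lambda>G. ?R `` {G}) ` tilde_groups n"
    by (auto simp: tilde_classes_def quotient_def)
  have "?R `` {G} \<in> (\<lambda>c. {H. coded H c}) ` set (listed_codes n)" if "G \<in> tilde_groups n" for G
  proof -
    obtain c where c: "c \<in> set (listed_codes n)" "coded G c" using mem \<open>G \<in> tilde_groups n\<close> by blast
    then show ?thesis using cls[OF c] by blast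
  qed
  moreover have "{H. coded H c} \<in> (\<lambda>G. ?R `` {G}) ` tilde_groups n" if c: "c \<in> set (listed_codes n)" for c
  proof -
    obtain N :: "nat monoid" where N: "coded N c" using ex_nat_group_coded[OF c] by blast
    then have "N \<in> tilde_groups n" using mem c by blast
    then show ?thesis using cls[OF c N] by blast
  qed
  ultimately have eq: "tilde_classes n = (\<lambda>c. {H. coded H c}) ` set (listed_codes n)"
    unfolding quot by (intro equalityI image_subsetI)
  have inj: "inj_on (\<lambda>c. {H :: nat monoid. coded H c}) (set (listed_codes n))"
  proof (rule inj_onI)
    fix c c' assume c: "c \<in> set (listed_codes n)" "c' \<in> set (listed_codes n)"
      and e: "{H :: nat monoid. coded H c} = {H. coded H c'}"
    obtain N :: "nat monoid" where N: "coded N c" using ex_nat_group_coded[OF c(1)] by blast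
    then have "coded N c'" using e by blast
    then show "c = c'" using code_unique[OF n c N] by blast
  qed
  have "n \<in> set [1..<13]" using n by auto
  then have l: "distinct (listed_codes n)" "length (listed_codes n) = [1, 0, 0, 0, 1, 3, 0, 4, 0, 9, 3, 4] ! (n - 1)"
    using listed_codes_lengths unfolding list_all_iff by blast+
  show "finite (tilde_classes n)" unfolding eq by simp
  show "card (tilde_classes n) = [1, 0, 0, 0, 1, 3, 0, 4, 0, 9, 3, 4] ! (n - 1)"
    unfolding eq card_image[OF inj] distinct_card[OF l(1)] l(2) ..
qed

theorem mainTheorem3:
  shows "(\<forall>(G :: ('a, 'b) monoid_scheme) n. group G \<and> finite (carrier G) \<and> carrier G = tilde G \<and> n \<in> {1..12} \<longrightarrow>
            (subgroup_count G = n \<longleftrightarrow> (\<exists>H \<in> set (listed_groups n). G \<cong> H)))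
       \<and> (\<forall>n \<in> {1..12}. \<forall>H \<in> set (listed_groups n).
            group H \<and> finite (carrier H) \<and> carrier H = tilde H \<and> subgroup_count H = n)
       \<and> (let L = concat (map listed_groups [1..<13]) in
            \<forall>i < length L. \<forall>j < length L. i \<noteq> j \<longrightarrow> \<not> L ! i \<cong> L ! j)
       \<and> (\<forall>n \<in> {1..12}. finite (tilde_classes n) \<and>
            card (tilde_classes n) = [1, 0, 0, 0, 1, 3, 0, 4, 0, 9, 3, 4] ! (n - 1))"
proof (intro conjI)
  show "\<forall>(G :: ('a, 'b) monoid_scheme) n. group G \<and> finite (carrier G) \<and> carrier G = tilde G \<and> n \<in> {1..12} \<longrightarrow>
      (subgroup_count G = n \<longleftrightarrow> (\<exists>H \<in> set (listed_groups n). G \<cong> H))"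
    by (intro allI impI, elim conjE) (rule iso_listed_iff)
  show "\<forall>n \<in> {1..12}. \<forall>H \<in> set (listed_groups n).
      group H \<and> finite (carrier H) \<and> carrier H = tilde H \<and> subgroup_count H = n"
    by (intro ballI iffD2[OF tilde_group_iff_coded] listed_group_coded)
  show "let L = concat (map listed_groups [1..<13]) in
      \<forall>i < length L. \<forall>j < length L. i \<noteq> j \<longrightarrow> \<not> L ! i \<cong> L ! j"
    unfolding Let_def by (intro allI impI) (rule listed_groups_not_iso[OF refl])
  show "\<forall>n \<in> {1..12}. finite (tilde_classes n) \<and>
      card (tilde_classes n) = [1, 0, 0, 0, 1, 3, 0, 4, 0, 9, 3, 4] ! (n - 1)"
    by (intro ballI conjI card_tilde_classes)
qed

end
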